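(* Let $(R,\mathfrak m)$ be a standard graded algebra over a field $k$. Let $x$ be a non-zero linear form and $I',T$ be non-zero homogeneous ideals of $R$ such that: (i) $I'$ is a Koszul module and $x$ is $I'$-regular (for example, $x$ is an $R$-regular element); (ii) $T\subseteq\mathfrak mI'$; (iii) $x$ is a regular element with respect to $R/T$ and with respect to $\operatorname{gr}_{\mathfrak m}T$. Denote $I=xI'+T$. Then the decomposition $I=xI'+T$ is a Betti splitting, and there is a chain $$\operatorname{ld}_RT\le\operatorname{ld}_RI=\operatorname{ld}_R(T+(x))=\operatorname{ld}_R(T/xT)\le\operatorname{ld}_RT+1.$$ Moreover, $I$ is a Koszul module if and only if $T$ is a Koszul module.
   Context: $\mathfrak m$ is the graded maximal ideal of $R$. Let $M$ be a finitely generated graded $R$-module with minimal graded free resolution $F$. For $i\ge 0$ let $\mathcal F^iF$ be the subcomplex $\cdots\to F_{i+1}\to F_i\to \mathfrak mF_{i-1}\to\cdots\to\mathfrak m^iF_0\to 0$ of $F$, and let $\operatorname{lin}^RF=\bigoplus_{i\ge0}\mathcal F^iF/\mathcal F^{i+1}F$. The linearity defect is $\operatorname{ld}_RM=\sup\{i : H_i(\operatorname{lin}^RF)\ne0\}$, and $M$ is called Koszul if $\operatorname{ld}_RM=0$. $\operatorname{gr}_{\mathfrak m}T=\bigoplus_{s\ge0}\mathfrak m^sT/\mathfrak m^{s+1}T$, a module over $\operatorname{gr}_{\mathfrak m}R\cong R$; $x$ is regular with respect to it if multiplication by $x$, $\mathfrak m^sT/\mathfrak m^{s+1}T\to\mathfrak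 m^{s+1}T/\mathfrak m^{s+2}T$, is injective for all $s\ge0$. For nonzero proper homogeneous ideals $P,A,B$ with $P=A+B$, the decomposition $P=A+B$ is called a Betti splitting if $\beta_i(P)=\beta_i(A)+\beta_i(B)+\beta_{i-1}(A\cap B)$ for all $i\ge0$, where $\beta_i(M)=\dim_k\operatorname{Tor}^R_i(k,M)$ and $\beta_{-1}=0$. *)

theory Defs
  imports "HOL-Algebra.Ideal_Product" "HOL-Algebra.Generated_Rings"
    "HOL-Library.Extended_Nat"
    "Jordan_Normal_Form.Missing_VectorSpace"
begin

hide_const (open) Multiset.mult

section \<open>Graded modules and standard graded algebras\<close>

text \<open>A graded module is a module record together with its homogeneous parts.  Gradings are
  indexed by the integers.  The same record serves for graded algebras over a field.\<close>

record ('a, 'm) gmodule = "('a, 'm) module" +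
  hpart :: "int \<Rightarrow> 'm set"

definition grading :: "('a, 'm, 'e) gmodule_scheme \<Rightarrow> bool" where
  "grading M \<longleftrightarrow>
     (\<forall>n. subgroup (hpart M n) (add_monoid M)) \<and>
     (\<forall>v\<in>carrier M. \<exists>!c. (\<forall>n. c n \<in> hpart M n) \<and> finite {n. c n \<noteq> \<zero>\<^bsub>M\<^esub>} \<and>
        v = (\<Oplus>\<^bsub>M\<^esub>n\<in>{n. c n \<noteq> \<zero>\<^bsub>M\<^esub>}. c n))"

locale standard_graded_algebra = K?: field K + R?: algebra K R
  for K :: "('k, 'c) ring_scheme" and R :: "('k, 'a) gmodule" (structure) +
  assumes graded: "grading R"
    and graded_mult: "\<lbrakk>a \<in> hpart R i; b \<in> hpart R j\<rbrakk> \<Longrightarrow> a \<otimes>\<^bsub>R\<^esub> b \<in> hpart R (i + j)"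
    and negative_part: "n < 0 \<Longrightarrow> hpart R n = {\<zero>\<^bsub>R\<^esub>}"
    and zero_part: "hpart R 0 = (\<lambda>c. c \<odot>\<^bsub>R\<^esub> \<one>\<^bsub>R\<^esub>) ` carrier K"
    and nontrivial: "\<one>\<^bsub>R\<^esub> \<noteq> \<zero>\<^bsub>R\<^esub>"
    and finitely_generated_by_linear_forms:
      "\<exists>S. finite S \<and> S \<subseteq> hpart R 1 \<and> generate_ring R (hpart R 0 \<union> S) = carrier R"

definition irrelevant :: "('k, 'a) gmodule \<Rightarrow> 'a set" where
  "irrelevant R = Idl\<^bsub>R\<^esub> (\<Union>n\<in>{1..}. hpart R n)"

text \<open>The ring as a module over itself, and its ideals as graded modules.\<close>

definition ring_mod :: "('k, 'a) gmodule \<Rightarrow> ('a, 'a) gmodule" where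
  "ring_mod R = \<lparr>carrier = carrier R, mult = mult R, one = \<one>\<^bsub>R\<^esub>, zero = \<zero>\<^bsub>R\<^esub>, add = add R,
     smult = mult R, hpart = hpart R\<rparr>"

definition ideal_mod :: "('k, 'a) gmodule \<Rightarrow> 'a set \<Rightarrow> ('a, 'a) gmodule" where
  "ideal_mod R I = (ring_mod R)\<lparr>carrier := I, hpart := \<lambda>n. I \<inter> hpart R n\<rparr>"

definition homogeneous_ideal :: "('k, 'a) gmodule \<Rightarrow> 'a set \<Rightarrow> bool" where
  "homogeneous_ideal R I \<longleftrightarrow> ideal I R \<and> grading (ideal_mod R I)"


section \<open>Quotient modules, direct sums, homology\<close>

text \<open>Elements of a quotient module are cosets.  The fields \<open>mult\<close> and \<open>one\<close> of a module record
  carry no meaning.  In the scalar multiplication the summand \<open>N\<close> turns the set of multiples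
  of a coset back into a full coset; the same is done in \<open>quot_map\<close>, the map into
  \<open>M' / N'\<close> induced by a map \<open>f\<close> into \<open>M'\<close>.\<close>

definition quot_mod :: "('a, 'm, 'e) module_scheme \<Rightarrow> 'm set \<Rightarrow> ('a, 'm set) module" where
  "quot_mod M N = \<lparr>carrier = a_rcosets\<^bsub>M\<^esub> N, mult = (\<lambda>U V. N), one = N, zero = N, add = set_add M,
     smult = (\<lambda>r U. ((\<lambda>v. r \<odot>\<^bsub>M\<^esub> v) ` U) <+>\<^bsub>M\<^esub> N)\<rparr>"

definition quot_gmod :: "('a, 'm) gmodule \<Rightarrow> 'm set \<Rightarrow> ('a, 'm set) gmodule" where
  "quot_gmod M N = module.extend (quot_mod M N)
     (gmodule.fields (\<lambda>n. (\<lambda>v. N +>\<^bsub>M\<^esub> v) ` hpart M n))"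

definition quot_map ::
    "('a, 'm2, 'e) module_scheme \<Rightarrow> 'm2 set \<Rightarrow> ('m1 \<Rightarrow> 'm2) \<Rightarrow> 'm1 set \<Rightarrow> 'm2 set" where
  "quot_map M' N' f U = (f ` U) <+>\<^bsub>M'\<^esub> N'"

definition direct_sum_mod :: "(nat \<Rightarrow> ('a, 'm) module) \<Rightarrow> ('a, nat \<Rightarrow> 'm) module" where
  "direct_sum_mod M =
     \<lparr>carrier = {c. (\<forall>p. c p \<in> carrier (M p)) \<and> finite {p. c p \<noteq> \<zero>\<^bsub>M p\<^esub>}},
      mult = (\<lambda>c c' p. \<zero>\<^bsub>M p\<^esub>), one = (\<lambda>p. \<zero>\<^bsub>M p\<^esub>), zero = (\<lambda>p. \<zero>\<^bsub>M p\<^esub>),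
      add = (\<lambda>c c' p. c p \<oplus>\<^bsub>M p\<^esub> c' p), smult = (\<lambda>r c p. r \<odot>\<^bsub>M p\<^esub> c p)\<rparr>"

text \<open>A complex is a family of modules \<open>C i\<close> with maps \<open>d i\<close> from \<open>C i\<close> to \<open>C (i - 1)\<close> for
  \<open>i > 0\<close>; the value of \<open>d 0\<close> is irrelevant, as \<open>C 0\<close> is mapped to the zero module.\<close>

definition cycles :: "(nat \<Rightarrow> ('a, 'm, 'e) module_scheme) \<Rightarrow> (nat \<Rightarrow> 'm \<Rightarrow> 'm) \<Rightarrow> nat \<Rightarrow> 'm set" where
  "cycles C d i = {z \<in> carrier (C i). i > 0 \<longrightarrow> d i z = \<zero>\<^bsub>C (i - 1)\<^esub>}"

definition boundaries ::
    "(nat \<Rightarrow> ('a, 'm, 'e) module_scheme) \<Rightarrow> (nat \<Rightarrow> 'm \<Rightarrow> 'm) \<Rightarrow> nat \<Rightarrow> 'm set" where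
  "boundaries C d i = d (Suc i) ` carrier (C (Suc i))"

definition homology ::
    "(nat \<Rightarrow> ('a, 'm, 'e) module_scheme) \<Rightarrow> (nat \<Rightarrow> 'm \<Rightarrow> 'm) \<Rightarrow> nat \<Rightarrow> ('a, 'm set) module" where
  "homology C d i = quot_mod ((C i)\<lparr>carrier := cycles C d i\<rparr>) (boundaries C d i)"


section \<open>Minimal graded free resolutions\<close>

text \<open>The submodule \<open>J N\<close> for an ideal \<open>J\<close> and a submodule \<open>N\<close> of \<open>M\<close>, and the submodule
  \<open>m^s M\<close> for the graded maximal ideal \<open>m\<close>.\<close>

definition ideal_smult ::
    "('a, 'b) ring_scheme \<Rightarrow> ('a, 'm, 'e) module_scheme \<Rightarrow> 'a set \<Rightarrow> 'm set \<Rightarrow> 'm set" where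
  "ideal_smult R M J N = LinearCombinations.module.span R M {r \<odot>\<^bsub>M\<^esub> v | r v. r \<in> J \<and> v \<in> N}"

definition max_power :: "('k, 'a) gmodule \<Rightarrow> ('a, 'm, 'e) module_scheme \<Rightarrow> nat \<Rightarrow> 'm set" where
  "max_power R M s = ((ideal_smult R M (irrelevant R)) ^^ s) (carrier M)"

text \<open>The graded free module of rank \<open>b\<close> whose basis elements have degrees \<open>s 0, \<dots>, s (b - 1)\<close>.\<close>

definition free_gmod :: "('k, 'a) gmodule \<Rightarrow> nat \<Rightarrow> (nat \<Rightarrow> int) \<Rightarrow> ('a, nat \<Rightarrow> 'a) gmodule" where
  "free_gmod R b s = module.extend (ring.func_space R {..<b})
     (gmodule.fields (\<lambda>n. {f \<in> {..<b} \<rightarrow>\<^sub>E carrier R. \<forall>j<b. f j \<in> hpart R (n - s j)}))"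

definition graded_hom ::
    "('k, 'a) gmodule \<Rightarrow> ('a, 'm) gmodule \<Rightarrow> ('a, 'n) gmodule \<Rightarrow> ('m \<Rightarrow> 'n) set" where
  "graded_hom R M N = {f \<in> module_hom R M N. \<forall>n. f ` hpart M n \<subseteq> hpart N n}"

record 'a free_complex =
  rank :: "nat \<Rightarrow> nat"
  degs :: "nat \<Rightarrow> nat \<Rightarrow> int"
  diff :: "nat \<Rightarrow> (nat \<Rightarrow> 'a) \<Rightarrow> (nat \<Rightarrow> 'a)"

definition fmod :: "('k, 'a) gmodule \<Rightarrow> 'a free_complex \<Rightarrow> nat \<Rightarrow> ('a, nat \<Rightarrow> 'a) gmodule" where
  "fmod R F i = free_gmod R (rank F i) (degs F i)"

definition min_free_resolution ::
    "('k, 'a) gmodule \<Rightarrow> ('a, 'm) gmodule \<Rightarrow> 'a free_complex \<Rightarrow> bool" where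
  "min_free_resolution R M F \<longleftrightarrow>
     (\<forall>i. diff F (Suc i) \<in> graded_hom R (fmod R F (Suc i)) (fmod R F i)) \<and>
     (\<forall>i. cycles (fmod R F) (diff F) (Suc i) = boundaries (fmod R F) (diff F) (Suc i)) \<and>
     (\<exists>\<epsilon>\<in>graded_hom R (fmod R F 0) M. \<epsilon> ` carrier (fmod R F 0) = carrier M \<and>
        {z \<in> carrier (fmod R F 0). \<epsilon> z = \<zero>\<^bsub>M\<^esub>} = boundaries (fmod R F) (diff F) 0) \<and>
     (\<forall>i. boundaries (fmod R F) (diff F) i \<subseteq> max_power R (fmod R F i) 1)"

text \<open>Finitely generated graded modules over a standard graded algebra have a minimal graded free
  resolution, unique up to isomorphism of complexes; one of them is chosen.\<close>

definition min_res :: "('k, 'a) gmodule \<Rightarrow> ('a, 'm) gmodule \<Rightarrow> 'a free_complex" where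
  "min_res R M = (SOME F. min_free_resolution R M F)"


section \<open>Linear part and linearity defect\<close>

text \<open>\<open>filt R F p i\<close> is the component in homological degree \<open>i\<close> of the \<open>p\<close>-th member of the
  filtration of \<open>F\<close>.  For \<open>i \<ge> p\<close> the truncated difference makes it all of \<open>F i\<close>, as required.\<close>

definition filt :: "('k, 'a) gmodule \<Rightarrow> 'a free_complex \<Rightarrow> nat \<Rightarrow> nat \<Rightarrow> (nat \<Rightarrow> 'a) set" where
  "filt R F p i = max_power R (fmod R F i) (p - i)"

definition lin_mod ::
    "('k, 'a) gmodule \<Rightarrow> 'a free_complex \<Rightarrow> nat \<Rightarrow> ('a, nat \<Rightarrow> (nat \<Rightarrow> 'a) set) module" where
  "lin_mod R F i = direct_sum_mod
     (\<lambda>p. quot_mod ((fmod R F i)\<lparr>carrier := filt R F p i\<rparr>) (filt R F (Suc p) i))"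

definition lin_diff :: "('k, 'a) gmodule \<Rightarrow> 'a free_complex \<Rightarrow> nat \<Rightarrow>
    (nat \<Rightarrow> (nat \<Rightarrow> 'a) set) \<Rightarrow> (nat \<Rightarrow> (nat \<Rightarrow> 'a) set)" where
  "lin_diff R F i c =
     (\<lambda>p. quot_map (fmod R F (i - 1)) (filt R F (Suc p) (i - 1)) (diff F i) (c p))"

text \<open>The supremum of the empty set is \<open>0\<close>, which affects only the zero module.\<close>

definition lin_defect :: "('k, 'a) gmodule \<Rightarrow> ('a, 'm) gmodule \<Rightarrow> enat" where
  "lin_defect R M = (let F = min_res R M; H = homology (lin_mod R F) (lin_diff R F) in
     SUP i\<in>{i. carrier (H i) \<noteq> {\<zero>\<^bsub>H i\<^esub>}}. enat i)"

definition koszul :: "('k, 'a) gmodule \<Rightarrow> ('a, 'm) gmodule \<Rightarrow> bool" where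
  "koszul R M \<longleftrightarrow> lin_defect R M = 0"


section \<open>Regular elements\<close>

text \<open>The condition \<open>x M \<noteq> M\<close>, which some authors include, is automatic by the graded Nakayama
  lemma when \<open>x\<close> is a linear form and \<open>M\<close> is a nonzero finitely generated graded module.\<close>

definition regular_on :: "'a \<Rightarrow> ('a, 'm, 'e) module_scheme \<Rightarrow> bool" where
  "regular_on x M \<longleftrightarrow> inj_on (\<lambda>v. x \<odot>\<^bsub>M\<^esub> v) (carrier M)"

definition gr_part :: "('k, 'a) gmodule \<Rightarrow> ('a, 'm) gmodule \<Rightarrow> nat \<Rightarrow> ('a, 'm set) module" where
  "gr_part R M s = quot_mod (M\<lparr>carrier := max_power R M s\<rparr>) (max_power R M (Suc s))"

definition gr_regular_on :: "('k, 'a) gmodule \<Rightarrow> 'a \<Rightarrow> ('a, 'm) gmodule \<Rightarrow> bool" where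
  "gr_regular_on R x M \<longleftrightarrow>
     (\<forall>s. inj_on (quot_map M (max_power R M (Suc (Suc s))) (\<lambda>v. x \<odot>\<^bsub>M\<^esub> v))
        (carrier (gr_part R M s)))"


section \<open>Tensor products, Tor, Betti numbers\<close>

definition free_on :: "('a, 'b) ring_scheme \<Rightarrow> 's set \<Rightarrow> ('a, 's \<Rightarrow> 'a) module" where
  "free_on R S = (ring.func_space R S)
     \<lparr>carrier := {f \<in> S \<rightarrow>\<^sub>E carrier R. finite {s \<in> S. f s \<noteq> \<zero>\<^bsub>R\<^esub>}}\<rparr>"

definition basis_elt :: "('a, 'b) ring_scheme \<Rightarrow> 's set \<Rightarrow> 's \<Rightarrow> ('s \<Rightarrow> 'a)" where
  "basis_elt R S s = (\<lambda>t\<in>S. if t = s then \<one>\<^bsub>R\<^esub> else \<zero>\<^bsub>R\<^esub>)"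

text \<open>The tensor product of \<open>M\<close> and \<open>N\<close> is the free module on pairs modulo bilinearity.\<close>

definition tensor_rel :: "('a, 'b) ring_scheme \<Rightarrow> ('a, 'm, 'e) module_scheme \<Rightarrow>
    ('a, 'n, 'f) module_scheme \<Rightarrow> ('m \<times> 'n \<Rightarrow> 'a) set" where
  "tensor_rel R M N =
     (let P = free_on R (carrier M \<times> carrier N); e = basis_elt R (carrier M \<times> carrier N) in
      LinearCombinations.module.span R P
       ({e (u \<oplus>\<^bsub>M\<^esub> u', v) \<ominus>\<^bsub>P\<^esub> (e (u, v) \<oplus>\<^bsub>P\<^esub> e (u', v)) | u u' v.
           u \<in> carrier M \<and> u' \<in> carrier M \<and> v \<in> carrier N} \<union>
        {e (u, v \<oplus>\<^bsub>N\<^esub> v') \<ominus>\<^bsub>P\<^esub> (e (u, v) \<oplus>\<^bsub>P\<^esub> e (u, v')) | u v v'.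
           u \<in> carrier M \<and> v \<in> carrier N \<and> v' \<in> carrier N} \<union>
        {e (r \<odot>\<^bsub>M\<^esub> u, v) \<ominus>\<^bsub>P\<^esub> r \<odot>\<^bsub>P\<^esub> e (u, v) | r u v.
           r \<in> carrier R \<and> u \<in> carrier M \<and> v \<in> carrier N} \<union>
        {e (u, r \<odot>\<^bsub>N\<^esub> v) \<ominus>\<^bsub>P\<^esub> r \<odot>\<^bsub>P\<^esub> e (u, v) | r u v.
           r \<in> carrier R \<and> u \<in> carrier M \<and> v \<in> carrier N}))"

definition tensor :: "('a, 'b) ring_scheme \<Rightarrow> ('a, 'm, 'e) module_scheme \<Rightarrow>
    ('a, 'n, 'f) module_scheme \<Rightarrow> ('a, ('m \<times> 'n \<Rightarrow> 'a) set) module" where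
  "tensor R M N = quot_mod (free_on R (carrier M \<times> carrier N)) (tensor_rel R M N)"

text \<open>The map from \<open>M \<otimes> N\<close> to \<open>M \<otimes> N'\<close> induced by \<open>f\<close>: the linear extension of
  \<open>(u, v) \<mapsto> (u, f v)\<close>, taken modulo the relations.\<close>

definition tensor_map :: "('a, 'b) ring_scheme \<Rightarrow> ('a, 'm, 'e) module_scheme \<Rightarrow>
    ('a, 'n, 'f) module_scheme \<Rightarrow> ('a, 'n', 'g) module_scheme \<Rightarrow> ('n \<Rightarrow> 'n') \<Rightarrow>
    ('m \<times> 'n \<Rightarrow> 'a) set \<Rightarrow> ('m \<times> 'n' \<Rightarrow> 'a) set" where
  "tensor_map R M N N' f =
     (let P' = free_on R (carrier M \<times> carrier N'); e' = basis_elt R (carrier M \<times> carrier N') in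
      quot_map P' (tensor_rel R M N')
        (\<lambda>\<phi>. \<Oplus>\<^bsub>P'\<^esub>s\<in>{s \<in> carrier M \<times> carrier N. \<phi> s \<noteq> \<zero>\<^bsub>R\<^esub>}.
               \<phi> s \<odot>\<^bsub>P'\<^esub> e' (fst s, f (snd s))))"

text \<open>\<open>Tor R N M i\<close> is the homology of the tensor product of \<open>N\<close> with the chosen resolution
  of \<open>M\<close>.  The field acts on it through \<open>restrict_scalars\<close>.\<close>

definition Tor :: "('k, 'a) gmodule \<Rightarrow> ('a, 'n, 'e) module_scheme \<Rightarrow> ('a, 'm) gmodule \<Rightarrow> nat \<Rightarrow>
    ('a, ('n \<times> (nat \<Rightarrow> 'a) \<Rightarrow> 'a) set set) module" where
  "Tor R N M = (let F = min_res R M in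
     homology (\<lambda>i. tensor R N (fmod R F i))
       (\<lambda>i. tensor_map R N (fmod R F i) (fmod R F (i - 1)) (diff F i)))"

definition residue_field :: "('k, 'a) gmodule \<Rightarrow> ('a, 'a set) module" where
  "residue_field R = quot_mod (ring_mod R) (irrelevant R)"

definition restrict_scalars :: "('k, 'a) gmodule \<Rightarrow> ('a, 'm) module \<Rightarrow> ('k, 'm) module" where
  "restrict_scalars R V = \<lparr>carrier = carrier V, mult = mult V, one = one V, zero = \<zero>\<^bsub>V\<^esub>,
     add = add V, smult = (\<lambda>c v. (c \<odot>\<^bsub>R\<^esub> \<one>\<^bsub>R\<^esub>) \<odot>\<^bsub>V\<^esub> v)\<rparr>"

definition betti :: "('k, 'c) ring_scheme \<Rightarrow> ('k, 'a) gmodule \<Rightarrow> ('a, 'm) gmodule \<Rightarrow> nat \<Rightarrow> nat" where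
  "betti K R M i = vectorspace.dim K (restrict_scalars R (Tor R (residue_field R) M i))"

definition betti_splitting ::
    "('k, 'c) ring_scheme \<Rightarrow> ('k, 'a) gmodule \<Rightarrow> 'a set \<Rightarrow> 'a set \<Rightarrow> 'a set \<Rightarrow> bool" where
  "betti_splitting K R P A B \<longleftrightarrow>
     (\<forall>J\<in>{P, A, B}. homogeneous_ideal R J \<and> J \<noteq> {\<zero>\<^bsub>R\<^esub>} \<and> J \<noteq> carrier R) \<and>
     P = A <+>\<^bsub>R\<^esub> B \<and>
     (\<forall>i. betti K R (ideal_mod R P) i =
        betti K R (ideal_mod R A) i + betti K R (ideal_mod R B) i +
        (if i = 0 then 0 else betti K R (ideal_mod R (A \<inter> B)) (i - 1)))"

definition mult_set :: "('a, 'b) ring_scheme \<Rightarrow> 'a \<Rightarrow> 'a set \<Rightarrow> 'a set" where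
  "mult_set R x J = (\<lambda>a. x \<otimes>\<^bsub>R\<^esub> a) ` J"

end

theory Submission
  imports Defs
begin

text \<open>Both \<open>I\<close> and \<open>T / x T\<close> are cokernels of injections of \<open>T\<close>: of \<open>w \<mapsto> (w, - x w)\<close> into \<open>I' \<oplus> T\<close>
  and of \<open>- x\<close> into \<open>T\<close>.  As \<open>T \<subseteq> m I'\<close>, the maps lift to minimal maps of minimal resolutions, so
  the mapping cones are minimal resolutions; comparing ranks gives the Betti splitting.  Further
  \<open>ld M \<le> t\<close> means that for \<open>i \<ge> t\<close> the maps \<open>Tor_(i+1)(R/m^(s+1), M) \<rightarrow> Tor_(i+1)(R/m^s, M)\<close>
  vanish, a condition on any minimal resolution.  Since \<open>I'\<close> is Koszul and \<open>T \<subseteq> m I'\<close>,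
  the inclusion \<open>T \<subseteq> I'\<close> lifts to a map \<open>\<phi>\<close> of minimal resolutions \<open>G \<rightarrow> F\<close> sending \<open>m^s G\<close> into
  \<open>m^(s+1) F\<close>; hence \<open>\<phi>\<close> is irrelevant for
  the condition, and the cones of \<open>(\<phi>, - x)\<close> and of \<open>- x\<close> satisfy it simultaneously.  Regularity of
  \<open>x\<close> on the associated graded module enters at the end of the complexes, where \<open>x\<close> acts on
  \<open>T\<close> itself.  The
  ideal \<open>T + (x)\<close> is the same situation with \<open>R\<close> in place of \<open>I'\<close>.\<close>

text \<open>\<open>lin_defect\<close> and \<open>betti\<close> refer to a resolution picked by
  \<open>SOME\<close>, so the existence of minimal graded free resolutions has to be proved. It
  rests on finite generation of submodules of free modules, obtained from Dickson's lemma directly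
  over \<open>R\<close>, where the monomials may be linearly dependent. Afterwards degrees are
  forgotten: \<open>minimal_resolution\<close> allows terms of any type, so that cones, whose
  elements are tuples, can replace the chosen resolution. The vanishing condition is preferred to
  the homology of the linear part because it survives a homotopy \<open>h\<close>: the error
  \<open>h (d z)\<close> has at least the order of \<open>d z\<close>. The price is that exactness
  of the linear part in one degree is recovered only from the condition in two consecutive degrees,
  so that tails \<open>k \<ge> t\<close> are compared. The upper bound contains \<open>+ 1\<close>
  because the cone over \<open>- x\<close> involves \<open>T\<close> in degrees \<open>i\<close> and
  \<open>i - 1\<close>; if \<open>T\<close> is Koszul, all degrees are available and no degree is
  lost.\<close>

lemma mod_homI:
  assumes "module R M" "module R N"
    and "\<And>v. v \<in> carrier M \<Longrightarrow> f v \<in> carrier N"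
    and "\<And>u v. u \<in> carrier M \<Longrightarrow> v \<in> carrier M \<Longrightarrow> f (u \<oplus>\<^bsub>M\<^esub> v) = f u \<oplus>\<^bsub>N\<^esub> f v"
    and "\<And>r v. r \<in> carrier R \<Longrightarrow> v \<in> carrier M \<Longrightarrow> f (r \<odot>\<^bsub>M\<^esub> v) = r \<odot>\<^bsub>N\<^esub> f v"
  shows "mod_hom R M N f"
  using assms by (auto simp: mod_hom_def mod_hom_axioms_def module_hom_def)

lemma mod_hom_modules: "mod_hom R M N f \<Longrightarrow> module R M" "mod_hom R M N f \<Longrightarrow> module R N"
  by (auto simp: mod_hom_def)

lemma mod_hom_comp:
  assumes "mod_hom R M N f" "mod_hom R N P g"
  shows "mod_hom R M P (\<lambda>v. g (f v))"
proof -
  interpret f: mod_hom R M N f by fact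
  interpret g: mod_hom R N P g by fact
  show ?thesis by (rule mod_homI) (auto intro: f.M.module_axioms g.N.module_axioms)
qed

lemma mod_hom_sub:
  assumes "mod_hom R M N f" "mod_hom R M N g"
  shows "mod_hom R M N (\<lambda>v. f v \<ominus>\<^bsub>N\<^esub> g v)"
proof -
  interpret f: mod_hom R M N f by fact
  interpret g: mod_hom R M N g by fact
  show ?thesis
  proof (rule mod_homI)
    fix r v assume r: "r \<in> carrier R" "v \<in> carrier M"
    then show "f (r \<odot>\<^bsub>M\<^esub> v) \<ominus>\<^bsub>N\<^esub> g (r \<odot>\<^bsub>M\<^esub> v) = r \<odot>\<^bsub>N\<^esub> (f v \<ominus>\<^bsub>N\<^esub> g v)"
      by (simp add: a_minus_def f.N.smult_r_distr f.N.smult_r_minus)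
  qed (auto intro: f.M.module_axioms f.N.module_axioms simp: a_minus_def f.N.M.minus_add f.N.M.a_ac)
qed

lemma mod_hom_neg:
  assumes "mod_hom R M N f"
  shows "mod_hom R M N (\<lambda>v. \<ominus>\<^bsub>N\<^esub> f v)"
proof -
  interpret f: mod_hom R M N f by fact
  show ?thesis
    by (rule mod_homI)
      (auto intro: f.M.module_axioms f.N.module_axioms simp: f.N.M.minus_add f.N.smult_r_minus)
qed

lemma mod_hom_add:
  assumes "mod_hom R M N f" "mod_hom R M N g"
  shows "mod_hom R M N (\<lambda>v. f v \<oplus>\<^bsub>N\<^esub> g v)"
proof -
  interpret f: mod_hom R M N f by fact
  interpret g: mod_hom R M N g by fact
  show ?thesis
    by (rule mod_homI)
      (auto intro: f.M.module_axioms f.N.module_axioms simp: f.N.M.a_ac f.N.smult_r_distr)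
qed

lemma mod_hom_id: "module R M \<Longrightarrow> mod_hom R M M (\<lambda>v. v)"
  by (rule mod_homI) auto

lemma mod_hom_zero:
  assumes "module R M" "module R N"
  shows "mod_hom R M N (\<lambda>v. \<zero>\<^bsub>N\<^esub>)"
proof -
  interpret N: module R N by fact
  show ?thesis using assms by (intro mod_homI) auto
qed

lemma mod_hom_smult:
  assumes "module R M" "r \<in> carrier R"
  shows "mod_hom R M M (\<lambda>v. r \<odot>\<^bsub>M\<^esub> v)"
proof -
  interpret M: module R M by fact
  show ?thesis
  proof (rule mod_homI)
    fix s v assume "s \<in> carrier R" "v \<in> carrier M"
    then show "r \<odot>\<^bsub>M\<^esub> (s \<odot>\<^bsub>M\<^esub> v) = s \<odot>\<^bsub>M\<^esub> (r \<odot>\<^bsub>M\<^esub> v)"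
      using assms by (simp add: M.smult_assoc1[symmetric] M.m_comm)
  qed (use assms in \<open>auto simp: M.smult_r_distr\<close>)
qed

lemma mod_hom_cong:
  assumes "mod_hom R M N f" "\<And>v. v \<in> carrier M \<Longrightarrow> f v = g v"
  shows "mod_hom R M N g"
proof -
  interpret f: mod_hom R M N f by fact
  show ?thesis
    by (rule mod_homI)
      (auto intro: f.M.module_axioms f.N.module_axioms simp: assms(2)[symmetric])
qed

section \<open>Submodules, their images and preimages\<close>

lemma submodI:
  assumes "module R M" "N \<subseteq> carrier M" "\<zero>\<^bsub>M\<^esub> \<in> N"
    and "\<And>u v. u \<in> N \<Longrightarrow> v \<in> N \<Longrightarrow> u \<oplus>\<^bsub>M\<^esub> v \<in> N"
    and "\<And>r v. r \<in> carrier R \<Longrightarrow> v \<in> N \<Longrightarrow> r \<odot>\<^bsub>M\<^esub> v \<in> N"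
  shows "submodule R N M"
  using assms by (auto simp: submodule_def)

lemma submodD:
  assumes "submodule R N M"
  shows "module R M" "N \<subseteq> carrier M" "\<zero>\<^bsub>M\<^esub> \<in> N"
    and "u \<in> N \<Longrightarrow> v \<in> N \<Longrightarrow> u \<oplus>\<^bsub>M\<^esub> v \<in> N"
    and "r \<in> carrier R \<Longrightarrow> v \<in> N \<Longrightarrow> r \<odot>\<^bsub>M\<^esub> v \<in> N"
  using assms by (auto simp: submodule_def)

lemma submod_uminus:
  assumes "submodule R N M" "v \<in> N"
  shows "\<ominus>\<^bsub>M\<^esub> v \<in> N"
proof -
  interpret M: module R M by (rule submodD(1)[OF assms(1)])
  have "(\<ominus>\<^bsub>R\<^esub> \<one>\<^bsub>R\<^esub>) \<odot>\<^bsub>M\<^esub> v \<in> N" by (rule submodD(5)[OF assms(1)]) (use assms in auto)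
  then show ?thesis using submodD(2)[OF assms(1)] assms(2) by (auto simp: M.smult_minus_1)
qed

lemma submod_minus:
  assumes "submodule R N M" "u \<in> N" "v \<in> N"
  shows "u \<ominus>\<^bsub>M\<^esub> v \<in> N"
  unfolding a_minus_def by (rule submodD(4)[OF assms(1)]) (auto intro: assms submod_uminus)

lemma submod_carrier:
  assumes "module R M" shows "submodule R (carrier M) M"
proof -
  interpret M: module R M by fact
  show "submodule R (carrier M) M" by (rule submodI) (auto intro: M.module_axioms)
qed

lemma submod_zero:
  assumes "module R M" shows "submodule R {\<zero>\<^bsub>M\<^esub>} M"
proof -
  interpret M: module R M by fact
  show "submodule R {\<zero>\<^bsub>M\<^esub>} M" by (rule submodI) (auto intro: M.module_axioms)
qed

lemma submod_module: "submodule R N M \<Longrightarrow> module R (M\<lparr>carrier := N\<rparr>)"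
  by (rule module.submodule_is_module) (auto dest: submodD)

lemma submod_image:
  assumes "mod_hom R M N f" "submodule R P M"
  shows "submodule R (f ` P) N"
proof -
  interpret f: mod_hom R M N f by fact
  have P: "\<And>v. v \<in> P \<Longrightarrow> v \<in> carrier M" using submodD(2)[OF assms(2)] by auto
  show ?thesis
  proof (rule submodI)
    show "\<zero>\<^bsub>N\<^esub> \<in> f ` P" using submodD(3)[OF assms(2)] f.f0_is_0 by (metis imageI)
    fix u v assume "u \<in> f ` P" "v \<in> f ` P"
    then obtain a b where "u = f a" "v = f b" "a \<in> P" "b \<in> P" by auto
    then show "u \<oplus>\<^bsub>N\<^esub> v \<in> f ` P"
      using P submodD(4)[OF assms(2), of a b] by (metis f.f_add imageI)
  next
    fix r v assume "r \<in> carrier R" "v \<in> f ` P"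
    then obtain a where "v = f a" "a \<in> P" by auto
    then show "r \<odot>\<^bsub>N\<^esub> v \<in> f ` P"
      using P submodD(5)[OF assms(2), of r a] \<open>r \<in> carrier R\<close> by (metis f.f_smult imageI)
  qed (use P in \<open>auto intro: f.N.module_axioms\<close>)
qed

lemma submod_preimage:
  assumes "mod_hom R M N f" "submodule R P N"
  shows "submodule R {v \<in> carrier M. f v \<in> P} M"
proof -
  interpret f: mod_hom R M N f by fact
  show ?thesis
    using submodD[OF assms(2)] by (intro submodI) (auto intro: f.M.module_axioms)
qed

lemma submod_kernel:
  assumes "mod_hom R M N f"
  shows "submodule R {v \<in> carrier M. f v = \<zero>\<^bsub>N\<^esub>} M"
  using submod_preimage[OF assms submod_zero[OF mod_hom_modules(2)[OF assms]]] by simp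

subsection \<open>Powers of the irrelevant ideal\<close>

text \<open>The comparison of resolutions, the cones and the linearity condition are developed over
  any commutative ring in which \<open>irrelevant R\<close> is an ideal; the grading returns with
  \<open>graded_cring\<close>, for the existence of resolutions and for the residue field.\<close>

locale irrelevant_cring = cring R for R :: "('k, 'a) gmodule" (structure) +
  assumes irrelevant_ideal: "ideal (irrelevant R) R"
begin

lemma irrelevant_carrier: "r \<in> irrelevant R \<Longrightarrow> r \<in> carrier R"
  using ideal.Icarr[OF irrelevant_ideal] .

lemma ideal_smult_submod:
  assumes "module R M" "J \<subseteq> carrier R" "N \<subseteq> carrier M"
  shows "submodule R (ideal_smult R M J N) M"
proof -
  interpret M: module R M by fact
  show ?thesis unfolding ideal_smult_def by (rule M.span_is_submodule) (use assms in auto)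
qed

lemma ideal_smult_mem:
  assumes "module R M" "J \<subseteq> carrier R" "N \<subseteq> carrier M" "r \<in> J" "v \<in> N"
  shows "r \<odot>\<^bsub>M\<^esub> v \<in> ideal_smult R M J N"
proof -
  interpret M: module R M by fact
  have "{r \<odot>\<^bsub>M\<^esub> v |r v. r \<in> J \<and> v \<in> N} \<subseteq> M.span {r \<odot>\<^bsub>M\<^esub> v |r v. r \<in> J \<and> v \<in> N}"
    by (rule M.in_own_span) (use assms in auto)
  then show ?thesis unfolding ideal_smult_def using assms by blast
qed

lemma ideal_smult_least:
  assumes "submodule R P M" "\<And>r v. r \<in> J \<Longrightarrow> v \<in> N \<Longrightarrow> r \<odot>\<^bsub>M\<^esub> v \<in> P"
  shows "ideal_smult R M J N \<subseteq> P"
proof -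
  interpret M: module R M by (rule submodD(1)[OF assms(1)])
  show ?thesis unfolding ideal_smult_def by (rule M.span_is_subset) (use assms in auto)
qed

lemma max_power_0 [simp]: "max_power R M 0 = carrier M"
  by (simp add: max_power_def)

lemma max_power_Suc: "max_power R M (Suc s) = ideal_smult R M (irrelevant R) (max_power R M s)"
  by (simp add: max_power_def)

lemma max_power_submod: "module R M \<Longrightarrow> submodule R (max_power R M s) M"
proof (induction s)
  case 0 then show ?case by (simp add: submod_carrier)
next
  case (Suc s)
  show ?case unfolding max_power_Suc
    by (rule ideal_smult_submod[OF Suc.prems]) (use irrelevant_carrier submodD(2)[OF Suc.IH[OF Suc.prems]] in auto)
qed

lemmas max_power_carrier = submodD(2)[OF max_power_submod, THEN subsetD]
lemmas max_power_zero = submodD(3)[OF max_power_submod]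
lemmas max_power_add = submodD(4)[OF max_power_submod]
lemmas max_power_smult = submodD(5)[OF max_power_submod]
lemmas max_power_uminus = submod_uminus[OF max_power_submod]
lemmas max_power_minus = submod_minus[OF max_power_submod]

lemma max_power_smult_Suc:
  "module R M \<Longrightarrow> r \<in> irrelevant R \<Longrightarrow> v \<in> max_power R M s \<Longrightarrow> r \<odot>\<^bsub>M\<^esub> v \<in> max_power R M (Suc s)"
  unfolding max_power_Suc
  by (rule ideal_smult_mem) (auto intro: irrelevant_carrier dest: max_power_carrier)

lemma max_power_Suc_least:
  assumes "submodule R P M" "\<And>r v. r \<in> irrelevant R \<Longrightarrow> v \<in> max_power R M s \<Longrightarrow> r \<odot>\<^bsub>M\<^esub> v \<in> P"
  shows "max_power R M (Suc s) \<subseteq> P"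
  unfolding max_power_Suc by (rule ideal_smult_least[OF assms])

lemma max_power_Suc_subset: "module R M \<Longrightarrow> max_power R M (Suc s) \<subseteq> max_power R M s"
  by (rule max_power_Suc_least[OF max_power_submod])
    (auto intro: max_power_smult irrelevant_carrier)

lemma max_power_antimono:
  assumes "module R M" "s \<le> t" shows "max_power R M t \<subseteq> max_power R M s"
  using assms(2) by (induction rule: dec_induct) (use max_power_Suc_subset[OF assms(1)] in auto)

text \<open>The preimage of a power of the maximal ideal is a submodule, and one more factor from
  the ideal on the left gives one more on the right. The shift \<open>t\<close> is kept because maps
  with values in \<open>m N\<close> gain one order at every level, the gain on which the treatment
  of \<open>\<phi>\<close> rests.\<close>

lemma max_power_hom:
  assumes f: "mod_hom R M N f" and t: "\<And>v. v \<in> carrier M \<Longrightarrow> f v \<in> max_power R N t"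
    and v: "v \<in> max_power R M s"
  shows "f v \<in> max_power R N (s + t)"
proof -
  interpret f: mod_hom R M N f by fact
  have "max_power R M s \<subseteq> {v \<in> carrier M. f v \<in> max_power R N (s + t)}"
  proof (induction s)
    case 0 then show ?case using t by auto
  next
    case (Suc s)
    show ?case
      by (rule max_power_Suc_least[OF submod_preimage[OF f max_power_submod[OF f.N.module_axioms]]])
        (use Suc in \<open>auto simp: max_power_smult_Suc f.N.module_axioms irrelevant_carrier\<close>)
  qed
  then show ?thesis using v by auto
qed

lemma max_power_hom0:
  assumes "mod_hom R M N f" "v \<in> max_power R M s"
  shows "f v \<in> max_power R N s"
  using max_power_hom[OF assms(1), of 0] assms by (simp add: mod_hom.f_im)

text \<open>The module \<open>m^(s+1) N\<close> is spanned by multiples of elements of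
  \<open>m^s N\<close>, which lift by induction, and the image of \<open>m^(s+1) M\<close> is a
  submodule containing these multiples. Through augmentations this turns orders in a module into
  orders in degree 0 of its resolution.\<close>

lemma max_power_hom_onto:
  assumes f: "mod_hom R M N f" and onto: "f ` carrier M = carrier N" and v: "v \<in> max_power R N s"
  shows "\<exists>u\<in>max_power R M s. f u = v"
proof -
  interpret f: mod_hom R M N f by fact
  have "max_power R N s \<subseteq> f ` max_power R M s"
  proof (induction s)
    case 0 then show ?case using onto by auto
  next
    case (Suc s)
    show ?case
    proof (rule max_power_Suc_least[OF submod_image[OF f max_power_submod[OF f.M.module_axioms]]])
      fix r v assume r: "r \<in> irrelevant R" "v \<in> max_power R N s"
      then obtain u where u: "u \<in> max_power R M s" "v = f u" using Suc by auto
      then have "r \<odot>\<^bsub>N\<^esub> v = f (r \<odot>\<^bsub>M\<^esub> u)"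
        using r by (simp add: irrelevant_carrier max_power_carrier[OF f.M.module_axioms])
      then show "r \<odot>\<^bsub>N\<^esub> v \<in> f ` max_power R M (Suc s)"
        using r u max_power_smult_Suc[OF f.M.module_axioms] by auto
    qed
  qed
  then show ?thesis using v by auto
qed

section \<open>Direct sums of two modules\<close>

lemma direct_sum_simps:
  "carrier (direct_sum M N) = carrier M \<times> carrier N"
  "\<zero>\<^bsub>direct_sum M N\<^esub> = (\<zero>\<^bsub>M\<^esub>, \<zero>\<^bsub>N\<^esub>)"
  "a \<oplus>\<^bsub>direct_sum M N\<^esub> b = (fst a \<oplus>\<^bsub>M\<^esub> fst b, snd a \<oplus>\<^bsub>N\<^esub> snd b)"
  "r \<odot>\<^bsub>direct_sum M N\<^esub> b = (r \<odot>\<^bsub>M\<^esub> fst b, r \<odot>\<^bsub>N\<^esub> snd b)"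
  by (auto simp: direct_sum_def)

lemma mod_hom_fst:
  assumes "module R M" "module R N" shows "mod_hom R (direct_sum M N) M fst"
  using assms by (intro mod_homI direct_sum_is_module) (auto simp: direct_sum_simps)

lemma mod_hom_snd:
  assumes "module R M" "module R N" shows "mod_hom R (direct_sum M N) N snd"
  using assms by (intro mod_homI direct_sum_is_module) (auto simp: direct_sum_simps)

lemma mod_hom_pair:
  assumes "mod_hom R P M f" "mod_hom R P N g" shows "mod_hom R P (direct_sum M N) (\<lambda>v. (f v, g v))"
proof -
  interpret f: mod_hom R P M f by fact
  interpret g: mod_hom R P N g by fact
  show ?thesis
    by (intro mod_homI direct_sum_is_module)
      (auto simp: direct_sum_simps intro: f.M.module_axioms f.N.module_axioms g.N.module_axioms)
qed

text \<open>Only functoriality is used: the two projections give one direction, the two inclusions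
  and addition the other.\<close>

lemma max_power_direct_sum:
  assumes "module R M" "module R N"
  shows "(u, v) \<in> max_power R (direct_sum M N) s \<longleftrightarrow> u \<in> max_power R M s \<and> v \<in> max_power R N s"
    (is "?L \<longleftrightarrow> ?A \<and> ?B")
proof
  assume ?L
  then show "?A \<and> ?B"
    using max_power_hom0[OF mod_hom_fst[OF assms], of "(u,v)"]
      max_power_hom0[OF mod_hom_snd[OF assms], of "(u,v)"] by auto
next
  assume *: "?A \<and> ?B"
  interpret M: module R M by fact
  interpret N: module R N by fact
  have S: "module R (direct_sum M N)" by (rule direct_sum_is_module) fact+
  have "(u, \<zero>\<^bsub>N\<^esub>) \<in> max_power R (direct_sum M N) s" "(\<zero>\<^bsub>M\<^esub>, v) \<in> max_power R (direct_sum M N) s"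
    using max_power_hom0[OF mod_hom_pair[OF mod_hom_id[OF assms(1)] mod_hom_zero[OF assms]]]
      max_power_hom0[OF mod_hom_pair[OF mod_hom_zero[OF assms(2,1)] mod_hom_id[OF assms(2)]]] *
    by auto
  from max_power_add[OF S this] show ?L
    using * max_power_carrier[OF assms(1)] max_power_carrier[OF assms(2)]
    by (auto simp: direct_sum_simps)
qed

end

text \<open>Meant for a homotopy formula: \<open>b\<close> is the image of \<open>z\<close> under a
  map homotopic to the identity, \<open>u\<close> and \<open>w\<close> are boundaries,
  \<open>h\<close> and \<open>y\<close> have high order, and \<open>z\<close> becomes a sum of the
  two kinds.\<close>

lemma (in abelian_group) split_difference:
  assumes "b \<in> carrier G" "z \<in> carrier G" "u \<in> carrier G" "h \<in> carrier G" "y \<in> carrier G" "w \<in> carrier G"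
    and "b \<ominus> z = u \<oplus> h" "b = y \<oplus> w"
  shows "z = (y \<ominus> h) \<oplus> (w \<ominus> u)"
proof -
  have "z = b \<ominus> (b \<ominus> z)"
    using assms(1,2) by (simp add: a_minus_def minus_add r_neg2)
  also have "\<dots> = (y \<oplus> w) \<ominus> (u \<oplus> h)" by (simp only: assms(7,8)[symmetric])
  also have "\<dots> = (y \<ominus> h) \<oplus> (w \<ominus> u)"
    using assms(1-6) by (simp add: a_minus_def minus_add a_ac)
  finally show ?thesis .
qed

subsection \<open>Free modules\<close>

context cring
begin

lemma func_space_simps:
  "carrier (func_space S) = S \<rightarrow>\<^sub>E carrier R"
  "\<zero>\<^bsub>func_space S\<^esub> = (\<lambda>v\<in>S. \<zero>)"
  "f \<oplus>\<^bsub>func_space S\<^esub> g = (\<lambda>v\<in>S. f v \<oplus> g v)"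
  "c \<odot>\<^bsub>func_space S\<^esub> f = (\<lambda>v\<in>S. c \<otimes> f v)"
  by (auto simp: func_space_def)

lemma finsum_hom:
  assumes "mod_hom R M N g" "finite J" "a \<in> J \<rightarrow> carrier M"
  shows "g (\<Oplus>\<^bsub>M\<^esub>j\<in>J. a j) = (\<Oplus>\<^bsub>N\<^esub>j\<in>J. g (a j))"
proof -
  interpret g: mod_hom R M N g by fact
  show ?thesis using assms(2,3)
  proof (induction J rule: finite_induct)
    case (insert j J)
    then have "(\<Oplus>\<^bsub>M\<^esub>j\<in>J. a j) \<in> carrier M" by (intro g.M.M.finsum_closed) auto
    with insert show ?case
      by (simp add: Pi_def)
  qed simp
qed

text \<open>The universal property of the coordinate module: a homomorphism is prescribed by the
  images \<open>a j\<close> of the basis vectors.\<close>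

lemma finsum_lin_hom:
  assumes M: "module R M" and S: "finite S" and a: "a \<in> S \<rightarrow> carrier M"
  shows "mod_hom R (func_space S) M (\<lambda>f. \<Oplus>\<^bsub>M\<^esub>j\<in>S. f j \<odot>\<^bsub>M\<^esub> a j)"
proof -
  interpret M: module R M by fact
  have a': "\<And>j. j \<in> S \<Longrightarrow> a j \<in> carrier M" using a by auto
  have c: "\<And>f j. f \<in> S \<rightarrow>\<^sub>E carrier R \<Longrightarrow> j \<in> S \<Longrightarrow> f j \<in> carrier R" by auto
  show ?thesis
  proof (rule mod_homI)
    fix f g assume *: "f \<in> carrier (func_space S)" "g \<in> carrier (func_space S)"
    have "(\<Oplus>\<^bsub>M\<^esub>j\<in>S. (f \<oplus>\<^bsub>func_space S\<^esub> g) j \<odot>\<^bsub>M\<^esub> a j) = (\<Oplus>\<^bsub>M\<^esub>j\<in>S. f j \<odot>\<^bsub>M\<^esub> a j \<oplus>\<^bsub>M\<^esub> g j \<odot>\<^bsub>M\<^esub> a j)"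
      using * a' c by (intro M.M.finsum_cong') (auto simp: func_space_simps M.smult_l_distr)
    also have "\<dots> = (\<Oplus>\<^bsub>M\<^esub>j\<in>S. f j \<odot>\<^bsub>M\<^esub> a j) \<oplus>\<^bsub>M\<^esub> (\<Oplus>\<^bsub>M\<^esub>j\<in>S. g j \<odot>\<^bsub>M\<^esub> a j)"
      using * a' c by (intro M.M.finsum_addf) (auto simp: func_space_simps)
    finally show "(\<Oplus>\<^bsub>M\<^esub>j\<in>S. (f \<oplus>\<^bsub>func_space S\<^esub> g) j \<odot>\<^bsub>M\<^esub> a j)
      = (\<Oplus>\<^bsub>M\<^esub>j\<in>S. f j \<odot>\<^bsub>M\<^esub> a j) \<oplus>\<^bsub>M\<^esub> (\<Oplus>\<^bsub>M\<^esub>j\<in>S. g j \<odot>\<^bsub>M\<^esub> a j)" .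
  next
    fix r f assume *: "r \<in> carrier R" "f \<in> carrier (func_space S)"
    have "(\<Oplus>\<^bsub>M\<^esub>j\<in>S. (r \<odot>\<^bsub>func_space S\<^esub> f) j \<odot>\<^bsub>M\<^esub> a j) = (\<Oplus>\<^bsub>M\<^esub>j\<in>S. r \<odot>\<^bsub>M\<^esub> (f j \<odot>\<^bsub>M\<^esub> a j))"
      using * a' c by (intro M.M.finsum_cong') (auto simp: func_space_simps M.smult_assoc1)
    also have "\<dots> = r \<odot>\<^bsub>M\<^esub> (\<Oplus>\<^bsub>M\<^esub>j\<in>S. f j \<odot>\<^bsub>M\<^esub> a j)"
      using * a' c S by (intro M.finsum_smult_ldistr[symmetric]) (auto simp: func_space_simps)
    finally show "(\<Oplus>\<^bsub>M\<^esub>j\<in>S. (r \<odot>\<^bsub>func_space S\<^esub> f) j \<odot>\<^bsub>M\<^esub> a j) = r \<odot>\<^bsub>M\<^esub> (\<Oplus>\<^bsub>M\<^esub>j\<in>S. f j \<odot>\<^bsub>M\<^esub> a j)" .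
  qed (use a' c in \<open>auto intro!: M.M.finsum_closed M.module_axioms func_space_is_module simp: func_space_simps\<close>)
qed

lemma finsum_func_space:
  assumes "finite J" "\<And>j. j \<in> J \<Longrightarrow> g j \<in> carrier (func_space S)" "t \<in> S"
  shows "(\<Oplus>\<^bsub>func_space S\<^esub>j\<in>J. g j) t = (\<Oplus>j\<in>J. g j t)"
proof -
  interpret V: module R "func_space S" by (rule func_space_is_module)
  have 0: "\<And>f. f \<in> carrier (func_space S) \<Longrightarrow> f t \<in> carrier R"
    using assms(3) by (auto simp: func_space_simps)
  show ?thesis using assms(1,2)
  proof (induction J rule: finite_induct)
    case empty then show ?case using assms(3) by (simp add: func_space_simps)
  next
    case (insert j J)
    then have "(\<Oplus>\<^bsub>func_space S\<^esub>j\<in>insert j J. g j) = g j \<oplus>\<^bsub>func_space S\<^esub> (\<Oplus>\<^bsub>func_space S\<^esub>j\<in>J. g j)"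
      by (intro V.M.finsum_insert) auto
    then have "(\<Oplus>\<^bsub>func_space S\<^esub>j\<in>insert j J. g j) t = g j t \<oplus> (\<Oplus>j\<in>J. g j t)"
      using insert assms(3) by (simp add: func_space_simps(3))
    also have "\<dots> = (\<Oplus>j\<in>insert j J. g j t)"
      using insert 0 by (intro finsum_insert[symmetric]) auto
    finally show ?case .
  qed
qed

lemma basis_elt_carrier: "j \<in> S \<Longrightarrow> basis_elt R S j \<in> carrier (func_space S)"
  by (auto simp: basis_elt_def func_space_simps)

lemma func_space_expand:
  assumes "finite S" "f \<in> carrier (func_space S)"
  shows "f = (\<Oplus>\<^bsub>func_space S\<^esub>j\<in>S. f j \<odot>\<^bsub>func_space S\<^esub> basis_elt R S j)" (is "_ = ?s")
proof
  interpret V: module R "func_space S" by (rule func_space_is_module)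
  have f: "\<And>j. j \<in> S \<Longrightarrow> f j \<in> carrier R" using assms(2) by (auto simp: func_space_simps)
  have s: "?s \<in> carrier (func_space S)"
    using f by (intro V.M.finsum_closed) (auto intro!: V.smult_closed basis_elt_carrier)
  fix t show "f t = ?s t"
  proof (cases "t \<in> S")
    case True
    have "?s t = (\<Oplus>j\<in>S. (f j \<odot>\<^bsub>func_space S\<^esub> basis_elt R S j) t)"
      by (rule finsum_func_space) (use assms f True in \<open>auto intro!: V.smult_closed basis_elt_carrier\<close>)
    also have "\<dots> = (\<Oplus>j\<in>S. if t = j then f j else \<zero>)"
      using f True by (intro finsum_cong') (auto simp: func_space_simps basis_elt_def)
    also have "\<dots> = f t" using assms(1) True f by (intro add.finprod_singleton) auto
    finally show ?thesis by simp
  next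
    case False
    then show ?thesis using s assms(2) by (auto simp: func_space_simps PiE_def extensional_def)
  qed
qed

lemma mod_hom_inv:
  assumes "mod_hom R M N f" "bij_betw f (carrier M) (carrier N)"
  shows "mod_hom R N M (inv_into (carrier M) f)"
proof -
  interpret f: mod_hom R M N f by fact
  let ?g = "inv_into (carrier M) f"
  have g: "\<And>v. v \<in> carrier N \<Longrightarrow> ?g v \<in> carrier M" "\<And>v. v \<in> carrier N \<Longrightarrow> f (?g v) = v"
    using assms(2) by (auto simp: bij_betw_def inv_into_into f_inv_into_f)
  have h: "\<And>u. u \<in> carrier M \<Longrightarrow> ?g (f u) = u"
    using assms(2) by (auto simp: bij_betw_def)
  show ?thesis
  proof (rule mod_homI)
    fix u v assume "u \<in> carrier N" "v \<in> carrier N"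
    then have "f (?g u \<oplus>\<^bsub>M\<^esub> ?g v) = u \<oplus>\<^bsub>N\<^esub> v" "?g u \<oplus>\<^bsub>M\<^esub> ?g v \<in> carrier M" using g by simp_all
    then show "?g (u \<oplus>\<^bsub>N\<^esub> v) = ?g u \<oplus>\<^bsub>M\<^esub> ?g v" using h by metis
  next
    fix r v assume "r \<in> carrier R" "v \<in> carrier N"
    then have "f (r \<odot>\<^bsub>M\<^esub> ?g v) = r \<odot>\<^bsub>N\<^esub> v" "r \<odot>\<^bsub>M\<^esub> ?g v \<in> carrier M" using g by simp_all
    then show "?g (r \<odot>\<^bsub>N\<^esub> v) = r \<odot>\<^bsub>M\<^esub> ?g v" using h by metis
  qed (use g in \<open>auto intro: f.M.module_axioms f.N.module_axioms\<close>)
qed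

end

text \<open>Freeness is an isomorphism with coordinates rather than a basis inside \<open>M\<close>,
  so that it passes easily to modules whose elements are pairs. Ranks of minimal resolutions are
  compared later by counting modulo the maximal ideal.\<close>

definition free_module :: "('a, 'b) ring_scheme \<Rightarrow> ('a, 'm, 'e) module_scheme \<Rightarrow> nat \<Rightarrow> bool" where
  "free_module R M n \<longleftrightarrow> module R M \<and>
     (\<exists>f. mod_hom R (ring.func_space R {..<n}) M f \<and>
        bij_betw f (carrier (ring.func_space R {..<n})) (carrier M))"

context cring
begin

lemma free_module_inverse:
  assumes "free_module R M n"
  shows "\<exists>f g. mod_hom R (func_space {..<n}) M f \<and> mod_hom R M (func_space {..<n}) g \<and>
    (\<forall>v\<in>carrier M. f (g v) = v) \<and> (\<forall>u\<in>carrier (func_space {..<n}). g (f u) = u)"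
proof -
  obtain f where f: "mod_hom R (func_space {..<n}) M f"
      "bij_betw f (carrier (func_space {..<n})) (carrier M)"
    using assms unfolding free_module_def by blast
  show ?thesis
    by (intro exI[of _ f] exI[of _ "inv_into (carrier (func_space {..<n})) f"] conjI f(1) mod_hom_inv[OF f])
      (use f(2) in \<open>auto simp: bij_betw_def f_inv_into_f\<close>)
qed

lemma free_moduleI:
  assumes "mod_hom R (func_space {..<n}) M f" "mod_hom R M (func_space {..<n}) g"
    "\<And>v. v \<in> carrier M \<Longrightarrow> f (g v) = v" "\<And>u. u \<in> carrier (func_space {..<n}) \<Longrightarrow> g (f u) = u"
  shows "free_module R M n"
  unfolding free_module_def
proof (intro conjI exI)
  show "bij_betw f (carrier (func_space {..<n})) (carrier M)"
    by (rule bij_betw_byWitness[where f' = g])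
      (use assms mod_hom.f_im[OF assms(1)] mod_hom.f_im[OF assms(2)] in auto)
qed (use assms mod_hom_modules in auto)

lemma free_module_module: "free_module R M n \<Longrightarrow> module R M"
  by (simp add: free_module_def)

lemma free_module_trivial:
  assumes "module R M" "carrier M = {\<zero>\<^bsub>M\<^esub>}"
  shows "free_module R M 0"
proof (rule free_moduleI)
  interpret V: module R "func_space {..<0::nat}" by (rule func_space_is_module)
  show "mod_hom R (func_space {..<0::nat}) M (\<lambda>v. \<zero>\<^bsub>M\<^esub>)" "mod_hom R M (func_space {..<0::nat}) (\<lambda>v. \<zero>\<^bsub>func_space {..<0::nat}\<^esub>)"
    using assms V.module_axioms by (auto intro: mod_hom_zero)
qed (use assms in \<open>auto simp: func_space_simps\<close>)

text \<open>Projectivity, by lifting the basis. The submodule \<open>A'\<close> confines the lift: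
  preimages of the basis elements are chosen in \<open>A'\<close>, and linear combinations of them
  stay there. With \<open>A'\<close> the whole module this is the usual statement; with
  \<open>A' = m A\<close> it produces lifts of positive order.\<close>

lemma free_module_lift:
  assumes P: "free_module R P n" and p: "mod_hom R A B p" and q: "mod_hom R P B q"
    and A': "submodule R A' A" and qp: "\<And>v. v \<in> carrier P \<Longrightarrow> q v \<in> p ` A'"
  shows "\<exists>l. mod_hom R P A l \<and> (\<forall>v\<in>carrier P. l v \<in> A' \<and> p (l v) = q v)"
proof -
  let ?V = "func_space {..<n}" and ?e = "basis_elt R {..<n}"
  obtain f g where f: "mod_hom R ?V P f" and g: "mod_hom R P ?V g"
      and fg: "\<forall>v\<in>carrier P. f (g v) = v"
    using free_module_inverse[OF P] by (elim exE conjE)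
  interpret f: mod_hom R ?V P f by fact
  interpret g: mod_hom R P ?V g by fact
  interpret p: mod_hom R A B p by fact
  interpret q: mod_hom R P B q by fact
  have "\<forall>j\<in>{..<n}. \<exists>a. a \<in> A' \<and> p a = q (f (?e j))"
  proof
    fix j assume "j \<in> {..<n}"
    then have "q (f (?e j)) \<in> p ` A'" by (intro qp f.f_im basis_elt_carrier)
    then show "\<exists>a. a \<in> A' \<and> p a = q (f (?e j))" by (metis imageE)
  qed
  then obtain a where a: "\<And>j. j \<in> {..<n} \<Longrightarrow> a j \<in> A'" "\<And>j. j \<in> {..<n} \<Longrightarrow> p (a j) = q (f (?e j))"
    by metis
  have aA: "\<And>j. j \<in> {..<n} \<Longrightarrow> a j \<in> carrier A" using a(1) submodD(2)[OF A'] by auto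
  define L where "L u = (\<Oplus>\<^bsub>A\<^esub>j\<in>{..<n}. u j \<odot>\<^bsub>A\<^esub> a j)" for u
  have L: "mod_hom R ?V A L"
    unfolding L_def by (rule finsum_lin_hom) (use aA p.M.module_axioms in auto)
  have sub: "L u \<in> A'" if u: "u \<in> carrier ?V" for u
  proof -
    have uc: "\<And>j. j \<in> {..<n} \<Longrightarrow> u j \<in> carrier R" using u by (auto simp: func_space_simps)
    have "J \<subseteq> {..<n} \<Longrightarrow> (\<Oplus>\<^bsub>A\<^esub>j\<in>J. u j \<odot>\<^bsub>A\<^esub> a j) \<in> A'" if "finite J" for J
      using that
    proof (induction J rule: finite_induct)
      case empty then show ?case using submodD(3)[OF A'] by simp
    next
      case (insert j J)
      then have "(\<Oplus>\<^bsub>A\<^esub>j\<in>insert j J. u j \<odot>\<^bsub>A\<^esub> a j) = u j \<odot>\<^bsub>A\<^esub> a j \<oplus>\<^bsub>A\<^esub> (\<Oplus>\<^bsub>A\<^esub>j\<in>J. u j \<odot>\<^bsub>A\<^esub> a j)"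
        using uc aA by (intro p.M.M.finsum_insert) auto
      then show ?case using insert uc a(1) by (auto intro!: submodD(4,5)[OF A'])
    qed
    then show ?thesis unfolding L_def by simp
  qed
  have comp: "p (L u) = q (f u)" if u: "u \<in> carrier ?V" for u
  proof -
    have uc: "\<And>j. j \<in> {..<n} \<Longrightarrow> u j \<in> carrier R" using u by (auto simp: func_space_simps)
    have qf: "mod_hom R ?V B (\<lambda>v. q (f v))" by (rule mod_hom_comp) fact+
    have "p (L u) = (\<Oplus>\<^bsub>B\<^esub>j\<in>{..<n}. p (u j \<odot>\<^bsub>A\<^esub> a j))"
      unfolding L_def by (rule finsum_hom[OF p]) (use uc aA in auto)
    also have "\<dots> = (\<Oplus>\<^bsub>B\<^esub>j\<in>{..<n}. q (f (u j \<odot>\<^bsub>?V\<^esub> ?e j)))"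
      using uc aA a(2)
      by (intro p.N.M.finsum_cong') (auto simp: f.f_smult basis_elt_carrier)
    also have "\<dots> = q (f (\<Oplus>\<^bsub>?V\<^esub>j\<in>{..<n}. u j \<odot>\<^bsub>?V\<^esub> ?e j))"
      by (rule finsum_hom[OF qf, symmetric]) (use uc in \<open>auto intro!: f.M.smult_closed basis_elt_carrier\<close>)
    also have "\<dots> = q (f u)" using func_space_expand[OF _ u] by simp
    finally show ?thesis .
  qed
  show ?thesis
    by (rule exI[of _ "\<lambda>v. L (g v)"]) (use sub comp fg mod_hom_comp[OF g L] in auto)
qed

lemma func_space_reindex_hom:
  assumes "\<And>j. j \<in> T \<Longrightarrow> p j \<in> S"
  shows "mod_hom R (func_space S) (func_space T) (\<lambda>u. \<lambda>j\<in>T. u (p j))"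
proof (rule mod_homI[OF func_space_is_module func_space_is_module])
  fix u v assume "u \<in> carrier (func_space S)" "v \<in> carrier (func_space S)"
  then show "(\<lambda>j\<in>T. (u \<oplus>\<^bsub>func_space S\<^esub> v) (p j)) =
    (\<lambda>j\<in>T. u (p j)) \<oplus>\<^bsub>func_space T\<^esub> (\<lambda>j\<in>T. v (p j))"
    using assms by (intro ext) (simp add: func_space_simps restrict_def)
next
  fix r v assume "r \<in> carrier R" "v \<in> carrier (func_space S)"
  then show "(\<lambda>j\<in>T. (r \<odot>\<^bsub>func_space S\<^esub> v) (p j)) = r \<odot>\<^bsub>func_space T\<^esub> (\<lambda>j\<in>T. v (p j))"
    using assms by (intro ext) (simp add: func_space_simps restrict_def)
qed (use assms in \<open>auto simp: func_space_simps\<close>)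

lemma free_module_direct_sum:
  assumes "free_module R M a" "free_module R N b"
  shows "free_module R (direct_sum M N) (a + b)"
proof -
  obtain f g where fg: "mod_hom R (func_space {..<a}) M f" "mod_hom R M (func_space {..<a}) g"
      "\<forall>v\<in>carrier M. f (g v) = v" "\<forall>u\<in>carrier (func_space {..<a}). g (f u) = u"
    using free_module_inverse[OF assms(1)] by (elim exE conjE)
  obtain f' g' where fg': "mod_hom R (func_space {..<b}) N f'" "mod_hom R N (func_space {..<b}) g'"
      "\<forall>v\<in>carrier N. f' (g' v) = v" "\<forall>u\<in>carrier (func_space {..<b}). g' (f' u) = u"
    using free_module_inverse[OF assms(2)] by (elim exE conjE)
  interpret f: mod_hom R "func_space {..<a}" M f by (rule fg(1))
  interpret f': mod_hom R "func_space {..<b}" N f' by (rule fg'(1))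
  interpret g: mod_hom R M "func_space {..<a}" g by (rule fg(2))
  interpret g': mod_hom R N "func_space {..<b}" g' by (rule fg'(2))
  \<comment> \<open>\<open>h1\<close> and \<open>h2\<close> cut a vector of length
    \<open>a + b\<close> into its first \<open>a\<close> and its last \<open>b\<close> coordinates,
    and \<open>k\<close> glues such pieces.\<close>
  define h1 where "h1 u = (\<lambda>j\<in>{..<a}. u j)" for u :: "nat \<Rightarrow> 'a"
  define h2 where "h2 u = (\<lambda>j\<in>{..<b}. u (a + j))" for u :: "nat \<Rightarrow> 'a"
  define k where "k u v = (\<lambda>j\<in>{..<a + b}. if j < a then u j else v (j - a))" for u v :: "nat \<Rightarrow> 'a"
  have h1: "mod_hom R (func_space {..<a + b}) (func_space {..<a}) h1"
    unfolding h1_def by (rule func_space_reindex_hom) simp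
  have h2: "mod_hom R (func_space {..<a + b}) (func_space {..<b}) h2"
    unfolding h2_def by (rule func_space_reindex_hom) simp
  have simps: "carrier (direct_sum M N) = carrier M \<times> carrier N"
    "\<And>a b. a \<oplus>\<^bsub>direct_sum M N\<^esub> b = (fst a \<oplus>\<^bsub>M\<^esub> fst b, snd a \<oplus>\<^bsub>N\<^esub> snd b)"
    "\<And>r b. r \<odot>\<^bsub>direct_sum M N\<^esub> b = (r \<odot>\<^bsub>M\<^esub> fst b, r \<odot>\<^bsub>N\<^esub> snd b)"
    by (auto simp: direct_sum_def)
  interpret h1: mod_hom R "func_space {..<a + b}" "func_space {..<a}" h1 by (rule h1)
  interpret h2: mod_hom R "func_space {..<a + b}" "func_space {..<b}" h2 by (rule h2)
  have M: "module R (direct_sum M N)"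
    by (rule direct_sum_is_module) (rule f.N.module_axioms f'.N.module_axioms)+
  have V: "u \<in> carrier (func_space {..<c}) \<longleftrightarrow> (\<forall>j<c. u j \<in> carrier R) \<and> (\<forall>j. \<not> j < c \<longrightarrow> u j = undefined)"
    for u c by (auto simp: func_space_simps PiE_def extensional_def)
  have k: "k u v \<in> carrier (func_space {..<a + b})"
    if "u \<in> carrier (func_space {..<a})" "v \<in> carrier (func_space {..<b})" for u v
    using that by (simp add: V k_def)
  have hk: "h1 (k u v) = u" "h2 (k u v) = v"
    if "u \<in> carrier (func_space {..<a})" "v \<in> carrier (func_space {..<b})" for u v
    using that by (simp_all add: V k_def h1_def h2_def fun_eq_iff restrict_def)
  have kh: "k (h1 u) (h2 u) = u" if "u \<in> carrier (func_space {..<a + b})" for u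
    using that by (simp add: V k_def h1_def h2_def fun_eq_iff restrict_def)
  have k_add: "k (u \<oplus>\<^bsub>func_space {..<a}\<^esub> u') (v \<oplus>\<^bsub>func_space {..<b}\<^esub> v')
      = k u v \<oplus>\<^bsub>func_space {..<a + b}\<^esub> k u' v'" for u u' v v'
    by (auto simp add: k_def func_space_simps(3) fun_eq_iff restrict_def)
  have k_smult: "k (r \<odot>\<^bsub>func_space {..<a}\<^esub> u) (r \<odot>\<^bsub>func_space {..<b}\<^esub> v)
      = r \<odot>\<^bsub>func_space {..<a + b}\<^esub> k u v" for r u v
    by (auto simp add: k_def func_space_simps(4) fun_eq_iff restrict_def)
  show ?thesis
  proof (rule free_moduleI)
    show "mod_hom R (func_space {..<a + b}) (direct_sum M N) (\<lambda>u. (f (h1 u), f' (h2 u)))"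
      by (rule mod_homI[OF func_space_is_module M]) (simp_all add: simps)
    show "mod_hom R (direct_sum M N) (func_space {..<a + b}) (\<lambda>u. k (g (fst u)) (g' (snd u)))"
    proof (rule mod_homI[OF M func_space_is_module])
      fix u assume "u \<in> carrier (direct_sum M N)"
      then show "k (g (fst u)) (g' (snd u)) \<in> carrier (func_space {..<a + b})"
        by (intro k) (simp_all add: simps mem_Times_iff)
    qed (simp_all add: simps mem_Times_iff k_add k_smult)
    show "(f (h1 (k (g (fst v)) (g' (snd v)))), f' (h2 (k (g (fst v)) (g' (snd v))))) = v"
      if "v \<in> carrier (direct_sum M N)" for v
      using that fg(3) fg'(3) by (simp add: simps mem_Times_iff hk)
    show "k (g (fst (f (h1 u), f' (h2 u)))) (g' (snd (f (h1 u), f' (h2 u)))) = u"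
      if "u \<in> carrier (func_space {..<a + b})" for u
      using that fg(4) fg'(4) h1.f_im h2.f_im kh by simp
  qed
qed

end

subsection \<open>Minimal free resolutions\<close>

text \<open>An ungraded minimal free resolution whose terms may be modules of any one type;
  \<open>n\<close> records the ranks. The resolution chosen in the definitions, direct sums of
  resolutions and mapping cones are all instances, and results about one can be carried to
  another.\<close>

locale minimal_resolution = irrelevant_cring R for R :: "('k, 'a) gmodule" (structure) +
  fixes C :: "nat \<Rightarrow> ('a, 'm, 'e) module_scheme" and d :: "nat \<Rightarrow> 'm \<Rightarrow> 'm"
    and e :: "'m \<Rightarrow> 'n" and M :: "('a, 'n, 'f) module_scheme" and n :: "nat \<Rightarrow> nat"
  assumes free: "free_module R (C i) (n i)"
    and d_hom: "mod_hom R (C (Suc i)) (C i) (d (Suc i))"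
    and e_hom: "mod_hom R (C 0) M e"
    and e_onto: "e ` carrier (C 0) = carrier M"
    and exact0: "{z \<in> carrier (C 0). e z = \<zero>\<^bsub>M\<^esub>} = d 1 ` carrier (C 1)"
    and exact: "{z \<in> carrier (C (Suc i)). d (Suc i) z = \<zero>\<^bsub>C i\<^esub>} = d (Suc (Suc i)) ` carrier (C (Suc (Suc i)))"
    and minimal: "v \<in> carrier (C (Suc i)) \<Longrightarrow> d (Suc i) v \<in> max_power R (C i) 1"
begin

lemma C_module: "module R (C i)"
  by (rule free_module_module[OF free])

lemma d_closed: "v \<in> carrier (C (Suc i)) \<Longrightarrow> d (Suc i) v \<in> carrier (C i)"
  by (rule mod_hom.f_im[OF d_hom])

lemma e_closed: "v \<in> carrier (C 0) \<Longrightarrow> e v \<in> carrier M"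
  by (rule mod_hom.f_im[OF e_hom])

lemma d_d: "v \<in> carrier (C (Suc (Suc i))) \<Longrightarrow> d (Suc i) (d (Suc (Suc i)) v) = \<zero>\<^bsub>C i\<^esub>"
  using exact[of i] by blast

lemma e_d: "v \<in> carrier (C (Suc 0)) \<Longrightarrow> e (d (Suc 0) v) = \<zero>\<^bsub>M\<^esub>"
  using exact0 by auto

lemma cycle_lift:
  assumes "z \<in> carrier (C (Suc i))" "d (Suc i) z = \<zero>\<^bsub>C i\<^esub>"
  shows "\<exists>w\<in>carrier (C (Suc (Suc i))). z = d (Suc (Suc i)) w"
  using exact[of i] assms by blast

lemma cycle_lift0:
  assumes "z \<in> carrier (C 0)" "e z = \<zero>\<^bsub>M\<^esub>"
  shows "\<exists>w\<in>carrier (C (Suc 0)). z = d (Suc 0) w"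
  using exact0 assms by auto

end

text \<open>For a minimal free resolution \<open>C\<close>, the condition \<open>linear_at C d i\<close> says that the map
  \<open>Tor_(i+1)(R/m^(s+1), -) \<rightarrow> Tor_(i+1)(R/m^s, -)\<close> vanishes for all \<open>s\<close>.\<close>

definition linear_at :: "('k, 'a) gmodule \<Rightarrow> (nat \<Rightarrow> ('a, 'm, 'e) module_scheme) \<Rightarrow>
    (nat \<Rightarrow> 'm \<Rightarrow> 'm) \<Rightarrow> nat \<Rightarrow> bool" where
  "linear_at R C d i \<longleftrightarrow> (\<forall>s. \<forall>z\<in>carrier (C (Suc i)). d (Suc i) z \<in> max_power R (C i) (Suc s) \<longrightarrow>
     (\<exists>y\<in>max_power R (C (Suc i)) s. \<exists>w\<in>carrier (C (Suc (Suc i))).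
        z = y \<oplus>\<^bsub>C (Suc i)\<^esub> d (Suc (Suc i)) w))"

text \<open>The comparison theorem for resolutions, with the values in degree \<open>i\<close>
  confined to a submodule \<open>A i\<close>. The hypothesis \<open>step\<close> is the condition
  under which a boundary met during the construction is the boundary of an element of
  \<open>A (Suc i)\<close>. For \<open>A i\<close> the whole module it is immediate; for
  \<open>A i = m F_i\<close> it comes from linearity of \<open>F\<close>.\<close>

lemma chain_map_exists:
  fixes G :: "nat \<Rightarrow> ('a, 'm, 'e) module_scheme" and F :: "nat \<Rightarrow> ('a, 'm2, 'e2) module_scheme"
  assumes "minimal_resolution R G dG eG N nG" and "minimal_resolution R F dF eF M nF"
    and f: "mod_hom R N M f"
    and A: "\<And>i. submodule R (A i) (F i)"
    and base: "\<And>v. v \<in> carrier (G 0) \<Longrightarrow> f (eG v) \<in> eF ` A 0"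
    and step: "\<And>i l w. mod_hom R (G i) (F i) l \<Longrightarrow> (\<And>v. v \<in> carrier (G i) \<Longrightarrow> l v \<in> A i) \<Longrightarrow>
      w \<in> carrier (G (Suc i)) \<Longrightarrow> l (dG (Suc i) w) \<in> dF (Suc i) ` carrier (F (Suc i)) \<Longrightarrow>
      l (dG (Suc i) w) \<in> dF (Suc i) ` A (Suc i)"
  obtains \<phi> where "\<And>i. mod_hom R (G i) (F i) (\<phi> i)"
    "\<And>i v. v \<in> carrier (G i) \<Longrightarrow> \<phi> i v \<in> A i"
    "\<And>v. v \<in> carrier (G 0) \<Longrightarrow> eF (\<phi> 0 v) = f (eG v)"
    "\<And>i v. v \<in> carrier (G (Suc i)) \<Longrightarrow> dF (Suc i) (\<phi> (Suc i) v) = \<phi> i (dG (Suc i) v)"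
proof -
  interpret R: irrelevant_cring R using assms(1) by (simp add: minimal_resolution_def)
  interpret G: minimal_resolution R G dG eG N nG by fact
  interpret F: minimal_resolution R F dF eF M nF by fact
  interpret f: mod_hom R N M f by (rule f)
  \<comment> \<open>The last conjunct says that composing with the differential of \<open>G\<close>
    gives boundaries, so that the next lift exists. Commutation with the differentials relates two
    consecutive maps and is put into \<open>?Q\<close>.\<close>
  let ?P = "\<lambda>i l. mod_hom R (G i) (F i) l \<and> (\<forall>v\<in>carrier (G i). l v \<in> A i) \<and>
    (i = 0 \<longrightarrow> (\<forall>v\<in>carrier (G 0). eF (l v) = f (eG v))) \<and>
    (\<forall>w\<in>carrier (G (Suc i)). l (dG (Suc i) w) \<in> dF (Suc i) ` carrier (F (Suc i)))"
  let ?Q = "\<lambda>i l l'. \<forall>v\<in>carrier (G (Suc i)). dF (Suc i) (l' v) = l (dG (Suc i) v)"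
  have "\<exists>\<phi>. \<forall>i. ?P i (\<phi> i) \<and> ?Q i (\<phi> i) (\<phi> (Suc i))"
  proof (rule dependent_nat_choice)
    obtain l where l: "mod_hom R (G 0) (F 0) l" "\<forall>v\<in>carrier (G 0). l v \<in> A 0 \<and> eF (l v) = f (eG v)"
      using R.free_module_lift[OF G.free F.e_hom mod_hom_comp[OF G.e_hom f] A base] by blast
    have "l (dG (Suc 0) w) \<in> dF (Suc 0) ` carrier (F (Suc 0))" if w: "w \<in> carrier (G (Suc 0))" for w
    proof -
      have "eF (l (dG (Suc 0) w)) = \<zero>\<^bsub>M\<^esub>"
        using l(2) w G.d_closed[OF w] G.e_d[OF w] by simp
      moreover have "l (dG (Suc 0) w) \<in> carrier (F 0)"
        using mod_hom.f_im[OF l(1)] G.d_closed[OF w] by auto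
      ultimately show ?thesis using F.cycle_lift0 by blast
    qed
    then show "\<exists>l. ?P 0 l" using l by (intro exI[of _ l]) simp
  next
    fix l i assume P: "?P i l"
    then have l: "mod_hom R (G i) (F i) l" by simp
    have "\<exists>l'. mod_hom R (G (Suc i)) (F (Suc i)) l' \<and>
        (\<forall>v\<in>carrier (G (Suc i)). l' v \<in> A (Suc i) \<and> dF (Suc i) (l' v) = l (dG (Suc i) v))"
      by (rule R.free_module_lift[OF G.free F.d_hom mod_hom_comp[OF G.d_hom l] A])
        (use P step[OF l] in auto)
    then obtain l' where l': "mod_hom R (G (Suc i)) (F (Suc i)) l'"
      "\<And>v. v \<in> carrier (G (Suc i)) \<Longrightarrow> l' v \<in> A (Suc i)"
      "\<And>v. v \<in> carrier (G (Suc i)) \<Longrightarrow> dF (Suc i) (l' v) = l (dG (Suc i) v)"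
      by blast
    have "l' (dG (Suc (Suc i)) w) \<in> dF (Suc (Suc i)) ` carrier (F (Suc (Suc i)))"
      if w: "w \<in> carrier (G (Suc (Suc i)))" for w
    proof -
      have "dF (Suc i) (l' (dG (Suc (Suc i)) w)) = \<zero>\<^bsub>F i\<^esub>"
        using l'(3)[OF G.d_closed[OF w]] G.d_d[OF w] mod_hom.f0_is_0[OF l] by simp
      then show ?thesis
        using F.cycle_lift mod_hom.f_im[OF l'(1) G.d_closed[OF w]] by blast
    qed
    then show "\<exists>l'. ?P (Suc i) l' \<and> ?Q i l l'" using l' by (intro exI[of _ l']) simp
  qed
  then obtain \<phi> where \<phi>: "\<And>i. ?P i (\<phi> i) \<and> ?Q i (\<phi> i) (\<phi> (Suc i))" by blast
  show thesis by (rule that[of \<phi>]) (use \<phi> in blast)+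
qed

text \<open>A chain endomorphism over the zero map of the resolved module: in each degree the part
  not yet accounted for is a cycle, hence a boundary, and lifts along the differential.\<close>

lemma null_homotopy_exists:
  fixes F :: "nat \<Rightarrow> ('a, 'm, 'e) module_scheme"
  assumes "minimal_resolution R F d e M n"
    and \<psi>: "\<And>i. mod_hom R (F i) (F i) (\<psi> i)"
    and \<psi>0: "\<And>v. v \<in> carrier (F 0) \<Longrightarrow> e (\<psi> 0 v) = \<zero>\<^bsub>M\<^esub>"
    and \<psi>d: "\<And>i v. v \<in> carrier (F (Suc i)) \<Longrightarrow> d (Suc i) (\<psi> (Suc i) v) = \<psi> i (d (Suc i) v)"
  obtains h where "\<And>i. mod_hom R (F i) (F (Suc i)) (h i)"
    "\<And>v. v \<in> carrier (F 0) \<Longrightarrow> \<psi> 0 v = d (Suc 0) (h 0 v)"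
    "\<And>i v. v \<in> carrier (F (Suc i)) \<Longrightarrow>
       \<psi> (Suc i) v = d (Suc (Suc i)) (h (Suc i) v) \<oplus>\<^bsub>F (Suc i)\<^esub> h i (d (Suc i) v)"
proof -
  interpret R: irrelevant_cring R using assms(1) by (simp add: minimal_resolution_def)
  interpret F: minimal_resolution R F d e M n by fact
  \<comment> \<open>The last conjunct, \<open>d h d = \<psi> d\<close>, is what makes
    \<open>\<psi> - h d\<close> in the next degree a cycle.\<close>
  let ?P = "\<lambda>i l. mod_hom R (F i) (F (Suc i)) l \<and>
    (i = 0 \<longrightarrow> (\<forall>v\<in>carrier (F 0). d (Suc 0) (l v) = \<psi> 0 v)) \<and>
    (\<forall>w\<in>carrier (F (Suc i)). d (Suc i) (l (d (Suc i) w)) = \<psi> i (d (Suc i) w))"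
  let ?Q = "\<lambda>i l l'. \<forall>v\<in>carrier (F (Suc i)).
    d (Suc (Suc i)) (l' v) = \<psi> (Suc i) v \<ominus>\<^bsub>F (Suc i)\<^esub> l (d (Suc i) v)"
  have "\<exists>h. \<forall>i. ?P i (h i) \<and> ?Q i (h i) (h (Suc i))"
  proof (rule dependent_nat_choice)
    have "\<exists>l. mod_hom R (F 0) (F (Suc 0)) l \<and>
        (\<forall>v\<in>carrier (F 0). l v \<in> carrier (F (Suc 0)) \<and> d (Suc 0) (l v) = \<psi> 0 v)"
      by (rule R.free_module_lift[OF F.free F.d_hom \<psi> submod_carrier[OF F.C_module]])
        (use F.cycle_lift0 \<psi>0 mod_hom.f_im[OF \<psi>] in blast)
    then show "\<exists>l. ?P 0 l" using F.d_closed by auto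
  next
    fix l i assume P: "?P i l"
    then have l: "mod_hom R (F i) (F (Suc i)) l" by simp
    let ?q = "\<lambda>v. \<psi> (Suc i) v \<ominus>\<^bsub>F (Suc i)\<^esub> l (d (Suc i) v)"
    interpret Fi: module R "F i" by (rule F.C_module)
    interpret FS: module R "F (Suc i)" by (rule F.C_module)
    have q: "mod_hom R (F (Suc i)) (F (Suc i)) ?q"
      by (rule mod_hom_sub[OF \<psi> mod_hom_comp[OF F.d_hom l]])
    have "\<exists>l'. mod_hom R (F (Suc i)) (F (Suc (Suc i))) l' \<and>
        (\<forall>v\<in>carrier (F (Suc i)). l' v \<in> carrier (F (Suc (Suc i))) \<and> d (Suc (Suc i)) (l' v) = ?q v)"
    proof (rule R.free_module_lift[OF F.free F.d_hom q submod_carrier[OF F.C_module]])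
      fix v assume v: "v \<in> carrier (F (Suc i))"
      have "d (Suc i) (?q v) = d (Suc i) (\<psi> (Suc i) v) \<ominus>\<^bsub>F i\<^esub> d (Suc i) (l (d (Suc i) v))"
        by (rule mod_hom.f_minus[OF F.d_hom])
          (use v mod_hom.f_im[OF \<psi>] mod_hom.f_im[OF l] F.d_closed in auto)
      also have "\<dots> = \<psi> i (d (Suc i) v) \<ominus>\<^bsub>F i\<^esub> \<psi> i (d (Suc i) v)" using P v \<psi>d by simp
      also have "\<dots> = \<zero>\<^bsub>F i\<^esub>" using v F.d_closed mod_hom.f_im[OF \<psi>] by (simp add: Fi.M.minus_other_side)
      finally show "?q v \<in> d (Suc (Suc i)) ` carrier (F (Suc (Suc i)))"
        using F.cycle_lift[OF mod_hom.f_im[OF q v]] by blast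
    qed
    then obtain l' where l': "mod_hom R (F (Suc i)) (F (Suc (Suc i))) l'"
        "\<And>v. v \<in> carrier (F (Suc i)) \<Longrightarrow> d (Suc (Suc i)) (l' v) = ?q v" by blast
    have "d (Suc (Suc i)) (l' (d (Suc (Suc i)) w)) = \<psi> (Suc i) (d (Suc (Suc i)) w)"
      if w: "w \<in> carrier (F (Suc (Suc i)))" for w
      using l'(2)[OF F.d_closed[OF w]] F.d_d[OF w] mod_hom.f0_is_0[OF l] mod_hom.f_im[OF \<psi> F.d_closed[OF w]]
      by (simp add: a_minus_def)
    then show "\<exists>l'. ?P (Suc i) l' \<and> ?Q i l l'" using l' by (intro exI[of _ l']) simp
  qed
  then obtain h where h: "\<And>i. ?P i (h i) \<and> ?Q i (h i) (h (Suc i))" by blast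
  show thesis
  proof (rule that[of h])
    fix i v assume v: "v \<in> carrier (F (Suc i))"
    interpret FS: module R "F (Suc i)" by (rule F.C_module)
    have hi: "mod_hom R (F i) (F (Suc i)) (h i)" using h by blast
    have c: "\<psi> (Suc i) v \<in> carrier (F (Suc i))" "h i (d (Suc i) v) \<in> carrier (F (Suc i))"
      using v mod_hom.f_im[OF \<psi>] mod_hom.f_im[OF hi] F.d_closed by auto
    have "d (Suc (Suc i)) (h (Suc i) v) = \<psi> (Suc i) v \<ominus>\<^bsub>F (Suc i)\<^esub> h i (d (Suc i) v)"
      using h[of i] v by blast
    then show "\<psi> (Suc i) v = d (Suc (Suc i)) (h (Suc i) v) \<oplus>\<^bsub>F (Suc i)\<^esub> h i (d (Suc i) v)"
      using c by (simp add: a_minus_def FS.M.a_assoc FS.M.l_neg)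
  qed (use h in auto)
qed

text \<open>Lifting the identity both ways gives \<open>\<alpha>\<close> and \<open>\<beta>\<close>;
  their composite on \<open>F\<close> minus the identity lies over zero and is therefore
  null-homotopic by \<open>h\<close>.\<close>

lemma resolution_comparison:
  fixes F :: "nat \<Rightarrow> ('a, 'm, 'e) module_scheme" and G :: "nat \<Rightarrow> ('a, 'm2, 'e2) module_scheme"
  assumes F: "minimal_resolution R F dF eF M nF" and G: "minimal_resolution R G dG eG M nG"
  obtains \<alpha> \<beta> h where
    "\<And>i. mod_hom R (F i) (G i) (\<alpha> i)" "\<And>i. mod_hom R (G i) (F i) (\<beta> i)"
    "\<And>i. mod_hom R (F i) (F (Suc i)) (h i)"
    "\<And>i v. v \<in> carrier (F (Suc i)) \<Longrightarrow> dG (Suc i) (\<alpha> (Suc i) v) = \<alpha> i (dF (Suc i) v)"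
    "\<And>i v. v \<in> carrier (G (Suc i)) \<Longrightarrow> dF (Suc i) (\<beta> (Suc i) v) = \<beta> i (dG (Suc i) v)"
    "\<And>v. v \<in> carrier (F 0) \<Longrightarrow> \<beta> 0 (\<alpha> 0 v) \<ominus>\<^bsub>F 0\<^esub> v = dF (Suc 0) (h 0 v)"
    "\<And>i v. v \<in> carrier (F (Suc i)) \<Longrightarrow> \<beta> (Suc i) (\<alpha> (Suc i) v) \<ominus>\<^bsub>F (Suc i)\<^esub> v
       = dF (Suc (Suc i)) (h (Suc i) v) \<oplus>\<^bsub>F (Suc i)\<^esub> h i (dF (Suc i) v)"
proof -
  interpret R: irrelevant_cring R using F by (simp add: minimal_resolution_def)
  interpret G: minimal_resolution R G dG eG M nG by fact
  interpret F: minimal_resolution R F dF eF M nF by fact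
  interpret M: module R M by (rule mod_hom_modules(2)[OF F.e_hom])
  note id = mod_hom_id[OF M.module_axioms]
  obtain \<alpha> where \<alpha>: "\<And>i. mod_hom R (F i) (G i) (\<alpha> i)"
      "\<And>v. v \<in> carrier (F 0) \<Longrightarrow> eG (\<alpha> 0 v) = eF v"
      "\<And>i v. v \<in> carrier (F (Suc i)) \<Longrightarrow> dG (Suc i) (\<alpha> (Suc i) v) = \<alpha> i (dF (Suc i) v)"
    by (rule chain_map_exists[OF F G id submod_carrier[OF G.C_module]])
      (use G.e_onto F.e_closed in auto)
  obtain \<beta> where \<beta>: "\<And>i. mod_hom R (G i) (F i) (\<beta> i)"
      "\<And>v. v \<in> carrier (G 0) \<Longrightarrow> eF (\<beta> 0 v) = eG v"
      "\<And>i v. v \<in> carrier (G (Suc i)) \<Longrightarrow> dF (Suc i) (\<beta> (Suc i) v) = \<beta> i (dG (Suc i) v)"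
    by (rule chain_map_exists[OF G F id submod_carrier[OF F.C_module]])
      (use F.e_onto G.e_closed in auto)
  note cl = mod_hom.f_im[OF \<alpha>(1)] mod_hom.f_im[OF \<beta>(1)]
  define \<psi> where "\<psi> i v = \<beta> i (\<alpha> i v) \<ominus>\<^bsub>F i\<^esub> v" for i v
  obtain h where h: "\<And>i. mod_hom R (F i) (F (Suc i)) (h i)"
    "\<And>v. v \<in> carrier (F 0) \<Longrightarrow> \<psi> 0 v = dF (Suc 0) (h 0 v)"
    "\<And>i v. v \<in> carrier (F (Suc i)) \<Longrightarrow>
       \<psi> (Suc i) v = dF (Suc (Suc i)) (h (Suc i) v) \<oplus>\<^bsub>F (Suc i)\<^esub> h i (dF (Suc i) v)"
  proof (rule null_homotopy_exists[OF F, of \<psi>])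
    show "mod_hom R (F i) (F i) (\<psi> i)" for i unfolding \<psi>_def
      by (rule mod_hom_sub[OF mod_hom_comp[OF \<alpha>(1) \<beta>(1)] mod_hom_id[OF F.C_module]])
    fix v assume v: "v \<in> carrier (F 0)"
    have "eF (\<psi> 0 v) = eF (\<beta> 0 (\<alpha> 0 v)) \<ominus>\<^bsub>M\<^esub> eF v"
      unfolding \<psi>_def by (rule mod_hom.f_minus[OF F.e_hom]) (use v cl in auto)
    then show "eF (\<psi> 0 v) = \<zero>\<^bsub>M\<^esub>"
      using v cl \<alpha>(2) \<beta>(2) F.e_closed by (simp add: M.M.minus_other_side)
  next
    fix i v assume v: "v \<in> carrier (F (Suc i))"
    have "dF (Suc i) (\<psi> (Suc i) v) = dF (Suc i) (\<beta> (Suc i) (\<alpha> (Suc i) v)) \<ominus>\<^bsub>F i\<^esub> dF (Suc i) v"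
      unfolding \<psi>_def by (rule mod_hom.f_minus[OF F.d_hom]) (use v cl in auto)
    then show "dF (Suc i) (\<psi> (Suc i) v) = \<psi> i (dF (Suc i) v)"
      using v cl \<alpha>(3) \<beta>(3) by (simp add: \<psi>_def)
  qed auto
  show thesis by (rule that[OF \<alpha>(1) \<beta>(1) h(1) \<alpha>(3) \<beta>(3)]) (use h(2,3) in \<open>auto simp: \<psi>_def\<close>)
qed

text \<open>Move \<open>z\<close> to \<open>G\<close> by \<open>\<alpha>\<close>, split it there and
  return by \<open>\<beta>\<close>. The homotopy changes the result by a boundary and by
  \<open>h (d z)\<close>, and the latter has at least the order of \<open>d z\<close>, so it can be
  absorbed into the part of order \<open>s\<close>.\<close>

lemma linear_at_independent:
  fixes F :: "nat \<Rightarrow> ('a, 'm, 'e) module_scheme" and G :: "nat \<Rightarrow> ('a, 'm2, 'e2) module_scheme"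
  assumes F: "minimal_resolution R F dF eF M nF" and G: "minimal_resolution R G dG eG M nG"
    and lin: "linear_at R G dG i"
  shows "linear_at R F dF i"
  unfolding linear_at_def
proof (intro allI ballI impI)
  interpret R: irrelevant_cring R using F by (simp add: minimal_resolution_def)
  interpret G: minimal_resolution R G dG eG M nG by fact
  interpret F: minimal_resolution R F dF eF M nF by fact
  obtain \<alpha> \<beta> h where \<alpha>: "\<And>i. mod_hom R (F i) (G i) (\<alpha> i)" and \<beta>: "\<And>i. mod_hom R (G i) (F i) (\<beta> i)"
    and h: "\<And>i. mod_hom R (F i) (F (Suc i)) (h i)"
    and \<alpha>d: "\<And>i v. v \<in> carrier (F (Suc i)) \<Longrightarrow> dG (Suc i) (\<alpha> (Suc i) v) = \<alpha> i (dF (Suc i) v)"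
    and \<beta>d: "\<And>i v. v \<in> carrier (G (Suc i)) \<Longrightarrow> dF (Suc i) (\<beta> (Suc i) v) = \<beta> i (dG (Suc i) v)"
    and eq: "\<And>i v. v \<in> carrier (F (Suc i)) \<Longrightarrow> \<beta> (Suc i) (\<alpha> (Suc i) v) \<ominus>\<^bsub>F (Suc i)\<^esub> v
       = dF (Suc (Suc i)) (h (Suc i) v) \<oplus>\<^bsub>F (Suc i)\<^esub> h i (dF (Suc i) v)"
    by (rule resolution_comparison[OF F G]) blast
  fix s z assume z: "z \<in> carrier (F (Suc i))" and dz: "dF (Suc i) z \<in> max_power R (F i) (Suc s)"
  let ?a = "\<alpha> (Suc i) z"
  have a: "?a \<in> carrier (G (Suc i))" using mod_hom.f_im[OF \<alpha>] z .
  have "dG (Suc i) ?a \<in> max_power R (G i) (Suc s)"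
    unfolding \<alpha>d[OF z] by (rule R.max_power_hom0[OF \<alpha> dz])
  with lin a obtain y w where y: "y \<in> max_power R (G (Suc i)) s" and w: "w \<in> carrier (G (Suc (Suc i)))"
    and yw: "?a = y \<oplus>\<^bsub>G (Suc i)\<^esub> dG (Suc (Suc i)) w"
    unfolding linear_at_def by blast
  interpret FS: module R "F (Suc i)" by (rule F.C_module)
  have yc: "y \<in> carrier (G (Suc i))" using R.max_power_carrier[OF G.C_module y] .
  have by': "\<beta> (Suc i) y \<in> max_power R (F (Suc i)) s" by (rule R.max_power_hom0[OF \<beta> y])
  have hd: "h i (dF (Suc i) z) \<in> max_power R (F (Suc i)) s"
    using R.max_power_hom0[OF h dz] R.max_power_Suc_subset[OF F.C_module] by blast
  let ?w = "\<beta> (Suc (Suc i)) w" and ?u = "h (Suc i) z"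
  have c: "?w \<in> carrier (F (Suc (Suc i)))" "?u \<in> carrier (F (Suc (Suc i)))"
    using mod_hom.f_im[OF \<beta>] mod_hom.f_im[OF h] w z by auto
  have ba: "\<beta> (Suc i) ?a = \<beta> (Suc i) y \<oplus>\<^bsub>F (Suc i)\<^esub> dF (Suc (Suc i)) ?w"
    unfolding yw using module_hom_add[OF mod_hom.f_hom[OF \<beta>] yc G.d_closed[OF w]] \<beta>d[OF w] by simp
  have "z = (\<beta> (Suc i) y \<ominus>\<^bsub>F (Suc i)\<^esub> h i (dF (Suc i) z)) \<oplus>\<^bsub>F (Suc i)\<^esub>
      (dF (Suc (Suc i)) ?w \<ominus>\<^bsub>F (Suc i)\<^esub> dF (Suc (Suc i)) ?u)"
    by (rule FS.M.split_difference[OF _ _ _ _ _ _ eq[OF z] ba])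
      (use z a c by' hd F.d_closed R.max_power_carrier[OF F.C_module] mod_hom.f_im[OF \<beta>] in auto)
  also have "dF (Suc (Suc i)) ?w \<ominus>\<^bsub>F (Suc i)\<^esub> dF (Suc (Suc i)) ?u
      = dF (Suc (Suc i)) (?w \<ominus>\<^bsub>F (Suc (Suc i))\<^esub> ?u)"
    by (rule mod_hom.f_minus[OF F.d_hom c, symmetric])
  finally have z': "z = (\<beta> (Suc i) y \<ominus>\<^bsub>F (Suc i)\<^esub> h i (dF (Suc i) z)) \<oplus>\<^bsub>F (Suc i)\<^esub>
      dF (Suc (Suc i)) (?w \<ominus>\<^bsub>F (Suc (Suc i))\<^esub> ?u)" .
  interpret FSS: module R "F (Suc (Suc i))" by (rule F.C_module)
  have "?w \<ominus>\<^bsub>F (Suc (Suc i))\<^esub> ?u \<in> carrier (F (Suc (Suc i)))" using c by simp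
  with z' show "\<exists>y\<in>max_power R (F (Suc i)) s. \<exists>w\<in>carrier (F (Suc (Suc i))). z = y \<oplus>\<^bsub>F (Suc i)\<^esub> dF (Suc (Suc i)) w"
    using R.max_power_minus[OF F.C_module by' hd] by blast
qed

text \<open>Only the augmentation changes. It serves the isomorphism of an ideal \<open>J\<close>
  with \<open>x J\<close>.\<close>

lemma minimal_resolution_iso:
  assumes C: "minimal_resolution R C d e M n" and g: "mod_hom R M N g"
    and bij: "bij_betw g (carrier M) (carrier N)"
  shows "minimal_resolution R C d (\<lambda>v. g (e v)) N n"
proof -
  interpret C: minimal_resolution R C d e M n by fact
  interpret g: mod_hom R M N g by (rule g)
  have k: "g v = \<zero>\<^bsub>N\<^esub> \<longleftrightarrow> v = \<zero>\<^bsub>M\<^esub>" if "v \<in> carrier M" for v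
    using bij that g.f0_is_0 g.M.M.zero_closed by (metis bij_betw_inv_into_left)
  show ?thesis
  proof (rule minimal_resolution.intro[OF C.irrelevant_cring_axioms minimal_resolution_axioms.intro])
    show "(\<lambda>v. g (e v)) ` carrier (C 0) = carrier N"
      using C.e_onto bij unfolding bij_betw_def by (metis image_image)
    show "{z \<in> carrier (C 0). g (e z) = \<zero>\<^bsub>N\<^esub>} = d 1 ` carrier (C 1)"
      using C.exact0 k C.e_closed by auto
    show "mod_hom R (C 0) N (\<lambda>v. g (e v))" by (rule mod_hom_comp[OF C.e_hom g])
    show "d (Suc i) v \<in> max_power R (C i) 1" if "v \<in> carrier (C (Suc i))" for i v
      using that by (rule C.minimal)
    show "free_module R (C i) (n i)" for i by (rule C.free)
    show "mod_hom R (C (Suc i)) (C i) (d (Suc i))" for i by (rule C.d_hom)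
    show "{z \<in> carrier (C (Suc i)). d (Suc i) z = \<zero>\<^bsub>C i\<^esub>} = d (Suc (Suc i)) ` carrier (C (Suc (Suc i)))" for i
      by (rule C.exact)
  qed
qed

subsection \<open>Direct sums and mapping cones of resolutions\<close>

lemma (in irrelevant_cring) mod_hom_direct_sum:
  assumes "mod_hom R M M' f" "mod_hom R N N' g"
  shows "mod_hom R (direct_sum M N) (direct_sum M' N') (\<lambda>p. (f (fst p), g (snd p)))"
  by (rule mod_hom_pair[OF mod_hom_comp[OF mod_hom_fst assms(1)] mod_hom_comp[OF mod_hom_snd assms(2)]])
    (use assms mod_hom_modules in auto)

lemma minimal_resolution_direct_sum:
  assumes F: "minimal_resolution R F dF eF M nF" and G: "minimal_resolution R G dG eG N nG"
  shows "minimal_resolution R (\<lambda>i. direct_sum (F i) (G i)) (\<lambda>i p. (dF i (fst p), dG i (snd p)))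
    (\<lambda>p. (eF (fst p), eG (snd p))) (direct_sum M N) (\<lambda>i. nF i + nG i)"
proof -
  interpret R: irrelevant_cring R using F by (simp add: minimal_resolution_def)
  interpret F: minimal_resolution R F dF eF M nF by fact
  interpret G: minimal_resolution R G dG eG N nG by fact
  show ?thesis
  proof (rule minimal_resolution.intro[OF R.irrelevant_cring_axioms minimal_resolution_axioms.intro])
    show "free_module R (direct_sum (F i) (G i)) (nF i + nG i)" for i
      by (rule R.free_module_direct_sum[OF F.free G.free])
    show "mod_hom R (direct_sum (F (Suc i)) (G (Suc i))) (direct_sum (F i) (G i))
        (\<lambda>p. (dF (Suc i) (fst p), dG (Suc i) (snd p)))" for i
      by (rule R.mod_hom_direct_sum[OF F.d_hom G.d_hom])
    show "mod_hom R (direct_sum (F 0) (G 0)) (direct_sum M N) (\<lambda>p. (eF (fst p), eG (snd p)))"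
      by (rule R.mod_hom_direct_sum[OF F.e_hom G.e_hom])
    show "(\<lambda>p. (eF (fst p), eG (snd p))) ` carrier (direct_sum (F 0) (G 0)) = carrier (direct_sum M N)"
      unfolding R.direct_sum_simps F.e_onto[symmetric] G.e_onto[symmetric] by force
    show "{z \<in> carrier (direct_sum (F 0) (G 0)). (eF (fst z), eG (snd z)) = \<zero>\<^bsub>direct_sum M N\<^esub>}
        = (\<lambda>p. (dF 1 (fst p), dG 1 (snd p))) ` carrier (direct_sum (F 1) (G 1))" (is "?L = ?R")
    proof -
      have "?L = {z \<in> carrier (F 0). eF z = \<zero>\<^bsub>M\<^esub>} \<times> {z \<in> carrier (G 0). eG z = \<zero>\<^bsub>N\<^esub>}"
        by (auto simp: R.direct_sum_simps)
      also have "\<dots> = ?R" unfolding F.exact0 G.exact0 R.direct_sum_simps by force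
      finally show ?thesis .
    qed
    show "{z \<in> carrier (direct_sum (F (Suc i)) (G (Suc i))).
          (dF (Suc i) (fst z), dG (Suc i) (snd z)) = \<zero>\<^bsub>direct_sum (F i) (G i)\<^esub>}
        = (\<lambda>p. (dF (Suc (Suc i)) (fst p), dG (Suc (Suc i)) (snd p))) `
          carrier (direct_sum (F (Suc (Suc i))) (G (Suc (Suc i))))" (is "?L = ?R") for i
    proof -
      have "?L = {z \<in> carrier (F (Suc i)). dF (Suc i) z = \<zero>\<^bsub>F i\<^esub>} \<times> {z \<in> carrier (G (Suc i)). dG (Suc i) z = \<zero>\<^bsub>G i\<^esub>}"
        by (auto simp: R.direct_sum_simps)
      also have "\<dots> = ?R" unfolding F.exact G.exact R.direct_sum_simps by force
      finally show ?thesis .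
    qed
    show "(dF (Suc i) (fst v), dG (Suc i) (snd v)) \<in> max_power R (direct_sum (F i) (G i)) 1"
      if "v \<in> carrier (direct_sum (F (Suc i)) (G (Suc i)))" for i v
      using that F.minimal G.minimal
      by (auto simp: R.max_power_direct_sum[OF F.C_module G.C_module] R.direct_sum_simps mem_Times_iff)
  qed
qed

text \<open>The zero module in degree 0 is written as the zero submodule of \<open>A 0\<close>,
  since all terms must have one type.\<close>

definition shift_complex :: "(nat \<Rightarrow> ('a, 'm, 'e) module_scheme) \<Rightarrow> nat \<Rightarrow> ('a, 'm, 'e) module_scheme" where
  "shift_complex A i = (case i of 0 \<Rightarrow> (A 0)\<lparr>carrier := {\<zero>\<^bsub>A 0\<^esub>}\<rparr> | Suc k \<Rightarrow> A k)"

definition cone :: "(nat \<Rightarrow> ('a, 'm, 'e) module_scheme) \<Rightarrow> (nat \<Rightarrow> ('a, 'm2, 'e2) module_scheme) \<Rightarrow>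
    nat \<Rightarrow> ('a, 'm \<times> 'm2) module" where
  "cone B A i = direct_sum (B i) (shift_complex A i)"

text \<open>The differential of the mapping cone of \<open>\<psi>\<close>, with term
  \<open>B_i \<oplus> A_(i-1)\<close> in degree \<open>i\<close>; the minus sign makes it a complex.
  In degree 1 the second component has to land in the zero module, whence the case distinction on
  \<open>i - 1\<close>.\<close>

definition cone_diff :: "(nat \<Rightarrow> ('a, 'm, 'e) module_scheme) \<Rightarrow> (nat \<Rightarrow> 'm \<Rightarrow> 'm) \<Rightarrow>
    (nat \<Rightarrow> ('a, 'm2, 'e2) module_scheme) \<Rightarrow> (nat \<Rightarrow> 'm2 \<Rightarrow> 'm2) \<Rightarrow> (nat \<Rightarrow> 'm2 \<Rightarrow> 'm) \<Rightarrow>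
    nat \<Rightarrow> 'm \<times> 'm2 \<Rightarrow> 'm \<times> 'm2" where
  "cone_diff B dB A dA \<psi> i p = (dB i (fst p) \<oplus>\<^bsub>B (i - 1)\<^esub> \<psi> (i - 1) (snd p),
     case i - 1 of 0 \<Rightarrow> \<zero>\<^bsub>A 0\<^esub> | Suc k \<Rightarrow> \<ominus>\<^bsub>A k\<^esub> dA (Suc k) (snd p))"

text \<open>A short exact sequence \<open>0 -> M' -> M -> Q -> 0\<close> with maps \<open>j\<close>
  and \<open>p\<close>, together with a lift \<open>\<psi>\<close> of \<open>j\<close> to minimal
  resolutions whose values lie in the maximal ideal times \<open>B\<close>. This last condition is
  what keeps the cone minimal.\<close>

locale minimal_cone =
  A: minimal_resolution R A dA eA M' nA + B: minimal_resolution R B dB eB M nB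
  for R :: "('k, 'a) gmodule" (structure)
    and A :: "nat \<Rightarrow> ('a, 'm, 'e) module_scheme" and dA eA and M' :: "('a, 'n, 'f) module_scheme" and nA
    and B :: "nat \<Rightarrow> ('a, 'm2, 'e2) module_scheme" and dB eB and M :: "('a, 'n2, 'f2) module_scheme" and nB +
  fixes \<psi> :: "nat \<Rightarrow> 'm \<Rightarrow> 'm2" and j :: "'n \<Rightarrow> 'n2" and p :: "'n2 \<Rightarrow> 'n3"
    and Q :: "('a, 'n3, 'f3) module_scheme"
  assumes psi_hom: "mod_hom R (A i) (B i) (\<psi> i)"
    and psi_minimal: "v \<in> carrier (A i) \<Longrightarrow> \<psi> i v \<in> max_power R (B i) 1"
    and psi_d: "v \<in> carrier (A (Suc i)) \<Longrightarrow> dB (Suc i) (\<psi> (Suc i) v) = \<psi> i (dA (Suc i) v)"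
    and psi_e: "v \<in> carrier (A 0) \<Longrightarrow> eB (\<psi> 0 v) = j (eA v)"
    and j_hom: "mod_hom R M' M j"
    and j_inj: "u \<in> carrier M' \<Longrightarrow> j u = \<zero>\<^bsub>M\<^esub> \<Longrightarrow> u = \<zero>\<^bsub>M'\<^esub>"
    and p_hom: "mod_hom R M Q p"
    and p_onto: "p ` carrier M = carrier Q"
    and p_kernel: "{u \<in> carrier M. p u = \<zero>\<^bsub>Q\<^esub>} = j ` carrier M'"
begin

sublocale R: irrelevant_cring R by (rule A.irrelevant_cring_axioms)

abbreviation "CC \<equiv> cone B A"
abbreviation "dC \<equiv> cone_diff B dB A dA \<psi>"

lemma shift_module: "module R (shift_complex A i)"
  using submod_module[OF submod_zero[OF A.C_module]] A.C_module
  by (auto simp: shift_complex_def split: nat.split)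

lemma shift_0: "carrier (shift_complex A 0) = {\<zero>\<^bsub>A 0\<^esub>}"
  by (simp add: shift_complex_def)

lemma shift_Suc [simp]: "shift_complex A (Suc i) = A i"
  by (simp add: shift_complex_def)

lemma zero_shift_0: "\<zero>\<^bsub>shift_complex A 0\<^esub> = \<zero>\<^bsub>A 0\<^esub>"
  by (simp add: shift_complex_def)

lemma free_shift: "free_module R (shift_complex A i) (case i of 0 \<Rightarrow> 0 | Suc k \<Rightarrow> nA k)"
proof (cases i)
  case 0
  then show ?thesis
    using A.free_module_trivial[OF shift_module[of 0]] by (simp add: shift_0 zero_shift_0)
qed (simp add: A.free)

lemma cone_carrier: "(b, a) \<in> carrier (CC i) \<longleftrightarrow> b \<in> carrier (B i) \<and> a \<in> carrier (shift_complex A i)"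
  by (simp add: cone_def A.direct_sum_simps)

lemma cone_zero: "\<zero>\<^bsub>CC i\<^esub> = (\<zero>\<^bsub>B i\<^esub>, \<zero>\<^bsub>shift_complex A i\<^esub>)"
  by (simp add: cone_def A.direct_sum_simps)

lemma cone_diff_1: "dC (Suc 0) (b, a) = (dB (Suc 0) b \<oplus>\<^bsub>B 0\<^esub> \<psi> 0 a, \<zero>\<^bsub>A 0\<^esub>)"
  by (simp add: cone_diff_def)

lemma cone_diff_Suc: "dC (Suc (Suc i)) (b, a) =
    (dB (Suc (Suc i)) b \<oplus>\<^bsub>B (Suc i)\<^esub> \<psi> (Suc i) a, \<ominus>\<^bsub>A i\<^esub> dA (Suc i) a)"
  by (simp add: cone_diff_def)

lemma psi_closed: "v \<in> carrier (A i) \<Longrightarrow> \<psi> i v \<in> carrier (B i)"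
  by (rule mod_hom.f_im[OF psi_hom])

lemma cone_diff_hom: "mod_hom R (CC (Suc i)) (CC i) (dC (Suc i))"
proof -
  have 1: "mod_hom R (CC (Suc i)) (B i) (\<lambda>q. dB (Suc i) (fst q) \<oplus>\<^bsub>B i\<^esub> \<psi> i (snd q))"
    unfolding cone_def shift_Suc
    by (intro mod_hom_add mod_hom_comp[OF A.mod_hom_fst[OF B.C_module A.C_module] B.d_hom]
          mod_hom_comp[OF A.mod_hom_snd[OF B.C_module A.C_module] psi_hom])
  show ?thesis
  proof (cases i)
    case 0
    have "mod_hom R (CC (Suc 0)) (shift_complex A 0) (\<lambda>q. \<zero>\<^bsub>A 0\<^esub>)"
      using mod_hom_zero[OF direct_sum_is_module[OF B.C_module A.C_module] shift_module[of 0]]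
      by (simp add: cone_def zero_shift_0)
    from A.mod_hom_pair[OF 1[unfolded 0] this] show ?thesis
      unfolding 0 cone_def[of B A 0] by (rule mod_hom_cong) (simp add: cone_diff_def)
  next
    case (Suc k)
    have "mod_hom R (CC (Suc (Suc k))) (shift_complex A (Suc k)) (\<lambda>q. \<ominus>\<^bsub>A k\<^esub> dA (Suc k) (snd q))"
      unfolding cone_def shift_Suc
      by (intro mod_hom_neg mod_hom_comp[OF A.mod_hom_snd[OF B.C_module A.C_module] A.d_hom])
    from A.mod_hom_pair[OF 1[unfolded Suc] this] show ?thesis
      unfolding Suc cone_def[of B A "Suc k"] by (rule mod_hom_cong) (simp add: cone_diff_def)
  qed
qed

lemma cone_diff_closed: "q \<in> carrier (CC (Suc i)) \<Longrightarrow> dC (Suc i) q \<in> carrier (CC i)"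
  by (rule mod_hom.f_im[OF cone_diff_hom])

lemma cone_diff_diff:
  assumes "b \<in> carrier (B (Suc (Suc i)))" "a \<in> carrier (A (Suc i))"
  shows "dC (Suc i) (dC (Suc (Suc i)) (b, a)) = \<zero>\<^bsub>CC i\<^esub>"
proof -
  interpret Bi: module R "B i" by (rule B.C_module)
  have cl: "dB (Suc (Suc i)) b \<in> carrier (B (Suc i))" "\<psi> (Suc i) a \<in> carrier (B (Suc i))"
      "dA (Suc i) a \<in> carrier (A i)"
    using assms B.d_closed A.d_closed psi_closed by auto
  have 1: "dB (Suc i) (dB (Suc (Suc i)) b \<oplus>\<^bsub>B (Suc i)\<^esub> \<psi> (Suc i) a) \<oplus>\<^bsub>B i\<^esub> \<psi> i (\<ominus>\<^bsub>A i\<^esub> dA (Suc i) a) = \<zero>\<^bsub>B i\<^esub>"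
    using cl module_hom_add[OF mod_hom.f_hom[OF B.d_hom] cl(1,2)] B.d_d[OF assms(1)] psi_d[OF assms(2)]
      mod_hom.f_neg[OF psi_hom cl(3)] psi_closed[OF cl(3)]
    by (simp add: Bi.M.r_neg)
  show ?thesis
  proof (cases i)
    case 0
    then show ?thesis using 1 by (simp add: cone_diff_Suc cone_diff_1 cone_zero zero_shift_0)
  next
    case (Suc k)
    interpret Ak: module R "A k" by (rule A.C_module)
    have "dA (Suc k) (\<ominus>\<^bsub>A (Suc k)\<^esub> dA (Suc (Suc k)) a) = \<zero>\<^bsub>A k\<^esub>"
      using mod_hom.f_neg[OF A.d_hom, of "dA (Suc (Suc k)) a" k] cl(3) A.d_d[of a k] assms(2) Suc by simp
    then show ?thesis using 1 Suc by (simp add: cone_diff_Suc cone_zero)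
  qed
qed

text \<open>Once \<open>a\<close> is a boundary \<open>dA a'\<close>, the element
  \<open>b + \<psi> a'\<close> is a cycle of \<open>B\<close>, hence some \<open>dB b'\<close>, and
  \<open>(b', - a')\<close> is sent to \<open>(b, a)\<close>. What remains in each degree is to see
  that \<open>a\<close> is a boundary.\<close>

lemma cone_cycle:
  assumes b: "b \<in> carrier (B (Suc i))" and a: "a \<in> carrier (A i)"
    and z: "dB (Suc i) b \<oplus>\<^bsub>B i\<^esub> \<psi> i a = \<zero>\<^bsub>B i\<^esub>" and w: "a' \<in> carrier (A (Suc i))" "a = dA (Suc i) a'"
  shows "(b, a) \<in> dC (Suc (Suc i)) ` carrier (CC (Suc (Suc i)))"
proof -
  interpret Bi: module R "B i" by (rule B.C_module)
  interpret BS: module R "B (Suc i)" by (rule B.C_module)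
  interpret AS: module R "A (Suc i)" by (rule A.C_module)
  interpret Ai: module R "A i" by (rule A.C_module)
  let ?b = "b \<oplus>\<^bsub>B (Suc i)\<^esub> \<psi> (Suc i) a'"
  have p: "\<psi> (Suc i) a' \<in> carrier (B (Suc i))" using psi_closed w by auto
  have "dB (Suc i) ?b = \<zero>\<^bsub>B i\<^esub>"
    using module_hom_add[OF mod_hom.f_hom[OF B.d_hom] b p] psi_d[OF w(1)] z w(2) by simp
  then obtain b' where b': "b' \<in> carrier (B (Suc (Suc i)))" "?b = dB (Suc (Suc i)) b'"
    using B.cycle_lift b p by (metis BS.M.a_closed)
  have n: "\<psi> (Suc i) (\<ominus>\<^bsub>A (Suc i)\<^esub> a') = \<ominus>\<^bsub>B (Suc i)\<^esub> \<psi> (Suc i) a'"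
    by (rule mod_hom.f_neg[OF psi_hom w(1)])
  have "dA (Suc i) (\<ominus>\<^bsub>A (Suc i)\<^esub> a') = \<ominus>\<^bsub>A i\<^esub> dA (Suc i) a'" by (rule mod_hom.f_neg[OF A.d_hom w(1)])
  then have "dC (Suc (Suc i)) (b', \<ominus>\<^bsub>A (Suc i)\<^esub> a') = (b, a)"
    unfolding cone_diff_Suc b'(2)[symmetric] n using b p w A.d_closed[OF w(1)]
    by (simp add: BS.M.a_assoc BS.M.r_neg)
  moreover have "(b', \<ominus>\<^bsub>A (Suc i)\<^esub> a') \<in> carrier (CC (Suc (Suc i)))"
    using b' w by (simp add: cone_carrier)
  ultimately show ?thesis by (metis imageI)
qed

text \<open>Exactness in degree 0 comes from the description of the kernel of \<open>p\<close>, in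
  degree 1 from injectivity of \<open>j\<close>, and above from exactness of \<open>A\<close> and
  \<open>B\<close>. The rank formula, with \<open>nA\<close> shifted by one, is the source of the
  Betti splitting.\<close>

theorem resolution: "minimal_resolution R CC dC (\<lambda>q. p (eB (fst q))) Q (\<lambda>i. nB i + (case i of 0 \<Rightarrow> 0 | Suc k \<Rightarrow> nA k))"
proof (rule minimal_resolution.intro[OF A.irrelevant_cring_axioms minimal_resolution_axioms.intro])
  interpret M: module R M by (rule mod_hom_modules(2)[OF B.e_hom])
  interpret M': module R M' by (rule mod_hom_modules(2)[OF A.e_hom])
  show "free_module R (CC i) (nB i + (case i of 0 \<Rightarrow> 0 | Suc k \<Rightarrow> nA k))" for i
    unfolding cone_def by (rule A.free_module_direct_sum[OF B.free free_shift])
  show "mod_hom R (CC (Suc i)) (CC i) (dC (Suc i))" for i by (rule cone_diff_hom)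
  show "mod_hom R (CC 0) Q (\<lambda>q. p (eB (fst q)))"
    unfolding cone_def
    by (intro mod_hom_comp[OF _ p_hom] mod_hom_comp[OF _ B.e_hom] A.mod_hom_fst B.C_module shift_module)
  show "(\<lambda>q. p (eB (fst q))) ` carrier (CC 0) = carrier Q"
  proof -
    have "(\<lambda>q. p (eB (fst q))) ` carrier (CC 0) = p ` eB ` fst ` carrier (CC 0)" by (simp add: image_image)
    also have "fst ` carrier (CC 0) = carrier (B 0)"
      by (simp add: cone_def A.direct_sum_simps shift_0)
    finally show ?thesis by (simp add: B.e_onto p_onto)
  qed
  show "{z \<in> carrier (CC 0). p (eB (fst z)) = \<zero>\<^bsub>Q\<^esub>} = dC 1 ` carrier (CC 1)"
  proof (intro equalityI subsetI)
    fix z assume "z \<in> {z \<in> carrier (CC 0). p (eB (fst z)) = \<zero>\<^bsub>Q\<^esub>}"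
    then obtain b where b: "z = (b, \<zero>\<^bsub>A 0\<^esub>)" "b \<in> carrier (B 0)" "p (eB b) = \<zero>\<^bsub>Q\<^esub>"
      by (cases z) (auto simp: cone_carrier shift_0)
    then obtain u where u: "u \<in> carrier M'" "eB b = j u" using p_kernel B.e_closed by blast
    then obtain a where a: "a \<in> carrier (A 0)" "u = eA a" using A.e_onto by blast
    interpret B0: module R "B 0" by (rule B.C_module)
    have pa: "\<psi> 0 a \<in> carrier (B 0)" using psi_closed a by auto
    have "eB (b \<ominus>\<^bsub>B 0\<^esub> \<psi> 0 a) = \<zero>\<^bsub>M\<^esub>"
      using mod_hom.f_minus[OF B.e_hom b(2) pa] psi_e[OF a(1)] u a B.e_closed[OF b(2)]
      by (simp add: M.M.minus_other_side)
    then obtain b' where b': "b' \<in> carrier (B (Suc 0))" "b \<ominus>\<^bsub>B 0\<^esub> \<psi> 0 a = dB (Suc 0) b'"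
      using B.cycle_lift0 b(2) pa by (metis B0.M.minus_closed)
    have "dC 1 (b', a) = z" using b' b pa
      by (simp add: cone_diff_1 b'(2)[symmetric] a_minus_def B0.M.a_assoc B0.M.l_neg)
    moreover have "(b', a) \<in> carrier (CC 1)" using b' a by (simp add: cone_carrier)
    ultimately show "z \<in> dC 1 ` carrier (CC 1)" by (metis imageI)
  next
    fix z assume "z \<in> dC 1 ` carrier (CC 1)"
    then obtain b a where z: "z = dC (Suc 0) (b, a)" "b \<in> carrier (B (Suc 0))" "a \<in> carrier (A 0)"
      by (auto simp: cone_def A.direct_sum_simps)
    have "eB (dB (Suc 0) b \<oplus>\<^bsub>B 0\<^esub> \<psi> 0 a) = j (eA a)"
      using module_hom_add[OF mod_hom.f_hom[OF B.e_hom] B.d_closed[OF z(2)] psi_closed[OF z(3)]]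
        B.e_d[OF z(2)] psi_e[OF z(3)] mod_hom.f_im[OF j_hom A.e_closed[OF z(3)]] by simp
    then have "p (eB (dB (Suc 0) b \<oplus>\<^bsub>B 0\<^esub> \<psi> 0 a)) = \<zero>\<^bsub>Q\<^esub>"
      using p_kernel A.e_closed[OF z(3)] by auto
    moreover have "z \<in> carrier (CC 0)" using cone_diff_closed[of "(b, a)" 0] z by (simp add: cone_carrier)
    ultimately show "z \<in> {z \<in> carrier (CC 0). p (eB (fst z)) = \<zero>\<^bsub>Q\<^esub>}"
      by (simp add: z(1) cone_diff_1)
  qed
  show "{z \<in> carrier (CC (Suc i)). dC (Suc i) z = \<zero>\<^bsub>CC i\<^esub>} = dC (Suc (Suc i)) ` carrier (CC (Suc (Suc i)))" for i
  proof (intro equalityI subsetI)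
    fix z assume z: "z \<in> {z \<in> carrier (CC (Suc i)). dC (Suc i) z = \<zero>\<^bsub>CC i\<^esub>}"
    obtain b a where ba: "z = (b, a)" by (cases z)
    have b: "b \<in> carrier (B (Suc i))" and a: "a \<in> carrier (A i)" using z by (auto simp: ba cone_carrier)
    have z1: "dB (Suc i) b \<oplus>\<^bsub>B i\<^esub> \<psi> i a = \<zero>\<^bsub>B i\<^esub>"
      using z by (simp add: ba cone_diff_def cone_zero)
    show "z \<in> dC (Suc (Suc i)) ` carrier (CC (Suc (Suc i)))"
    proof (cases i)
      case 0
      \<comment> \<open>In degree 1 the differential puts no condition on \<open>a\<close> by
        itself. Applying the augmentation to the first component gives \<open>j (eA a) = 0\<close>,
        and injectivity of \<open>j\<close> makes \<open>a\<close> a boundary.\<close>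
      have "eB (dB (Suc 0) b \<oplus>\<^bsub>B 0\<^esub> \<psi> 0 a) = j (eA a)"
        using module_hom_add[OF mod_hom.f_hom[OF B.e_hom] B.d_closed psi_closed, of b a] 0 a b
          B.e_d psi_e mod_hom.f_im[OF j_hom A.e_closed] by simp
      then have "j (eA a) = \<zero>\<^bsub>M\<^esub>" using z1 mod_hom.f0_is_0[OF B.e_hom] 0 by simp
      then have "eA a = \<zero>\<^bsub>M'\<^esub>" using j_inj A.e_closed a 0 by auto
      then obtain a' where "a' \<in> carrier (A (Suc 0))" "a = dA (Suc 0) a'"
        using A.cycle_lift0 a 0 by blast
      then show ?thesis unfolding ba using cone_cycle[OF b a z1] 0 by auto
    next
      case (Suc k)
      interpret Ak: module R "A k" by (rule A.C_module)
      have "\<ominus>\<^bsub>A k\<^esub> dA (Suc k) a = \<zero>\<^bsub>A k\<^esub>" using z Suc by (simp add: ba cone_diff_Suc cone_zero)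
      then have "dA (Suc k) a = \<zero>\<^bsub>A k\<^esub>"
        using A.d_closed[of a k] a Suc Ak.M.add.inv_eq_1_iff[of "dA (Suc k) a"] by simp
      then obtain a' where "a' \<in> carrier (A (Suc (Suc k)))" "a = dA (Suc (Suc k)) a'"
        using A.cycle_lift a Suc by blast
      then show ?thesis unfolding ba using cone_cycle[OF b a z1] Suc by auto
    qed
  next
    fix z assume "z \<in> dC (Suc (Suc i)) ` carrier (CC (Suc (Suc i)))"
    then obtain b a where z: "z = dC (Suc (Suc i)) (b, a)" "b \<in> carrier (B (Suc (Suc i)))" "a \<in> carrier (A (Suc i))"
      by (auto simp: cone_def A.direct_sum_simps)
    then show "z \<in> {z \<in> carrier (CC (Suc i)). dC (Suc i) z = \<zero>\<^bsub>CC i\<^esub>}"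
      using cone_diff_diff cone_diff_closed by (simp add: cone_carrier)
  qed
  show "dC (Suc i) v \<in> max_power R (CC i) 1" if v: "v \<in> carrier (CC (Suc i))" for i v
  proof -
    obtain b a where ba: "v = (b, a)" by (cases v)
    have b: "b \<in> carrier (B (Suc i))" and a: "a \<in> carrier (A i)" using v by (auto simp: ba cone_carrier)
    have 1: "dB (Suc i) b \<oplus>\<^bsub>B i\<^esub> \<psi> i a \<in> max_power R (B i) 1"
      by (rule A.max_power_add[OF B.C_module B.minimal[OF b] psi_minimal[OF a]])
    show ?thesis
    proof (cases i)
      case 0
      have "\<zero>\<^bsub>shift_complex A 0\<^esub> \<in> max_power R (shift_complex A 0) 1" by (rule A.max_power_zero[OF shift_module])
      then show ?thesis using 1 0
        by (simp add: ba cone_diff_1 cone_def A.max_power_direct_sum[OF B.C_module shift_module] zero_shift_0)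
    next
      case (Suc k)
      have "\<ominus>\<^bsub>A k\<^esub> dA (Suc k) a \<in> max_power R (A k) 1"
        by (rule A.max_power_uminus[OF A.C_module A.minimal]) (use a Suc in auto)
      then show ?thesis using 1 Suc
        by (simp add: ba cone_diff_Suc cone_def A.max_power_direct_sum[OF B.C_module A.C_module])
    qed
  qed
qed

lemma cone_diff_max_power:
  assumes "b \<in> carrier (B (Suc i))" "a \<in> carrier (A i)"
  shows "dC (Suc i) (b, a) \<in> max_power R (CC i) s \<longleftrightarrow>
    dB (Suc i) b \<oplus>\<^bsub>B i\<^esub> \<psi> i a \<in> max_power R (B i) s \<and>
    (\<forall>k. i = Suc k \<longrightarrow> dA (Suc k) a \<in> max_power R (A k) s)"
proof (cases i)
  case 0
  have "\<zero>\<^bsub>shift_complex A 0\<^esub> \<in> max_power R (shift_complex A 0) s" by (rule A.max_power_zero[OF shift_module])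
  then show ?thesis using 0
    by (simp add: cone_diff_1 cone_def A.max_power_direct_sum[OF B.C_module shift_module] zero_shift_0)
next
  case (Suc k)
  interpret Ak: module R "A k" by (rule A.C_module)
  have "\<ominus>\<^bsub>A k\<^esub> dA (Suc k) a \<in> max_power R (A k) s \<longleftrightarrow> dA (Suc k) a \<in> max_power R (A k) s"
    using A.max_power_uminus[OF A.C_module] A.d_closed[of a k] assms(2) Suc by (metis Ak.M.minus_minus)
  then show ?thesis using Suc
    by (simp add: cone_diff_Suc cone_def A.max_power_direct_sum[OF B.C_module A.C_module])
qed

text \<open>The condition for the cone, written on pairs \<open>(b, a)\<close>. For
  \<open>i = 0\<close> the second component of the differential is zero, so a bound on
  \<open>dA a\<close> appears only when \<open>i\<close> is a successor.\<close>

lemma linear_at_cone: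
  "linear_at R CC dC i \<longleftrightarrow>
    (\<forall>s. \<forall>b\<in>carrier (B (Suc i)). \<forall>a\<in>carrier (A i).
      dB (Suc i) b \<oplus>\<^bsub>B i\<^esub> \<psi> i a \<in> max_power R (B i) (Suc s) \<longrightarrow>
      (\<forall>k. i = Suc k \<longrightarrow> dA (Suc k) a \<in> max_power R (A k) (Suc s)) \<longrightarrow>
      (\<exists>y\<in>max_power R (B (Suc i)) s. \<exists>y'\<in>max_power R (A i) s.
        \<exists>b'\<in>carrier (B (Suc (Suc i))). \<exists>a'\<in>carrier (A (Suc i)).
          b = y \<oplus>\<^bsub>B (Suc i)\<^esub> (dB (Suc (Suc i)) b' \<oplus>\<^bsub>B (Suc i)\<^esub> \<psi> (Suc i) a') \<and>
          a = y' \<ominus>\<^bsub>A i\<^esub> dA (Suc i) a'))" (is "_ \<longleftrightarrow> (\<forall>s. \<forall>b\<in>_. \<forall>a\<in>_. ?P s b a \<longrightarrow> ?T s a \<longrightarrow> ?E s b a)")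
proof -
  have m: "(y, y') \<in> max_power R (CC (Suc i)) s \<longleftrightarrow> y \<in> max_power R (B (Suc i)) s \<and> y' \<in> max_power R (A i) s"
    for y y' s by (simp add: cone_def A.max_power_direct_sum[OF B.C_module A.C_module])
  have E: "(\<exists>y\<in>max_power R (CC (Suc i)) s. \<exists>w\<in>carrier (CC (Suc (Suc i))). (b, a) = y \<oplus>\<^bsub>CC (Suc i)\<^esub> dC (Suc (Suc i)) w)
      \<longleftrightarrow> ?E s b a" for s b a
  proof -
    have "(\<exists>y\<in>max_power R (CC (Suc i)) s. \<exists>w\<in>carrier (CC (Suc (Suc i))). (b, a) = y \<oplus>\<^bsub>CC (Suc i)\<^esub> dC (Suc (Suc i)) w) \<longleftrightarrow>
      (\<exists>y y' b' a'. (y, y') \<in> max_power R (CC (Suc i)) s \<and> (b', a') \<in> carrier (CC (Suc (Suc i))) \<and>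
         (b, a) = (y, y') \<oplus>\<^bsub>CC (Suc i)\<^esub> dC (Suc (Suc i)) (b', a'))" by (simp add: Bex_def split_paired_Ex)
    also have "\<dots> \<longleftrightarrow> ?E s b a"
      by (simp add: m cone_carrier cone_diff_Suc Bex_def) (auto simp: cone_def A.direct_sum_simps a_minus_def)
    finally show ?thesis .
  qed
  have "linear_at R CC dC i \<longleftrightarrow> (\<forall>s b a. (b, a) \<in> carrier (CC (Suc i)) \<longrightarrow>
      dC (Suc i) (b, a) \<in> max_power R (CC i) (Suc s) \<longrightarrow> ?E s b a)"
    unfolding linear_at_def by (simp add: E[symmetric] Ball_def split_paired_All)
  also have "\<dots> \<longleftrightarrow> (\<forall>s. \<forall>b\<in>carrier (B (Suc i)). \<forall>a\<in>carrier (A i). ?P s b a \<longrightarrow> ?T s a \<longrightarrow> ?E s b a)"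
    by (simp add: cone_carrier cone_diff_max_power cong: conj_cong imp_cong) blast
  finally show ?thesis .
qed

end

lemma (in abelian_group) add_minus_swap:
  assumes "f \<in> carrier G" "p \<in> carrier G" "y \<in> carrier G" "q \<in> carrier G" "f \<ominus> p = y \<oplus> q"
  shows "f = y \<oplus> (q \<oplus> p)"
proof -
  have "f = (f \<ominus> p) \<oplus> p" using assms(1,2) by (simp add: a_minus_def a_assoc l_neg)
  then show ?thesis using assms by (simp add: a_assoc)
qed

lemma (in abelian_group) minus_shift:
  assumes "u \<in> carrier G" "h \<in> carrier G" "y \<in> carrier G" "p \<in> carrier G" "h = y \<ominus> p"
  shows "u \<ominus> p = (u \<oplus> h) \<ominus> y"
proof -
  have "(u \<oplus> h) \<ominus> y = (u \<oplus> (y \<ominus> p)) \<ominus> y" by (simp only: assms(5)[symmetric])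
  also have "\<dots> = (u \<ominus> p) \<oplus> (y \<ominus> y)" using assms(1-4) by (simp add: a_minus_def a_ac)
  finally show ?thesis using assms(1-4) by (simp add: a_minus_def r_neg)
qed

lemma (in abelian_group) add_add_minus:
  assumes "u \<in> carrier G" "a \<in> carrier G" "b \<in> carrier G"
  shows "(u \<oplus> (a \<oplus> b)) \<ominus> a = u \<oplus> b"
proof -
  have "(u \<oplus> (a \<oplus> b)) \<ominus> a = (u \<oplus> b) \<oplus> (a \<ominus> a)" using assms by (simp add: a_minus_def a_ac)
  then show ?thesis using assms by (simp add: a_minus_def r_neg)
qed

subsection \<open>Linearity along the mapping cones\<close>

context minimal_resolution
begin

text \<open>The part of \<open>u\<close> that is itself a boundary is killed by \<open>d\<close>, so
  \<open>d u\<close> is already the differential of the remaining part, which has order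
  \<open>s\<close>.\<close>

lemma linear_at_boundary:
  assumes "linear_at R C d i" "u \<in> carrier (C (Suc i))" "d (Suc i) u \<in> max_power R (C i) (Suc s)"
  shows "d (Suc i) u \<in> d (Suc i) ` max_power R (C (Suc i)) s"
proof -
  obtain y w where y: "y \<in> max_power R (C (Suc i)) s" and w: "w \<in> carrier (C (Suc (Suc i)))"
      and u: "u = y \<oplus>\<^bsub>C (Suc i)\<^esub> d (Suc (Suc i)) w"
    using assms unfolding linear_at_def by blast
  interpret Ci: module R "C i" by (rule C_module)
  have yc: "y \<in> carrier (C (Suc i))" by (rule max_power_carrier[OF C_module y])
  have "d (Suc i) u = d (Suc i) y"
    using module_hom_add[OF mod_hom.f_hom[OF d_hom] yc d_closed[OF w]] d_d[OF w] d_closed[OF yc] u by simp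
  then show ?thesis using y by auto
qed

end

text \<open>\<open>M\<close> stands for the Koszul module, later the ideal \<open>I'\<close> or
  \<open>R\<close> itself, and \<open>j\<close> for the inclusion of \<open>T\<close>. Linearity
  defect 0 is stated as the linearity condition in every degree of one minimal resolution
  \<open>F\<close>.\<close>

locale koszul_splitting =
  F: minimal_resolution R F dF eF M nF + G: minimal_resolution R G dG eG T nG
  for R :: "('k, 'a) gmodule" (structure)
    and F :: "nat \<Rightarrow> ('a, 'm, 'e) module_scheme" and dF eF and M :: "('a, 'n, 'f) module_scheme" and nF
    and G :: "nat \<Rightarrow> ('a, 'm2, 'e2) module_scheme" and dG eG and T :: "('a, 'n2, 'f2) module_scheme" and nG +
  fixes x :: 'a and j :: "'n2 \<Rightarrow> 'n"
  assumes x: "x \<in> irrelevant R"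
    and koszul: "linear_at R F dF i"
    and j_hom: "mod_hom R T M j"
    and j_max: "v \<in> carrier T \<Longrightarrow> j v \<in> max_power R M 1"
begin

lemma x_carrier: "x \<in> carrier R"
  using x by (rule F.irrelevant_carrier)

text \<open>Order one is passed on from degree to degree: \<open>l\<close> of order one applied to
  \<open>dG w\<close>, itself of order one, has order two, and a boundary of order two in a linear
  resolution is the boundary of an element of order one. At the start, \<open>j T\<close> lies in
  \<open>m M\<close>, which is the image of \<open>m F_0\<close>.\<close>

lemma small_chain_map:
  obtains \<phi> where "\<And>i. mod_hom R (G i) (F i) (\<phi> i)"
    "\<And>i v. v \<in> carrier (G i) \<Longrightarrow> \<phi> i v \<in> max_power R (F i) 1"
    "\<And>v. v \<in> carrier (G 0) \<Longrightarrow> eF (\<phi> 0 v) = j (eG v)"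
    "\<And>i v. v \<in> carrier (G (Suc i)) \<Longrightarrow> dF (Suc i) (\<phi> (Suc i) v) = \<phi> i (dG (Suc i) v)"
proof (rule chain_map_exists[OF G.minimal_resolution_axioms F.minimal_resolution_axioms j_hom,
      of "\<lambda>i. max_power R (F i) 1"])
  show "submodule R (max_power R (F i) 1) (F i)" for i by (rule F.max_power_submod[OF F.C_module])
  show "j (eG v) \<in> eF ` max_power R (F 0) 1" if "v \<in> carrier (G 0)" for v
    using F.max_power_hom_onto[OF F.e_hom F.e_onto j_max[OF G.e_closed[OF that]]] by (metis imageI)
  show "l (dG (Suc i) w) \<in> dF (Suc i) ` max_power R (F (Suc i)) 1"
    if l: "mod_hom R (G i) (F i) l" "\<And>v. v \<in> carrier (G i) \<Longrightarrow> l v \<in> max_power R (F i) 1"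
      and w: "w \<in> carrier (G (Suc i))" "l (dG (Suc i) w) \<in> dF (Suc i) ` carrier (F (Suc i))" for i l w
  proof -
    have "l (dG (Suc i) w) \<in> max_power R (F i) (1 + 1)"
      by (rule F.max_power_hom[OF l G.minimal[OF w(1)]])
    moreover obtain u where "u \<in> carrier (F (Suc i))" "l (dG (Suc i) w) = dF (Suc i) u" using w(2) by blast
    ultimately show ?thesis using F.linear_at_boundary[OF koszul, of u i 1] by simp
  qed
qed (rule that)

text \<open>The lift becomes a constant of the locale so that the mapping cone over it can be named
  as a sublocale.\<close>

definition \<phi> where "\<phi> = (SOME \<phi>. (\<forall>i. mod_hom R (G i) (F i) (\<phi> i)) \<and>
    (\<forall>i. \<forall>v\<in>carrier (G i). \<phi> i v \<in> max_power R (F i) 1) \<and>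
    (\<forall>v\<in>carrier (G 0). eF (\<phi> 0 v) = j (eG v)) \<and>
    (\<forall>i. \<forall>v\<in>carrier (G (Suc i)). dF (Suc i) (\<phi> (Suc i) v) = \<phi> i (dG (Suc i) v)))"

lemma phi_all: "(\<forall>i. mod_hom R (G i) (F i) (\<phi> i)) \<and>
    (\<forall>i. \<forall>v\<in>carrier (G i). \<phi> i v \<in> max_power R (F i) 1) \<and>
    (\<forall>v\<in>carrier (G 0). eF (\<phi> 0 v) = j (eG v)) \<and>
    (\<forall>i. \<forall>v\<in>carrier (G (Suc i)). dF (Suc i) (\<phi> (Suc i) v) = \<phi> i (dG (Suc i) v))"
proof -
  have "\<exists>\<phi>. (\<forall>i. mod_hom R (G i) (F i) (\<phi> i)) \<and>
    (\<forall>i. \<forall>v\<in>carrier (G i). \<phi> i v \<in> max_power R (F i) 1) \<and>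
    (\<forall>v\<in>carrier (G 0). eF (\<phi> 0 v) = j (eG v)) \<and>
    (\<forall>i. \<forall>v\<in>carrier (G (Suc i)). dF (Suc i) (\<phi> (Suc i) v) = \<phi> i (dG (Suc i) v))"
    by (rule small_chain_map) blast
  from someI_ex[OF this] show ?thesis unfolding \<phi>_def .
qed

lemma phi_hom: "mod_hom R (G i) (F i) (\<phi> i)"
  and phi_max: "v \<in> carrier (G i) \<Longrightarrow> \<phi> i v \<in> max_power R (F i) 1"
  and phi_e: "v \<in> carrier (G 0) \<Longrightarrow> eF (\<phi> 0 v) = j (eG v)"
  and phi_d: "v \<in> carrier (G (Suc i)) \<Longrightarrow> dF (Suc i) (\<phi> (Suc i) v) = \<phi> i (dG (Suc i) v)"
  using phi_all by blast+

lemma phi_closed: "v \<in> carrier (G i) \<Longrightarrow> \<phi> i v \<in> carrier (F i)"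
  by (rule mod_hom.f_im[OF phi_hom])

lemma phi_max_Suc: "v \<in> max_power R (G i) s \<Longrightarrow> \<phi> i v \<in> max_power R (F i) (Suc s)"
  using F.max_power_hom[OF phi_hom phi_max] by fastforce

text \<open>The sign matches the kernel of the sum map \<open>(u, v) \<mapsto> x u + v\<close> in
  the application, which consists of the pairs \<open>(w, - x w)\<close>.\<close>

definition mx where "mx i v = \<ominus>\<^bsub>G i\<^esub> (x \<odot>\<^bsub>G i\<^esub> v)"

lemma mx_hom: "mod_hom R (G i) (G i) (mx i)"
  unfolding mx_def by (rule mod_hom_neg[OF mod_hom_smult[OF G.C_module x_carrier]])

lemma mx_closed: "v \<in> carrier (G i) \<Longrightarrow> mx i v \<in> carrier (G i)"
  by (rule mod_hom.f_im[OF mx_hom])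

lemma mx_max_Suc: "v \<in> max_power R (G i) s \<Longrightarrow> mx i v \<in> max_power R (G i) (Suc s)"
  unfolding mx_def
  by (rule F.max_power_uminus[OF G.C_module F.max_power_smult_Suc[OF G.C_module x]])

lemma mx_max: "v \<in> carrier (G i) \<Longrightarrow> mx i v \<in> max_power R (G i) 1"
  using mx_max_Suc[of v i 0] by simp

lemma mx_d:
  assumes "v \<in> carrier (G (Suc i))"
  shows "dG (Suc i) (mx (Suc i) v) = mx i (dG (Suc i) v)"
proof -
  interpret GS: module R "G (Suc i)" by (rule G.C_module)
  have "x \<odot>\<^bsub>G (Suc i)\<^esub> v \<in> carrier (G (Suc i))" using assms x_carrier by simp
  then show ?thesis unfolding mx_def
    using mod_hom.f_neg[OF G.d_hom] module_hom_smult[OF mod_hom.f_hom[OF G.d_hom] x_carrier assms] by simp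
qed

lemma mx_e:
  assumes "v \<in> carrier (G 0)"
  shows "eG (mx 0 v) = \<ominus>\<^bsub>T\<^esub> (x \<odot>\<^bsub>T\<^esub> eG v)"
proof -
  interpret G0: module R "G 0" by (rule G.C_module)
  have "x \<odot>\<^bsub>G 0\<^esub> v \<in> carrier (G 0)" using assms x_carrier by simp
  then show ?thesis unfolding mx_def
    using mod_hom.f_neg[OF G.e_hom] module_hom_smult[OF mod_hom.f_hom[OF G.e_hom] x_carrier assms] by simp
qed

end

text \<open>\<open>Q\<close> is the cokernel of the map \<open>w \<mapsto> (j w, - x w)\<close> from \<open>T\<close> to \<open>M \<oplus> T\<close>, resolved by the cone
  over \<open>(\<phi>, - x)\<close>, and \<open>Q'\<close> is \<open>T / x T\<close>, resolved by the cone over \<open>- x\<close>.\<close>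

locale koszul_splitting_cones = koszul_splitting R F dF eF M nF G dG eG T nG x j
  for R :: "('k, 'a) gmodule" (structure)
    and F :: "nat \<Rightarrow> ('a, 'm, 'e) module_scheme" and dF eF and M :: "('a, 'n, 'f) module_scheme" and nF
    and G :: "nat \<Rightarrow> ('a, 'm2, 'e2) module_scheme" and dG eG and T :: "('a, 'n2, 'f2) module_scheme" and nG
    and x j +
  fixes p :: "'n \<times> 'n2 \<Rightarrow> 'n3" and Q :: "('a, 'n3, 'f3) module_scheme"
    and p' :: "'n2 \<Rightarrow> 'n4" and Q' :: "('a, 'n4, 'f4) module_scheme"
  assumes p_hom: "mod_hom R (direct_sum M T) Q p"
    and p_onto: "p ` carrier (direct_sum M T) = carrier Q"
    and p_kernel: "{u \<in> carrier (direct_sum M T). p u = \<zero>\<^bsub>Q\<^esub>} = (\<lambda>w. (j w, \<ominus>\<^bsub>T\<^esub> (x \<odot>\<^bsub>T\<^esub> w))) ` carrier T"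
    and p'_hom: "mod_hom R T Q' p'"
    and p'_onto: "p' ` carrier T = carrier Q'"
    and p'_kernel: "{u \<in> carrier T. p' u = \<zero>\<^bsub>Q'\<^esub>} = (\<lambda>w. \<ominus>\<^bsub>T\<^esub> (x \<odot>\<^bsub>T\<^esub> w)) ` carrier T"
    and x_regular: "w \<in> carrier T \<Longrightarrow> x \<odot>\<^bsub>T\<^esub> w = \<zero>\<^bsub>T\<^esub> \<Longrightarrow> w = \<zero>\<^bsub>T\<^esub>"
    and x_gr_regular: "w \<in> max_power R T s \<Longrightarrow> x \<odot>\<^bsub>T\<^esub> w \<in> max_power R T (Suc (Suc s)) \<Longrightarrow>
      w \<in> max_power R T (Suc s)"
begin

abbreviation "FG i \<equiv> direct_sum (F i) (G i)"
abbreviation "dFG i q \<equiv> (dF i (fst q), dG i (snd q))"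

lemma T_module: "module R T" by (rule mod_hom_modules(2)[OF G.e_hom])

lemma T_uminus_zero: "w \<in> carrier T \<Longrightarrow> \<ominus>\<^bsub>T\<^esub> (x \<odot>\<^bsub>T\<^esub> w) = \<zero>\<^bsub>T\<^esub> \<Longrightarrow> w = \<zero>\<^bsub>T\<^esub>"
proof -
  interpret T: module R T by (rule T_module)
  assume "w \<in> carrier T" "\<ominus>\<^bsub>T\<^esub> (x \<odot>\<^bsub>T\<^esub> w) = \<zero>\<^bsub>T\<^esub>"
  then show ?thesis using x_regular x_carrier by simp
qed

sublocale C: minimal_cone R G dG eG T nG G dG eG T nG mx "\<lambda>w. \<ominus>\<^bsub>T\<^esub> (x \<odot>\<^bsub>T\<^esub> w)" p' Q'
proof (rule minimal_cone.intro[OF G.minimal_resolution_axioms G.minimal_resolution_axioms minimal_cone_axioms.intro])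
  show "mod_hom R T T (\<lambda>w. \<ominus>\<^bsub>T\<^esub> (x \<odot>\<^bsub>T\<^esub> w))"
    by (rule mod_hom_neg[OF mod_hom_smult[OF T_module x_carrier]])
qed (use mx_hom mx_max mx_d mx_e T_uminus_zero p'_hom p'_onto p'_kernel in simp_all)

text \<open>Its term in degree \<open>i\<close> is \<open>F_i \<oplus> G_i \<oplus> G_(i-1)\<close>:
  the first copy of \<open>G\<close> resolves the summand \<open>T\<close> of
  \<open>M \<oplus> T\<close>, the shifted copy resolves the submodule that is divided out.\<close>

sublocale H: minimal_cone R G dG eG T nG FG dFG "\<lambda>q. (eF (fst q), eG (snd q))" "direct_sum M T" "\<lambda>i. nF i + nG i"
  "\<lambda>i v. (\<phi> i v, mx i v)" "\<lambda>w. (j w, \<ominus>\<^bsub>T\<^esub> (x \<odot>\<^bsub>T\<^esub> w))" p Q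
proof (rule minimal_cone.intro[OF G.minimal_resolution_axioms
      minimal_resolution_direct_sum[OF F.minimal_resolution_axioms G.minimal_resolution_axioms] minimal_cone_axioms.intro])
  show "mod_hom R (G i) (FG i) (\<lambda>v. (\<phi> i v, mx i v))" for i by (rule F.mod_hom_pair[OF phi_hom mx_hom])
  show "mod_hom R T (direct_sum M T) (\<lambda>w. (j w, \<ominus>\<^bsub>T\<^esub> (x \<odot>\<^bsub>T\<^esub> w)))"
    by (rule F.mod_hom_pair[OF j_hom mod_hom_neg[OF mod_hom_smult[OF T_module x_carrier]]])
  show "(\<phi> i v, mx i v) \<in> max_power R (FG i) 1" if "v \<in> carrier (G i)" for v i
    using phi_max[OF that] mx_max[OF that] by (simp add: F.max_power_direct_sum[OF F.C_module G.C_module])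
  show "u = \<zero>\<^bsub>T\<^esub>" if "u \<in> carrier T" "(j u, \<ominus>\<^bsub>T\<^esub> (x \<odot>\<^bsub>T\<^esub> u)) = \<zero>\<^bsub>direct_sum M T\<^esub>" for u
    using that T_uminus_zero by (simp add: F.direct_sum_simps)
qed (use phi_d phi_e mx_d mx_e p_hom p_onto p_kernel in simp_all)

text \<open>Elements of degree \<open>i + 1\<close> of the cone are triples
  \<open>(f, g, h)\<close>. The conditions on \<open>(g, h)\<close> alone are those of the cone
  \<open>C\<close> over \<open>- x\<close>, and \<open>\<phi>\<close> occurs only in the conditions
  on \<open>f\<close>; this is the form in which the two cones are compared.\<close>

lemma linear_at_H:
  "linear_at R H.CC H.dC i \<longleftrightarrow>
    (\<forall>s. \<forall>f\<in>carrier (F (Suc i)). \<forall>g\<in>carrier (G (Suc i)). \<forall>h\<in>carrier (G i).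
      dF (Suc i) f \<oplus>\<^bsub>F i\<^esub> \<phi> i h \<in> max_power R (F i) (Suc s) \<longrightarrow>
      dG (Suc i) g \<oplus>\<^bsub>G i\<^esub> mx i h \<in> max_power R (G i) (Suc s) \<longrightarrow>
      (\<forall>k. i = Suc k \<longrightarrow> dG (Suc k) h \<in> max_power R (G k) (Suc s)) \<longrightarrow>
      (\<exists>y0\<in>max_power R (F (Suc i)) s. \<exists>y1\<in>max_power R (G (Suc i)) s. \<exists>y2\<in>max_power R (G i) s.
        \<exists>f'\<in>carrier (F (Suc (Suc i))). \<exists>g'\<in>carrier (G (Suc (Suc i))). \<exists>h'\<in>carrier (G (Suc i)).
          f = y0 \<oplus>\<^bsub>F (Suc i)\<^esub> (dF (Suc (Suc i)) f' \<oplus>\<^bsub>F (Suc i)\<^esub> \<phi> (Suc i) h') \<and>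
          g = y1 \<oplus>\<^bsub>G (Suc i)\<^esub> (dG (Suc (Suc i)) g' \<oplus>\<^bsub>G (Suc i)\<^esub> mx (Suc i) h') \<and>
          h = y2 \<ominus>\<^bsub>G i\<^esub> dG (Suc i) h'))" (is "_ \<longleftrightarrow> ?R")
proof -
  have B: "(\<forall>q\<in>carrier (FG k). P q) \<longleftrightarrow> (\<forall>f\<in>carrier (F k). \<forall>g\<in>carrier (G k). P (f, g))"
    "(\<exists>q\<in>carrier (FG k). P q) \<longleftrightarrow> (\<exists>f\<in>carrier (F k). \<exists>g\<in>carrier (G k). P (f, g))" for k P
    by (auto simp: F.direct_sum_simps)
  have E: "(\<exists>q\<in>max_power R (FG k) s. P q) \<longleftrightarrow> (\<exists>f\<in>max_power R (F k) s. \<exists>g\<in>max_power R (G k) s. P (f, g))" for k s P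
    by (simp add: Bex_def split_paired_Ex F.max_power_direct_sum[OF F.C_module G.C_module])
  show ?thesis
    unfolding H.linear_at_cone B E
    by (simp add: imp_conjL F.direct_sum_simps(3) F.max_power_direct_sum[OF F.C_module G.C_module])
qed

text \<open>Test the cone with the triple \<open>(0, z, 0)\<close>. Its splitting expresses
  \<open>z\<close> by an element of order \<open>s + 1\<close>, a boundary and
  \<open>- x h'\<close>, while the third component forces \<open>dG h'\<close> to have order
  \<open>s + 1\<close>. By induction \<open>h'\<close> is, up to a boundary, of order
  \<open>s\<close>, and multiplication by \<open>x\<close> supplies the missing order.\<close>

lemma linear_at_T:
  assumes lin: "linear_at R H.CC H.dC i"
  shows "linear_at R G dG i"
proof -
  interpret Fi: module R "F i" by (rule F.C_module)
  interpret Gi: module R "G i" by (rule G.C_module)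
  interpret FS: module R "F (Suc i)" by (rule F.C_module)
  interpret GS: module R "G (Suc i)" by (rule G.C_module)
  interpret GSS: module R "G (Suc (Suc i))" by (rule G.C_module)
  have "\<forall>z\<in>carrier (G (Suc i)). dG (Suc i) z \<in> max_power R (G i) (Suc s) \<longrightarrow>
     (\<exists>y\<in>max_power R (G (Suc i)) s. \<exists>w\<in>carrier (G (Suc (Suc i))). z = y \<oplus>\<^bsub>G (Suc i)\<^esub> dG (Suc (Suc i)) w)" for s
  proof (induction s)
    case 0
    show ?case
    proof (intro ballI impI)
      fix z assume "z \<in> carrier (G (Suc i))"
      then show "\<exists>y\<in>max_power R (G (Suc i)) 0. \<exists>w\<in>carrier (G (Suc (Suc i))). z = y \<oplus>\<^bsub>G (Suc i)\<^esub> dG (Suc (Suc i)) w"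
        by (intro bexI[of _ z] bexI[of _ "\<zero>\<^bsub>G (Suc (Suc i))\<^esub>"]) (auto simp: mod_hom.f0_is_0[OF G.d_hom])
    qed
  next
    case (Suc s)
    show ?case
    proof (intro ballI impI)
      fix z assume z: "z \<in> carrier (G (Suc i))" and dz: "dG (Suc i) z \<in> max_power R (G i) (Suc (Suc s))"
      have "dF (Suc i) \<zero>\<^bsub>F (Suc i)\<^esub> \<oplus>\<^bsub>F i\<^esub> \<phi> i \<zero>\<^bsub>G i\<^esub> \<in> max_power R (F i) (Suc (Suc s))"
        using F.max_power_zero[OF F.C_module] by (simp add: mod_hom.f0_is_0[OF F.d_hom] mod_hom.f0_is_0[OF phi_hom])
      moreover have "dG (Suc i) z \<oplus>\<^bsub>G i\<^esub> mx i \<zero>\<^bsub>G i\<^esub> \<in> max_power R (G i) (Suc (Suc s))"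
        using dz z G.d_closed by (simp add: mod_hom.f0_is_0[OF mx_hom])
      moreover have "dG (Suc k) \<zero>\<^bsub>G i\<^esub> \<in> max_power R (G k) (Suc (Suc s))" if "i = Suc k" for k
        using F.max_power_zero[OF G.C_module] mod_hom.f0_is_0[OF G.d_hom] that by simp
      ultimately obtain y1 y2 g' h' where y1: "y1 \<in> max_power R (G (Suc i)) (Suc s)"
        and y2: "y2 \<in> max_power R (G i) (Suc s)" and g': "g' \<in> carrier (G (Suc (Suc i)))"
        and h': "h' \<in> carrier (G (Suc i))"
        and z': "z = y1 \<oplus>\<^bsub>G (Suc i)\<^esub> (dG (Suc (Suc i)) g' \<oplus>\<^bsub>G (Suc i)\<^esub> mx (Suc i) h')"
        and 0: "\<zero>\<^bsub>G i\<^esub> = y2 \<ominus>\<^bsub>G i\<^esub> dG (Suc i) h'"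
        using lin[unfolded linear_at_H, rule_format, OF FS.M.zero_closed z Gi.M.zero_closed] by blast
      have "y2 = dG (Suc i) h'"
        using 0 Gi.M.minus_other_side[OF F.max_power_carrier[OF G.C_module y2] G.d_closed[OF h']] by simp
      then obtain y w where y: "y \<in> max_power R (G (Suc i)) s" and w: "w \<in> carrier (G (Suc (Suc i)))"
        and h'_eq: "h' = y \<oplus>\<^bsub>G (Suc i)\<^esub> dG (Suc (Suc i)) w"
        using Suc h' y2 by blast
      have yc: "y \<in> carrier (G (Suc i))" "y1 \<in> carrier (G (Suc i))"
        using F.max_power_carrier[OF G.C_module] y y1 by auto
      have "mx (Suc i) h' = mx (Suc i) y \<oplus>\<^bsub>G (Suc i)\<^esub> dG (Suc (Suc i)) (mx (Suc (Suc i)) w)"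
        unfolding h'_eq mx_d[OF w] by (rule module_hom_add[OF mod_hom.f_hom[OF mx_hom] yc(1) G.d_closed[OF w]])
      then have "z = (y1 \<oplus>\<^bsub>G (Suc i)\<^esub> mx (Suc i) y) \<oplus>\<^bsub>G (Suc i)\<^esub>
          (dG (Suc (Suc i)) g' \<oplus>\<^bsub>G (Suc i)\<^esub> dG (Suc (Suc i)) (mx (Suc (Suc i)) w))"
        unfolding z' using yc mx_closed G.d_closed g' w by (simp add: GS.M.a_ac)
      also have "dG (Suc (Suc i)) g' \<oplus>\<^bsub>G (Suc i)\<^esub> dG (Suc (Suc i)) (mx (Suc (Suc i)) w)
          = dG (Suc (Suc i)) (g' \<oplus>\<^bsub>G (Suc (Suc i))\<^esub> mx (Suc (Suc i)) w)"
        by (rule module_hom_add[OF mod_hom.f_hom[OF G.d_hom] g' mx_closed[OF w], symmetric])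
      finally show "\<exists>y\<in>max_power R (G (Suc i)) (Suc s). \<exists>w\<in>carrier (G (Suc (Suc i))).
          z = y \<oplus>\<^bsub>G (Suc i)\<^esub> dG (Suc (Suc i)) w"
        using F.max_power_add[OF G.C_module y1 mx_max_Suc[OF y]] g' mx_closed[OF w] by blast
    qed
  qed
  then show ?thesis unfolding linear_at_def by blast
qed

text \<open>The pair \<open>(g, h)\<close> is split by the cone over \<open>- x\<close>, which also
  determines \<open>h'\<close>. Then \<open>f - \<phi> h'\<close> has a differential of order
  \<open>s + 1\<close>, because the leftover \<open>\<phi> y2\<close> gains one order over
  \<open>y2\<close>, and linearity of \<open>F\<close> splits it.\<close>

lemma linear_at_C_imp_H:
  assumes lin: "linear_at R C.CC C.dC i"
  shows "linear_at R H.CC H.dC i"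
  unfolding linear_at_H
proof (intro allI ballI impI)
  interpret Fi: module R "F i" by (rule F.C_module)
  interpret Gi: module R "G i" by (rule G.C_module)
  interpret FS: module R "F (Suc i)" by (rule F.C_module)
  fix s f g h
  assume f: "f \<in> carrier (F (Suc i))" and g: "g \<in> carrier (G (Suc i))" and h: "h \<in> carrier (G i)"
    and df: "dF (Suc i) f \<oplus>\<^bsub>F i\<^esub> \<phi> i h \<in> max_power R (F i) (Suc s)"
    and dg: "dG (Suc i) g \<oplus>\<^bsub>G i\<^esub> mx i h \<in> max_power R (G i) (Suc s)"
    and dh: "\<forall>k. i = Suc k \<longrightarrow> dG (Suc k) h \<in> max_power R (G k) (Suc s)"
  obtain y1 y2 g' h' where y1: "y1 \<in> max_power R (G (Suc i)) s"
    and y2: "y2 \<in> max_power R (G i) s" and g': "g' \<in> carrier (G (Suc (Suc i)))"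
    and h': "h' \<in> carrier (G (Suc i))"
    and ge: "g = y1 \<oplus>\<^bsub>G (Suc i)\<^esub> (dG (Suc (Suc i)) g' \<oplus>\<^bsub>G (Suc i)\<^esub> mx (Suc i) h')"
    and he: "h = y2 \<ominus>\<^bsub>G i\<^esub> dG (Suc i) h'"
    using lin[unfolded C.linear_at_cone, rule_format, OF g h dg] dh by blast
  let ?f = "f \<ominus>\<^bsub>F (Suc i)\<^esub> \<phi> (Suc i) h'"
  have y2c: "y2 \<in> carrier (G i)" by (rule F.max_power_carrier[OF G.C_module y2])
  have "\<phi> i h = \<phi> i y2 \<ominus>\<^bsub>F i\<^esub> \<phi> i (dG (Suc i) h')"
    unfolding he by (rule mod_hom.f_minus[OF phi_hom y2c G.d_closed[OF h']])
  then have "dF (Suc i) ?f = (dF (Suc i) f \<oplus>\<^bsub>F i\<^esub> \<phi> i h) \<ominus>\<^bsub>F i\<^esub> \<phi> i y2"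
    using mod_hom.f_minus[OF F.d_hom f phi_closed[OF h']] phi_d[OF h']
      Fi.M.minus_shift[of "dF (Suc i) f" "\<phi> i h" "\<phi> i y2" "\<phi> i (dG (Suc i) h')"]
      f h y2c h' phi_closed F.d_closed G.d_closed by simp
  then have "dF (Suc i) ?f \<in> max_power R (F i) (Suc s)"
    using F.max_power_minus[OF F.C_module df phi_max_Suc[OF y2]] by simp
  moreover have fc: "?f \<in> carrier (F (Suc i))" using f h' phi_closed by simp
  ultimately obtain y0 f' where y0: "y0 \<in> max_power R (F (Suc i)) s" and f': "f' \<in> carrier (F (Suc (Suc i)))"
      and fe: "?f = y0 \<oplus>\<^bsub>F (Suc i)\<^esub> dF (Suc (Suc i)) f'"
    using koszul[of i] unfolding linear_at_def by blast
  have "f = y0 \<oplus>\<^bsub>F (Suc i)\<^esub> (dF (Suc (Suc i)) f' \<oplus>\<^bsub>F (Suc i)\<^esub> \<phi> (Suc i) h')"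
    by (rule FS.M.add_minus_swap[OF f phi_closed[OF h'] F.max_power_carrier[OF F.C_module y0] F.d_closed[OF f'] fe])
  then show "\<exists>y0\<in>max_power R (F (Suc i)) s. \<exists>y1\<in>max_power R (G (Suc i)) s. \<exists>y2\<in>max_power R (G i) s.
        \<exists>f'\<in>carrier (F (Suc (Suc i))). \<exists>g'\<in>carrier (G (Suc (Suc i))). \<exists>h'\<in>carrier (G (Suc i)).
          f = y0 \<oplus>\<^bsub>F (Suc i)\<^esub> (dF (Suc (Suc i)) f' \<oplus>\<^bsub>F (Suc i)\<^esub> \<phi> (Suc i) h') \<and>
          g = y1 \<oplus>\<^bsub>G (Suc i)\<^esub> (dG (Suc (Suc i)) g' \<oplus>\<^bsub>G (Suc i)\<^esub> mx (Suc i) h') \<and>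
          h = y2 \<ominus>\<^bsub>G i\<^esub> dG (Suc i) h'"
    using y0 y1 y2 f' g' h' ge he by blast
qed

text \<open>The only place where regularity of \<open>x\<close> on the associated graded module enters.\<close>

lemma head_decomposition:
  assumes g: "g \<in> carrier (G (Suc 0))" and h: "h \<in> carrier (G 0)"
    and dg: "dG (Suc 0) g \<oplus>\<^bsub>G 0\<^esub> mx 0 h \<in> max_power R (G 0) (Suc s)"
  shows "\<exists>y\<in>max_power R (G 0) s. \<exists>w\<in>carrier (G (Suc 0)). h = y \<oplus>\<^bsub>G 0\<^esub> dG (Suc 0) w"
proof -
  interpret T: module R T by (rule T_module)
  interpret G0: module R "G 0" by (rule G.C_module)
  let ?u = "eG h"
  have u: "?u \<in> carrier T" by (rule G.e_closed[OF h])
  have "eG (dG (Suc 0) g \<oplus>\<^bsub>G 0\<^esub> mx 0 h) = \<ominus>\<^bsub>T\<^esub> (x \<odot>\<^bsub>T\<^esub> ?u)"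
    using module_hom_add[OF mod_hom.f_hom[OF G.e_hom] G.d_closed[OF g] mx_closed[OF h]] G.e_d[OF g] mx_e[OF h]
      u x_carrier by simp
  then have "\<ominus>\<^bsub>T\<^esub> (x \<odot>\<^bsub>T\<^esub> ?u) \<in> max_power R T (Suc s)"
    using F.max_power_hom0[OF G.e_hom dg] by simp
  then have xu: "x \<odot>\<^bsub>T\<^esub> ?u \<in> max_power R T (Suc s)"
    using F.max_power_uminus[OF T_module] u x_carrier by (metis T.M.minus_minus T.smult_closed)
  \<comment> \<open>Climb one order at a time: if \<open>u\<close> lies in \<open>m^t T\<close> with
    \<open>t < s\<close>, then \<open>x u\<close> lies in \<open>m^(s+1) T\<close>, hence in
    \<open>m^(t+2) T\<close>; its class in the next graded piece vanishes, and so does the class of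
    \<open>u\<close>.\<close>
  have "t \<le> s \<Longrightarrow> ?u \<in> max_power R T t" for t
  proof (induction t)
    case 0 then show ?case using u by simp
  next
    case (Suc t)
    then have "x \<odot>\<^bsub>T\<^esub> ?u \<in> max_power R T (Suc (Suc t))"
      using xu F.max_power_antimono[OF T_module, of "Suc (Suc t)" "Suc s"] by auto
    moreover have "?u \<in> max_power R T t" using Suc by simp
    ultimately show ?case by (rule x_gr_regular[rotated])
  qed
  \<comment> \<open>The order of \<open>u\<close> in \<open>T\<close> is realised by a preimage in
    \<open>G 0\<close>; \<open>h\<close> differs from it by an element of the kernel of the
    augmentation, which is a boundary.\<close>
  then obtain y where y: "y \<in> max_power R (G 0) s" "eG y = ?u"
    using F.max_power_hom_onto[OF G.e_hom G.e_onto] by blast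
  have yc: "y \<in> carrier (G 0)" by (rule F.max_power_carrier[OF G.C_module y(1)])
  have "eG (h \<ominus>\<^bsub>G 0\<^esub> y) = \<zero>\<^bsub>T\<^esub>"
    using mod_hom.f_minus[OF G.e_hom h yc] y(2) u by (simp add: T.M.minus_other_side)
  then obtain w where w: "w \<in> carrier (G (Suc 0))" "h \<ominus>\<^bsub>G 0\<^esub> y = dG (Suc 0) w"
    using G.cycle_lift0 G0.M.minus_closed[OF h yc] by blast
  have "h = y \<oplus>\<^bsub>G 0\<^esub> dG (Suc 0) w"
    unfolding w(2)[symmetric] using h yc by (simp add: a_minus_def G0.M.a_ac G0.M.r_neg)
  then show ?thesis using y w by blast
qed

text \<open>To use the hypothesis, \<open>(g, h)\<close> must be completed to a triple, so
  \<open>\<phi> h\<close> has to be a boundary up to order \<open>s + 1\<close>. For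
  \<open>i = Suc k\<close> this is linearity of \<open>F\<close> applied to \<open>\<phi> h\<close>,
  whose differential \<open>\<phi> (dG h)\<close> has order \<open>s + 2\<close>; for
  \<open>i = 0\<close> there is no such differential and \<open>head_decomposition\<close> takes its
  place.\<close>

lemma linear_at_H_imp_C:
  assumes lin: "linear_at R H.CC H.dC i"
  shows "linear_at R C.CC C.dC i"
  unfolding C.linear_at_cone
proof (intro allI ballI impI)
  interpret Fi: module R "F i" by (rule F.C_module)
  fix s g h
  assume g: "g \<in> carrier (G (Suc i))" and h: "h \<in> carrier (G i)"
    and dg: "dG (Suc i) g \<oplus>\<^bsub>G i\<^esub> mx i h \<in> max_power R (G i) (Suc s)"
    and dh: "\<forall>k. i = Suc k \<longrightarrow> dG (Suc k) h \<in> max_power R (G k) (Suc s)"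
  have "\<exists>y\<in>max_power R (F i) (Suc s). \<exists>f\<in>carrier (F (Suc i)). \<phi> i h = y \<oplus>\<^bsub>F i\<^esub> dF (Suc i) f"
  proof (cases i)
    case 0
    then obtain y w where y: "y \<in> max_power R (G 0) s" and w: "w \<in> carrier (G (Suc 0))"
        and he: "h = y \<oplus>\<^bsub>G 0\<^esub> dG (Suc 0) w"
      using head_decomposition g h dg by blast
    have "\<phi> 0 h = \<phi> 0 y \<oplus>\<^bsub>F 0\<^esub> dF (Suc 0) (\<phi> (Suc 0) w)"
      unfolding he phi_d[OF w]
      by (rule module_hom_add[OF mod_hom.f_hom[OF phi_hom] F.max_power_carrier[OF G.C_module y] G.d_closed[OF w]])
    then show ?thesis using phi_max_Suc[OF y] phi_closed[OF w] 0 by blast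
  next
    case (Suc k)
    have "dF (Suc k) (\<phi> (Suc k) h) \<in> max_power R (F k) (Suc (Suc s))"
      using phi_d[of h k] h dh phi_max_Suc Suc by simp
    then show ?thesis using koszul[of k] phi_closed h Suc unfolding linear_at_def by blast
  qed
  then obtain y f where y: "y \<in> max_power R (F i) (Suc s)" and f: "f \<in> carrier (F (Suc i))"
      and e: "\<phi> i h = y \<oplus>\<^bsub>F i\<^esub> dF (Suc i) f" by blast
  interpret FS: module R "F (Suc i)" by (rule F.C_module)
  \<comment> \<open>The completing component is \<open>- f\<close>, which cancels the boundary part
    of \<open>\<phi> h\<close>.\<close>
  have f': "\<ominus>\<^bsub>F (Suc i)\<^esub> f \<in> carrier (F (Suc i))" using f by simp
  have "dF (Suc i) (\<ominus>\<^bsub>F (Suc i)\<^esub> f) \<oplus>\<^bsub>F i\<^esub> \<phi> i h = y"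
    unfolding e using mod_hom.f_neg[OF F.d_hom f] F.max_power_carrier[OF F.C_module y] F.d_closed[OF f]
    by (simp add: Fi.M.a_ac Fi.M.r_neg2 Fi.M.r_neg1 Fi.M.r_neg)
  then have "dF (Suc i) (\<ominus>\<^bsub>F (Suc i)\<^esub> f) \<oplus>\<^bsub>F i\<^esub> \<phi> i h \<in> max_power R (F i) (Suc s)" using y by simp
  from lin[unfolded linear_at_H, rule_format, OF f' g h this dg] dh
  show "\<exists>y\<in>max_power R (G (Suc i)) s. \<exists>y'\<in>max_power R (G i) s.
      \<exists>b'\<in>carrier (G (Suc (Suc i))). \<exists>a'\<in>carrier (G (Suc i)).
        g = y \<oplus>\<^bsub>G (Suc i)\<^esub> (dG (Suc (Suc i)) b' \<oplus>\<^bsub>G (Suc i)\<^esub> mx (Suc i) a') \<and>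
        h = y' \<ominus>\<^bsub>G i\<^esub> dG (Suc i) a'" by blast
qed

text \<open>The component \<open>h\<close> lives in degree \<open>i\<close> and has its differential
  in degree \<open>i - 1\<close>, so the condition for \<open>T\<close> at the predecessor of
  \<open>i\<close> is what splits it; for \<open>i = 0\<close> regularity on the associated graded
  module does. This loss of one degree is the \<open>+ 1\<close> in the upper bound.\<close>

lemma linear_at_T_imp_C:
  assumes lin: "linear_at R G dG i" and pred: "\<And>k. i = Suc k \<Longrightarrow> linear_at R G dG k"
  shows "linear_at R C.CC C.dC i"
  unfolding C.linear_at_cone
proof (intro allI ballI impI)
  interpret Gi: module R "G i" by (rule G.C_module)
  interpret GS: module R "G (Suc i)" by (rule G.C_module)
  fix s g h
  assume g: "g \<in> carrier (G (Suc i))" and h: "h \<in> carrier (G i)"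
    and dg: "dG (Suc i) g \<oplus>\<^bsub>G i\<^esub> mx i h \<in> max_power R (G i) (Suc s)"
    and dh: "\<forall>k. i = Suc k \<longrightarrow> dG (Suc k) h \<in> max_power R (G k) (Suc s)"
  have "\<exists>y\<in>max_power R (G i) s. \<exists>w\<in>carrier (G (Suc i)). h = y \<oplus>\<^bsub>G i\<^esub> dG (Suc i) w"
  proof (cases i)
    case 0
    then show ?thesis using head_decomposition g h dg by blast
  next
    case (Suc k)
    then show ?thesis using pred[OF Suc] dh h unfolding linear_at_def by blast
  qed
  then obtain y w where y: "y \<in> max_power R (G i) s" and w: "w \<in> carrier (G (Suc i))"
      and he: "h = y \<oplus>\<^bsub>G i\<^esub> dG (Suc i) w" by blast
  have yc: "y \<in> carrier (G i)" by (rule F.max_power_carrier[OF G.C_module y])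
  \<comment> \<open>Subtracting from \<open>(g, h)\<close> the boundary of \<open>(0, - w)\<close>
    leaves \<open>(g + mx w, y)\<close>, whose second component already has order
    \<open>s\<close>.\<close>
  let ?w = "\<ominus>\<^bsub>G (Suc i)\<^esub> w"
  let ?g = "g \<oplus>\<^bsub>G (Suc i)\<^esub> mx (Suc i) w"
  have wc: "?w \<in> carrier (G (Suc i))" using w by simp
  have mw: "mx (Suc i) ?w = \<ominus>\<^bsub>G (Suc i)\<^esub> mx (Suc i) w" by (rule mod_hom.f_neg[OF mx_hom w])
  have dw: "dG (Suc i) ?w = \<ominus>\<^bsub>G i\<^esub> dG (Suc i) w" by (rule mod_hom.f_neg[OF G.d_hom w])
  have "dG (Suc i) ?g = dG (Suc i) g \<oplus>\<^bsub>G i\<^esub> mx i (dG (Suc i) w)"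
    using module_hom_add[OF mod_hom.f_hom[OF G.d_hom] g mx_closed[OF w]] mx_d[OF w] by simp
  moreover have "mx i h = mx i y \<oplus>\<^bsub>G i\<^esub> mx i (dG (Suc i) w)"
    unfolding he by (rule module_hom_add[OF mod_hom.f_hom[OF mx_hom] yc G.d_closed[OF w]])
  ultimately have "dG (Suc i) ?g = (dG (Suc i) g \<oplus>\<^bsub>G i\<^esub> mx i h) \<ominus>\<^bsub>G i\<^esub> mx i y"
    using Gi.M.add_add_minus[of "dG (Suc i) g" "mx i y" "mx i (dG (Suc i) w)"] g w yc G.d_closed mx_closed
    by simp
  then have "dG (Suc i) ?g \<in> max_power R (G i) (Suc s)"
    using F.max_power_minus[OF G.C_module dg mx_max_Suc[OF y]] by simp
  moreover have "?g \<in> carrier (G (Suc i))" using g w mx_closed by simp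
  ultimately obtain y' w' where y': "y' \<in> max_power R (G (Suc i)) s" and w': "w' \<in> carrier (G (Suc (Suc i)))"
      and ge: "?g = y' \<oplus>\<^bsub>G (Suc i)\<^esub> dG (Suc (Suc i)) w'"
    using lin unfolding linear_at_def by blast
  have "g \<ominus>\<^bsub>G (Suc i)\<^esub> mx (Suc i) ?w = y' \<oplus>\<^bsub>G (Suc i)\<^esub> dG (Suc (Suc i)) w'"
    unfolding mw ge[symmetric] using g w mx_closed by (simp add: a_minus_def)
  then have "g = y' \<oplus>\<^bsub>G (Suc i)\<^esub> (dG (Suc (Suc i)) w' \<oplus>\<^bsub>G (Suc i)\<^esub> mx (Suc i) ?w)"
    by (rule GS.M.add_minus_swap[OF g mx_closed[OF wc] F.max_power_carrier[OF G.C_module y'] G.d_closed[OF w']])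
  moreover have "h = y \<ominus>\<^bsub>G i\<^esub> dG (Suc i) ?w"
    unfolding dw he using yc G.d_closed[OF w] by (simp add: a_minus_def)
  ultimately show "\<exists>y\<in>max_power R (G (Suc i)) s. \<exists>y'\<in>max_power R (G i) s.
      \<exists>b'\<in>carrier (G (Suc (Suc i))). \<exists>a'\<in>carrier (G (Suc i)).
        g = y \<oplus>\<^bsub>G (Suc i)\<^esub> (dG (Suc (Suc i)) b' \<oplus>\<^bsub>G (Suc i)\<^esub> mx (Suc i) a') \<and>
        h = y' \<ominus>\<^bsub>G i\<^esub> dG (Suc i) a'"
    using y y' w' wc by blast
qed

end

subsection \<open>Quotients and direct sums\<close>

text \<open>Structure transported along a surjection \<open>f\<close> compatible with all
  operations. It serves quotient modules, with \<open>f\<close> the coset map, and changes of the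
  module record, with \<open>f\<close> the identity.\<close>

lemma module_image:
  assumes M: "module R M" and c: "carrier Q = f ` carrier M" and z: "\<zero>\<^bsub>Q\<^esub> = f \<zero>\<^bsub>M\<^esub>"
    and a: "\<And>u v. u \<in> carrier M \<Longrightarrow> v \<in> carrier M \<Longrightarrow> f u \<oplus>\<^bsub>Q\<^esub> f v = f (u \<oplus>\<^bsub>M\<^esub> v)"
    and s: "\<And>r v. r \<in> carrier R \<Longrightarrow> v \<in> carrier M \<Longrightarrow> r \<odot>\<^bsub>Q\<^esub> f v = f (r \<odot>\<^bsub>M\<^esub> v)"
  shows "module R Q" and "mod_hom R M Q f"
proof -
  interpret M: module R M by fact
  have neg: "\<exists>neg_v\<in>carrier Q. v \<oplus>\<^bsub>Q\<^esub> neg_v = \<zero>\<^bsub>Q\<^esub>" if "v \<in> carrier Q" for v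
  proof -
    from that obtain u where "u \<in> carrier M" "v = f u" using c by auto
    then show ?thesis
      by (intro bexI[of _ "f (\<ominus>\<^bsub>M\<^esub> u)"]) (auto simp: a z c M.M.r_neg)
  qed
  show Q: "module R Q"
    by (rule module_criteria)
      (use neg in \<open>auto simp: c z a s M.M.a_ac M.smult_l_distr M.smult_r_distr M.smult_assoc1 intro: M.R.cring_axioms\<close>)
  show "mod_hom R M Q f" by (rule mod_homI[OF M Q]) (auto simp: c a s)
qed

lemma submod_additive:
  assumes "submodule R N M" shows "abelian_subgroup N M"
proof -
  interpret M: module R M by (rule submodD(1)[OF assms])
  show ?thesis
  proof (rule abelian_subgroupI3)
    show "additive_subgroup N M"
    proof (rule additive_subgroup.intro, rule subgroup.intro)
      fix v assume "v \<in> N"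
      then show "inv\<^bsub>add_monoid M\<^esub> v \<in> N" using submod_uminus[OF assms] by (simp add: a_inv_def)
    qed (use submodD[OF assms] in auto)
  qed (rule M.M.abelian_group_axioms)
qed

lemma coset_eq_iff:
  assumes "submodule R N M" "u \<in> carrier M" "v \<in> carrier M"
  shows "N +>\<^bsub>M\<^esub> u = N +>\<^bsub>M\<^esub> v \<longleftrightarrow> (\<exists>n\<in>N. u = n \<oplus>\<^bsub>M\<^esub> v)"
proof -
  interpret M: module R M by (rule submodD(1)[OF assms(1)])
  interpret N: abelian_subgroup N M by (rule submod_additive[OF assms(1)])
  have "(\<exists>n\<in>N. u = n \<oplus>\<^bsub>M\<^esub> v) \<longleftrightarrow> u \<in> N +>\<^bsub>M\<^esub> v" by (auto simp: a_r_coset_def')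
  also have "\<dots> \<longleftrightarrow> N +>\<^bsub>M\<^esub> u = N +>\<^bsub>M\<^esub> v"
    using N.a_rcos_self[OF assms(2)] N.a_repr_independence'[OF _ assms(3)] by auto
  finally show ?thesis ..
qed

lemma coset_eq_self_iff:
  assumes "submodule R N M" "u \<in> carrier M"
  shows "N +>\<^bsub>M\<^esub> u = N \<longleftrightarrow> u \<in> N"
proof -
  interpret M: module R M by (rule submodD(1)[OF assms(1)])
  interpret N: abelian_subgroup N M by (rule submod_additive[OF assms(1)])
  have "N = N +>\<^bsub>M\<^esub> \<zero>\<^bsub>M\<^esub>" using submodD(2)[OF assms(1)] by (simp add: M.M.a_coset_add_zero)
  then have "N +>\<^bsub>M\<^esub> u = N \<longleftrightarrow> N +>\<^bsub>M\<^esub> u = N +>\<^bsub>M\<^esub> \<zero>\<^bsub>M\<^esub>" by simp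
  also have "\<dots> \<longleftrightarrow> u \<in> N"
    unfolding coset_eq_iff[OF assms M.M.zero_closed] using submodD(2)[OF assms(1)] by auto
  finally show ?thesis .
qed

text \<open>The added summand \<open>N'\<close> fills the image of a coset up to a full coset. Both
  the scalar multiplication of \<open>quot_mod\<close> and the map \<open>quot_map\<close> have this
  form.\<close>

lemma coset_image_add:
  assumes f: "mod_hom R M M' f" and N: "submodule R N M" and N': "submodule R N' M'"
    and fN: "f ` N \<subseteq> N'" and v: "v \<in> carrier M"
  shows "(f ` (N +>\<^bsub>M\<^esub> v)) <+>\<^bsub>M'\<^esub> N' = N' +>\<^bsub>M'\<^esub> f v"
proof -
  interpret f: mod_hom R M M' f by fact
  have c: "\<And>n. n \<in> N \<Longrightarrow> n \<in> carrier M" "\<And>n. n \<in> N' \<Longrightarrow> n \<in> carrier M'"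
    using submodD(2)[OF N] submodD(2)[OF N'] by auto
  show ?thesis
  proof (intro equalityI subsetI)
    fix w assume "w \<in> (f ` (N +>\<^bsub>M\<^esub> v)) <+>\<^bsub>M'\<^esub> N'"
    then obtain n n' where n: "n \<in> N" "n' \<in> N'" and w: "w = f (n \<oplus>\<^bsub>M\<^esub> v) \<oplus>\<^bsub>M'\<^esub> n'"
      by (auto simp: set_add_def' a_r_coset_def')
    have "w = (f n \<oplus>\<^bsub>M'\<^esub> n') \<oplus>\<^bsub>M'\<^esub> f v" using w n c v by (simp add: f.N.M.a_ac)
    moreover have "f n \<oplus>\<^bsub>M'\<^esub> n' \<in> N'" using submodD(4)[OF N'] fN n by auto
    ultimately show "w \<in> N' +>\<^bsub>M'\<^esub> f v" by (auto simp: a_r_coset_def')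
  next
    fix w assume "w \<in> N' +>\<^bsub>M'\<^esub> f v"
    then obtain n' where n': "n' \<in> N'" "w = n' \<oplus>\<^bsub>M'\<^esub> f v" by (auto simp: a_r_coset_def')
    then have "w = f (\<zero>\<^bsub>M\<^esub> \<oplus>\<^bsub>M\<^esub> v) \<oplus>\<^bsub>M'\<^esub> n'" using c v by (simp add: f.N.M.a_ac)
    then show "w \<in> (f ` (N +>\<^bsub>M\<^esub> v)) <+>\<^bsub>M'\<^esub> N'"
      using n'(1) submodD(3)[OF N] unfolding set_add_def' a_r_coset_def' by blast
  qed
qed

lemma quot_mod_simps:
  "carrier (quot_mod M N) = (\<lambda>v. N +>\<^bsub>M\<^esub> v) ` carrier M"
  "\<zero>\<^bsub>quot_mod M N\<^esub> = N"
  "U \<oplus>\<^bsub>quot_mod M N\<^esub> V = U <+>\<^bsub>M\<^esub> V"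
  "r \<odot>\<^bsub>quot_mod M N\<^esub> U = ((\<lambda>v. r \<odot>\<^bsub>M\<^esub> v) ` U) <+>\<^bsub>M\<^esub> N"
  by (auto simp: quot_mod_def A_RCOSETS_def')

lemma quot_mod_module:
  assumes N: "submodule R N M"
  shows "module R (quot_mod M N)" and "mod_hom R M (quot_mod M N) (\<lambda>v. N +>\<^bsub>M\<^esub> v)"
proof -
  have M: "module R M" by (rule submodD(1)[OF N])
  interpret M: module R M by fact
  interpret N: abelian_subgroup N M by (rule submod_additive[OF N])
  have z: "\<zero>\<^bsub>quot_mod M N\<^esub> = N +>\<^bsub>M\<^esub> \<zero>\<^bsub>M\<^esub>"
    using submodD(2)[OF N] by (simp add: quot_mod_simps M.M.a_coset_add_zero)
  have s: "r \<odot>\<^bsub>quot_mod M N\<^esub> (N +>\<^bsub>M\<^esub> v) = N +>\<^bsub>M\<^esub> (r \<odot>\<^bsub>M\<^esub> v)"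
    if "r \<in> carrier R" "v \<in> carrier M" for r v
    unfolding quot_mod_simps
    by (rule coset_image_add[OF mod_hom_smult[OF M that(1)] N N _ that(2)])
      (use submodD(5)[OF N that(1)] in auto)
  note * = module_image[OF M quot_mod_simps(1) z _ s]
  show "module R (quot_mod M N)" "mod_hom R M (quot_mod M N) (\<lambda>v. N +>\<^bsub>M\<^esub> v)"
    by (rule *; simp add: quot_mod_simps N.a_rcos_sum)+
qed

lemma quot_map_coset:
  assumes "mod_hom R M M' f" "submodule R N M" "submodule R N' M'" "f ` N \<subseteq> N'" "v \<in> carrier M"
  shows "quot_map M' N' f (N +>\<^bsub>M\<^esub> v) = N' +>\<^bsub>M'\<^esub> f v"
  unfolding quot_map_def by (rule coset_image_add[OF assms])

lemma submod_restrict: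
  assumes "submodule R P M" "submodule R N M" "N \<subseteq> P"
  shows "submodule R N (M\<lparr>carrier := P\<rparr>)"
  using assms submod_module[OF assms(1)] by (auto simp: submodule_def)

lemma coset_restrict: "N +>\<^bsub>M\<lparr>carrier := P\<rparr>\<^esub> v = N +>\<^bsub>M\<^esub> v"
  by (simp add: a_r_coset_def')

lemma quot_map_hom:
  assumes f: "mod_hom R M M' f" and P: "submodule R P M" and N: "submodule R N M" "N \<subseteq> P"
    and P': "submodule R P' M'" and N': "submodule R N' M'" "N' \<subseteq> P'" and fP: "f ` P \<subseteq> P'" and fN: "f ` N \<subseteq> N'"
  shows "mod_hom R (quot_mod (M\<lparr>carrier := P\<rparr>) N) (quot_mod (M'\<lparr>carrier := P'\<rparr>) N') (quot_map M' N' f)"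
proof -
  let ?P = "M\<lparr>carrier := P\<rparr>" and ?P' = "M'\<lparr>carrier := P'\<rparr>"
  have q: "mod_hom R ?P (quot_mod ?P N) (\<lambda>v. N +>\<^bsub>M\<^esub> v)"
    using quot_mod_module(2)[OF submod_restrict[OF P N]] by (simp add: coset_restrict)
  have q': "mod_hom R ?P' (quot_mod ?P' N') (\<lambda>v. N' +>\<^bsub>M'\<^esub> v)"
    using quot_mod_module(2)[OF submod_restrict[OF P' N']] by (simp add: coset_restrict)
  interpret f: mod_hom R M M' f by fact
  interpret q: mod_hom R ?P "quot_mod ?P N" "\<lambda>v. N +>\<^bsub>M\<^esub> v" by fact
  interpret q': mod_hom R ?P' "quot_mod ?P' N'" "\<lambda>v. N' +>\<^bsub>M'\<^esub> v" by fact
  have PM: "\<And>v. v \<in> P \<Longrightarrow> v \<in> carrier M" using submodD(2)[OF P] by auto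
  have m: "quot_map M' N' f (N +>\<^bsub>M\<^esub> v) = N' +>\<^bsub>M'\<^esub> f v" if "v \<in> P" for v
    by (rule quot_map_coset[OF f N(1) N'(1) fN]) (rule PM[OF that])
  show ?thesis
  proof (rule mod_homI[OF q.N.module_axioms q'.N.module_axioms])
    fix U assume "U \<in> carrier (quot_mod ?P N)"
    then obtain u where "u \<in> P" "U = N +>\<^bsub>M\<^esub> u" by (auto simp: quot_mod_simps coset_restrict)
    then show "quot_map M' N' f U \<in> carrier (quot_mod ?P' N')" using m fP q'.f_im by auto
  next
    fix U V assume "U \<in> carrier (quot_mod ?P N)" "V \<in> carrier (quot_mod ?P N)"
    then obtain u v where u: "u \<in> P" "U = N +>\<^bsub>M\<^esub> u" "v \<in> P" "V = N +>\<^bsub>M\<^esub> v"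
      by (auto simp: quot_mod_simps coset_restrict)
    have "U \<oplus>\<^bsub>quot_mod ?P N\<^esub> V = N +>\<^bsub>M\<^esub> (u \<oplus>\<^bsub>M\<^esub> v)" using q.f_add[of u v] u by simp
    moreover have "u \<oplus>\<^bsub>M\<^esub> v \<in> P" using submodD(4)[OF P] u by auto
    moreover have "f u \<in> P'" "f v \<in> P'" using fP u by auto
    ultimately show "quot_map M' N' f (U \<oplus>\<^bsub>quot_mod ?P N\<^esub> V)
        = quot_map M' N' f U \<oplus>\<^bsub>quot_mod ?P' N'\<^esub> quot_map M' N' f V"
      using q'.f_add[of "f u" "f v"] u m PM by simp
  next
    fix r U assume r: "r \<in> carrier R" and "U \<in> carrier (quot_mod ?P N)"
    then obtain u where u: "u \<in> P" "U = N +>\<^bsub>M\<^esub> u" by (auto simp: quot_mod_simps coset_restrict)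
    have "r \<odot>\<^bsub>quot_mod ?P N\<^esub> U = N +>\<^bsub>M\<^esub> (r \<odot>\<^bsub>M\<^esub> u)" using q.f_smult[OF r, of u] u by simp
    moreover have "r \<odot>\<^bsub>M\<^esub> u \<in> P" using submodD(5)[OF P r] u by auto
    moreover have "f u \<in> P'" using fP u by auto
    ultimately show "quot_map M' N' f (r \<odot>\<^bsub>quot_mod ?P N\<^esub> U) = r \<odot>\<^bsub>quot_mod ?P' N'\<^esub> quot_map M' N' f U"
      using q'.f_smult[OF r, of "f u"] u m PM r by simp
  qed
qed

section \<open>Infinite direct sums and the vanishing of homology\<close>

lemma direct_sum_mod_simps:
  "carrier (direct_sum_mod M) = {c. (\<forall>p. c p \<in> carrier (M p)) \<and> finite {p. c p \<noteq> \<zero>\<^bsub>M p\<^esub>}}"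
  "\<zero>\<^bsub>direct_sum_mod M\<^esub> = (\<lambda>p. \<zero>\<^bsub>M p\<^esub>)"
  "c \<oplus>\<^bsub>direct_sum_mod M\<^esub> c' = (\<lambda>p. c p \<oplus>\<^bsub>M p\<^esub> c' p)"
  "r \<odot>\<^bsub>direct_sum_mod M\<^esub> c = (\<lambda>p. r \<odot>\<^bsub>M p\<^esub> c p)"
  by (auto simp: direct_sum_mod_def)

lemma direct_sum_mod_module:
  assumes "\<And>p. module R (M p)"
  shows "module R (direct_sum_mod M)"
proof -
  have ag: "\<And>p. abelian_group (M p)" using assms by (simp add: module_def)
  have am: "\<And>p. abelian_monoid (M p)" using ag by (simp add: abelian_group_def)
  have cr: "cring R" using assms[of 0] by (simp add: module_def)
  note cl = abelian_monoid.a_closed[OF am] module.smult_closed[OF assms] abelian_monoid.zero_closed[OF am]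
    abelian_group.a_inv_closed[OF ag]
  note eq = abelian_monoid.l_zero[OF am] abelian_monoid.r_zero[OF am] module.smult_r_null[OF assms]
    abelian_group.r_neg[OF ag]
  have fin_add: "finite {p. a p \<oplus>\<^bsub>M p\<^esub> b p \<noteq> \<zero>\<^bsub>M p\<^esub>}"
    if "finite {p. a p \<noteq> \<zero>\<^bsub>M p\<^esub>}" "finite {p. b p \<noteq> \<zero>\<^bsub>M p\<^esub>}" for a b
    by (rule finite_subset[OF _ finite_UnI[OF that]]) (auto simp: eq cl)
  have fin_smult: "finite {p. r \<odot>\<^bsub>M p\<^esub> a p \<noteq> \<zero>\<^bsub>M p\<^esub>}"
    if "finite {p. a p \<noteq> \<zero>\<^bsub>M p\<^esub>}" "r \<in> carrier R" for a r
    by (rule finite_subset[OF _ that(1)]) (use that in \<open>auto simp: eq\<close>)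
  have fin_neg: "finite {p. \<ominus>\<^bsub>M p\<^esub> a p \<noteq> \<zero>\<^bsub>M p\<^esub>}"
    if "finite {p. a p \<noteq> \<zero>\<^bsub>M p\<^esub>}" for a
    by (rule finite_subset[OF _ that]) (auto simp: abelian_group.minus_equality[OF ag] eq cl)
  show ?thesis
  proof (rule module_criteria[OF cr])
    show "\<forall>v\<in>carrier (direct_sum_mod M). \<exists>neg_v\<in>carrier (direct_sum_mod M).
        v \<oplus>\<^bsub>direct_sum_mod M\<^esub> neg_v = \<zero>\<^bsub>direct_sum_mod M\<^esub>"
    proof
      fix v assume "v \<in> carrier (direct_sum_mod M)"
      then show "\<exists>neg_v\<in>carrier (direct_sum_mod M). v \<oplus>\<^bsub>direct_sum_mod M\<^esub> neg_v = \<zero>\<^bsub>direct_sum_mod M\<^esub>"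
        by (intro bexI[of _ "\<lambda>p. \<ominus>\<^bsub>M p\<^esub> v p"]) (auto simp: direct_sum_mod_simps eq cl fin_neg)
    qed
    show "\<forall>v w. v \<in> carrier (direct_sum_mod M) \<and> w \<in> carrier (direct_sum_mod M) \<longrightarrow>
        v \<oplus>\<^bsub>direct_sum_mod M\<^esub> w = w \<oplus>\<^bsub>direct_sum_mod M\<^esub> v"
      by (auto simp: direct_sum_mod_simps abelian_monoid.a_comm[OF am])
    show "\<forall>v w x. v \<in> carrier (direct_sum_mod M) \<and> w \<in> carrier (direct_sum_mod M) \<and> x \<in> carrier (direct_sum_mod M) \<longrightarrow>
        v \<oplus>\<^bsub>direct_sum_mod M\<^esub> w \<oplus>\<^bsub>direct_sum_mod M\<^esub> x = v \<oplus>\<^bsub>direct_sum_mod M\<^esub> (w \<oplus>\<^bsub>direct_sum_mod M\<^esub> x)"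
      by (auto simp: direct_sum_mod_simps abelian_monoid.a_assoc[OF am])
  qed (auto simp: direct_sum_mod_simps eq cl fin_add fin_smult module.smult_one[OF assms]
      module.smult_l_distr[OF assms] module.smult_r_distr[OF assms] module.smult_assoc1[OF assms])
qed

lemma direct_sum_mod_hom:
  assumes "\<And>p. mod_hom R (M p) (N p) (f p)"
  shows "mod_hom R (direct_sum_mod M) (direct_sum_mod N) (\<lambda>c p. f p (c p))"
proof (rule mod_homI)
  show "module R (direct_sum_mod M)" "module R (direct_sum_mod N)"
    by (rule direct_sum_mod_module; rule mod_hom_modules[OF assms])+
  show "(\<lambda>p. f p (v p)) \<in> carrier (direct_sum_mod N)" if "v \<in> carrier (direct_sum_mod M)" for v
  proof -
    have "finite {p. f p (v p) \<noteq> \<zero>\<^bsub>N p\<^esub>}"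
      by (rule finite_subset[of _ "{p. v p \<noteq> \<zero>\<^bsub>M p\<^esub>}"])
        (use that in \<open>auto simp: direct_sum_mod_simps mod_hom.f0_is_0[OF assms]\<close>)
    then show ?thesis using that mod_hom.f_im[OF assms] by (auto simp: direct_sum_mod_simps)
  qed
qed (auto simp: direct_sum_mod_simps module_hom_add[OF mod_hom.f_hom[OF assms]]
      module_hom_smult[OF mod_hom.f_hom[OF assms]])

lemma homology_zero_iff:
  assumes C: "module R (C i)" and C': "mod_hom R (C (Suc i)) (C i) (d (Suc i))"
    and Z: "submodule R (cycles C d i) (C i)"
    and B: "boundaries C d i \<subseteq> cycles C d i"
  shows "carrier (homology C d i) = {\<zero>\<^bsub>homology C d i\<^esub>} \<longleftrightarrow> cycles C d i \<subseteq> boundaries C d i"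
proof -
  interpret d: mod_hom R "C (Suc i)" "C i" "d (Suc i)" by fact
  have Bs: "submodule R (boundaries C d i) (C i)"
    unfolding boundaries_def by (rule submod_image[OF C' submod_carrier[OF d.M.module_axioms]])
  have "carrier (homology C d i) = (\<lambda>z. boundaries C d i +>\<^bsub>C i\<^esub> z) ` cycles C d i"
    by (simp add: homology_def quot_mod_simps coset_restrict)
  moreover have "\<zero>\<^bsub>homology C d i\<^esub> = boundaries C d i" by (simp add: homology_def quot_mod_simps)
  moreover have "cycles C d i \<noteq> {}" using submodD(3)[OF Z] by auto
  moreover have "boundaries C d i +>\<^bsub>C i\<^esub> z = boundaries C d i \<longleftrightarrow> z \<in> boundaries C d i" if "z \<in> cycles C d i" for z
    by (rule coset_eq_self_iff[OF Bs]) (use that submodD(2)[OF Z] in auto)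
  ultimately show ?thesis by (auto simp: image_iff subset_iff) blast+
qed

subsection \<open>The linearity defect and minimal resolutions\<close>

context irrelevant_cring
begin

lemma fmod_simps:
  "carrier (fmod R F i) = {..<rank F i} \<rightarrow>\<^sub>E carrier R"
  "\<zero>\<^bsub>fmod R F i\<^esub> = \<zero>\<^bsub>func_space {..<rank F i}\<^esub>"
  "f \<oplus>\<^bsub>fmod R F i\<^esub> g = f \<oplus>\<^bsub>func_space {..<rank F i}\<^esub> g"
  "r \<odot>\<^bsub>fmod R F i\<^esub> g = r \<odot>\<^bsub>func_space {..<rank F i}\<^esub> g"
  by (simp_all add: fmod_def free_gmod_def module.extend_def func_space_def)

lemma fmod_module: "module R (fmod R F i)"
  and fmod_free: "free_module R (fmod R F i) (rank F i)"
proof -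
  have 1: "carrier (fmod R F i) = (\<lambda>v. v) ` carrier (func_space {..<rank F i})"
    by (simp add: fmod_simps func_space_simps)
  note * = module_image[where f = "\<lambda>v. v", OF func_space_is_module 1]
  show m: "module R (fmod R F i)" by (rule *) (simp_all add: fmod_simps)
  have "mod_hom R (func_space {..<rank F i}) (fmod R F i) (\<lambda>v. v)" by (rule *) (simp_all add: fmod_simps)
  moreover have "mod_hom R (fmod R F i) (func_space {..<rank F i}) (\<lambda>v. v)"
    by (rule mod_homI[OF m func_space_is_module]) (simp_all add: fmod_simps func_space_simps)
  ultimately show "free_module R (fmod R F i) (rank F i)" by (rule free_moduleI) auto
qed

text \<open>The passage from the graded resolutions of the definitions to
  \<open>minimal_resolution\<close>: degrees are dropped, the ranks stay.\<close>

lemma min_free_resolution_imp: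
  assumes "min_free_resolution R M F" "module R M"
  shows "\<exists>e. minimal_resolution R (fmod R F) (diff F) e M (rank F)"
proof -
  have "\<exists>e\<in>graded_hom R (fmod R F 0) M. e ` carrier (fmod R F 0) = carrier M \<and>
      {z \<in> carrier (fmod R F 0). e z = \<zero>\<^bsub>M\<^esub>} = boundaries (fmod R F) (diff F) 0"
    using assms(1)[unfolded min_free_resolution_def] by (elim conjE)
  then obtain e where e: "e \<in> graded_hom R (fmod R F 0) M"
      "e ` carrier (fmod R F 0) = carrier M"
      "{z \<in> carrier (fmod R F 0). e z = \<zero>\<^bsub>M\<^esub>} = boundaries (fmod R F) (diff F) 0"
    by (elim bexE conjE)
  note m = assms(1)[unfolded min_free_resolution_def]
  note d = m[THEN conjunct1, THEN spec] m[THEN conjunct2, THEN conjunct1, THEN spec]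
    m[THEN conjunct2, THEN conjunct2, THEN conjunct2, THEN spec]
  show ?thesis
  proof (intro exI minimal_resolution.intro[OF irrelevant_cring_axioms minimal_resolution_axioms.intro])
    show "free_module R (fmod R F i) (rank F i)" for i by (rule fmod_free)
    show "mod_hom R (fmod R F (Suc i)) (fmod R F i) (diff F (Suc i))" for i
      using d(1)[of i] fmod_module by (simp add: graded_hom_def mod_hom_def mod_hom_axioms_def)
    show "mod_hom R (fmod R F 0) M e"
      using e(1) fmod_module assms(2) by (simp add: graded_hom_def mod_hom_def mod_hom_axioms_def)
    show "e ` carrier (fmod R F 0) = carrier M" by fact
    show "{z \<in> carrier (fmod R F 0). e z = \<zero>\<^bsub>M\<^esub>} = diff F 1 ` carrier (fmod R F 1)"
      using e(3) by (simp add: boundaries_def)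
    show "{z \<in> carrier (fmod R F (Suc i)). diff F (Suc i) z = \<zero>\<^bsub>fmod R F i\<^esub>}
        = diff F (Suc (Suc i)) ` carrier (fmod R F (Suc (Suc i)))" for i
      using d(2)[of i] by (simp add: boundaries_def cycles_def)
    show "diff F (Suc i) v \<in> max_power R (fmod R F i) 1" if "v \<in> carrier (fmod R F (Suc i))" for i v
      using d(3)[of i] that by (auto simp: boundaries_def)
  qed
qed

end

text \<open>Exactness of the linear part in homological degree \<open>Suc k\<close>, on
  representatives: \<open>z\<close> of filtration level \<open>p\<close> whose differential lies in
  level \<open>Suc p\<close> is, modulo level \<open>Suc p\<close>, the differential of an element
  of level \<open>p\<close>. The truncated differences are those in \<open>filt\<close>.\<close>

definition lin_exact :: "('k, 'a) gmodule \<Rightarrow> (nat \<Rightarrow> ('a, 'm, 'e) module_scheme) \<Rightarrow> (nat \<Rightarrow> 'm \<Rightarrow> 'm) \<Rightarrow> nat \<Rightarrow> bool" where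
  "lin_exact R C d k \<longleftrightarrow> (\<forall>p. \<forall>z\<in>max_power R (C (Suc k)) (p - Suc k). d (Suc k) z \<in> max_power R (C k) (Suc p - k) \<longrightarrow>
     (\<exists>w\<in>max_power R (C (Suc (Suc k))) (p - Suc (Suc k)). \<exists>y\<in>max_power R (C (Suc k)) (Suc p - Suc k).
        z = y \<oplus>\<^bsub>C (Suc k)\<^esub> d (Suc (Suc k)) w))"

context minimal_resolution
begin

text \<open>Induction on \<open>s\<close>: if \<open>z = y + d w\<close> with \<open>y\<close> of
  order \<open>s\<close>, then \<open>d y = d z\<close> has one order more than the level of
  \<open>y\<close> predicts, so exactness at level \<open>p = Suc k + s\<close> raises the order of
  \<open>y\<close> by one at the cost of a further boundary.\<close>

lemma lin_exact_imp_linear_at: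
  assumes "lin_exact R C d k"
  shows "linear_at R C d k"
proof -
  interpret CS: module R "C (Suc k)" by (rule C_module)
  interpret Ck: module R "C k" by (rule C_module)
  interpret CSS: module R "C (Suc (Suc k))" by (rule C_module)
  have "\<forall>z\<in>carrier (C (Suc k)). d (Suc k) z \<in> max_power R (C k) (Suc s) \<longrightarrow>
     (\<exists>y\<in>max_power R (C (Suc k)) s. \<exists>w\<in>carrier (C (Suc (Suc k))). z = y \<oplus>\<^bsub>C (Suc k)\<^esub> d (Suc (Suc k)) w)" for s
  proof (induction s)
    case 0
    show ?case
    proof (intro ballI impI)
      fix z assume "z \<in> carrier (C (Suc k))"
      then show "\<exists>y\<in>max_power R (C (Suc k)) 0. \<exists>w\<in>carrier (C (Suc (Suc k))). z = y \<oplus>\<^bsub>C (Suc k)\<^esub> d (Suc (Suc k)) w"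
        by (intro bexI[of _ z] bexI[of _ "\<zero>\<^bsub>C (Suc (Suc k))\<^esub>"]) (auto simp: mod_hom.f0_is_0[OF d_hom])
    qed
  next
    case (Suc s)
    show ?case
    proof (intro ballI impI)
      fix z assume z: "z \<in> carrier (C (Suc k))" and dz: "d (Suc k) z \<in> max_power R (C k) (Suc (Suc s))"
      have "d (Suc k) z \<in> max_power R (C k) (Suc s)" using dz max_power_Suc_subset[OF C_module] by blast
      with Suc z obtain y w where y: "y \<in> max_power R (C (Suc k)) s" and w: "w \<in> carrier (C (Suc (Suc k)))"
        and ze: "z = y \<oplus>\<^bsub>C (Suc k)\<^esub> d (Suc (Suc k)) w" by blast
      have yc: "y \<in> carrier (C (Suc k))" by (rule max_power_carrier[OF C_module y])
      have "d (Suc k) z = d (Suc k) y"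
        unfolding ze using module_hom_add[OF mod_hom.f_hom[OF d_hom] yc d_closed[OF w]] d_d[OF w] d_closed[OF yc] by simp
      then have "d (Suc k) y \<in> max_power R (C k) (Suc (Suc k + s) - k)" using dz by (simp add: Suc_diff_le)
      moreover have "y \<in> max_power R (C (Suc k)) (Suc k + s - Suc k)" using y by simp
      ultimately obtain w' y' where w': "w' \<in> max_power R (C (Suc (Suc k))) (Suc k + s - Suc (Suc k))"
        and y': "y' \<in> max_power R (C (Suc k)) (Suc (Suc k + s) - Suc k)"
        and ye: "y = y' \<oplus>\<^bsub>C (Suc k)\<^esub> d (Suc (Suc k)) w'"
        using assms[unfolded lin_exact_def, rule_format] by blast
      have y'c: "y' \<in> carrier (C (Suc k))" and w'c: "w' \<in> carrier (C (Suc (Suc k)))"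
        using max_power_carrier[OF C_module] y' w' by blast+
      have "z = y' \<oplus>\<^bsub>C (Suc k)\<^esub> d (Suc (Suc k)) (w' \<oplus>\<^bsub>C (Suc (Suc k))\<^esub> w)"
        unfolding ze ye module_hom_add[OF mod_hom.f_hom[OF d_hom] w'c w]
        using y'c d_closed[OF w'c] d_closed[OF w] by (simp add: CS.M.a_assoc)
      moreover have "y' \<in> max_power R (C (Suc k)) (Suc s)" using y' by (simp add: Suc_diff_le)
      ultimately show "\<exists>y\<in>max_power R (C (Suc k)) (Suc s). \<exists>w\<in>carrier (C (Suc (Suc k))). z = y \<oplus>\<^bsub>C (Suc k)\<^esub> d (Suc (Suc k)) w"
        using w'c w by blast
    qed
  qed
  then show ?thesis unfolding linear_at_def by blast
qed

text \<open>The condition at \<open>k\<close> splits \<open>z\<close> but says nothing about the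
  order of \<open>w\<close>. As \<open>d w = z - y\<close> has high order, the condition at
  \<open>Suc k\<close> replaces \<open>w\<close> by an element of the right order with the same
  differential; this is where a second degree comes in.\<close>

lemma linear_at_imp_lin_exact:
  assumes "linear_at R C d k" "linear_at R C d (Suc k)"
  shows "lin_exact R C d k"
  unfolding lin_exact_def
proof (intro allI ballI impI)
  interpret CS: module R "C (Suc k)" by (rule C_module)
  interpret CSS: module R "C (Suc (Suc k))" by (rule C_module)
  fix p z assume z: "z \<in> max_power R (C (Suc k)) (p - Suc k)" and dz: "d (Suc k) z \<in> max_power R (C k) (Suc p - k)"
  have zc: "z \<in> carrier (C (Suc k))" by (rule max_power_carrier[OF C_module z])
  show "\<exists>w\<in>max_power R (C (Suc (Suc k))) (p - Suc (Suc k)). \<exists>y\<in>max_power R (C (Suc k)) (Suc p - Suc k).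
        z = y \<oplus>\<^bsub>C (Suc k)\<^esub> d (Suc (Suc k)) w"
  \<comment> \<open>For \<open>p \<le> k\<close> the truncated exponent \<open>Suc p - Suc k\<close>
    is 0, and \<open>z\<close> itself serves as \<open>y\<close>.\<close>
  proof (cases "p < Suc k")
    case True
    have "z = z \<oplus>\<^bsub>C (Suc k)\<^esub> d (Suc (Suc k)) \<zero>\<^bsub>C (Suc (Suc k))\<^esub>"
      using zc by (simp add: mod_hom.f0_is_0[OF d_hom])
    moreover have "z \<in> max_power R (C (Suc k)) (Suc p - Suc k)" using True zc by simp
    ultimately show ?thesis using max_power_zero[OF C_module] by blast
  next
    case False
    then obtain s where p: "p = Suc k + s" using le_Suc_ex by (metis not_less)
    have "d (Suc k) z \<in> max_power R (C k) (Suc (Suc s))" using dz p by (simp add: Suc_diff_le)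
    then obtain y w where y: "y \<in> max_power R (C (Suc k)) (Suc s)" and w: "w \<in> carrier (C (Suc (Suc k)))"
        and ze: "z = y \<oplus>\<^bsub>C (Suc k)\<^esub> d (Suc (Suc k)) w"
      using assms(1) zc unfolding linear_at_def by blast
    have yp: "y \<in> max_power R (C (Suc k)) (Suc p - Suc k)" using y p by (simp add: Suc_diff_le)
    have yc: "y \<in> carrier (C (Suc k))" by (rule max_power_carrier[OF C_module y])
    show ?thesis
    proof (cases s)
      case 0
      then show ?thesis using yp w ze p by auto
    next
      case (Suc t)
      have "d (Suc (Suc k)) w = z \<ominus>\<^bsub>C (Suc k)\<^esub> y"
        unfolding ze using yc d_closed[OF w] by (simp add: a_minus_def CS.M.a_ac CS.M.r_neg2)
      moreover have "y \<in> max_power R (C (Suc k)) (Suc t)" using y Suc max_power_Suc_subset[OF C_module] by blast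
      moreover have "z \<in> max_power R (C (Suc k)) (Suc t)" using z p Suc by simp
      ultimately have "d (Suc (Suc k)) w \<in> max_power R (C (Suc k)) (Suc t)"
        using max_power_minus[OF C_module] by simp
      then have "d (Suc (Suc k)) w \<in> d (Suc (Suc k)) ` max_power R (C (Suc (Suc k))) t"
        by (rule linear_at_boundary[OF assms(2) w])
      then obtain w' where "w' \<in> max_power R (C (Suc (Suc k))) t" "d (Suc (Suc k)) w = d (Suc (Suc k)) w'" by blast
      then show ?thesis using yp ze p Suc by auto
    qed
  qed
qed

end

context irrelevant_cring
begin

text \<open>Cycles and boundaries of the direct sum can be tested in each filtration level
  separately; each level is then read off on coset representatives.\<close>

lemma lin_homology_zero_iff:
  assumes "minimal_resolution R (fmod R F) (diff F) e M (rank F)"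
  defines "H \<equiv> homology (lin_mod R F) (lin_diff R F)"
  shows "carrier (H (Suc k)) = {\<zero>\<^bsub>H (Suc k)\<^esub>} \<longleftrightarrow> lin_exact R (fmod R F) (diff F) k"
proof -
  interpret F: minimal_resolution R "fmod R F" "diff F" e M "rank F" by fact
  let ?C = "fmod R F" and ?d = "diff F"
  let ?q = "\<lambda>p i. quot_mod ((?C i)\<lparr>carrier := filt R F p i\<rparr>) (filt R F (Suc p) i)"
  have filt: "submodule R (filt R F p i) (?C i)" for p i
    unfolding filt_def by (rule max_power_submod[OF F.C_module])
  have filt_Suc: "filt R F (Suc p) i \<subseteq> filt R F p i" for p i
    unfolding filt_def by (rule max_power_antimono[OF F.C_module]) simp
  have filt_c: "v \<in> carrier (?C i)" if "v \<in> filt R F p i" for v p i using submodD(2)[OF filt] that by auto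
  have d_filt: "?d (Suc i) ` filt R F p (Suc i) \<subseteq> filt R F p i" for p i
  proof
    fix v assume "v \<in> ?d (Suc i) ` filt R F p (Suc i)"
    then obtain u where u: "u \<in> max_power R (?C (Suc i)) (p - Suc i)" "v = ?d (Suc i) u" by (auto simp: filt_def)
    have "v \<in> max_power R (?C i) (p - Suc i + 1)"
      unfolding u(2) by (rule max_power_hom[OF F.d_hom F.minimal u(1)])
    then show "v \<in> filt R F p i"
      unfolding filt_def using max_power_antimono[OF F.C_module, of "p - i" "p - Suc i + 1" i] by fastforce
  qed
  have qm: "module R (?q p i)" for p i
    by (rule quot_mod_module(1)[OF submod_restrict[OF filt filt filt_Suc]])
  have qd: "mod_hom R (?q p (Suc i)) (?q p i) (quot_map (?C i) (filt R F (Suc p) i) (?d (Suc i)))" for p i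
    by (rule quot_map_hom[OF F.d_hom filt filt filt_Suc filt filt filt_Suc d_filt d_filt])
  have L: "module R (lin_mod R F i)" for i
    unfolding lin_mod_def by (rule direct_sum_mod_module[OF qm])
  have D: "mod_hom R (lin_mod R F (Suc i)) (lin_mod R F i) (lin_diff R F (Suc i))" for i
  proof -
    have "lin_diff R F (Suc i) = (\<lambda>c p. quot_map (?C i) (filt R F (Suc p) i) (?d (Suc i)) (c p))"
      by (simp add: lin_diff_def fun_eq_iff)
    then show ?thesis unfolding lin_mod_def using direct_sum_mod_hom[OF qd] by simp
  qed
  let ?co = "\<lambda>p i z. filt R F (Suc p) i +>\<^bsub>?C i\<^esub> z"
  have qc: "carrier (?q p i) = ?co p i ` filt R F p i" for p i by (simp add: quot_mod_simps coset_restrict)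
  have q0: "\<zero>\<^bsub>?q p i\<^esub> = filt R F (Suc p) i" for p i by (simp add: quot_mod_simps)
  have qdc: "quot_map (?C i) (filt R F (Suc p) i) (?d (Suc i)) (?co p (Suc i) z) = ?co p i (?d (Suc i) z)"
    if "z \<in> filt R F p (Suc i)" for p i z
    by (rule quot_map_coset[OF F.d_hom filt filt d_filt filt_c[OF that]])
  have self: "?co p i z = filt R F (Suc p) i \<longleftrightarrow> z \<in> filt R F (Suc p) i" if "z \<in> carrier (?C i)" for p i z
    by (rule coset_eq_self_iff[OF filt that])
  have cyc: "cycles (lin_mod R F) (lin_diff R F) (Suc k) = {c \<in> carrier (lin_mod R F (Suc k)).
      \<forall>p. quot_map (?C k) (filt R F (Suc p) k) (?d (Suc k)) (c p) = filt R F (Suc p) k}"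
    by (auto simp: cycles_def lin_diff_def lin_mod_def direct_sum_mod_simps q0 fun_eq_iff)
  have bd: "boundaries (lin_mod R F) (lin_diff R F) (Suc k) =
      (\<lambda>b p. quot_map (?C (Suc k)) (filt R F (Suc p) (Suc k)) (?d (Suc (Suc k))) (b p)) ` carrier (lin_mod R F (Suc (Suc k)))"
    by (auto simp: boundaries_def lin_diff_def fun_eq_iff image_iff)
  have "carrier (H (Suc k)) = {\<zero>\<^bsub>H (Suc k)\<^esub>} \<longleftrightarrow>
      cycles (lin_mod R F) (lin_diff R F) (Suc k) \<subseteq> boundaries (lin_mod R F) (lin_diff R F) (Suc k)"
    unfolding H_def
  proof (rule homology_zero_iff[of R "lin_mod R F" "Suc k" "lin_diff R F", OF L D])
    show "submodule R (cycles (lin_mod R F) (lin_diff R F) (Suc k)) (lin_mod R F (Suc k))"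
      using submod_kernel[OF D[of k]] by (simp add: cycles_def)
    show "boundaries (lin_mod R F) (lin_diff R F) (Suc k) \<subseteq> cycles (lin_mod R F) (lin_diff R F) (Suc k)"
    proof
      fix c assume "c \<in> boundaries (lin_mod R F) (lin_diff R F) (Suc k)"
      then obtain b where b: "b \<in> carrier (lin_mod R F (Suc (Suc k)))"
          "c = lin_diff R F (Suc (Suc k)) b" by (auto simp: boundaries_def)
      have "quot_map (?C k) (filt R F (Suc p) k) (?d (Suc k)) (c p) = filt R F (Suc p) k" for p
      proof -
        have "b p \<in> carrier (?q p (Suc (Suc k)))" using b(1) by (simp add: lin_mod_def direct_sum_mod_simps)
        then obtain w where w: "w \<in> filt R F p (Suc (Suc k))" "b p = ?co p (Suc (Suc k)) w" using qc by auto
        have "c p = ?co p (Suc k) (?d (Suc (Suc k)) w)" using b(2) qdc[OF w(1)] w(2) by (simp add: lin_diff_def)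
        then have "quot_map (?C k) (filt R F (Suc p) k) (?d (Suc k)) (c p) = ?co p k (?d (Suc k) (?d (Suc (Suc k)) w))"
          using qdc[of "?d (Suc (Suc k)) w" p k] d_filt[THEN subsetD, OF imageI[OF w(1)]] by simp
        also have "\<dots> = ?co p k \<zero>\<^bsub>?C k\<^esub>" using F.d_d[OF filt_c[OF w(1)]] by simp
        also have "\<dots> = filt R F (Suc p) k"
          using self[of "\<zero>\<^bsub>?C k\<^esub>" k p] submodD(3)[OF filt] filt_c by blast
        finally show ?thesis .
      qed
      moreover have "c \<in> carrier (lin_mod R F (Suc k))" using mod_hom.f_im[OF D b(1)] b(2) by simp
      ultimately show "c \<in> cycles (lin_mod R F) (lin_diff R F) (Suc k)" unfolding cyc by simp
    qed
  qed
  also have "\<dots> \<longleftrightarrow> lin_exact R ?C ?d k"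
  proof
    assume sub: "cycles (lin_mod R F) (lin_diff R F) (Suc k) \<subseteq> boundaries (lin_mod R F) (lin_diff R F) (Suc k)"
    show "lin_exact R ?C ?d k"
      unfolding lin_exact_def filt_def[symmetric]
    proof (intro allI ballI impI)
      fix p z assume z: "z \<in> filt R F p (Suc k)" and dz: "?d (Suc k) z \<in> filt R F (Suc p) k"
      \<comment> \<open>A single class is tested by the family concentrated in level
        \<open>p\<close>; the zero of the quotient module in level \<open>q\<close> is the submodule
        \<open>filt R F (Suc q) (Suc k)\<close>.\<close>
      define c where "c q = (if q = p then ?co p (Suc k) z else filt R F (Suc q) (Suc k))" for q
      have "finite {q. c q \<noteq> \<zero>\<^bsub>?q q (Suc k)\<^esub>}"
        by (rule finite_subset[of _ "{p}"]) (auto simp: c_def q0)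
      moreover have "c q \<in> carrier (?q q (Suc k))" for q
      proof (cases "q = p")
        case True then show ?thesis using z by (auto simp: c_def qc)
      next
        case False
        interpret q: module R "?q q (Suc k)" by (rule qm)
        show ?thesis using q.M.zero_closed False by (simp add: c_def q0)
      qed
      ultimately have "c \<in> carrier (lin_mod R F (Suc k))" by (simp add: lin_mod_def direct_sum_mod_simps)
      moreover have "quot_map (?C k) (filt R F (Suc q) k) (?d (Suc k)) (c q) = filt R F (Suc q) k" for q
      proof (cases "q = p")
        case True
        then show ?thesis using qdc[OF z] self[OF filt_c[OF dz], of p] dz by (simp add: c_def)
      next
        case False
        then show ?thesis using mod_hom.f0_is_0[OF qd[of q k]] by (simp add: c_def q0)
      qed
      ultimately have "c \<in> boundaries (lin_mod R F) (lin_diff R F) (Suc k)" using sub unfolding cyc by blast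
      then obtain b where b: "b \<in> carrier (lin_mod R F (Suc (Suc k)))"
          "c p = quot_map (?C (Suc k)) (filt R F (Suc p) (Suc k)) (?d (Suc (Suc k))) (b p)" unfolding bd by auto
      have "b p \<in> carrier (?q p (Suc (Suc k)))" using b(1) by (simp add: lin_mod_def direct_sum_mod_simps)
      then obtain w where w: "w \<in> filt R F p (Suc (Suc k))" "b p = ?co p (Suc (Suc k)) w" using qc by auto
      have "?co p (Suc k) z = ?co p (Suc k) (?d (Suc (Suc k)) w)"
        using b(2) qdc[OF w(1)] w(2) by (simp add: c_def)
      then show "\<exists>w\<in>filt R F p (Suc (Suc k)). \<exists>y\<in>filt R F (Suc p) (Suc k). z = y \<oplus>\<^bsub>?C (Suc k)\<^esub> ?d (Suc (Suc k)) w"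
        using coset_eq_iff[OF filt filt_c[OF z] F.d_closed[OF filt_c[OF w(1)]]] w(1) by blast
    qed
  next
    assume ex: "lin_exact R ?C ?d k"
    show "cycles (lin_mod R F) (lin_diff R F) (Suc k) \<subseteq> boundaries (lin_mod R F) (lin_diff R F) (Suc k)"
    proof
      fix c assume c: "c \<in> cycles (lin_mod R F) (lin_diff R F) (Suc k)"
      then have cc: "\<And>p. c p \<in> carrier (?q p (Suc k))" and cfin: "finite {p. c p \<noteq> \<zero>\<^bsub>?q p (Suc k)\<^esub>}"
        and c0: "\<And>p. quot_map (?C k) (filt R F (Suc p) k) (?d (Suc k)) (c p) = filt R F (Suc p) k"
        unfolding cyc by (auto simp: lin_mod_def direct_sum_mod_simps)
      \<comment> \<open>Preimages are taken to be zero wherever \<open>c\<close> is zero, which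
        keeps the resulting family finitely supported.\<close>
      have "\<exists>B\<in>carrier (?q p (Suc (Suc k))). (c p = \<zero>\<^bsub>?q p (Suc k)\<^esub> \<longrightarrow> B = \<zero>\<^bsub>?q p (Suc (Suc k))\<^esub>) \<and>
        c p = quot_map (?C (Suc k)) (filt R F (Suc p) (Suc k)) (?d (Suc (Suc k))) B" for p
      proof (cases "c p = \<zero>\<^bsub>?q p (Suc k)\<^esub>")
        case True
        interpret q: module R "?q p (Suc (Suc k))" by (rule qm)
        show ?thesis using True mod_hom.f0_is_0[OF qd[of p "Suc k"]] q.M.zero_closed by metis
      next
        case False
        obtain z where z: "z \<in> filt R F p (Suc k)" "c p = ?co p (Suc k) z" using cc[of p] qc by auto
        have "?co p k (?d (Suc k) z) = filt R F (Suc p) k" using c0[of p] qdc[OF z(1)] z(2) by simp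
        then have "?d (Suc k) z \<in> filt R F (Suc p) k" using self[OF F.d_closed[OF filt_c[OF z(1)]]] by simp
        then obtain w y where w: "w \<in> filt R F p (Suc (Suc k))" and y: "y \<in> filt R F (Suc p) (Suc k)"
            and e: "z = y \<oplus>\<^bsub>?C (Suc k)\<^esub> ?d (Suc (Suc k)) w"
          using ex z(1) unfolding lin_exact_def filt_def[symmetric] by blast
        have "c p = ?co p (Suc k) (?d (Suc (Suc k)) w)"
          unfolding z(2) using coset_eq_iff[OF filt filt_c[OF z(1)] F.d_closed[OF filt_c[OF w]]] y e by blast
        then show ?thesis using False qdc[OF w] w qc by (intro bexI[of _ "?co p (Suc (Suc k)) w"]) auto
      qed
      then obtain b where b: "\<And>p. b p \<in> carrier (?q p (Suc (Suc k)))"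
        "\<And>p. c p = \<zero>\<^bsub>?q p (Suc k)\<^esub> \<Longrightarrow> b p = \<zero>\<^bsub>?q p (Suc (Suc k))\<^esub>"
        "\<And>p. c p = quot_map (?C (Suc k)) (filt R F (Suc p) (Suc k)) (?d (Suc (Suc k))) (b p)"
        by metis
      have "finite {p. b p \<noteq> \<zero>\<^bsub>?q p (Suc (Suc k))\<^esub>}"
        by (rule finite_subset[OF _ cfin]) (use b(2) in auto)
      then have "b \<in> carrier (lin_mod R F (Suc (Suc k)))" using b(1) by (simp add: lin_mod_def direct_sum_mod_simps)
      moreover have "c = (\<lambda>p. quot_map (?C (Suc k)) (filt R F (Suc p) (Suc k)) (?d (Suc (Suc k))) (b p))"
        using b(3) by auto
      ultimately show "c \<in> boundaries (lin_mod R F) (lin_diff R F) (Suc k)" unfolding bd by (intro image_eqI[where x = b])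
    qed
  qed
  finally show ?thesis .
qed

text \<open>By \<open>linear_at_independent\<close> the defect can be read off any minimal
  resolution, whatever its type. Homology must vanish in degrees above \<open>t\<close>, that is in
  degrees \<open>Suc k\<close> with \<open>k \<ge> t\<close>; on such a tail exactness of the linear
  part and the linearity condition are equivalent.\<close>

theorem lin_defect_le_iff:
  fixes M :: "('a, 'm) gmodule" and C :: "nat \<Rightarrow> ('a, 'm2, 'e2) module_scheme"
  assumes ex: "\<exists>F. min_free_resolution R M F" and M: "module R M"
    and C: "minimal_resolution R C d e' M n"
  shows "lin_defect R M \<le> enat t \<longleftrightarrow> (\<forall>k\<ge>t. linear_at R C d k)"
proof -
  let ?F = "min_res R M"
  have "min_free_resolution R M ?F" unfolding min_res_def using ex by (rule someI_ex)
  then obtain e where e: "minimal_resolution R (fmod R ?F) (diff ?F) e M (rank ?F)"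
    using min_free_resolution_imp[OF _ M] by blast
  interpret F: minimal_resolution R "fmod R ?F" "diff ?F" e M "rank ?F" by fact
  have indep: "linear_at R (fmod R ?F) (diff ?F) k \<longleftrightarrow> linear_at R C d k" for k
    using linear_at_independent[OF e C] linear_at_independent[OF C e] by blast
  let ?H = "homology (lin_mod R ?F) (lin_diff R ?F)"
  have "lin_defect R M \<le> enat t \<longleftrightarrow> (\<forall>i. carrier (?H i) \<noteq> {\<zero>\<^bsub>?H i\<^esub>} \<longrightarrow> i \<le> t)"
    by (simp add: lin_defect_def Let_def SUP_le_iff)
  also have "\<dots> \<longleftrightarrow> (\<forall>k\<ge>t. carrier (?H (Suc k)) = {\<zero>\<^bsub>?H (Suc k)\<^esub>})"
  proof (intro iffI allI impI)
    fix k assume "\<forall>i. carrier (?H i) \<noteq> {\<zero>\<^bsub>?H i\<^esub>} \<longrightarrow> i \<le> t" "k \<ge> t"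
    then show "carrier (?H (Suc k)) = {\<zero>\<^bsub>?H (Suc k)\<^esub>}" by (metis not_less_eq_eq)
  next
    fix i assume *: "\<forall>k\<ge>t. carrier (?H (Suc k)) = {\<zero>\<^bsub>?H (Suc k)\<^esub>}" "carrier (?H i) \<noteq> {\<zero>\<^bsub>?H i\<^esub>}"
    show "i \<le> t"
    proof (rule ccontr)
      assume "\<not> i \<le> t"
      then obtain k where "i = Suc k" "k \<ge> t" by (cases i) auto
      then show False using * by auto
    qed
  qed
  also have "\<dots> \<longleftrightarrow> (\<forall>k\<ge>t. lin_exact R (fmod R ?F) (diff ?F) k)"
    using lin_homology_zero_iff[OF e] by simp
  also have "\<dots> \<longleftrightarrow> (\<forall>k\<ge>t. linear_at R C d k)"
    using F.lin_exact_imp_linear_at F.linear_at_imp_lin_exact indep by (meson le_SucI)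
  finally show ?thesis .
qed

end

subsection \<open>Homogeneous components\<close>

definition component :: "('a, 'm) gmodule \<Rightarrow> 'm \<Rightarrow> int \<Rightarrow> 'm" where
  "component M v = (THE c. (\<forall>n. c n \<in> hpart M n) \<and> finite {n. c n \<noteq> \<zero>\<^bsub>M\<^esub>} \<and>
     v = (\<Oplus>\<^bsub>M\<^esub>n\<in>{n. c n \<noteq> \<zero>\<^bsub>M\<^esub>}. c n))"

locale graded_group = abelian_group M for M :: "('a, 'm) gmodule" (structure) +
  assumes grading: "grading M"
begin

lemma hpart_subgroup: "subgroup (hpart M n) (add_monoid M)"
  using grading by (simp add: grading_def)

lemma hpart_carrier: "v \<in> hpart M n \<Longrightarrow> v \<in> carrier M"
  using subgroup.subset[OF hpart_subgroup] by auto

lemma hpart_zero: "\<zero> \<in> hpart M n"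
  using subgroup.one_closed[OF hpart_subgroup] by simp

lemma hpart_add: "u \<in> hpart M n \<Longrightarrow> v \<in> hpart M n \<Longrightarrow> u \<oplus> v \<in> hpart M n"
  using subgroup.m_closed[OF hpart_subgroup] by simp

lemma hpart_uminus: "v \<in> hpart M n \<Longrightarrow> \<ominus> v \<in> hpart M n"
  using subgroup.m_inv_closed[OF hpart_subgroup] by (simp add: a_inv_def)

lemma hpart_finsum: "finite A \<Longrightarrow> (\<And>i. i \<in> A \<Longrightarrow> f i \<in> hpart M n) \<Longrightarrow> (\<Oplus>i\<in>A. f i) \<in> hpart M n"
proof (induction A rule: finite_induct)
  case (insert i A)
  then have "(\<Oplus>i\<in>insert i A. f i) = f i \<oplus> (\<Oplus>i\<in>A. f i)"
    by (intro finsum_insert) (auto intro: hpart_carrier)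
  then show ?case using insert by (simp add: hpart_add)
qed (simp add: hpart_zero)

lemma component_all:
  assumes "v \<in> carrier M"
  shows "(\<forall>n. component M v n \<in> hpart M n) \<and> finite {n. component M v n \<noteq> \<zero>} \<and>
     v = (\<Oplus>n\<in>{n. component M v n \<noteq> \<zero>}. component M v n)"
proof -
  have "\<exists>!c. (\<forall>n. c n \<in> hpart M n) \<and> finite {n. c n \<noteq> \<zero>} \<and> v = (\<Oplus>n\<in>{n. c n \<noteq> \<zero>}. c n)"
    using grading assms by (simp add: grading_def)
  from theI'[OF this] show ?thesis unfolding component_def .
qed

lemma component_hpart: "v \<in> carrier M \<Longrightarrow> component M v n \<in> hpart M n"
  using component_all by blast

lemma component_carrier: "v \<in> carrier M \<Longrightarrow> component M v n \<in> carrier M"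
  using component_hpart hpart_carrier by blast

lemma component_finite: "v \<in> carrier M \<Longrightarrow> finite {n. component M v n \<noteq> \<zero>}"
  using component_all by blast

lemma component_sum: "v \<in> carrier M \<Longrightarrow> (\<Oplus>n\<in>{n. component M v n \<noteq> \<zero>}. component M v n) = v"
  using component_all by metis

lemma component_unique:
  assumes c: "\<And>n. c n \<in> hpart M n" and S: "finite S" "\<And>n. n \<notin> S \<Longrightarrow> c n = \<zero>" and v: "v = (\<Oplus>n\<in>S. c n)"
  shows "component M v = c"
proof -
  have cc: "\<And>n. c n \<in> carrier M" using c hpart_carrier by blast
  have vc: "v \<in> carrier M" unfolding v using cc by auto
  have fin: "finite {n. c n \<noteq> \<zero>}" by (rule finite_subset[OF _ S(1)]) (use S(2) in auto)
  have "(\<Oplus>n\<in>{n. c n \<noteq> \<zero>}. c n) = (\<Oplus>n\<in>S. c n)"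
    by (rule add.finprod_mono_neutral_cong_left[OF S(1)]) (use S cc in auto)
  with v have v': "v = (\<Oplus>n\<in>{n. c n \<noteq> \<zero>}. c n)" by simp
  have "\<exists>!c. (\<forall>n. c n \<in> hpart M n) \<and> finite {n. c n \<noteq> \<zero>} \<and> v = (\<Oplus>n\<in>{n. c n \<noteq> \<zero>}. c n)"
    using grading vc by (simp add: grading_def)
  then show ?thesis unfolding component_def
    by (rule the1_equality) (use c fin v' in auto)
qed

lemma component_homogeneous:
  assumes "v \<in> hpart M n"
  shows "component M v = (\<lambda>k. if k = n then v else \<zero>)"
  by (rule component_unique[of _ "{n}"]) (use assms hpart_zero hpart_carrier in auto)

lemma component_zero: "component M \<zero> n = \<zero>"
  using component_homogeneous[OF hpart_zero, of 0] by simp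

lemma component_sum_superset:
  assumes "v \<in> carrier M" "finite S" "{n. component M v n \<noteq> \<zero>} \<subseteq> S"
  shows "(\<Oplus>n\<in>S. component M v n) = v"
proof -
  have "(\<Oplus>n\<in>{n. component M v n \<noteq> \<zero>}. component M v n) = (\<Oplus>n\<in>S. component M v n)"
    by (rule add.finprod_mono_neutral_cong_left[OF assms(2,3)])
      (use component_carrier[OF assms(1)] in auto)
  then show ?thesis using component_sum[OF assms(1)] by simp
qed

lemma component_add:
  assumes "u \<in> carrier M" "v \<in> carrier M"
  shows "component M (u \<oplus> v) n = component M u n \<oplus> component M v n"
proof -
  let ?S = "{n. component M u n \<noteq> \<zero>} \<union> {n. component M v n \<noteq> \<zero>}"
  have fin: "finite ?S" using component_finite assms by simp
  have "component M (u \<oplus> v) = (\<lambda>n. component M u n \<oplus> component M v n)"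
  proof (rule component_unique[OF _ fin])
    have "(\<Oplus>n\<in>?S. component M u n \<oplus> component M v n)
        = (\<Oplus>n\<in>?S. component M u n) \<oplus> (\<Oplus>n\<in>?S. component M v n)"
      by (rule finsum_addf) (use component_carrier assms in auto)
    then show "u \<oplus> v = (\<Oplus>n\<in>?S. component M u n \<oplus> component M v n)"
      using component_sum_superset[OF assms(1) fin] component_sum_superset[OF assms(2) fin] by simp
  qed (use assms component_hpart hpart_add in auto)
  then show ?thesis by simp
qed

lemma component_finsum:
  assumes "finite A" "\<And>i. i \<in> A \<Longrightarrow> f i \<in> carrier M"
  shows "component M (\<Oplus>i\<in>A. f i) n = (\<Oplus>i\<in>A. component M (f i) n)"
  using assms
proof (induction A rule: finite_induct)
  case empty then show ?case by (simp add: component_zero)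
next
  case (insert i A)
  have 1: "(\<Oplus>i\<in>insert i A. f i) = f i \<oplus> (\<Oplus>i\<in>A. f i)"
    by (rule finsum_insert) (use insert in auto)
  have 2: "(\<Oplus>i\<in>insert i A. component M (f i) n) = component M (f i) n \<oplus> (\<Oplus>i\<in>A. component M (f i) n)"
    by (rule finsum_insert) (use insert component_carrier in auto)
  have "component M (\<Oplus>i\<in>insert i A. f i) n = component M (f i) n \<oplus> component M (\<Oplus>i\<in>A. f i) n"
    unfolding 1 by (rule component_add) (use insert in \<open>auto intro!: finsum_closed\<close>)
  then show ?case unfolding 2 using insert by simp
qed

lemma component_memI:
  assumes "v \<in> carrier M" "\<zero> \<in> P" "\<And>u v. u \<in> P \<Longrightarrow> v \<in> P \<Longrightarrow> u \<oplus> v \<in> P"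
    and "\<And>n. component M v n \<noteq> \<zero> \<Longrightarrow> component M v n \<in> P"
  shows "v \<in> P"
proof -
  have "finite A \<Longrightarrow> A \<subseteq> {n. component M v n \<noteq> \<zero>} \<Longrightarrow> (\<Oplus>n\<in>A. component M v n) \<in> P" for A
  proof (induction A rule: finite_induct)
    case (insert n A)
    have "(\<Oplus>n\<in>insert n A. component M v n) = component M v n \<oplus> (\<Oplus>n\<in>A. component M v n)"
      by (rule finsum_insert) (use insert component_carrier[OF assms(1)] in auto)
    then show ?case using insert assms(3,4) by auto
  qed (simp add: assms(2))
  from this[OF component_finite[OF assms(1)]] show ?thesis using component_sum[OF assms(1)] by simp
qed

end

locale graded_cring = cring R for R :: "('k, 'a) gmodule" (structure) +
  assumes graded: "grading R"
    and graded_mult: "\<lbrakk>a \<in> hpart R i; b \<in> hpart R j\<rbrakk> \<Longrightarrow> a \<otimes> b \<in> hpart R (i + j)"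
    and negative_part: "n < 0 \<Longrightarrow> hpart R n = {\<zero>}"
    and one_hpart: "\<one> \<in> hpart R 0"
    and zero_part_inverse: "\<lbrakk>a \<in> hpart R 0; a \<noteq> \<zero>\<rbrakk> \<Longrightarrow> \<exists>b\<in>hpart R 0. b \<otimes> a = \<one>"
    and nontrivial: "\<one> \<noteq> \<zero>"
    and generated: "\<exists>S. finite S \<and> S \<subseteq> hpart R 1 \<and> generate_ring R (hpart R 0 \<union> S) = carrier R"

sublocale graded_cring \<subseteq> G: graded_group R
  by (rule graded_group.intro[OF abelian_group_axioms graded_group_axioms.intro[OF graded]])

context graded_cring
begin

lemma hpart_subset_irrelevant: "n \<ge> 1 \<Longrightarrow> hpart R n \<subseteq> irrelevant R"
proof -
  assume "n \<ge> 1"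
  have "(\<Union>n\<in>{1..}. hpart R n) \<subseteq> carrier R" using G.hpart_carrier by auto
  from genideal_self[OF this] show ?thesis unfolding irrelevant_def using \<open>n \<ge> 1\<close> by auto
qed

lemma ideal_irrelevant: "ideal (irrelevant R) R"
  unfolding irrelevant_def by (rule genideal_ideal) (use G.hpart_carrier in auto)

lemma component_negative: "a \<in> carrier R \<Longrightarrow> n < 0 \<Longrightarrow> component R a n = \<zero>"
  using G.component_hpart negative_part by blast

lemma component_mult_homogeneous:
  assumes "module R M" "graded_group M" and smult: "\<And>i j a v. a \<in> hpart R i \<Longrightarrow> v \<in> hpart M j \<Longrightarrow> a \<odot>\<^bsub>M\<^esub> v \<in> hpart M (i + j)"
    and a: "a \<in> carrier R" and v: "v \<in> hpart M s"
  shows "component M (a \<odot>\<^bsub>M\<^esub> v) n = component R a (n - s) \<odot>\<^bsub>M\<^esub> v"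
proof -
  interpret M: module R M by fact
  interpret GM: graded_group M by fact
  have vc: "v \<in> carrier M" using v GM.hpart_carrier by auto
  let ?S = "{n. component R a n \<noteq> \<zero>}"
  have fin: "finite ?S" by (rule G.component_finite[OF a])
  have "component M (a \<odot>\<^bsub>M\<^esub> v) = (\<lambda>n. component R a (n - s) \<odot>\<^bsub>M\<^esub> v)"
  proof (rule GM.component_unique[of _ "(\<lambda>n. n + s) ` ?S"])
    show "component R a (n - s) \<odot>\<^bsub>M\<^esub> v \<in> hpart M n" for n
      using smult[OF G.component_hpart[OF a] v, of "n - s"] by simp
    show "finite ((\<lambda>n. n + s) ` ?S)" using fin by simp
    show "component R a (n - s) \<odot>\<^bsub>M\<^esub> v = \<zero>\<^bsub>M\<^esub>" if "n \<notin> (\<lambda>n. n + s) ` ?S" for n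
    proof -
      have "component R a (n - s) = \<zero>" using that by (auto simp: image_iff)
      then show ?thesis using vc by simp
    qed
    have "(\<Oplus>\<^bsub>M\<^esub>n\<in>(\<lambda>n. n + s) ` ?S. component R a (n - s) \<odot>\<^bsub>M\<^esub> v) = (\<Oplus>\<^bsub>M\<^esub>n\<in>?S. component R a n \<odot>\<^bsub>M\<^esub> v)"
      using G.component_carrier[OF a] vc by (subst M.M.finsum_reindex) (auto simp: inj_on_def)
    also have "\<dots> = (\<Oplus>n\<in>?S. component R a n) \<odot>\<^bsub>M\<^esub> v"
    proof -
      have "finite A \<Longrightarrow> (\<Oplus>\<^bsub>M\<^esub>n\<in>A. component R a n \<odot>\<^bsub>M\<^esub> v) = (\<Oplus>n\<in>A. component R a n) \<odot>\<^bsub>M\<^esub> v" for A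
      proof (induction A rule: finite_induct)
        case (insert n A)
        have "(\<Oplus>n\<in>insert n A. component R a n) = component R a n \<oplus> (\<Oplus>n\<in>A. component R a n)"
          by (rule finsum_insert) (use insert G.component_carrier[OF a] in auto)
        moreover have "(\<Oplus>\<^bsub>M\<^esub>n\<in>insert n A. component R a n \<odot>\<^bsub>M\<^esub> v)
            = component R a n \<odot>\<^bsub>M\<^esub> v \<oplus>\<^bsub>M\<^esub> (\<Oplus>\<^bsub>M\<^esub>n\<in>A. component R a n \<odot>\<^bsub>M\<^esub> v)"
          by (rule M.M.finsum_insert) (use insert G.component_carrier[OF a] vc in auto)
        moreover have "(\<Oplus>n\<in>A. component R a n) \<in> carrier R"
          by (rule finsum_closed) (use G.component_carrier[OF a] in auto)
        ultimately show ?case using insert G.component_carrier[OF a] vc by (simp add: M.smult_l_distr)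
      qed (use vc in simp)
      then show ?thesis using fin by simp
    qed
    finally show "a \<odot>\<^bsub>M\<^esub> v = (\<Oplus>\<^bsub>M\<^esub>n\<in>(\<lambda>n. n + s) ` ?S. component R a (n - s) \<odot>\<^bsub>M\<^esub> v)"
      using G.component_sum[OF a] by simp
  qed
  then show ?thesis by simp
qed

text \<open>The elements without component of degree 0 form an ideal, since degrees are nonnegative
  and a product of components \<open>r_i b_j\<close> with \<open>j > 0\<close> has positive degree.
  It contains all forms of positive degree, hence the ideal they generate; conversely each of its
  elements is a sum of such forms.\<close>

lemma irrelevant_iff: "a \<in> irrelevant R \<longleftrightarrow> a \<in> carrier R \<and> component R a 0 = \<zero>"
proof
  let ?J = "{a \<in> carrier R. component R a 0 = \<zero>}"
  interpret I: ideal "irrelevant R" R by (rule ideal_irrelevant)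
  assume a: "a \<in> irrelevant R"
  have mult: "r \<otimes> b \<in> ?J" if r: "r \<in> carrier R" and b: "b \<in> ?J" for r b
  proof -
    have bc: "b \<in> carrier R" "component R b 0 = \<zero>" using b by auto
    let ?B = "{j. component R b j \<noteq> \<zero>}" and ?A = "{j. component R r j \<noteq> \<zero>}"
    have fB: "finite ?B" and fA: "finite ?A" using G.component_finite bc r by auto
    have cl: "component R r i \<in> carrier R" "component R b i \<in> carrier R" for i using G.component_carrier bc r by auto
    have "r \<otimes> b = (\<Oplus>i\<in>?A. component R r i) \<otimes> b" using G.component_sum[OF r] by simp
    also have "\<dots> = (\<Oplus>i\<in>?A. component R r i \<otimes> b)"
      by (rule finsum_ldistr[OF fA bc(1)]) (use cl in auto)
    finally have rb: "component R (r \<otimes> b) 0 = (\<Oplus>i\<in>?A. component R (component R r i \<otimes> b) 0)"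
      using G.component_finsum[OF fA] cl bc by simp
    have z: "component R (component R r i \<otimes> b) 0 = \<zero>" for i
    proof -
      have "component R r i \<otimes> b = component R r i \<otimes> (\<Oplus>j\<in>?B. component R b j)"
        using G.component_sum[OF bc(1)] by simp
      also have "\<dots> = (\<Oplus>j\<in>?B. component R r i \<otimes> component R b j)"
        by (rule finsum_rdistr[OF fB]) (use cl in auto)
      finally have "component R (component R r i \<otimes> b) 0 = (\<Oplus>j\<in>?B. component R (component R r i \<otimes> component R b j) 0)"
        using G.component_finsum[OF fB] cl by simp
      also have "\<dots> = (\<Oplus>j\<in>?B. \<zero>)"
      proof (rule finsum_cong')
        fix j assume j: "j \<in> ?B"
        then have "j > 0" using component_negative[OF bc(1), of j] bc(2) by (metis (mono_tags) linorder_neqE mem_Collect_eq)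
        have m: "component R r i \<otimes> component R b j \<in> hpart R (i + j)"
          by (rule graded_mult) (use G.component_hpart bc r in auto)
        show "component R (component R r i \<otimes> component R b j) 0 = \<zero>"
        proof (cases "i < 0")
          case True
          then show ?thesis using component_negative[OF r True] cl G.component_zero by simp
        next
          case False
          then show ?thesis using G.component_homogeneous[OF m] \<open>j > 0\<close> by simp
        qed
      qed auto
      finally show ?thesis by simp
    qed
    show ?thesis unfolding mem_Collect_eq rb z using r bc by simp
  qed
  have J: "ideal ?J R"
  proof (rule idealI)
    show "subgroup ?J (add_monoid R)"
    proof (rule subgroup.intro)
      show "inv\<^bsub>add_monoid R\<^esub> a \<in> ?J" if "a \<in> ?J" for a
      proof -
        have "\<ominus> \<one> \<otimes> a \<in> ?J" using mult[of "\<ominus> \<one>" a] that by simp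
        then show ?thesis using that by (simp add: a_inv_def[symmetric] l_minus)
      qed
    qed (auto simp: G.component_add G.component_zero)
    show "x \<otimes> a \<in> ?J" if "a \<in> ?J" "x \<in> carrier R" for a x using mult that by blast
    then show "a \<otimes> x \<in> ?J" if "a \<in> ?J" "x \<in> carrier R" for a x using that m_comm by auto
  qed (use ring_axioms in auto)
  have "irrelevant R \<subseteq> ?J"
    unfolding irrelevant_def
  proof (rule genideal_minimal[OF J])
    show "(\<Union>n\<in>{1..}. hpart R n) \<subseteq> ?J" using G.hpart_carrier G.component_homogeneous by auto
  qed
  then show "a \<in> carrier R \<and> component R a 0 = \<zero>" using a by auto
next
  interpret I: ideal "irrelevant R" R by (rule ideal_irrelevant)
  assume a: "a \<in> carrier R \<and> component R a 0 = \<zero>"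
  show "a \<in> irrelevant R"
  proof (rule G.component_memI)
    fix n assume n: "component R a n \<noteq> \<zero>"
    then have "n \<ge> 1" using a component_negative[of a n] by (metis int_one_le_iff_zero_less linorder_neqE)
    then show "component R a n \<in> irrelevant R" using hpart_subset_irrelevant G.component_hpart a by blast
  qed (use a in auto)
qed

end

sublocale graded_cring \<subseteq> irrelevant_cring R
  by (rule irrelevant_cring.intro[OF cring_axioms irrelevant_cring_axioms.intro[OF ideal_irrelevant]])

context graded_cring
begin

lemma component_0_add: "a \<in> carrier R \<Longrightarrow> b \<in> carrier R \<Longrightarrow> component R (a \<oplus> b) 0 = component R a 0 \<oplus> component R b 0"
  by (rule G.component_add)

lemma minus_component_0:
  assumes "a \<in> carrier R" shows "a \<ominus> component R a 0 \<in> irrelevant R"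
proof -
  have c: "component R a 0 \<in> carrier R" "component R a 0 \<in> hpart R 0"
    using assms G.component_carrier G.component_hpart by auto
  have "component R (a \<ominus> component R a 0) 0 = component R a 0 \<oplus> component R (\<ominus> component R a 0) 0"
    unfolding a_minus_def using assms c by (simp add: G.component_add)
  also have "component R (\<ominus> component R a 0) 0 = \<ominus> component R a 0"
    using G.component_homogeneous[OF G.hpart_uminus[OF c(2)]] by simp
  finally show ?thesis using assms c by (simp add: irrelevant_iff r_neg)
qed

text \<open>Modulo the irrelevant ideal, whose elements have no component of degree 0,
  \<open>a\<close> and \<open>b\<close> may be replaced by their components of degree 0.\<close>

lemma component_0_mult:
  assumes "a \<in> carrier R" "b \<in> carrier R"
  shows "component R (a \<otimes> b) 0 = component R a 0 \<otimes> component R b 0"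
proof -
  interpret I: ideal "irrelevant R" R by (rule ideal_irrelevant)
  let ?a = "component R a 0" and ?b = "component R b 0"
  have c: "?a \<in> carrier R" "?b \<in> carrier R" "?a \<in> hpart R 0" "?b \<in> hpart R 0"
    using assms G.component_carrier G.component_hpart by auto
  have 1: "(a \<ominus> ?a) \<otimes> b \<in> irrelevant R" "?a \<otimes> (b \<ominus> ?b) \<in> irrelevant R"
    using minus_component_0 assms c I.I_l_closed I.I_r_closed by auto
  have "a \<otimes> b = ?a \<otimes> ?b \<oplus> ((a \<ominus> ?a) \<otimes> b \<oplus> ?a \<otimes> (b \<ominus> ?b))"
    using assms c by algebra
  then have "component R (a \<otimes> b) 0 = component R (?a \<otimes> ?b) 0 \<oplus> (component R ((a \<ominus> ?a) \<otimes> b) 0 \<oplus> component R (?a \<otimes> (b \<ominus> ?b)) 0)"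
    using assms c by (simp add: G.component_add)
  also have "component R ((a \<ominus> ?a) \<otimes> b) 0 = \<zero>" using 1(1) unfolding irrelevant_iff by (rule conjunct2)
  also have "component R (?a \<otimes> (b \<ominus> ?b)) 0 = \<zero>" using 1(2) unfolding irrelevant_iff by (rule conjunct2)
  also have "component R (?a \<otimes> ?b) 0 \<oplus> (\<zero> \<oplus> \<zero>) = component R (?a \<otimes> ?b) 0"
    using G.component_carrier[OF m_closed[OF c(1,2)]] by simp
  also have "\<dots> = ?a \<otimes> ?b" using G.component_homogeneous[OF graded_mult[OF c(3,4)]] by simp
  finally show ?thesis .
qed

end

lemma (in standard_graded_algebra) graded_cring: "graded_cring R"
proof (rule graded_cring.intro)
  show "cring R" by (rule R.M_cring)
  have one: "\<one>\<^bsub>R\<^esub> \<in> carrier R" by (rule cring.cring_simprules(6)[OF R.M_cring])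
  show "graded_cring_axioms R"
  proof
    show "\<one>\<^bsub>R\<^esub> \<in> hpart R 0"
      unfolding zero_part using R.smult_one[OF one] by (metis K.one_closed imageI)
    show "\<exists>b\<in>hpart R 0. b \<otimes>\<^bsub>R\<^esub> a = \<one>\<^bsub>R\<^esub>" if a: "a \<in> hpart R 0" "a \<noteq> \<zero>\<^bsub>R\<^esub>" for a
    proof -
      obtain c where c: "c \<in> carrier K" "a = c \<odot>\<^bsub>R\<^esub> \<one>\<^bsub>R\<^esub>" using a(1) zero_part by auto
      have "c \<noteq> \<zero>\<^bsub>K\<^esub>" using a(2) c R.smult_l_null[OF one] by auto
      then have i: "inv\<^bsub>K\<^esub> c \<in> carrier K" "inv\<^bsub>K\<^esub> c \<otimes>\<^bsub>K\<^esub> c = \<one>\<^bsub>K\<^esub>"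
        using c K.field_Units by auto
      have "(inv\<^bsub>K\<^esub> c \<odot>\<^bsub>R\<^esub> \<one>\<^bsub>R\<^esub>) \<otimes>\<^bsub>R\<^esub> a = inv\<^bsub>K\<^esub> c \<odot>\<^bsub>R\<^esub> (\<one>\<^bsub>R\<^esub> \<otimes>\<^bsub>R\<^esub> a)"
        by (rule R.smult_assoc2[OF i(1)]) (use c in auto)
      also have "\<dots> = (inv\<^bsub>K\<^esub> c \<otimes>\<^bsub>K\<^esub> c) \<odot>\<^bsub>R\<^esub> \<one>\<^bsub>R\<^esub>"
        using c i one by (simp add: R.smult_assoc1[symmetric] cring.cring_simprules[OF R.M_cring])
      finally show ?thesis using i c by (intro bexI[of _ "inv\<^bsub>K\<^esub> c \<odot>\<^bsub>R\<^esub> \<one>\<^bsub>R\<^esub>"]) (auto simp: zero_part)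
    qed
    show "grading R" by (rule graded)
    show "a \<otimes>\<^bsub>R\<^esub> b \<in> hpart R (i + j)" if "a \<in> hpart R i" "b \<in> hpart R j" for a b i j
      using that by (rule graded_mult)
    show "hpart R n = {\<zero>\<^bsub>R\<^esub>}" if "n < 0" for n using that by (rule negative_part)
    show "\<one>\<^bsub>R\<^esub> \<noteq> \<zero>\<^bsub>R\<^esub>" by (rule nontrivial)
    show "\<exists>S. finite S \<and> S \<subseteq> hpart R 1 \<and> generate_ring R (hpart R 0 \<union> S) = carrier R"
      by (rule finitely_generated_by_linear_forms)
  qed
qed

subsection \<open>Dickson's lemma\<close>

text \<open>Every tail has a position where its minimum is attained; jumping repeatedly to such
  positions gives the subsequence.\<close>

lemma nat_mono_subsequence:
  fixes g :: "nat \<Rightarrow> nat"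
  shows "\<exists>\<phi> :: nat \<Rightarrow> nat. strict_mono \<phi> \<and> (\<forall>i j. i \<le> j \<longrightarrow> g (\<phi> i) \<le> g (\<phi> j))"
proof -
  have inf: "\<exists>k\<ge>n. \<forall>m\<ge>k. g k \<le> g m" for n
  proof -
    define v where "v = (LEAST v. v \<in> g ` {n..})"
    have "v \<in> g ` {n..}" unfolding v_def by (rule LeastI[of _ "g n"]) auto
    then obtain k where "k \<ge> n" "g k = v" by auto
    moreover have "v \<le> g m" if "m \<ge> k" for m
      unfolding v_def by (rule Least_le) (use that \<open>k \<ge> n\<close> in auto)
    ultimately show ?thesis by auto
  qed
  have "\<exists>\<phi>. \<forall>n. (\<forall>m\<ge>\<phi> n. g (\<phi> n) \<le> g m) \<and> \<phi> n < \<phi> (Suc n)"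
  proof (rule dependent_nat_choice)
    show "\<exists>k. \<forall>m\<ge>k. g k \<le> g m" using inf[of 0] by auto
    show "\<exists>l. (\<forall>m\<ge>l. g l \<le> g m) \<and> k < l" for k n :: nat using inf[of "Suc k"] by (auto simp: Suc_le_eq)
  qed
  then obtain \<phi> where \<phi>: "\<And>n m. m \<ge> \<phi> n \<Longrightarrow> g (\<phi> n) \<le> g m" "\<And>n. \<phi> n < \<phi> (Suc n)" by blast
  have sm: "strict_mono \<phi>" using \<phi>(2) by (simp add: strict_mono_Suc_iff)
  show ?thesis using sm \<phi>(1) strict_mono_less_eq[OF sm] by blast
qed

text \<open>The coordinates are treated one after the other, passing to a subsequence each
  time.\<close>

lemma list_mono_subsequence:
  fixes f :: "nat \<Rightarrow> nat list"
  assumes "\<And>i. length (f i) = m"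
  shows "\<exists>\<phi> :: nat \<Rightarrow> nat. strict_mono \<phi> \<and> (\<forall>i j. i \<le> j \<longrightarrow> list_all2 (\<le>) (f (\<phi> i)) (f (\<phi> j)))"
  using assms
proof (induction m arbitrary: f)
  case 0
  then show ?case by (intro exI[of _ "\<lambda>n::nat. n"]) (auto simp: strict_mono_def)
next
  case (Suc m)
  have ne: "f i = hd (f i) # tl (f i)" for i using Suc.prems[of i] by (cases "f i") auto
  have "\<exists>\<phi> :: nat \<Rightarrow> nat. strict_mono \<phi> \<and> (\<forall>i j. i \<le> j \<longrightarrow> list_all2 (\<le>) (tl (f (\<phi> i))) (tl (f (\<phi> j))))"
    by (rule Suc.IH) (simp add: Suc.prems)
  then obtain \<phi> :: "nat \<Rightarrow> nat" where \<phi>: "strict_mono \<phi>"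
    "\<And>i j. i \<le> j \<Longrightarrow> list_all2 (\<le>) (tl (f (\<phi> i))) (tl (f (\<phi> j)))" by blast
  obtain \<psi> :: "nat \<Rightarrow> nat" where \<psi>: "strict_mono \<psi>" "\<And>i j. i \<le> j \<Longrightarrow> hd (f (\<phi> (\<psi> i))) \<le> hd (f (\<phi> (\<psi> j)))"
    using nat_mono_subsequence[of "\<lambda>i. hd (f (\<phi> i))"] by blast
  have "list_all2 (\<le>) (f (\<phi> (\<psi> i))) (f (\<phi> (\<psi> j)))" if "i \<le> j" for i j
  proof -
    have "\<psi> i \<le> \<psi> j" using that strict_mono_less_eq[OF \<psi>(1)] by simp
    then show ?thesis using \<psi>(2)[OF that] \<phi>(2) ne list_all2_Cons by metis
  qed
  then show ?case using strict_mono_o[OF \<phi>(1) \<psi>(1)] by (intro exI[of _ "\<phi> \<circ> \<psi>"]) (simp add: o_def)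
qed

text \<open>Comparable means: the same basis element, and divisibility of the exponent vectors.\<close>

definition divides_exp :: "nat list \<times> nat \<Rightarrow> nat list \<times> nat \<Rightarrow> bool" where
  "divides_exp p q \<longleftrightarrow> snd p = snd q \<and> list_all2 (\<le>) (fst p) (fst q)"

text \<open>If no finite subset works, elements can be chosen one after the other with none
  divisible by an earlier one, against the existence of a coordinatewise increasing
  subsequence.\<close>

lemma dickson:
  assumes L: "\<And>p. p \<in> L \<Longrightarrow> length (fst p) = m \<and> snd p < b"
  shows "\<exists>B\<subseteq>L. finite B \<and> (\<forall>q\<in>L. \<exists>p\<in>B. divides_exp p q)"
proof (rule ccontr)
  assume "\<not> ?thesis"
  then have bad: "\<exists>q\<in>L. \<forall>p\<in>B. \<not> divides_exp p q" if "B \<subseteq> L" "finite B" for B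
    using that by simp
  have "\<exists>f :: nat \<Rightarrow> nat list \<times> nat. \<forall>n. f n \<in> L \<and> (\<forall>k<n. \<not> divides_exp (f k) (f n))"
  proof (rule dependent_wellorder_choice)
    fix n :: nat and f assume "\<And>y. y < n \<Longrightarrow> f y \<in> L \<and> (\<forall>k<y. \<not> divides_exp (f k) (f y))"
    then have "f ` {..<n} \<subseteq> L" by auto
    from bad[OF this] show "\<exists>r. r \<in> L \<and> (\<forall>k<n. \<not> divides_exp (f k) r)"
      by (metis finite_imageI finite_lessThan imageI lessThan_iff)
  qed simp
  then obtain f :: "nat \<Rightarrow> nat list \<times> nat" where f: "\<And>n. f n \<in> L" "\<And>n k. k < n \<Longrightarrow> \<not> divides_exp (f k) (f n)"
    by auto
  \<comment> \<open>The index and its complement to \<open>b\<close> are both made coordinates: if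
    both increase weakly, the index is constant, which is the equality required by
    \<open>divides_exp\<close>.\<close>
  let ?g = "\<lambda>n. snd (f n) # (b - snd (f n)) # fst (f n)"
  obtain \<phi> :: "nat \<Rightarrow> nat" where \<phi>: "strict_mono \<phi>" "\<And>i j. i \<le> j \<Longrightarrow> list_all2 (\<le>) (?g (\<phi> i)) (?g (\<phi> j))"
    using list_mono_subsequence[of ?g "Suc (Suc m)"] f(1) L by auto
  have "divides_exp (f (\<phi> 0)) (f (\<phi> 1))"
    using \<phi>(2)[of 0 1] L[OF f(1)[of "\<phi> 0"]] L[OF f(1)[of "\<phi> 1"]] by (auto simp: divides_exp_def)
  moreover have "\<phi> 0 < \<phi> 1" using \<phi>(1) by (simp add: strict_mono_def)
  ultimately show False using f(2) by blast
qed

section \<open>A well-founded order on exponents, compatible with addition\<close>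

lemma lex_total:
  "length xs = length ys \<Longrightarrow> (xs, ys) \<in> lex less_than \<or> xs = ys \<or> (ys, xs) \<in> lex less_than"
  for xs ys :: "nat list"
  by (induction xs ys rule: list_induct2) auto

lemma lex_add:
  "length zs = length xs \<Longrightarrow> (xs, ys) \<in> lex less_than \<Longrightarrow> (map2 (+) zs xs, map2 (+) zs ys) \<in> lex less_than"
  for xs ys zs :: "nat list"
proof (induction zs xs arbitrary: ys rule: list_induct2)
  case (Cons z zs x xs)
  then show ?case by (cases ys) auto
qed simp

text \<open>The monomial order: \<open>lex\<close> relates only lists of equal length, which makes
  it well founded, and the index of the generator breaks ties.\<close>

definition exp_less :: "((nat list \<times> nat) \<times> (nat list \<times> nat)) set" where
  "exp_less = inv_image (lex less_than <*lex*> less_than) id"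

lemma exp_less_iff: "(p, q) \<in> exp_less \<longleftrightarrow> (fst p, fst q) \<in> lex less_than \<or> fst p = fst q \<and> snd p < snd q"
  by (cases p; cases q) (auto simp: exp_less_def inv_image_def)

lemma wf_exp_less: "wf exp_less"
  unfolding exp_less_def by (intro wf_inv_image wf_lex_prod wf_lex wf_less_than)

lemma trans_exp_less: "trans exp_less"
proof -
  have "trans (lex less_than)" by (rule lex_transI[OF trans_less_than])
  then show ?thesis unfolding exp_less_def by (intro trans_inv_image trans_lex_prod trans_less_than)
qed

text \<open>Generation of \<open>N\<close> is expressed by quantifying over the submodules of
  \<open>M\<close> that contain \<open>B\<close>, so that it can be pushed along homomorphisms by
  taking preimages.\<close>

definition fin_gen :: "('a, 'b) ring_scheme \<Rightarrow> ('a, 'm, 'e) module_scheme \<Rightarrow> 'm set \<Rightarrow> bool" where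
  "fin_gen R M N \<longleftrightarrow> (\<exists>B. finite B \<and> B \<subseteq> N \<and> (\<forall>P. submodule R P M \<longrightarrow> B \<subseteq> P \<longrightarrow> N \<subseteq> P))"

subsection \<open>Submodules of finitely generated modules\<close>

primrec (in cring) monomial :: "'a list \<Rightarrow> nat list \<Rightarrow> 'a" where
  "monomial [] \<alpha> = \<one>"
| "monomial (x # xs) \<alpha> = x [^] hd \<alpha> \<otimes> monomial xs (tl \<alpha>)"

context cring
begin

lemma monomial_closed: "set xs \<subseteq> carrier R \<Longrightarrow> monomial xs \<alpha> \<in> carrier R"
  by (induction xs arbitrary: \<alpha>) auto

lemma monomial_add:
  "set xs \<subseteq> carrier R \<Longrightarrow> length \<alpha> = length xs \<Longrightarrow> length \<beta> = length xs \<Longrightarrow>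
    monomial xs (map2 (+) \<alpha> \<beta>) = monomial xs \<alpha> \<otimes> monomial xs \<beta>"
proof (induction xs arbitrary: \<alpha> \<beta>)
  case (Cons x xs)
  obtain a \<alpha>' b \<beta>' where e: "\<alpha> = a # \<alpha>'" "\<beta> = b # \<beta>'" using Cons.prems by (cases \<alpha>; cases \<beta>) auto
  show ?case using Cons monomial_closed[of xs] by (simp add: e nat_pow_mult[symmetric] m_ac)
qed simp

lemma monomial_zero: "set xs \<subseteq> carrier R \<Longrightarrow> monomial xs (replicate (length xs) 0) = \<one>"
  by (induction xs) auto

lemma monomial_unit:
  "set xs \<subseteq> carrier R \<Longrightarrow> i < length xs \<Longrightarrow> monomial xs ((replicate (length xs) 0)[i := 1]) = xs ! i"
proof (induction xs arbitrary: i)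
  case (Cons x xs)
  show ?case
  proof (cases i)
    case (Suc k)
    then have "xs ! k \<in> carrier R" using Cons.prems nth_mem[of k xs] by auto
    then show ?thesis using Cons Suc by simp
  qed (use Cons in \<open>simp add: monomial_zero\<close>)
qed simp

end

text \<open>The products of monomials in \<open>xs\<close> with the generators \<open>v j\<close>
  span \<open>M\<close> over the part of degree 0 but may be linearly dependent, so an element has
  no well-defined leading term. In place of a leading-term function the argument uses, for each
  exponent \<open>p\<close>, the span \<open>low p\<close> of all smaller products.\<close>

locale leading_terms = graded_cring R + M: module R M
  for R :: "('k, 'a) gmodule" (structure) and M :: "('a, 'm, 'e) module_scheme" +
  fixes xs :: "'a list" and v :: "nat \<Rightarrow> 'm" and b :: nat
  assumes xs: "set xs \<subseteq> hpart R 1" and xs_gen: "generate_ring R (hpart R 0 \<union> set xs) = carrier R"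
    and v: "\<And>j. j < b \<Longrightarrow> v j \<in> carrier M"
    and v_gen: "\<And>P. submodule R P M \<Longrightarrow> v ` {..<b} \<subseteq> P \<Longrightarrow> P = carrier M"
begin

definition exps :: "(nat list \<times> nat) set" where
  [simp]: "exps = {p. length (fst p) = length xs \<and> snd p < b}"

definition \<mu> where "\<mu> p = monomial xs (fst p) \<odot>\<^bsub>M\<^esub> v (snd p)"

inductive_set low :: "nat list \<times> nat \<Rightarrow> 'm set" for p where
  zero: "\<zero>\<^bsub>M\<^esub> \<in> low p"
| step: "u \<in> low p \<Longrightarrow> c \<in> hpart R 0 \<Longrightarrow> q \<in> exps \<Longrightarrow> (q, p) \<in> exp_less \<Longrightarrow> u \<oplus>\<^bsub>M\<^esub> c \<odot>\<^bsub>M\<^esub> \<mu> q \<in> low p"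

lemma xs_carrier: "set xs \<subseteq> carrier R"
  using xs G.hpart_carrier by auto

lemma k0_carrier: "c \<in> hpart R 0 \<Longrightarrow> c \<in> carrier R"
  by (rule G.hpart_carrier)

lemma k0_mult: "c \<in> hpart R 0 \<Longrightarrow> d \<in> hpart R 0 \<Longrightarrow> c \<otimes> d \<in> hpart R 0"
  using graded_mult[of c 0 d 0] by simp

lemma mu_carrier: "p \<in> exps \<Longrightarrow> \<mu> p \<in> carrier M"
  unfolding \<mu>_def using v monomial_closed[OF xs_carrier] by auto

lemma low_carrier: "u \<in> low p \<Longrightarrow> u \<in> carrier M"
  by (induction rule: low.induct) (auto intro!: mu_carrier k0_carrier M.smult_closed)

lemma low_add: "u \<in> low p \<Longrightarrow> w \<in> low p \<Longrightarrow> u \<oplus>\<^bsub>M\<^esub> w \<in> low p"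
proof (induction rule: low.induct)
  case zero then show ?case using low_carrier by simp
next
  case (step u c q)
  have c: "c \<odot>\<^bsub>M\<^esub> \<mu> q \<in> carrier M" using step mu_carrier k0_carrier by blast
  have "u \<oplus>\<^bsub>M\<^esub> c \<odot>\<^bsub>M\<^esub> \<mu> q \<oplus>\<^bsub>M\<^esub> w = (u \<oplus>\<^bsub>M\<^esub> w) \<oplus>\<^bsub>M\<^esub> c \<odot>\<^bsub>M\<^esub> \<mu> q"
    using low_carrier[OF step(1)] low_carrier[OF step.prems] c by (simp add: M.M.a_ac)
  then show ?case using low.step[OF step.IH[OF step.prems] step(2-4)] by simp
qed

lemma low_smult: "u \<in> low p \<Longrightarrow> c \<in> hpart R 0 \<Longrightarrow> c \<odot>\<^bsub>M\<^esub> u \<in> low p"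
proof (induction rule: low.induct)
  case zero then show ?case using k0_carrier by (simp add: low.zero)
next
  case (step u d q)
  have "c \<odot>\<^bsub>M\<^esub> (u \<oplus>\<^bsub>M\<^esub> d \<odot>\<^bsub>M\<^esub> \<mu> q) = c \<odot>\<^bsub>M\<^esub> u \<oplus>\<^bsub>M\<^esub> (c \<otimes> d) \<odot>\<^bsub>M\<^esub> \<mu> q"
    using low_carrier[OF step(1)] k0_carrier step mu_carrier by (simp add: M.smult_r_distr M.smult_assoc1)
  then show ?case using low.step[OF step.IH[OF step.prems] k0_mult[OF step.prems step(2)] step(3,4)] by simp
qed

lemma low_minus: "u \<in> low p \<Longrightarrow> w \<in> low p \<Longrightarrow> u \<ominus>\<^bsub>M\<^esub> w \<in> low p"
proof -
  assume u: "u \<in> low p" and w: "w \<in> low p"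
  have "(\<ominus> \<one>) \<odot>\<^bsub>M\<^esub> w \<in> low p" by (rule low_smult[OF w G.hpart_uminus[OF one_hpart]])
  then show ?thesis using low_add[OF u] low_carrier[OF w] by (simp add: a_minus_def M.smult_l_minus)
qed

lemma low_mono: "u \<in> low p \<Longrightarrow> (p, q) \<in> exp_less \<Longrightarrow> u \<in> low q"
  by (induction rule: low.induct) (auto intro: low.intros transD[OF trans_exp_less])

text \<open>Extraction of a top term. A further term \<open>d \<mu> r\<close> is compared with the
  current top \<open>q\<close>: below it, it joins the rest; above it, it becomes the top; at
  \<open>q\<close> itself the coefficients add, so the coefficient of the top may vanish.\<close>

lemma low_cases:
  assumes "u \<in> low p"
  shows "u = \<zero>\<^bsub>M\<^esub> \<or> (\<exists>q c u'. q \<in> exps \<and> (q, p) \<in> exp_less \<and> c \<in> hpart R 0 \<and> u' \<in> low q \<and>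
    u = c \<odot>\<^bsub>M\<^esub> \<mu> q \<oplus>\<^bsub>M\<^esub> u')"
  using assms
proof (induction rule: low.induct)
  case zero then show ?case by simp
next
  case (step w d r)
  have dr: "d \<odot>\<^bsub>M\<^esub> \<mu> r \<in> carrier M" "\<mu> r \<in> carrier M" using step mu_carrier k0_carrier by blast+
  have top: ?case if "w \<in> low r"
    using that step dr low_carrier[OF that]
    by (intro disjI2 exI[of _ r] exI[of _ d] exI[of _ w]) (auto simp: M.M.a_ac)
  from step.IH show ?case
  proof
    assume "w = \<zero>\<^bsub>M\<^esub>" then show ?case using top low.zero by simp
  next
    assume "\<exists>q c u'. q \<in> exps \<and> (q, p) \<in> exp_less \<and> c \<in> hpart R 0 \<and> u' \<in> low q \<and> w = c \<odot>\<^bsub>M\<^esub> \<mu> q \<oplus>\<^bsub>M\<^esub> u'"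
    then obtain q c u' where q: "q \<in> exps" "(q, p) \<in> exp_less" "c \<in> hpart R 0" "u' \<in> low q"
      "w = c \<odot>\<^bsub>M\<^esub> \<mu> q \<oplus>\<^bsub>M\<^esub> u'" by blast
    have cq: "c \<odot>\<^bsub>M\<^esub> \<mu> q \<in> carrier M" "u' \<in> carrier M" using q mu_carrier k0_carrier low_carrier by blast+
    have "(q, r) \<in> exp_less \<or> q = r \<or> (r, q) \<in> exp_less"
      using lex_total[of "fst q" "fst r"] q(1) step(3) by (auto simp: exp_less_iff prod_eq_iff)
    then consider "(q, r) \<in> exp_less" | "q = r" | "(r, q) \<in> exp_less" by blast
    then show ?case
    proof cases
      case 1
      have "\<zero>\<^bsub>M\<^esub> \<oplus>\<^bsub>M\<^esub> c \<odot>\<^bsub>M\<^esub> \<mu> q \<in> low r" by (rule low.step[OF low.zero q(3,1) 1])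
      then have "w \<in> low r" unfolding q(5) using low_add low_mono[OF q(4) 1] cq by simp
      then show ?thesis by (rule top)
    next
      case 2
      have "w \<oplus>\<^bsub>M\<^esub> d \<odot>\<^bsub>M\<^esub> \<mu> r = (c \<oplus> d) \<odot>\<^bsub>M\<^esub> \<mu> r \<oplus>\<^bsub>M\<^esub> u'"
        unfolding q(5) 2 using cq dr step q k0_carrier 2 by (simp add: M.smult_l_distr M.M.a_ac)
      then show ?thesis using q step G.hpart_add[OF q(3) step(2)] 2 by blast
    next
      case 3
      have "u' \<oplus>\<^bsub>M\<^esub> d \<odot>\<^bsub>M\<^esub> \<mu> r \<in> low q" by (rule low.step[OF q(4) step(2,3) 3])
      moreover have "w \<oplus>\<^bsub>M\<^esub> d \<odot>\<^bsub>M\<^esub> \<mu> r = c \<odot>\<^bsub>M\<^esub> \<mu> q \<oplus>\<^bsub>M\<^esub> (u' \<oplus>\<^bsub>M\<^esub> d \<odot>\<^bsub>M\<^esub> \<mu> r)"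
        unfolding q(5) using cq dr by (simp add: M.M.a_assoc)
      ultimately show ?thesis using q by blast
    qed
  qed
qed

definition shift where "shift \<gamma> p = (map2 (+) \<gamma> (fst p), snd p)"

lemma mu_shift:
  assumes "p \<in> exps" "length \<gamma> = length xs"
  shows "monomial xs \<gamma> \<odot>\<^bsub>M\<^esub> \<mu> p = \<mu> (shift \<gamma> p)" and "shift \<gamma> p \<in> exps"
proof -
  show "shift \<gamma> p \<in> exps" using assms by (simp add: shift_def)
  have "v (snd p) \<in> carrier M" using assms v by auto
  then show "monomial xs \<gamma> \<odot>\<^bsub>M\<^esub> \<mu> p = \<mu> (shift \<gamma> p)"
    using assms monomial_closed[OF xs_carrier] monomial_add[OF xs_carrier, of \<gamma> "fst p"]
    by (simp add: \<mu>_def shift_def M.smult_assoc1[symmetric])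
qed

lemma exp_less_shift:
  assumes "(q, p) \<in> exp_less" "q \<in> exps" "length \<gamma> = length xs"
  shows "(shift \<gamma> q, shift \<gamma> p) \<in> exp_less"
  using assms lex_add[of \<gamma> "fst q" "fst p"] by (auto simp: exp_less_iff shift_def)

text \<open>Multiplication by a monomial shifts exponents and preserves the order, hence sends
  smaller products to smaller products.\<close>

lemma low_shift:
  assumes "u \<in> low p" "length \<gamma> = length xs"
  shows "monomial xs \<gamma> \<odot>\<^bsub>M\<^esub> u \<in> low (shift \<gamma> p)"
  using assms(1)
proof (induction rule: low.induct)
  case zero then show ?case using monomial_closed[OF xs_carrier] by (simp add: low.zero)
next
  case (step u c q)
  have c: "c \<in> carrier R" "\<mu> q \<in> carrier M" "u \<in> carrier M" using step k0_carrier mu_carrier low_carrier by auto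
  have "monomial xs \<gamma> \<odot>\<^bsub>M\<^esub> (u \<oplus>\<^bsub>M\<^esub> c \<odot>\<^bsub>M\<^esub> \<mu> q) = monomial xs \<gamma> \<odot>\<^bsub>M\<^esub> u \<oplus>\<^bsub>M\<^esub> c \<odot>\<^bsub>M\<^esub> (monomial xs \<gamma> \<odot>\<^bsub>M\<^esub> \<mu> q)"
    using c monomial_closed[OF xs_carrier, of \<gamma>]
    by (simp add: M.smult_r_distr M.smult_assoc1[symmetric] m_comm)
  then show ?case
    unfolding mu_shift(1)[OF step(3) assms(2)]
    using low.step[OF step.IH step(2) mu_shift(2)[OF step(3) assms(2)] exp_less_shift[OF step(4,3) assms(2)]] by simp
qed

text \<open>Some exponent strictly above \<open>p\<close>. Without variables only the index of the
  generator can grow, possibly beyond \<open>b\<close>, which is why \<open>levels\<close> puts no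
  bound on the index.\<close>

definition "bump p = (case fst p of [] \<Rightarrow> ([], Suc (snd p)) | a # \<alpha> \<Rightarrow> (Suc a # \<alpha>, snd p))"

lemma exp_less_bump: "(p, bump p) \<in> exp_less"
  by (cases p; cases "fst p") (auto simp: bump_def exp_less_iff)

lemma length_bump: "length (fst (bump p)) = length (fst p)"
  by (auto simp: bump_def split: list.split)

abbreviation "levels \<equiv> {p :: nat list \<times> nat. length (fst p) = length xs}"

text \<open>The union of all \<open>low p\<close> is a submodule: it is closed under sums because
  exponents are totally ordered, and under scalars because \<open>R\<close> is generated as a ring
  by its part of degree 0 and \<open>xs\<close>, which act on coefficients and by shifts. It
  contains the generators, hence everything.\<close>

lemma all_low:
  assumes "u \<in> carrier M"
  shows "\<exists>p\<in>levels. u \<in> low p"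
proof -
  let ?V = "\<Union>p\<in>levels. low p"
  have max: "\<exists>r\<in>levels. u \<in> low r \<and> w \<in> low r" if "p \<in> levels" "q \<in> levels" "u \<in> low p" "w \<in> low q" for p q u w
  proof -
    have "(q, p) \<in> exp_less \<or> q = p \<or> (p, q) \<in> exp_less"
      using lex_total[of "fst q" "fst p"] that by (auto simp: exp_less_iff prod_eq_iff)
    then show ?thesis using that low_mono by blast
  qed
  have add: "u \<oplus>\<^bsub>M\<^esub> w \<in> ?V" if "u \<in> ?V" "w \<in> ?V" for u w
  proof -
    obtain p q where "p \<in> levels" "u \<in> low p" "q \<in> levels" "w \<in> low q" using \<open>u \<in> ?V\<close> \<open>w \<in> ?V\<close> by blast
    then obtain r where "r \<in> levels" "u \<in> low r" "w \<in> low r" using max by blast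
    then show ?thesis using low_add by blast
  qed
  have c: "u \<in> carrier M" if "u \<in> ?V" for u using that low_carrier by auto
  have k0: "a \<odot>\<^bsub>M\<^esub> u \<in> ?V" if "a \<in> hpart R 0" "u \<in> ?V" for a u using that low_smult by blast
  have x: "a \<odot>\<^bsub>M\<^esub> u \<in> ?V" if a: "a \<in> set xs" and u: "u \<in> ?V" for a u
  proof -
    obtain i where i: "i < length xs" "a = xs ! i" using a by (metis in_set_conv_nth)
    obtain p where p: "p \<in> levels" "u \<in> low p" using u by auto
    let ?\<gamma> = "(replicate (length xs) 0)[i := 1]"
    have "monomial xs ?\<gamma> \<odot>\<^bsub>M\<^esub> u \<in> low (shift ?\<gamma> p)" by (rule low_shift[OF p(2)]) simp
    moreover have "shift ?\<gamma> p \<in> levels" using p by (simp add: shift_def)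
    ultimately show ?thesis unfolding monomial_unit[OF xs_carrier i(1)] i(2) by blast
  qed
  have smult: "a \<odot>\<^bsub>M\<^esub> u \<in> ?V" if "a \<in> carrier R" "u \<in> ?V" for a u
  proof -
    have H: "hpart R 0 \<union> set xs \<subseteq> carrier R" using xs_carrier k0_carrier by auto
    have "a \<in> generate_ring R (hpart R 0 \<union> set xs)" using that xs_gen by simp
    then have "\<forall>u\<in>?V. a \<odot>\<^bsub>M\<^esub> u \<in> ?V"
    proof (induction rule: generate_ring.induct)
      case one then show ?case using c by simp
    next
      case (incl h) then show ?case using k0 x by blast
    next
      case (a_inv h)
      have h: "h \<in> carrier R" by (rule generate_ring_in_carrier[OF H a_inv(1)])
      show ?case
      proof
        fix u assume u: "u \<in> ?V"
        have "(\<ominus> \<one>) \<odot>\<^bsub>M\<^esub> (h \<odot>\<^bsub>M\<^esub> u) \<in> ?V" using k0[OF G.hpart_uminus[OF one_hpart]] a_inv u by blast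
        then show "(\<ominus> h) \<odot>\<^bsub>M\<^esub> u \<in> ?V" using h c[OF u] by (simp add: M.smult_l_minus)
      qed
    next
      case (eng_add h1 h2)
      have h: "h1 \<in> carrier R" "h2 \<in> carrier R" using generate_ring_in_carrier[OF H] eng_add by auto
      show ?case
      proof
        fix u assume u: "u \<in> ?V"
        show "(h1 \<oplus> h2) \<odot>\<^bsub>M\<^esub> u \<in> ?V"
          unfolding M.smult_l_distr[OF h c[OF u]] by (rule add) (use eng_add u in blast)+
      qed
    next
      case (eng_mult h1 h2)
      have h: "h1 \<in> carrier R" "h2 \<in> carrier R" using generate_ring_in_carrier[OF H] eng_mult by auto
      show ?case
      proof
        fix u assume u: "u \<in> ?V"
        show "(h1 \<otimes> h2) \<odot>\<^bsub>M\<^esub> u \<in> ?V"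
          unfolding M.smult_assoc1[OF h c[OF u]] using eng_mult u by blast
      qed
    qed
    then show ?thesis using that by blast
  qed
  let ?e = "(replicate (length xs) 0, 0) :: nat list \<times> nat"
  have "submodule R ?V M"
  proof (rule submodI[OF M.module_axioms])
    have "?e \<in> levels" by simp
    then show "\<zero>\<^bsub>M\<^esub> \<in> ?V" using low.zero by blast
    show "?V \<subseteq> carrier M" using c by (rule subsetI)
  qed (fact add smult)+
  moreover have "v ` {..<b} \<subseteq> ?V"
  proof
    fix w assume "w \<in> v ` {..<b}"
    then obtain j where j: "j < b" "w = v j" by auto
    let ?p = "(replicate (length xs) 0, j)"
    have m: "\<mu> ?p = w" using v[OF j(1)] j monomial_zero[OF xs_carrier] by (simp add: \<mu>_def)
    have "\<zero>\<^bsub>M\<^esub> \<oplus>\<^bsub>M\<^esub> \<one> \<odot>\<^bsub>M\<^esub> \<mu> ?p \<in> low (bump ?p)"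
      by (rule low.step[OF low.zero one_hpart _ exp_less_bump]) (use j in auto)
    then have "w \<in> low (bump ?p)" using m v[OF j(1)] j by simp
    moreover have "bump ?p \<in> levels" by (simp add: length_bump)
    ultimately show "w \<in> ?V" by blast
  qed
  ultimately have "?V = carrier M" by (rule v_gen)
  then have "u \<in> ?V" using assms by simp
  then show ?thesis by (rule UN_E) blast
qed

text \<open>The division algorithm: the top term of an element of \<open>N\<close> is divisible by
  the top term of one of finitely many chosen elements, and subtracting a multiple of the latter
  moves strictly down in a well-founded order.\<close>

theorem submodule_fin_gen:
  assumes N: "submodule R N M"
  shows "fin_gen R M N"
proof -
  \<comment> \<open>The exponents that are leading, with coefficient 1, in some presentation of an
    element of \<open>N\<close>. Elements rather than terms cannot be indexed, as presentations are
    not unique.\<close>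
  define L where "L = {p \<in> exps. \<exists>l\<in>low p. \<mu> p \<oplus>\<^bsub>M\<^esub> l \<in> N}"
  have "\<And>p. p \<in> L \<Longrightarrow> length (fst p) = length xs \<and> snd p < b" unfolding L_def by simp
  from dickson[OF this] obtain B where B: "B \<subseteq> L" "finite B" "\<And>q. q \<in> L \<Longrightarrow> \<exists>p\<in>B. divides_exp p q" by metis
  have "\<forall>p\<in>B. \<exists>l. l \<in> low p \<and> \<mu> p \<oplus>\<^bsub>M\<^esub> l \<in> N" using B(1) unfolding L_def by blast
  then obtain l where l: "\<And>p. p \<in> B \<Longrightarrow> l p \<in> low p" "\<And>p. p \<in> B \<Longrightarrow> \<mu> p \<oplus>\<^bsub>M\<^esub> l p \<in> N" by metis
  let ?G = "(\<lambda>p. \<mu> p \<oplus>\<^bsub>M\<^esub> l p) ` B"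
  have main: "u \<in> P" if P: "submodule R P M" "?G \<subseteq> P" and u: "u \<in> low p" "u \<in> N" for P p u
    using u
  proof (induction p arbitrary: u rule: wf_induct_rule[OF wf_exp_less])
    case (1 p)
    from low_cases[OF 1(2)] show ?case
    proof
      assume "u = \<zero>\<^bsub>M\<^esub>" then show ?thesis using submodD(3)[OF P(1)] by simp
    next
      assume "\<exists>q c u'. q \<in> exps \<and> (q, p) \<in> exp_less \<and> c \<in> hpart R 0 \<and> u' \<in> low q \<and> u = c \<odot>\<^bsub>M\<^esub> \<mu> q \<oplus>\<^bsub>M\<^esub> u'"
      then obtain q c u' where q: "q \<in> exps" "(q, p) \<in> exp_less" "c \<in> hpart R 0" "u' \<in> low q"
        and ue: "u = c \<odot>\<^bsub>M\<^esub> \<mu> q \<oplus>\<^bsub>M\<^esub> u'" by blast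
      have cl: "\<mu> q \<in> carrier M" "u' \<in> carrier M" "c \<in> carrier R" using q mu_carrier k0_carrier low_carrier by auto
      show ?thesis
      proof (cases "c = \<zero>")
        case True
        then have "u = u'" using ue cl by simp
        then show ?thesis using 1(1)[OF q(2)] q(4) 1(3) by simp
      next
        case False
        \<comment> \<open>Dividing by the nonzero top coefficient shows that the top exponent
          \<open>q\<close> belongs to \<open>L\<close>.\<close>
        then obtain d where d: "d \<in> hpart R 0" "d \<otimes> c = \<one>" using zero_part_inverse q(3) by blast
        have dc: "d \<in> carrier R" using d k0_carrier by auto
        have "d \<odot>\<^bsub>M\<^esub> u = \<mu> q \<oplus>\<^bsub>M\<^esub> d \<odot>\<^bsub>M\<^esub> u'"
          unfolding ue using cl dc d by (simp add: M.smult_r_distr M.smult_assoc1[symmetric])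
        moreover have "d \<odot>\<^bsub>M\<^esub> u \<in> N" using submodD(5)[OF N dc] 1(3) by simp
        ultimately have "q \<in> L" unfolding L_def using q(1) low_smult[OF q(4) d(1)] by auto
        then obtain r where r: "r \<in> B" "divides_exp r q" using B(3) by blast
        have rL: "r \<in> exps" using r(1) B(1) unfolding L_def by auto
        \<comment> \<open>The exponent of the quotient monomial; subtraction of naturals is exact
          here because \<open>r\<close> divides \<open>q\<close>.\<close>
        define \<gamma> where "\<gamma> = map2 (-) (fst q) (fst r)"
        have \<gamma>: "length \<gamma> = length xs" using q(1) rL by (simp add: \<gamma>_def)
        have "shift \<gamma> r = q"
        proof -
          have "map2 (+) \<gamma> (fst r) = fst q"
            using r(2) unfolding \<gamma>_def divides_exp_def
            by (auto simp: list_eq_iff_nth_eq list_all2_conv_all_nth)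
          then show ?thesis using r(2) by (simp add: shift_def divides_exp_def prod_eq_iff)
        qed
        let ?m = "monomial xs \<gamma>"
        have m: "?m \<in> carrier R" by (rule monomial_closed[OF xs_carrier])
        have lr: "l r \<in> carrier M" "\<mu> r \<in> carrier M" using low_carrier[OF l(1)[OF r(1)]] mu_carrier[OF rL] by auto
        let ?w = "c \<odot>\<^bsub>M\<^esub> (?m \<odot>\<^bsub>M\<^esub> (\<mu> r \<oplus>\<^bsub>M\<^esub> l r))"
        have wP: "?w \<in> P" using P r(1) cl(3) m by (intro submodD(5)[OF P(1)]) auto
        have wN: "?w \<in> N" using l(2)[OF r(1)] cl(3) m by (intro submodD(5)[OF N]) auto
        have ml: "?m \<odot>\<^bsub>M\<^esub> l r \<in> low q" using low_shift[OF l(1)[OF r(1)] \<gamma>] \<open>shift \<gamma> r = q\<close> by simp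
        have we: "?w = c \<odot>\<^bsub>M\<^esub> \<mu> q \<oplus>\<^bsub>M\<^esub> c \<odot>\<^bsub>M\<^esub> (?m \<odot>\<^bsub>M\<^esub> l r)"
          using mu_shift(1)[OF rL \<gamma>] \<open>shift \<gamma> r = q\<close> lr m cl by (simp add: M.smult_r_distr)
        have cm: "c \<odot>\<^bsub>M\<^esub> (?m \<odot>\<^bsub>M\<^esub> l r) \<in> low q" by (rule low_smult[OF ml q(3)])
        have "u \<ominus>\<^bsub>M\<^esub> ?w = u' \<ominus>\<^bsub>M\<^esub> c \<odot>\<^bsub>M\<^esub> (?m \<odot>\<^bsub>M\<^esub> l r)"
        proof -
          have "(a \<oplus>\<^bsub>M\<^esub> x) \<ominus>\<^bsub>M\<^esub> (a \<oplus>\<^bsub>M\<^esub> y) = x \<ominus>\<^bsub>M\<^esub> y"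
            if "a \<in> carrier M" "x \<in> carrier M" "y \<in> carrier M" for a x y
          proof -
            have "(a \<oplus>\<^bsub>M\<^esub> x) \<ominus>\<^bsub>M\<^esub> (a \<oplus>\<^bsub>M\<^esub> y) = (a \<ominus>\<^bsub>M\<^esub> a) \<oplus>\<^bsub>M\<^esub> (x \<ominus>\<^bsub>M\<^esub> y)"
              using that by (simp add: a_minus_def M.M.minus_add M.M.a_ac)
            then show ?thesis using that by (simp add: a_minus_def M.M.r_neg)
          qed
          then show ?thesis unfolding we ue using cl low_carrier[OF cm] by simp
        qed
        then have "u \<ominus>\<^bsub>M\<^esub> ?w \<in> low q" using low_minus[OF q(4) cm] by simp
        then have "u \<ominus>\<^bsub>M\<^esub> ?w \<in> P" using 1(1)[OF q(2)] submod_minus[OF N 1(3) wN] by blast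
        then have "(u \<ominus>\<^bsub>M\<^esub> ?w) \<oplus>\<^bsub>M\<^esub> ?w \<in> P" using submodD(4)[OF P(1)] wP by blast
        moreover have "(u \<ominus>\<^bsub>M\<^esub> ?w) \<oplus>\<^bsub>M\<^esub> ?w = u"
          using low_carrier[OF 1(2)] submodD(2)[OF N] wN by (auto simp: a_minus_def M.M.a_assoc M.M.l_neg)
        ultimately show ?thesis by simp
      qed
    qed
  qed
  show ?thesis
    unfolding fin_gen_def
  proof (intro exI[of _ ?G] conjI allI impI subsetI)
    fix P u assume "submodule R P M" "?G \<subseteq> P" "u \<in> N"
    moreover have "u \<in> carrier M" using submodD(2)[OF N] \<open>u \<in> N\<close> by auto
    ultimately show "u \<in> P" using all_low main by blast
  qed (use B(2) l(2) in auto)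
qed

end

context graded_cring
begin

lemma noetherian:
  fixes v :: "nat \<Rightarrow> 'm" and M :: "('a, 'm, 'e) module_scheme"
  assumes M: "module R M" and v: "\<And>j. j < b \<Longrightarrow> v j \<in> carrier M"
    and gen: "\<And>P. submodule R P M \<Longrightarrow> v ` {..<b} \<subseteq> P \<Longrightarrow> P = carrier M" and N: "submodule R N M"
  shows "fin_gen R M N"
proof -
  obtain S where S: "finite S" "S \<subseteq> hpart R 1" "generate_ring R (hpart R 0 \<union> S) = carrier R"
    using generated by blast
  obtain xs where "set xs = S" using finite_list[OF S(1)] by blast
  then have "leading_terms R M xs v b"
    using S v gen M graded_cring_axioms
    by (intro leading_terms.intro leading_terms_axioms.intro) auto
  then show ?thesis by (rule leading_terms.submodule_fin_gen[OF _ N])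
qed

end

subsection \<open>Existence of minimal graded free resolutions\<close>

lemma submod_finsum:
  assumes "submodule R N M" "finite A" "\<And>i. i \<in> A \<Longrightarrow> f i \<in> N"
  shows "(\<Oplus>\<^bsub>M\<^esub>i\<in>A. f i) \<in> N"
  using assms(2,3)
proof (induction A rule: finite_induct)
  interpret M: module R M by (rule submodD(1)[OF assms(1)])
  case empty then show ?case using submodD(3)[OF assms(1)] by simp
next
  interpret M: module R M by (rule submodD(1)[OF assms(1)])
  case (insert i A)
  have "(\<Oplus>\<^bsub>M\<^esub>i\<in>insert i A. f i) = f i \<oplus>\<^bsub>M\<^esub> (\<Oplus>\<^bsub>M\<^esub>i\<in>A. f i)"
    by (rule M.M.finsum_insert) (use insert submodD(2)[OF assms(1)] in auto)
  then show ?case using insert submodD(4)[OF assms(1)] by simp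
qed

definition graded_module :: "('k, 'a) gmodule \<Rightarrow> ('a, 'm) gmodule \<Rightarrow> bool" where
  "graded_module R M \<longleftrightarrow> module R M \<and> graded_group M \<and>
     (\<forall>i j. \<forall>a\<in>hpart R i. \<forall>v\<in>hpart M j. a \<odot>\<^bsub>M\<^esub> v \<in> hpart M (i + j))"

definition graded_closed :: "('a, 'm) gmodule \<Rightarrow> 'm set \<Rightarrow> bool" where
  "graded_closed M N \<longleftrightarrow> (\<forall>v\<in>N. \<forall>n. component M v n \<in> N)"

context graded_cring
begin

lemma graded_moduleD:
  assumes "graded_module R M"
  shows "module R M" "graded_group M" "a \<in> hpart R i \<Longrightarrow> v \<in> hpart M j \<Longrightarrow> a \<odot>\<^bsub>M\<^esub> v \<in> hpart M (i + j)"
  using assms by (auto simp: graded_module_def)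

lemma component_smult_homogeneous:
  assumes "graded_module R M" "a \<in> carrier R" "v \<in> hpart M s"
  shows "component M (a \<odot>\<^bsub>M\<^esub> v) n = component R a (n - s) \<odot>\<^bsub>M\<^esub> v"
  by (rule component_mult_homogeneous[OF graded_moduleD(1,2)[OF assms(1)] graded_moduleD(3)[OF assms(1)] assms(2,3)])

lemma component_hom:
  assumes M: "graded_module R M" and N: "graded_module R N" and f: "mod_hom R M N f"
    and gr: "\<And>n v. v \<in> hpart M n \<Longrightarrow> f v \<in> hpart N n" and v: "v \<in> carrier M"
  shows "component N (f v) n = f (component M v n)"
proof -
  interpret GM: graded_group M by (rule graded_moduleD(2)[OF M])
  interpret GN: graded_group N by (rule graded_moduleD(2)[OF N])
  interpret f: mod_hom R M N f by fact
  let ?S = "{n. component M v n \<noteq> \<zero>\<^bsub>M\<^esub>}"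
  have "component N (f v) = (\<lambda>n. f (component M v n))"
  proof (rule GN.component_unique[OF _ GM.component_finite[OF v]])
    show "f (component M v n) \<in> hpart N n" for n by (rule gr[OF GM.component_hpart[OF v]])
    have "f v = f (\<Oplus>\<^bsub>M\<^esub>n\<in>?S. component M v n)" using GM.component_sum[OF v] by simp
    also have "\<dots> = (\<Oplus>\<^bsub>N\<^esub>n\<in>?S. f (component M v n))"
      by (rule finsum_hom[OF f GM.component_finite[OF v]]) (use GM.component_carrier[OF v] in auto)
    finally show "f v = (\<Oplus>\<^bsub>N\<^esub>n\<in>?S. f (component M v n))" .
  qed auto
  then show ?thesis by simp
qed

text \<open>The homogeneous components of finitely many generators stay in \<open>N\<close>, are
  finite in number, and generate what the generators did.\<close>

lemma homogeneous_generators: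
  assumes M: "graded_module R M" and N: "submodule R N M" "graded_closed M N" "fin_gen R M N"
  shows "\<exists>b v s. (\<forall>j<b::nat. v j \<in> N \<and> v j \<in> hpart M (s j)) \<and>
    (\<forall>P. submodule R P M \<longrightarrow> v ` {..<b} \<subseteq> P \<longrightarrow> N \<subseteq> P)"
proof -
  interpret GM: graded_group M by (rule graded_moduleD(2)[OF M])
  obtain B where B: "finite B" "B \<subseteq> N" "\<And>P. submodule R P M \<Longrightarrow> B \<subseteq> P \<Longrightarrow> N \<subseteq> P"
    using N(3) unfolding fin_gen_def by blast
  have Bc: "g \<in> carrier M" if "g \<in> B" for g using that B(2) submodD(2)[OF N(1)] by auto
  define H where "H = (\<Union>g\<in>B. component M g ` {n. component M g n \<noteq> \<zero>\<^bsub>M\<^esub>})"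
  have "finite H" unfolding H_def using B(1) GM.component_finite Bc by auto
  then obtain ys where ys: "set ys = H" using finite_list by blast
  have H: "h \<in> N \<and> (\<exists>n. h \<in> hpart M n)" if "h \<in> H" for h
  proof -
    from that obtain g n where g: "g \<in> B" "h = component M g n" unfolding H_def by blast
    have "h \<in> N" using N(2) B(2) g unfolding graded_closed_def by auto
    moreover have "h \<in> hpart M n" unfolding g(2) by (rule GM.component_hpart[OF Bc[OF g(1)]])
    ultimately show ?thesis by blast
  qed
  have gen: "N \<subseteq> P" if P: "submodule R P M" "H \<subseteq> P" for P
  proof (rule B(3)[OF P(1)], rule subsetI)
    fix g assume g: "g \<in> B"
    show "g \<in> P"
    proof (rule GM.component_memI[OF Bc[OF g]])
      show "\<zero>\<^bsub>M\<^esub> \<in> P" by (rule submodD(3)[OF P(1)])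
      show "u \<oplus>\<^bsub>M\<^esub> v \<in> P" if "u \<in> P" "v \<in> P" for u v using submodD(4)[OF P(1)] that .
      show "component M g n \<in> P" if "component M g n \<noteq> \<zero>\<^bsub>M\<^esub>" for n
        using that g P(2) unfolding H_def by blast
    qed
  qed
  define s where "s j = (SOME n. ys ! j \<in> hpart M n)" for j
  have "ys ! j \<in> N \<and> ys ! j \<in> hpart M (s j)" if "j < length ys" for j
  proof -
    have "ys ! j \<in> H" using that ys by auto
    then show ?thesis using H unfolding s_def by (metis someI_ex)
  qed
  moreover have "(!) ys ` {..<length ys} = H" using ys by (auto simp: set_conv_nth)
  ultimately show ?thesis using gen by (intro exI[of _ "length ys"] exI[of _ "(!) ys"] exI[of _ s]) auto
qed

section \<open>Graded free modules of finite rank\<close>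

lemma free_gmod_fmod: "free_gmod R b s = fmod R \<lparr>rank = (\<lambda>_. b), degs = (\<lambda>_. s), diff = undefined\<rparr> 0"
  by (simp add: fmod_def)

lemma free_gmod_simps:
  "carrier (free_gmod R b s) = {..<b} \<rightarrow>\<^sub>E carrier R"
  "\<zero>\<^bsub>free_gmod R b s\<^esub> = \<zero>\<^bsub>func_space {..<b}\<^esub>"
  "f \<oplus>\<^bsub>free_gmod R b s\<^esub> g = f \<oplus>\<^bsub>func_space {..<b}\<^esub> g"
  "r \<odot>\<^bsub>free_gmod R b s\<^esub> g = r \<odot>\<^bsub>func_space {..<b}\<^esub> g"
  by (simp_all add: free_gmod_fmod fmod_simps)

lemma free_gmod_hpart: "hpart (free_gmod R b s) n = {f \<in> {..<b} \<rightarrow>\<^sub>E carrier R. \<forall>j<b. f j \<in> hpart R (n - s j)}"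
  by (simp add: free_gmod_def module.extend_def gmodule.fields_def)

lemma free_gmod_module: "module R (free_gmod R b s)"
  unfolding free_gmod_fmod by (rule fmod_module)

lemma free_gmod_to_func_space: "mod_hom R (free_gmod R b s) (func_space {..<b}) (\<lambda>v. v)"
  by (rule mod_homI[OF free_gmod_module func_space_is_module]) (simp_all add: free_gmod_simps func_space_simps)

lemma func_space_to_free_gmod: "mod_hom R (func_space {..<b}) (free_gmod R b s) (\<lambda>v. v)"
  by (rule mod_homI[OF func_space_is_module free_gmod_module]) (simp_all add: free_gmod_simps func_space_simps)

lemma finsum_free_gmod:
  assumes "finite J" "\<And>j. j \<in> J \<Longrightarrow> g j \<in> carrier (free_gmod R b s)" "t < b"
  shows "(\<Oplus>\<^bsub>free_gmod R b s\<^esub>j\<in>J. g j) t = (\<Oplus>j\<in>J. g j t)"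
proof -
  have "(\<Oplus>\<^bsub>free_gmod R b s\<^esub>j\<in>J. g j) = (\<Oplus>\<^bsub>func_space {..<b}\<^esub>j\<in>J. g j)"
    by (rule finsum_hom[OF free_gmod_to_func_space assms(1)]) (use assms(2) in auto)
  then show ?thesis using finsum_func_space[OF assms(1), of g "{..<b}" t] assms(2,3)
    by (simp add: free_gmod_simps func_space_simps)
qed

lemma free_gmod_expand:
  assumes "f \<in> carrier (free_gmod R b s)"
  shows "f = (\<Oplus>\<^bsub>free_gmod R b s\<^esub>j\<in>{..<b}. f j \<odot>\<^bsub>free_gmod R b s\<^esub> basis_elt R {..<b} j)"
proof -
  interpret V: module R "func_space {..<b}" by (rule func_space_is_module)
  have f: "f \<in> carrier (func_space {..<b})" using assms by (simp add: free_gmod_simps func_space_simps)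
  have fj: "f j \<in> carrier R" if "j < b" for j using f that by (auto simp: func_space_simps)
  have "f = (\<Oplus>\<^bsub>func_space {..<b}\<^esub>j\<in>{..<b}. f j \<odot>\<^bsub>func_space {..<b}\<^esub> basis_elt R {..<b} j)"
    by (rule func_space_expand[OF _ f]) simp
  also have "\<dots> = (\<Oplus>\<^bsub>free_gmod R b s\<^esub>j\<in>{..<b}. f j \<odot>\<^bsub>func_space {..<b}\<^esub> basis_elt R {..<b} j)"
    by (rule finsum_hom[OF func_space_to_free_gmod]) (use fj in \<open>auto intro!: V.smult_closed basis_elt_carrier\<close>)
  finally show ?thesis by (simp add: free_gmod_simps)
qed

lemma free_gmod_basis: "j < b \<Longrightarrow> basis_elt R {..<b} j \<in> carrier (free_gmod R b s)"
  using basis_elt_carrier[of j "{..<b}"] by (simp add: free_gmod_simps func_space_simps)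

lemma free_gmod_irrelevant:
  assumes "f \<in> carrier (free_gmod R b s)" "\<And>j. j < b \<Longrightarrow> f j \<in> irrelevant R"
  shows "f \<in> max_power R (free_gmod R b s) 1"
proof -
  have "(\<Oplus>\<^bsub>free_gmod R b s\<^esub>j\<in>{..<b}. f j \<odot>\<^bsub>free_gmod R b s\<^esub> basis_elt R {..<b} j) \<in> max_power R (free_gmod R b s) (Suc 0)"
    by (rule submod_finsum[OF max_power_submod[OF free_gmod_module]])
      (use assms(2) free_gmod_basis in \<open>auto intro!: max_power_smult_Suc[OF free_gmod_module]\<close>)
  then show ?thesis using free_gmod_expand[OF assms(1)] by simp
qed

lemma free_gmod_graded: "graded_module R (free_gmod R b s)"
proof -
  let ?F = "free_gmod R b s"
  interpret F: module R ?F by (rule free_gmod_module)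
  have car: "f \<in> carrier ?F \<longleftrightarrow> (\<forall>j<b. f j \<in> carrier R) \<and> (\<forall>j. \<not> j < b \<longrightarrow> f j = undefined)" for f
    by (auto simp: free_gmod_simps PiE_def extensional_def)
  have hp: "f \<in> hpart ?F n \<longleftrightarrow> f \<in> carrier ?F \<and> (\<forall>j<b. f j \<in> hpart R (n - s j))" for f n
    by (simp add: free_gmod_hpart free_gmod_simps)
  have ev: "\<And>f g j. j < b \<Longrightarrow> (f \<oplus>\<^bsub>?F\<^esub> g) j = f j \<oplus> g j" "\<And>r g j. j < b \<Longrightarrow> (r \<odot>\<^bsub>?F\<^esub> g) j = r \<otimes> g j"
    "\<And>j. j < b \<Longrightarrow> \<zero>\<^bsub>?F\<^esub> j = \<zero>" by (auto simp: free_gmod_simps func_space_simps)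
  have smult: "a \<odot>\<^bsub>?F\<^esub> v \<in> hpart ?F (i + j)" if "a \<in> hpart R i" "v \<in> hpart ?F j" for a v i j
  proof -
    have "a \<in> carrier R" by (rule G.hpart_carrier[OF that(1)])
    moreover have "a \<otimes> v k \<in> hpart R (i + j - s k)" if "k < b" for k
      using graded_mult[OF \<open>a \<in> hpart R i\<close>, of "v k" "j - s k"] \<open>v \<in> hpart ?F j\<close> that
      by (simp add: hp algebra_simps)
    ultimately show ?thesis using that by (simp add: hp ev)
  qed
  have sub: "subgroup (hpart ?F n) (add_monoid ?F)" for n
  proof (rule subgroup.intro)
    fix f assume f: "f \<in> hpart ?F n"
    have "(\<ominus> \<one>) \<odot>\<^bsub>?F\<^esub> f \<in> hpart ?F (0 + n)" by (rule smult[OF G.hpart_uminus[OF one_hpart] f])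
    then show "inv\<^bsub>add_monoid ?F\<^esub> f \<in> hpart ?F n"
      using f by (simp add: hp F.smult_l_minus a_inv_def[symmetric])
  qed (auto simp: hp ev G.hpart_add G.hpart_zero)
  have "grading ?F"
    unfolding grading_def
  proof (intro conjI allI ballI)
    fix f assume f: "f \<in> carrier ?F"
    have fj: "f j \<in> carrier R" if "j < b" for j using f that by (simp add: car)
    \<comment> \<open>The basis vector \<open>j\<close> has degree \<open>s j\<close>, so the part
      of degree \<open>n\<close> has in coordinate \<open>j\<close> the component of degree
      \<open>n - s j\<close>.\<close>
    define c where "c n = (\<lambda>j\<in>{..<b}. component R (f j) (n - s j))" for n
    have cc: "c n \<in> carrier ?F" for n using G.component_carrier[OF fj] by (simp add: c_def car)
    have c0: "c n = \<zero>\<^bsub>?F\<^esub> \<longleftrightarrow> (\<forall>j<b. component R (f j) (n - s j) = \<zero>)" for n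
      by (auto simp: c_def free_gmod_simps func_space_simps fun_eq_iff restrict_def)
    let ?S = "{n. c n \<noteq> \<zero>\<^bsub>?F\<^esub>}"
    have "?S \<subseteq> (\<Union>j\<in>{..<b}. (\<lambda>n. n + s j) ` {n. component R (f j) n \<noteq> \<zero>})"
    proof
      fix n assume "n \<in> ?S"
      then obtain j where j: "j < b" "component R (f j) (n - s j) \<noteq> \<zero>" by (auto simp: c0)
      then have "n \<in> (\<lambda>n. n + s j) ` {n. component R (f j) n \<noteq> \<zero>}"
        by (intro image_eqI[of _ _ "n - s j"]) auto
      then show "n \<in> (\<Union>j\<in>{..<b}. (\<lambda>n. n + s j) ` {n. component R (f j) n \<noteq> \<zero>})" using j(1) by blast
    qed
    then have fin: "finite ?S" by (rule finite_subset) (use G.component_finite[OF fj] in auto)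
    have sum_at: "(\<Oplus>n\<in>(\<lambda>n. n - s j) ` S. component R (f j) n) = (\<Oplus>n\<in>S. c n j)" if "j < b" "finite S" for j S
      using that G.component_carrier[OF fj[OF that(1)]]
      by (subst add.finprod_reindex) (auto simp: inj_on_def c_def)
    have "f = (\<Oplus>\<^bsub>?F\<^esub>n\<in>?S. c n)"
    proof
      fix j
      have s: "(\<Oplus>\<^bsub>?F\<^esub>n\<in>?S. c n) \<in> carrier ?F" using cc by (intro F.M.finsum_closed) auto
      show "f j = (\<Oplus>\<^bsub>?F\<^esub>n\<in>?S. c n) j"
      proof (cases "j < b")
        case True
        have "(\<Oplus>\<^bsub>?F\<^esub>n\<in>?S. c n) j = (\<Oplus>n\<in>?S. c n j)" by (rule finsum_free_gmod[OF fin]) (use cc True in auto)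
        also have "\<dots> = (\<Oplus>n\<in>(\<lambda>n. n - s j) ` ?S. component R (f j) n)" by (rule sum_at[OF True fin, symmetric])
        also have "\<dots> = f j"
        proof (rule G.component_sum_superset[OF fj[OF True]])
          show "{n. component R (f j) n \<noteq> \<zero>} \<subseteq> (\<lambda>n. n - s j) ` ?S"
          proof
            fix n assume "n \<in> {n. component R (f j) n \<noteq> \<zero>}"
            then have "n + s j \<in> ?S" using True by (auto simp: c0)
            then show "n \<in> (\<lambda>n. n - s j) ` ?S" by (rule rev_image_eqI) simp
          qed
        qed (use fin in simp)
        finally show ?thesis by simp
      next
        case False then show ?thesis using f s by (simp add: car)
      qed
    qed
    moreover have "c n \<in> hpart ?F n" for n using cc G.component_hpart[OF fj] by (simp add: hp) (simp add: c_def)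
    ultimately have "(\<forall>n. c n \<in> hpart ?F n) \<and> finite ?S \<and> f = (\<Oplus>\<^bsub>?F\<^esub>n\<in>?S. c n)" using fin by blast
    moreover have "c' = c" if c': "(\<forall>n. c' n \<in> hpart ?F n) \<and> finite {n. c' n \<noteq> \<zero>\<^bsub>?F\<^esub>} \<and> f = (\<Oplus>\<^bsub>?F\<^esub>n\<in>{n. c' n \<noteq> \<zero>\<^bsub>?F\<^esub>}. c' n)" for c'
    proof (intro ext)
      fix n j
      let ?S' = "{n. c' n \<noteq> \<zero>\<^bsub>?F\<^esub>}"
      have cc': "c' n \<in> carrier ?F" for n using c' by (simp add: hp)
      show "c' n j = c n j"
      proof (cases "j < b")
        case True
        have "f j = (\<Oplus>n\<in>?S'. c' n j)"
          using finsum_free_gmod[of ?S' c' b s j] c' cc' True by simp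
        also have "\<dots> = (\<Oplus>n\<in>(\<lambda>n. n - s j) ` ?S'. c' (n + s j) j)"
          using cc' True by (subst add.finprod_reindex) (auto simp: inj_on_def car)
        finally have sum: "f j = (\<Oplus>n\<in>(\<lambda>n. n - s j) ` ?S'. c' (n + s j) j)" .
        have "component R (f j) = (\<lambda>n. c' (n + s j) j)"
        proof (rule G.component_unique[OF _ _ _ sum])
          show "c' (n + s j) j \<in> hpart R n" for n
          proof -
            have "c' (n + s j) \<in> hpart ?F (n + s j)" using c' by blast
            then show ?thesis using True by (simp add: hp) (metis add_diff_cancel_right')
          qed
          show "c' (n + s j) j = \<zero>" if "n \<notin> (\<lambda>n. n - s j) ` ?S'" for n
          proof -
            have "n + s j \<notin> ?S'" using that by (metis add_diff_cancel_right' imageI)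
            then show ?thesis using ev(3)[OF True] by simp
          qed
        qed (use c' in simp)
        then show ?thesis using True by (simp add: c_def)
      next
        case False then show ?thesis using cc'[of n] cc[of n] by (simp add: car)
      qed
    qed
    ultimately show "\<exists>!c. (\<forall>n. c n \<in> hpart ?F n) \<and> finite {n. c n \<noteq> \<zero>\<^bsub>?F\<^esub>} \<and> f = (\<Oplus>\<^bsub>?F\<^esub>n\<in>{n. c n \<noteq> \<zero>\<^bsub>?F\<^esub>}. c n)"
      by (intro ex1I[of _ c])
  qed (rule sub)
  then show ?thesis
    using smult F.module_axioms F.M.abelian_group_axioms
    by (auto simp: graded_module_def graded_group_def graded_group_axioms_def)
qed

lemma free_gmod_fin_gen:
  assumes "submodule R N (free_gmod R b s)" shows "fin_gen R (free_gmod R b s) N"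
proof (rule noetherian[OF free_gmod_module _ _ assms, of b "basis_elt R {..<b}"])
  fix P assume P: "submodule R P (free_gmod R b s)" "basis_elt R {..<b} ` {..<b} \<subseteq> P"
  have "f \<in> P" if f: "f \<in> carrier (free_gmod R b s)" for f
  proof -
    have "f j \<in> carrier R" if "j < b" for j using f that by (auto simp: free_gmod_simps)
    then have "(\<Oplus>\<^bsub>free_gmod R b s\<^esub>j\<in>{..<b}. f j \<odot>\<^bsub>free_gmod R b s\<^esub> basis_elt R {..<b} j) \<in> P"
      using P(2) by (intro submod_finsum[OF P(1)] submodD(5)[OF P(1)]) auto
    then show ?thesis using free_gmod_expand[OF f] by simp
  qed
  then show "P = carrier (free_gmod R b s)" using submodD(2)[OF P(1)] by auto
qed (rule free_gmod_basis)

text \<open>Homogeneous generators are taken in the least possible number. A relation with a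
  coefficient outside the irrelevant ideal has there a nonzero component of degree 0, which is
  invertible, and its part of the right degree would express one generator by the others.\<close>

lemma minimal_presentation:
  fixes M :: "('a, 'm) gmodule"
  assumes M: "graded_module R M" and N: "submodule R N M" "graded_closed M N" "fin_gen R M N"
  shows "\<exists>b s f. f \<in> graded_hom R (free_gmod R b s) M \<and> f ` carrier (free_gmod R b s) = N \<and>
    {z \<in> carrier (free_gmod R b s). f z = \<zero>\<^bsub>M\<^esub>} \<subseteq> max_power R (free_gmod R b s) 1"
proof -
  interpret M: module R M by (rule graded_moduleD(1)[OF M])
  interpret GM: graded_group M by (rule graded_moduleD(2)[OF M])
  define Q where "Q b v s \<longleftrightarrow> (\<forall>j<b::nat. v j \<in> N \<and> v j \<in> hpart M (s j)) \<and>
    (\<forall>P. submodule R P M \<longrightarrow> v ` {..<b} \<subseteq> P \<longrightarrow> N \<subseteq> P)" for b and v :: "nat \<Rightarrow> 'm" and s :: "nat \<Rightarrow> int"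
  define b where "b = (LEAST b. \<exists>v s. Q b v s)"
  have "\<exists>b v s. Q b v s" using homogeneous_generators[OF M N] unfolding Q_def by blast
  then have "\<exists>v s. Q b v s" unfolding b_def by (rule LeastI_ex)
  then obtain v s where vs: "Q b v s" by blast
  have minimal: "\<not> Q b' v' s'" if "b' < b" for b' v' s' using not_less_Least[OF that[unfolded b_def]] by blast
  have vN: "v j \<in> N" and vh: "v j \<in> hpart M (s j)" if "j < b" for j using vs that unfolding Q_def by auto
  have vc: "v j \<in> carrier M" if "j < b" for j using vN[OF that] submodD(2)[OF N(1)] by auto
  have vgen: "N \<subseteq> P" if "submodule R P M" "v ` {..<b} \<subseteq> P" for P using vs that unfolding Q_def by blast
  let ?F = "free_gmod R b s"
  interpret F: module R ?F by (rule free_gmod_module)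
  define f where "f z = (\<Oplus>\<^bsub>M\<^esub>j\<in>{..<b}. z j \<odot>\<^bsub>M\<^esub> v j)" for z
  have zc: "z j \<in> carrier R" if "z \<in> carrier ?F" "j < b" for z j using that by (auto simp: free_gmod_simps)
  have f: "mod_hom R ?F M f"
  proof -
    have "mod_hom R (func_space {..<b}) M f"
      unfolding f_def by (rule finsum_lin_hom[OF M.module_axioms]) (use vc in auto)
    from mod_hom_comp[OF free_gmod_to_func_space this] show ?thesis .
  qed
  have gr: "f z \<in> hpart M n" if "z \<in> hpart ?F n" for z n
    unfolding f_def
  proof (rule GM.hpart_finsum)
    fix j assume j: "j \<in> {..<b}"
    have "z j \<in> hpart R (n - s j)" using that j by (simp add: free_gmod_hpart)
    then show "z j \<odot>\<^bsub>M\<^esub> v j \<in> hpart M n" using graded_moduleD(3)[OF M _ vh, of "z j" "n - s j" j] j by simp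
  qed simp
  have "f ` carrier ?F = N"
  proof
    show "f ` carrier ?F \<subseteq> N"
      using zc vN unfolding f_def by (auto intro!: submod_finsum[OF N(1)] submodD(5)[OF N(1)])
    have "v j = f (basis_elt R {..<b} j)" if j: "j < b" for j
    proof -
      have "f (basis_elt R {..<b} j) = (\<Oplus>\<^bsub>M\<^esub>i\<in>{..<b}. if j = i then v i else \<zero>\<^bsub>M\<^esub>)"
        unfolding f_def by (rule M.M.finsum_cong') (use vc in \<open>auto simp: basis_elt_def\<close>)
      also have "\<dots> = v j" using j vc by (intro M.M.add.finprod_singleton) auto
      finally show ?thesis by simp
    qed
    then have "v ` {..<b} \<subseteq> f ` carrier ?F" using free_gmod_basis by auto
    then show "N \<subseteq> f ` carrier ?F"
      by (rule vgen[OF submod_image[OF f submod_carrier[OF F.module_axioms]]])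
  qed
  moreover have "z \<in> max_power R ?F 1" if z: "z \<in> carrier ?F" "f z = \<zero>\<^bsub>M\<^esub>" for z
  proof (rule free_gmod_irrelevant[OF z(1)], rule ccontr)
    fix k assume k: "k < b" and zk: "z k \<notin> irrelevant R"
    let ?c = "component R (z k) 0"
    have "?c \<noteq> \<zero>" using zk zc[OF z(1) k] by (simp add: irrelevant_iff)
    moreover have ch: "?c \<in> hpart R 0" by (rule G.component_hpart[OF zc[OF z(1) k]])
    ultimately obtain d where d: "d \<in> hpart R 0" "d \<otimes> ?c = \<one>" using zero_part_inverse by blast
    have dc: "d \<in> carrier R" "?c \<in> carrier R" using d(1) ch G.hpart_carrier by auto
    \<comment> \<open>The part of the relation in degree \<open>s k\<close>: the coefficient of
      \<open>v k\<close> becomes the unit \<open>?c\<close>, that of \<open>v j\<close> the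
      component of degree \<open>s k - s j\<close>.\<close>
    let ?g = "\<lambda>j. component R (z j) (s k - s j) \<odot>\<^bsub>M\<^esub> v j"
    have gc: "?g j \<in> carrier M" if "j < b" for j using that vc G.component_carrier[OF zc[OF z(1)]] by auto
    have "component M (f z) (s k) = (\<Oplus>\<^bsub>M\<^esub>j\<in>{..<b}. component M (z j \<odot>\<^bsub>M\<^esub> v j) (s k))"
      unfolding f_def by (rule GM.component_finsum) (use vc zc[OF z(1)] in auto)
    also have "\<dots> = (\<Oplus>\<^bsub>M\<^esub>j\<in>{..<b}. ?g j)"
      by (rule M.M.finsum_cong') (use gc component_smult_homogeneous[OF M zc[OF z(1)] vh] in auto)
    finally have sum0: "(\<Oplus>\<^bsub>M\<^esub>j\<in>{..<b}. ?g j) = \<zero>\<^bsub>M\<^esub>" using z(2) GM.component_zero by simp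
    have "{..<b} = insert k ({..<b} - {k})" using k by auto
    then have "(\<Oplus>\<^bsub>M\<^esub>j\<in>{..<b}. ?g j) = (\<Oplus>\<^bsub>M\<^esub>j\<in>insert k ({..<b} - {k}). ?g j)" by simp
    also have "\<dots> = ?g k \<oplus>\<^bsub>M\<^esub> (\<Oplus>\<^bsub>M\<^esub>j\<in>{..<b} - {k}. ?g j)"
      by (rule M.M.finsum_insert) (use gc gc[OF k] k in auto)
    finally have split: "?g k \<oplus>\<^bsub>M\<^esub> (\<Oplus>\<^bsub>M\<^esub>j\<in>{..<b} - {k}. ?g j) = \<zero>\<^bsub>M\<^esub>" using sum0 by simp
    let ?r = "\<Oplus>\<^bsub>M\<^esub>j\<in>{..<b} - {k}. ?g j"
    have rc: "?r \<in> carrier M" by (rule M.M.finsum_closed) (use gc in auto)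
    have gk: "?c \<odot>\<^bsub>M\<^esub> v k = \<ominus>\<^bsub>M\<^esub> ?r"
      using M.M.minus_equality[OF split rc gc[OF k]] gc[OF k] by simp
    have drop: "v k \<in> P" if P: "submodule R P M" "v ` ({..<b} - {k}) \<subseteq> P" for P
    proof -
      have "?r \<in> P"
        by (rule submod_finsum[OF P(1)])
          (use P(2) G.component_carrier[OF zc[OF z(1)]] in \<open>auto intro!: submodD(5)[OF P(1)]\<close>)
      then have "d \<odot>\<^bsub>M\<^esub> (?c \<odot>\<^bsub>M\<^esub> v k) \<in> P"
        unfolding gk using submod_uminus[OF P(1)] submodD(5)[OF P(1) dc(1)] by blast
      then show ?thesis using d dc vc[OF k] by (simp add: M.smult_assoc1[symmetric])
    qed
    \<comment> \<open>Generator \<open>k\<close> is dropped by moving the last one into its place,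
      so that the indices are again an initial segment.\<close>
    define v' where "v' = v(k := v (b - 1))"
    define s' where "s' = s(k := s (b - 1))"
    have "Q (b - 1) v' s'"
      unfolding Q_def
    proof (intro conjI allI impI)
      fix j assume "j < b - 1"
      then show "v' j \<in> N" "v' j \<in> hpart M (s' j)" using vN vh by (auto simp: v'_def s'_def)
    next
      fix P assume P: "submodule R P M" "v' ` {..<b - 1} \<subseteq> P"
      have "v ` ({..<b} - {k}) \<subseteq> P"
      proof
        fix w assume "w \<in> v ` ({..<b} - {k})"
        then obtain j where j: "j < b" "j \<noteq> k" "w = v j" by auto
        show "w \<in> P"
        proof (cases "j = b - 1")
          case True
          then have "k < b - 1" "w = v' k" using j k by (auto simp: v'_def)
          then show ?thesis using P(2) by auto
        next
          case False
          then have "j < b - 1" "w = v' j" using j by (auto simp: v'_def)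
          then show ?thesis using P(2) by auto
        qed
      qed
      then have "v ` {..<b} \<subseteq> P" using drop[OF P(1)] by auto
      then show "N \<subseteq> P" by (rule vgen[OF P(1)])
    qed
    then show False using minimal[of "b - 1"] k by auto
  qed
  moreover have "f \<in> graded_hom R ?F M"
    using gr mod_hom.f_hom[OF f] by (auto simp: graded_hom_def)
  ultimately show ?thesis by (intro exI[of _ b] exI[of _ s] exI[of _ f]) auto
qed

lemma kernel_graded_closed:
  assumes M: "graded_module R M" and f: "f \<in> graded_hom R (free_gmod R b s) M"
  shows "submodule R {z \<in> carrier (free_gmod R b s). f z = \<zero>\<^bsub>M\<^esub>} (free_gmod R b s)"
    and "graded_closed (free_gmod R b s) {z \<in> carrier (free_gmod R b s). f z = \<zero>\<^bsub>M\<^esub>}"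
proof -
  interpret GM: graded_group M by (rule graded_moduleD(2)[OF M])
  interpret GF: graded_group "free_gmod R b s" by (rule graded_moduleD(2)[OF free_gmod_graded])
  have fh: "mod_hom R (free_gmod R b s) M f"
    using f free_gmod_module graded_moduleD(1)[OF M] by (simp add: graded_hom_def mod_hom_def mod_hom_axioms_def)
  show "submodule R {z \<in> carrier (free_gmod R b s). f z = \<zero>\<^bsub>M\<^esub>} (free_gmod R b s)" by (rule submod_kernel[OF fh])
  have gr: "f v \<in> hpart M n" if "v \<in> hpart (free_gmod R b s) n" for v n
    using f that by (auto simp: graded_hom_def)
  show "graded_closed (free_gmod R b s) {z \<in> carrier (free_gmod R b s). f z = \<zero>\<^bsub>M\<^esub>}"
    unfolding graded_closed_def
    using component_hom[OF free_gmod_graded M fh gr, symmetric] GM.component_zero GF.component_carrier by auto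
qed

text \<open>Iterated minimal presentations: each kernel is closed under components and, by the
  Noetherian property of free modules, finitely generated, so it can be presented again.\<close>

theorem min_free_resolution_exists:
  fixes M :: "('a, 'm) gmodule"
  assumes M: "graded_module R M" and fg: "fin_gen R M (carrier M)"
  shows "\<exists>F. min_free_resolution R M F"
proof -
  interpret GM: graded_group M by (rule graded_moduleD(2)[OF M])
  have "graded_closed M (carrier M)" by (simp add: graded_closed_def GM.component_carrier)
  from minimal_presentation[OF M submod_carrier[OF graded_moduleD(1)[OF M]] this fg]
  obtain b0 s0 e where e: "e \<in> graded_hom R (free_gmod R b0 s0) M" "e ` carrier (free_gmod R b0 s0) = carrier M"
    "{z \<in> carrier (free_gmod R b0 s0). e z = \<zero>\<^bsub>M\<^esub>} \<subseteq> max_power R (free_gmod R b0 s0) 1" by blast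
  \<comment> \<open>A state consists of the rank, the degrees and the kernel \<open>N\<close> still
    to be resolved; the first one is tied to the presentation \<open>e\<close> of \<open>M\<close>.
    Minimality is the containment of \<open>N\<close> in the maximal ideal times the free
    module.\<close>
  let ?P = "\<lambda>i (b, s, N). submodule R N (free_gmod R b s) \<and> graded_closed (free_gmod R b s) N \<and>
    N \<subseteq> max_power R (free_gmod R b s) 1 \<and>
    (i = 0 \<longrightarrow> b = b0 \<and> s = s0 \<and> N = {z \<in> carrier (free_gmod R b0 s0). e z = \<zero>\<^bsub>M\<^esub>})"
  let ?Q = "\<lambda>(b, s, N) (b', s', N'). \<exists>f. f \<in> graded_hom R (free_gmod R b' s') (free_gmod R b s) \<and>
    f ` carrier (free_gmod R b' s') = N \<and> N' = {z \<in> carrier (free_gmod R b' s'). f z = \<zero>\<^bsub>free_gmod R b s\<^esub>}"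
  have "\<exists>st. \<forall>i::nat. ?P i (st i) \<and> ?Q (st i) (st (Suc i))"
  proof (rule dependent_nat_choice)
    show "\<exists>st. ?P 0 st"
      by (rule exI[of _ "(b0, s0, {z \<in> carrier (free_gmod R b0 s0). e z = \<zero>\<^bsub>M\<^esub>})"])
        (use e kernel_graded_closed[OF M e(1)] in simp)
  next
    fix st and i :: nat assume P: "?P i st"
    obtain b s N where st: "st = (b, s, N)" by (cases st)
    have N: "submodule R N (free_gmod R b s)" "graded_closed (free_gmod R b s) N" using P by (auto simp: st)
    from minimal_presentation[OF free_gmod_graded N free_gmod_fin_gen[OF N(1)]]
    obtain b' s' f where f: "f \<in> graded_hom R (free_gmod R b' s') (free_gmod R b s)"
      "f ` carrier (free_gmod R b' s') = N"
      "{z \<in> carrier (free_gmod R b' s'). f z = \<zero>\<^bsub>free_gmod R b s\<^esub>} \<subseteq> max_power R (free_gmod R b' s') 1" by blast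
    show "\<exists>st'. ?P (Suc i) st' \<and> ?Q st st'"
      by (rule exI[of _ "(b', s', {z \<in> carrier (free_gmod R b' s'). f z = \<zero>\<^bsub>free_gmod R b s\<^esub>})"])
        (use f kernel_graded_closed[OF free_gmod_graded f(1)] in \<open>auto simp: st\<close>)
  qed
  then obtain st where all: "\<forall>i. ?P i (st i) \<and> ?Q (st i) (st (Suc i))" by (rule exE)
  note st = all[THEN spec, THEN conjunct1] all[THEN spec, THEN conjunct2]
  define b where "b i = fst (st i)" for i
  define s where "s i = fst (snd (st i))" for i
  define N where "N i = snd (snd (st i))" for i
  have st_eq: "st i = (b i, s i, N i)" for i by (simp add: b_def s_def N_def)
  have P: "N i \<subseteq> max_power R (free_gmod R (b i) (s i)) 1" for i using st(1)[of i] by (simp add: st_eq)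
  have P0: "b 0 = b0" "s 0 = s0" "N 0 = {z \<in> carrier (free_gmod R b0 s0). e z = \<zero>\<^bsub>M\<^esub>}"
    using st(1)[of 0] by (simp_all add: st_eq)
  have ex: "\<forall>i. \<exists>f. f \<in> graded_hom R (free_gmod R (b (Suc i)) (s (Suc i))) (free_gmod R (b i) (s i)) \<and>
    f ` carrier (free_gmod R (b (Suc i)) (s (Suc i))) = N i \<and>
    N (Suc i) = {z \<in> carrier (free_gmod R (b (Suc i)) (s (Suc i))). f z = \<zero>\<^bsub>free_gmod R (b i) (s i)\<^esub>}"
    using st(2) by (simp add: st_eq)
  from choice[OF ex] obtain f where all_f: "\<forall>i. f i \<in> graded_hom R (free_gmod R (b (Suc i)) (s (Suc i))) (free_gmod R (b i) (s i)) \<and>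
    f i ` carrier (free_gmod R (b (Suc i)) (s (Suc i))) = N i \<and>
    N (Suc i) = {z \<in> carrier (free_gmod R (b (Suc i)) (s (Suc i))). f i z = \<zero>\<^bsub>free_gmod R (b i) (s i)\<^esub>}"
    by (rule exE)
  note f = all_f[THEN spec, THEN conjunct1] all_f[THEN spec, THEN conjunct2, THEN conjunct1]
    all_f[THEN spec, THEN conjunct2, THEN conjunct2]
  \<comment> \<open>The map \<open>f i\<close> starts in homological degree \<open>Suc i\<close>,
    hence the shift of index in \<open>diff\<close>.\<close>
  define F where "F = \<lparr>rank = b, degs = s, diff = (\<lambda>i. f (i - 1))\<rparr>"
  have FF: "fmod R F i = free_gmod R (b i) (s i)" "diff F (Suc i) = f i" for i by (simp_all add: fmod_def F_def)
  have bd: "boundaries (fmod R F) (diff F) i = N i" for i by (simp add: boundaries_def FF f(2))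
  have cy: "cycles (fmod R F) (diff F) (Suc i) = N (Suc i)" for i by (simp add: cycles_def FF f(3))
  show ?thesis
    unfolding min_free_resolution_def
    by (rule exI[of _ F]) (use e P P0 f(1) in \<open>auto simp: FF bd cy\<close>)
qed

end

subsection \<open>Homogeneous ideals and their quotients as graded modules\<close>

lemma ring_mod_simps:
  "carrier (ring_mod R) = carrier R" "\<zero>\<^bsub>ring_mod R\<^esub> = \<zero>\<^bsub>R\<^esub>"
  "a \<oplus>\<^bsub>ring_mod R\<^esub> b = a \<oplus>\<^bsub>R\<^esub> b" "a \<odot>\<^bsub>ring_mod R\<^esub> b = a \<otimes>\<^bsub>R\<^esub> b"
  "hpart (ring_mod R) n = hpart R n"
  by (simp_all add: ring_mod_def)

lemma ideal_mod_simps: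
  "carrier (ideal_mod R J) = J" "\<zero>\<^bsub>ideal_mod R J\<^esub> = \<zero>\<^bsub>R\<^esub>"
  "a \<oplus>\<^bsub>ideal_mod R J\<^esub> b = a \<oplus>\<^bsub>R\<^esub> b" "a \<odot>\<^bsub>ideal_mod R J\<^esub> b = a \<otimes>\<^bsub>R\<^esub> b"
  "hpart (ideal_mod R J) n = J \<inter> hpart R n"
  by (simp_all add: ideal_mod_def ring_mod_def)

lemma (in irrelevant_cring) ring_mod_module: "module R (ring_mod R)"
  by (rule module_criteria) (auto simp: ring_mod_simps is_cring a_ac m_assoc l_distr r_distr r_neg intro: bexI[of _ "\<ominus> _"])

lemma (in irrelevant_cring) submodule_ring_mod_iff: "submodule R J (ring_mod R) \<longleftrightarrow> ideal J R"
proof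
  assume J: "submodule R J (ring_mod R)"
  note d = submodD[OF J, unfolded ring_mod_simps]
  show "ideal J R"
  proof (rule idealI)
    show "subgroup J (add_monoid R)"
    proof (rule subgroup.intro)
      fix a assume a: "a \<in> J"
      then have "\<ominus> \<one> \<otimes> a \<in> J" using d(5)[of "\<ominus> \<one>" a] by simp
      then show "inv\<^bsub>add_monoid R\<^esub> a \<in> J" using a d(2) by (auto simp: a_inv_def[symmetric] l_minus)
    qed (use d in auto)
    show "x \<otimes> a \<in> J" if "a \<in> J" "x \<in> carrier R" for a x using d(5) that by simp
    show "a \<otimes> x \<in> J" if "a \<in> J" "x \<in> carrier R" for a x
      using d(5)[of x a] d(2) that m_comm[of a x] by auto
  qed (rule ring_axioms)
next
  assume J: "ideal J R"
  interpret J: ideal J R by fact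
  show "submodule R J (ring_mod R)"
    by (rule submodI[OF ring_mod_module]) (use J.a_subset J.I_l_closed in \<open>auto simp: ring_mod_simps\<close>)
qed

lemma (in irrelevant_cring) ideal_mod_module:
  assumes "ideal J R" shows "module R (ideal_mod R J)"
proof -
  have J: "submodule R J (ring_mod R)" using assms by (simp add: submodule_ring_mod_iff)
  show ?thesis
    by (rule module_image(1)[where f = "\<lambda>v. v", OF submod_module[OF J]]) (simp_all add: ideal_mod_simps ring_mod_simps)
qed

lemma (in irrelevant_cring) ideal_mod_inclusion:
  assumes "ideal J R" "ideal J' R" "J \<subseteq> J'" shows "mod_hom R (ideal_mod R J) (ideal_mod R J') (\<lambda>v. v)"
  by (rule mod_homI[OF ideal_mod_module[OF assms(1)] ideal_mod_module[OF assms(2)]])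
    (use assms(3) in \<open>auto simp: ideal_mod_simps\<close>)

lemma (in irrelevant_cring) ideal_mod_ring_mod:
  assumes "ideal J R" shows "mod_hom R (ideal_mod R J) (ring_mod R) (\<lambda>v. v)"
  by (rule mod_homI[OF ideal_mod_module[OF assms] ring_mod_module])
    (use ideal.Icarr[OF assms] in \<open>auto simp: ideal_mod_simps ring_mod_simps\<close>)

lemma ring_mod_finsum: "finsum (ring_mod R) f A = finsum R f A"
  by (simp add: finsum_def finprod_def ring_mod_def)

lemma ring_mod_subgroup: "subgroup H (add_monoid (ring_mod R)) \<longleftrightarrow> subgroup H (add_monoid R)"
  by (simp add: subgroup_def m_inv_def ring_mod_def)

lemma component_ring_mod: "component (ring_mod R) = component R"
  by (intro ext) (simp add: component_def ring_mod_simps ring_mod_finsum)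

lemma submodule_ideal_modI:
  assumes "submodule R P (ideal_mod R J)" "module R (ring_mod R)" "J \<subseteq> carrier R"
  shows "submodule R P (ring_mod R)"
  using submodD[OF assms(1)] assms(2,3)
  by (intro submodI) (auto simp: ideal_mod_simps ring_mod_simps)

context graded_cring
begin

lemma ring_mod_graded: "graded_module R (ring_mod R)"
proof -
  interpret M: module R "ring_mod R" by (rule ring_mod_module)
  have "grading (ring_mod R)"
    using graded unfolding grading_def ring_mod_subgroup by (simp add: ring_mod_simps ring_mod_finsum)
  then show ?thesis
    using M.module_axioms M.M.abelian_group_axioms graded_mult
    by (auto simp: graded_module_def graded_group_def graded_group_axioms_def ring_mod_simps)
qed

lemma component_mult:
  assumes "a \<in> carrier R" "x \<in> hpart R s"
  shows "component R (a \<otimes> x) n = component R a (n - s) \<otimes> x"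
  using component_smult_homogeneous[OF ring_mod_graded assms(1), of x s n] assms(2)
  by (simp add: ring_mod_simps component_ring_mod)

lemma ideal_mod_finsum:
  assumes "ideal J R" "finite A" "f \<in> A \<rightarrow> J"
  shows "finsum (ideal_mod R J) f A = finsum R f A"
  using finsum_hom[OF ideal_mod_ring_mod[OF assms(1)] assms(2), of f] assms(3)
  by (simp add: ideal_mod_simps ring_mod_finsum)

text \<open>If the ideal is graded by its intersections with the parts of \<open>R\<close>,
  uniqueness of decompositions in \<open>R\<close> identifies both notions of component; conversely
  the components in \<open>R\<close> provide the grading.\<close>

lemma homogeneous_ideal_iff:
  "homogeneous_ideal R J \<longleftrightarrow> ideal J R \<and> (\<forall>a\<in>J. \<forall>n. component R a n \<in> J)"
proof (intro iffI conjI ballI allI)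
  assume H: "homogeneous_ideal R J"
  then show J: "ideal J R" by (simp add: homogeneous_ideal_def)
  fix a n assume a: "a \<in> J"
  interpret M: module R "ideal_mod R J" by (rule ideal_mod_module[OF J])
  interpret M: graded_group "ideal_mod R J"
    using H M.M.abelian_group_axioms by (simp add: graded_group_def graded_group_axioms_def homogeneous_ideal_def)
  have ac: "a \<in> carrier (ideal_mod R J)" using a by (simp add: ideal_mod_simps)
  let ?c = "component (ideal_mod R J) a"
  have "component R a = ?c"
  proof (rule G.component_unique)
    show "?c n \<in> hpart R n" for n using M.component_hpart[OF ac] by (simp add: ideal_mod_simps)
    show fin: "finite {n. ?c n \<noteq> \<zero>}" using M.component_finite[OF ac] by (simp add: ideal_mod_simps)
    have "a = (\<Oplus>\<^bsub>ideal_mod R J\<^esub>n\<in>{n. ?c n \<noteq> \<zero>}. ?c n)" using M.component_sum[OF ac] by (simp add: ideal_mod_simps)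
    also have "\<dots> = (\<Oplus>n\<in>{n. ?c n \<noteq> \<zero>}. ?c n)"
      by (rule ideal_mod_finsum[OF J fin]) (use M.component_carrier[OF ac] in \<open>auto simp: ideal_mod_simps\<close>)
    finally show "a = (\<Oplus>n\<in>{n. ?c n \<noteq> \<zero>}. ?c n)" .
  qed auto
  then show "component R a n \<in> J" using M.component_carrier[OF ac] by (simp add: ideal_mod_simps)
next
  assume H: "ideal J R \<and> (\<forall>a\<in>J. \<forall>n. component R a n \<in> J)"
  then have J: "ideal J R" by simp
  interpret J: ideal J R by (rule J)
  have "grading (ideal_mod R J)"
    unfolding grading_def
  proof (intro conjI allI ballI)
    show "subgroup (hpart (ideal_mod R J) n) (add_monoid (ideal_mod R J))" for n
    proof (rule subgroup.intro)
      fix a assume a: "a \<in> hpart (ideal_mod R J) n"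
      interpret M: module R "ideal_mod R J" by (rule ideal_mod_module[OF J])
      have "(\<ominus> \<one>) \<odot>\<^bsub>ideal_mod R J\<^esub> a = \<ominus>\<^bsub>ideal_mod R J\<^esub> a"
        by (rule M.smult_minus_1) (use a in \<open>simp add: ideal_mod_simps\<close>)
      moreover have "(\<ominus> \<one>) \<odot>\<^bsub>ideal_mod R J\<^esub> a = \<ominus> a"
        using a J.Icarr by (auto simp: ideal_mod_simps l_minus)
      moreover have "\<ominus> a \<in> J \<inter> hpart R n" using a G.hpart_uminus by (auto simp: ideal_mod_simps)
      moreover have "inv\<^bsub>add_monoid (ideal_mod R J)\<^esub> a = \<ominus>\<^bsub>ideal_mod R J\<^esub> a" by (simp only: a_inv_def)
      ultimately show "inv\<^bsub>add_monoid (ideal_mod R J)\<^esub> a \<in> hpart (ideal_mod R J) n"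
        by (simp only: ideal_mod_simps(5))
    qed (auto simp: ideal_mod_simps G.hpart_add G.hpart_zero)
    fix a assume "a \<in> carrier (ideal_mod R J)"
    then have a: "a \<in> J" "a \<in> carrier R" using J.Icarr by (auto simp: ideal_mod_simps)
    let ?c = "component R a"
    have fin: "finite {n. ?c n \<noteq> \<zero>}" by (rule G.component_finite[OF a(2)])
    show "\<exists>!c. (\<forall>n. c n \<in> hpart (ideal_mod R J) n) \<and> finite {n. c n \<noteq> \<zero>\<^bsub>ideal_mod R J\<^esub>} \<and>
        a = (\<Oplus>\<^bsub>ideal_mod R J\<^esub>n\<in>{n. c n \<noteq> \<zero>\<^bsub>ideal_mod R J\<^esub>}. c n)"
    proof (rule ex1I[of _ ?c])
      have "(\<Oplus>\<^bsub>ideal_mod R J\<^esub>n\<in>{n. ?c n \<noteq> \<zero>}. ?c n) = a"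
        using ideal_mod_finsum[OF J fin, of ?c] H a G.component_sum[OF a(2)] by auto
      then show "(\<forall>n. ?c n \<in> hpart (ideal_mod R J) n) \<and> finite {n. ?c n \<noteq> \<zero>\<^bsub>ideal_mod R J\<^esub>} \<and>
          a = (\<Oplus>\<^bsub>ideal_mod R J\<^esub>n\<in>{n. ?c n \<noteq> \<zero>\<^bsub>ideal_mod R J\<^esub>}. ?c n)"
        using fin H a G.component_hpart[OF a(2)] by (simp add: ideal_mod_simps)
    next
      fix c assume c: "(\<forall>n. c n \<in> hpart (ideal_mod R J) n) \<and> finite {n. c n \<noteq> \<zero>\<^bsub>ideal_mod R J\<^esub>} \<and>
          a = (\<Oplus>\<^bsub>ideal_mod R J\<^esub>n\<in>{n. c n \<noteq> \<zero>\<^bsub>ideal_mod R J\<^esub>}. c n)"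
      have "component R a = c"
      proof (rule G.component_unique)
        show "finite {n. c n \<noteq> \<zero>}" using c by (simp add: ideal_mod_simps)
        then show "a = (\<Oplus>n\<in>{n. c n \<noteq> \<zero>}. c n)"
          using ideal_mod_finsum[OF J, of "{n. c n \<noteq> \<zero>}" c] c by (auto simp: ideal_mod_simps)
      qed (use c in \<open>auto simp: ideal_mod_simps\<close>)
      then show "c = ?c" by simp
    qed
  qed
  then show "homogeneous_ideal R J" using J by (simp add: homogeneous_ideal_def)
qed

lemma homogeneous_idealD: "homogeneous_ideal R J \<Longrightarrow> ideal J R"
  by (simp add: homogeneous_ideal_iff)

lemma ideal_mod_graded:
  assumes "homogeneous_ideal R J" shows "graded_module R (ideal_mod R J)"
proof -
  have J: "ideal J R" by (rule homogeneous_idealD[OF assms])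
  interpret J: ideal J R by (rule J)
  interpret M: module R "ideal_mod R J" by (rule ideal_mod_module[OF J])
  show ?thesis
    using assms M.module_axioms M.M.abelian_group_axioms graded_mult G.hpart_carrier J.I_l_closed
    by (auto simp: graded_module_def graded_group_def graded_group_axioms_def ideal_mod_simps homogeneous_ideal_def)
qed

lemma component_ideal_mod:
  assumes "homogeneous_ideal R J" "a \<in> J"
  shows "component (ideal_mod R J) a n = component R a n"
  using component_hom[OF ideal_mod_graded[OF assms(1)] ring_mod_graded ideal_mod_ring_mod[OF homogeneous_idealD[OF assms(1)]], of a n] assms(2)
  by (simp add: ideal_mod_simps ring_mod_simps component_ring_mod)

text \<open>\<open>R\<close> is generated by \<open>1\<close>, so ideals are finitely generated
  inside \<open>ring_mod R\<close>; submodules of the ideal are submodules of \<open>R\<close>,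
  which transfers generation.\<close>

lemma ideal_mod_fin_gen:
  assumes "ideal J R" shows "fin_gen R (ideal_mod R J) J"
proof -
  have J: "submodule R J (ring_mod R)" using assms by (simp add: submodule_ring_mod_iff)
  have "fin_gen R (ring_mod R) J"
  proof (rule noetherian[OF ring_mod_module _ _ J, of 1 "\<lambda>_. \<one>"])
    fix P assume P: "submodule R P (ring_mod R)" "(\<lambda>_. \<one>) ` {..<1::nat} \<subseteq> P"
    interpret P: ideal P R using P(1) by (simp add: submodule_ring_mod_iff)
    have "\<one> \<in> P" using P(2) by (auto simp: image_subset_iff)
    then show "P = carrier (ring_mod R)" using P.one_imp_carrier by (simp add: ring_mod_simps)
  qed (simp add: ring_mod_simps)
  then show ?thesis
    unfolding fin_gen_def
    using submodule_ideal_modI[OF _ ring_mod_module, of _ J] ideal.Icarr[OF assms] by (metis subsetI)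
qed

lemma ideal_mod_resolution_exists:
  assumes "homogeneous_ideal R J" shows "\<exists>F. min_free_resolution R (ideal_mod R J) F"
  using min_free_resolution_exists[OF ideal_mod_graded[OF assms]] ideal_mod_fin_gen[OF homogeneous_idealD[OF assms]]
  by (simp add: ideal_mod_simps)

lemma homogeneous_ideal_sum:
  assumes "homogeneous_ideal R A" "homogeneous_ideal R B" shows "homogeneous_ideal R (A <+>\<^bsub>R\<^esub> B)"
  unfolding homogeneous_ideal_iff
proof (intro conjI ballI allI)
  interpret A: ideal A R by (rule homogeneous_idealD[OF assms(1)])
  interpret B: ideal B R by (rule homogeneous_idealD[OF assms(2)])
  show "ideal (A <+>\<^bsub>R\<^esub> B) R" by (rule add_ideals) (rule homogeneous_idealD[OF assms(1)] homogeneous_idealD[OF assms(2)])+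
  fix c n assume "c \<in> A <+>\<^bsub>R\<^esub> B"
  then obtain a b where ab: "a \<in> A" "b \<in> B" "c = a \<oplus> b" by (auto simp: set_add_def')
  then have "component R c n = component R a n \<oplus> component R b n" using A.Icarr B.Icarr by (simp add: G.component_add)
  moreover have "component R a n \<in> A" "component R b n \<in> B" using assms ab by (auto simp: homogeneous_ideal_iff)
  ultimately show "component R c n \<in> A <+>\<^bsub>R\<^esub> B" by (auto simp: set_add_def')
qed

lemma mult_set_ideal:
  assumes "ideal J R" "x \<in> carrier R" shows "ideal (mult_set R x J) R"
proof -
  have "submodule R ((\<lambda>v. x \<odot>\<^bsub>ring_mod R\<^esub> v) ` J) (ring_mod R)"
    by (rule submod_image[OF mod_hom_smult[OF ring_mod_module assms(2)]]) (use assms(1) in \<open>simp add: submodule_ring_mod_iff\<close>)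
  then show ?thesis unfolding submodule_ring_mod_iff ring_mod_simps mult_set_def .
qed

lemma homogeneous_ideal_mult_set:
  assumes "homogeneous_ideal R J" "x \<in> hpart R s" shows "homogeneous_ideal R (mult_set R x J)"
  unfolding homogeneous_ideal_iff
proof (intro conjI ballI allI)
  interpret J: ideal J R by (rule homogeneous_idealD[OF assms(1)])
  have x: "x \<in> carrier R" by (rule G.hpart_carrier[OF assms(2)])
  show "ideal (mult_set R x J) R" by (rule mult_set_ideal[OF homogeneous_idealD[OF assms(1)] x])
  fix c n assume "c \<in> mult_set R x J"
  then obtain a where a: "a \<in> J" "c = x \<otimes> a" by (auto simp: mult_set_def)
  have "component R c n = x \<otimes> component R a (n - s)"
    using component_mult[OF J.Icarr[OF a(1)] assms(2), of n] a J.Icarr x G.component_carrier by (simp add: m_comm)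
  moreover have "component R a (n - s) \<in> J" using assms(1) a(1) by (simp add: homogeneous_ideal_iff)
  ultimately show "component R c n \<in> mult_set R x J" by (simp add: mult_set_def)
qed

lemma homogeneous_ideal_carrier: "homogeneous_ideal R (carrier R)"
  by (simp add: homogeneous_ideal_iff oneideal G.component_carrier)

lemma PIdl_mult_set: "x \<in> carrier R \<Longrightarrow> PIdl x = mult_set R x (carrier R)"
  by (auto simp: cgenideal_def mult_set_def m_comm)

section \<open>Quotients of graded modules\<close>

lemma quot_gmod_simps:
  "carrier (quot_gmod M N) = carrier (quot_mod M N)" "\<zero>\<^bsub>quot_gmod M N\<^esub> = \<zero>\<^bsub>quot_mod M N\<^esub>"
  "U \<oplus>\<^bsub>quot_gmod M N\<^esub> V = U \<oplus>\<^bsub>quot_mod M N\<^esub> V" "r \<odot>\<^bsub>quot_gmod M N\<^esub> U = r \<odot>\<^bsub>quot_mod M N\<^esub> U"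
  "hpart (quot_gmod M N) n = (\<lambda>v. N +>\<^bsub>M\<^esub> v) ` hpart M n"
  by (simp_all add: quot_gmod_def module.extend_def gmodule.fields_def)

lemma quot_gmod_module:
  assumes "submodule R N M"
  shows "module R (quot_gmod M N)" and "mod_hom R M (quot_gmod M N) (\<lambda>v. N +>\<^bsub>M\<^esub> v)"
proof -
  interpret q: mod_hom R M "quot_mod M N" "\<lambda>v. N +>\<^bsub>M\<^esub> v" by (rule quot_mod_module(2)[OF assms])
  note * = module_image[where f = "\<lambda>v. N +>\<^bsub>M\<^esub> v", OF submodD(1)[OF assms]]
  have z: "\<zero>\<^bsub>quot_gmod M N\<^esub> = N +>\<^bsub>M\<^esub> \<zero>\<^bsub>M\<^esub>" using q.f0_is_0 by (simp add: quot_gmod_simps)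
  show "module R (quot_gmod M N)"
    by (rule *) (use z in \<open>simp_all add: quot_gmod_simps quot_mod_simps(1) q.f_add q.f_smult\<close>)
  show "mod_hom R M (quot_gmod M N) (\<lambda>v. N +>\<^bsub>M\<^esub> v)"
    by (rule *) (use z in \<open>simp_all add: quot_gmod_simps quot_mod_simps(1) q.f_add q.f_smult\<close>)
qed

lemma quot_gmod_kernel:
  assumes "submodule R N M"
  shows "{v \<in> carrier M. N +>\<^bsub>M\<^esub> v = \<zero>\<^bsub>quot_gmod M N\<^esub>} = N"
  using coset_eq_self_iff[OF assms] submodD(2)[OF assms] by (auto simp: quot_gmod_simps quot_mod_simps)

text \<open>The main point is uniqueness. Homogeneous representatives of a second decomposition add
  up to an element that differs from \<open>v\<close> by some \<open>m\<close> in \<open>N\<close>;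
  as \<open>N\<close> contains the components of \<open>m\<close>, the classes agree degree by
  degree.\<close>

lemma quot_gmod_graded:
  assumes M: "graded_module R M" and N: "submodule R N M" "graded_closed M N"
  shows "graded_module R (quot_gmod M N)"
proof -
  let ?Q = "quot_gmod M N" and ?q = "\<lambda>v. N +>\<^bsub>M\<^esub> v"
  interpret GM: graded_group M by (rule graded_moduleD(2)[OF M])
  interpret q: mod_hom R M ?Q ?q by (rule quot_gmod_module(2)[OF N(1)])
  have car: "carrier ?Q = ?q ` carrier M" by (simp add: quot_gmod_simps quot_mod_simps)
  have zero: "?q v = \<zero>\<^bsub>?Q\<^esub> \<longleftrightarrow> v \<in> N" if "v \<in> carrier M" for v using quot_gmod_kernel[OF N(1)] that by auto
  have hp: "hpart ?Q n = ?q ` hpart M n" for n by (simp add: quot_gmod_simps)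
  have smult: "a \<odot>\<^bsub>?Q\<^esub> U \<in> hpart ?Q (i + j)" if a: "a \<in> hpart R i" and U: "U \<in> hpart ?Q j" for a U i j
  proof -
    obtain v where v: "v \<in> hpart M j" "U = ?q v" using U hp by auto
    have "a \<odot>\<^bsub>?Q\<^esub> U = ?q (a \<odot>\<^bsub>M\<^esub> v)" using q.f_smult[of a v] v G.hpart_carrier[OF a] GM.hpart_carrier by simp
    then show ?thesis using graded_moduleD(3)[OF M a v(1)] hp by auto
  qed
  have "grading ?Q"
    unfolding grading_def
  proof (intro conjI allI ballI)
    show "subgroup (hpart ?Q n) (add_monoid ?Q)" for n
    proof (rule subgroup.intro)
      show "hpart ?Q n \<subseteq> carrier (add_monoid ?Q)" using hp car GM.hpart_carrier by auto
      show "U \<otimes>\<^bsub>add_monoid ?Q\<^esub> V \<in> hpart ?Q n" if UV: "U \<in> hpart ?Q n" "V \<in> hpart ?Q n" for U V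
      proof -
        obtain u v where uv: "u \<in> hpart M n" "v \<in> hpart M n" "U = ?q u" "V = ?q v" using UV hp by auto
        have "U \<oplus>\<^bsub>?Q\<^esub> V = ?q (u \<oplus>\<^bsub>M\<^esub> v)" using q.f_add[of u v] uv GM.hpart_carrier by simp
        then show ?thesis using GM.hpart_add uv hp by auto
      qed
      show "\<one>\<^bsub>add_monoid ?Q\<^esub> \<in> hpart ?Q n" unfolding hp using imageI[OF GM.hpart_zero, of ?q n] q.f0_is_0 by simp
      show "inv\<^bsub>add_monoid ?Q\<^esub> U \<in> hpart ?Q n" if U: "U \<in> hpart ?Q n" for U
      proof -
        have "(\<ominus> \<one>) \<odot>\<^bsub>?Q\<^esub> U \<in> hpart ?Q (0 + n)" by (rule smult[OF G.hpart_uminus[OF one_hpart] U])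
        moreover have "U \<in> carrier ?Q" using U hp car GM.hpart_carrier by auto
        ultimately show ?thesis by (simp add: q.N.smult_minus_1 a_inv_def[symmetric])
      qed
    qed
    fix U assume "U \<in> carrier ?Q"
    then obtain v where v: "v \<in> carrier M" "U = ?q v" using car by auto
    let ?c = "\<lambda>n. ?q (component M v n)"
    let ?S = "{n. component M v n \<noteq> \<zero>\<^bsub>M\<^esub>}"
    have vfin: "finite ?S" by (rule GM.component_finite[OF v(1)])
    show "\<exists>!c. (\<forall>n. c n \<in> hpart ?Q n) \<and> finite {n. c n \<noteq> \<zero>\<^bsub>?Q\<^esub>} \<and> U = (\<Oplus>\<^bsub>?Q\<^esub>n\<in>{n. c n \<noteq> \<zero>\<^bsub>?Q\<^esub>}. c n)"
    proof (rule ex1I[of _ ?c], intro conjI allI)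
      show "?c n \<in> hpart ?Q n" for n using hp GM.component_hpart[OF v(1)] by auto
      have sub: "{n. ?c n \<noteq> \<zero>\<^bsub>?Q\<^esub>} \<subseteq> ?S" by auto
      show "finite {n. ?c n \<noteq> \<zero>\<^bsub>?Q\<^esub>}" by (rule finite_subset[OF sub vfin])
      have "U = ?q (\<Oplus>\<^bsub>M\<^esub>n\<in>?S. component M v n)" using v GM.component_sum[OF v(1)] by simp
      also have "\<dots> = (\<Oplus>\<^bsub>?Q\<^esub>n\<in>?S. ?c n)"
        by (rule finsum_hom[OF q.mod_hom_axioms vfin]) (use GM.component_carrier[OF v(1)] in auto)
      also have "\<dots> = (\<Oplus>\<^bsub>?Q\<^esub>n\<in>{n. ?c n \<noteq> \<zero>\<^bsub>?Q\<^esub>}. ?c n)"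
        by (rule q.N.M.add.finprod_mono_neutral_cong_right[OF vfin sub]) (use GM.component_carrier[OF v(1)] q.f_im in auto)
      finally show "U = (\<Oplus>\<^bsub>?Q\<^esub>n\<in>{n. ?c n \<noteq> \<zero>\<^bsub>?Q\<^esub>}. ?c n)" .
    next
      fix c assume c: "(\<forall>n. c n \<in> hpart ?Q n) \<and> finite {n. c n \<noteq> \<zero>\<^bsub>?Q\<^esub>} \<and> U = (\<Oplus>\<^bsub>?Q\<^esub>n\<in>{n. c n \<noteq> \<zero>\<^bsub>?Q\<^esub>}. c n)"
      let ?S' = "{n. c n \<noteq> \<zero>\<^bsub>?Q\<^esub>}"
      \<comment> \<open>Zero classes get the representative zero, so that the representatives have
        finite support.\<close>
      have "\<forall>n. \<exists>w. w \<in> hpart M n \<and> c n = ?q w \<and> (c n = \<zero>\<^bsub>?Q\<^esub> \<longrightarrow> w = \<zero>\<^bsub>M\<^esub>)"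
      proof
        fix n
        show "\<exists>w. w \<in> hpart M n \<and> c n = ?q w \<and> (c n = \<zero>\<^bsub>?Q\<^esub> \<longrightarrow> w = \<zero>\<^bsub>M\<^esub>)"
        proof (cases "c n = \<zero>\<^bsub>?Q\<^esub>")
          case True
          then show ?thesis using GM.hpart_zero q.f0_is_0 by (intro exI[of _ "\<zero>\<^bsub>M\<^esub>"]) simp
        next
          case False
          then show ?thesis using c hp by (auto simp: image_iff)
        qed
      qed
      from choice[OF this] obtain w where w: "\<forall>n. w n \<in> hpart M n \<and> c n = ?q (w n) \<and> (c n = \<zero>\<^bsub>?Q\<^esub> \<longrightarrow> w n = \<zero>\<^bsub>M\<^esub>)"
        by (rule exE)
      have wc: "w n \<in> carrier M" for n using w GM.hpart_carrier by blast
      have fin: "finite ?S'" using c by simp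
      let ?u = "\<Oplus>\<^bsub>M\<^esub>n\<in>?S'. w n"
      have uc: "?u \<in> carrier M" using wc by (intro GM.finsum_closed) auto
      have cu: "component M ?u = w"
        by (rule GM.component_unique[OF _ fin]) (use w in auto)
      have "?q ?u = (\<Oplus>\<^bsub>?Q\<^esub>n\<in>?S'. ?q (w n))" by (rule finsum_hom[OF q.mod_hom_axioms fin]) (use wc in auto)
      also have "\<dots> = (\<Oplus>\<^bsub>?Q\<^esub>n\<in>?S'. c n)"
        by (rule q.N.M.finsum_cong') (use w wc q.f_im in auto)
      finally have "?q ?u = ?q v" using c v(2) by simp
      then obtain m where m: "m \<in> N" "?u = m \<oplus>\<^bsub>M\<^esub> v" using coset_eq_iff[OF N(1) uc v(1)] by blast
      have mc: "m \<in> carrier M" using m(1) submodD(2)[OF N(1)] by auto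
      show "c = ?c"
      proof
        fix n
        have "w n = component M m n \<oplus>\<^bsub>M\<^esub> component M v n"
          using cu m(2) GM.component_add[OF mc v(1)] by metis
        moreover have "component M m n \<in> N" using N(2) m(1) by (simp add: graded_closed_def)
        ultimately have "?q (w n) = ?c n"
          using coset_eq_iff[OF N(1) wc GM.component_carrier[OF v(1)]] by blast
        then show "c n = ?c n" using w by simp
      qed
    qed
  qed
  then show ?thesis
    using smult q.N.module_axioms q.N.M.abelian_group_axioms
    by (simp add: graded_module_def graded_group_def graded_group_axioms_def)
qed

lemma fin_gen_image:
  assumes f: "mod_hom R M Q f" and fg: "fin_gen R M (carrier M)"
  shows "fin_gen R Q (f ` carrier M)"
proof -
  obtain B where B: "finite B" "B \<subseteq> carrier M" "\<And>P. submodule R P M \<Longrightarrow> B \<subseteq> P \<Longrightarrow> carrier M \<subseteq> P"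
    using fg unfolding fin_gen_def by blast
  show ?thesis
    unfolding fin_gen_def
  proof (intro exI[of _ "f ` B"] conjI allI impI)
    fix P assume P: "submodule R P Q" "f ` B \<subseteq> P"
    have "carrier M \<subseteq> {v \<in> carrier M. f v \<in> P}"
      by (rule B(3)[OF submod_preimage[OF f P(1)]]) (use B(2) P(2) in auto)
    then show "f ` carrier M \<subseteq> P" by auto
  qed (use B(1,2) in auto)
qed

lemma quot_gmod_resolution_exists:
  assumes M: "graded_module R M" "fin_gen R M (carrier M)" and N: "submodule R N M" "graded_closed M N"
  shows "\<exists>F. min_free_resolution R (quot_gmod M N) F"
proof (rule min_free_resolution_exists[OF quot_gmod_graded[OF M(1) N]])
  show "fin_gen R (quot_gmod M N) (carrier (quot_gmod M N))"
    using fin_gen_image[OF quot_gmod_module(2)[OF N(1)] M(2)] by (simp add: quot_gmod_simps quot_mod_simps)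
qed

end

subsection \<open>The residue field\<close>

text \<open>\<open>res\<close> is the residue map to the coefficient field, with kernel the
  irrelevant ideal, and \<open>emb\<close> its section by constants. \<open>K\<close> and
  \<open>R\<close> have different types, and the dimension counts pass back and forth along these
  two maps.\<close>

locale graded_residue = graded_cring R + K: field K
  for K :: "('k, 'c) ring_scheme" and R :: "('k, 'a) gmodule" (structure) +
  fixes res :: "'a \<Rightarrow> 'k" and emb :: "'k \<Rightarrow> 'a"
  assumes res_closed: "a \<in> carrier R \<Longrightarrow> res a \<in> carrier K"
    and res_add: "a \<in> carrier R \<Longrightarrow> b \<in> carrier R \<Longrightarrow> res (a \<oplus> b) = res a \<oplus>\<^bsub>K\<^esub> res b"
    and res_mult: "a \<in> carrier R \<Longrightarrow> b \<in> carrier R \<Longrightarrow> res (a \<otimes> b) = res a \<otimes>\<^bsub>K\<^esub> res b"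
    and res_zero_iff: "a \<in> carrier R \<Longrightarrow> res a = \<zero>\<^bsub>K\<^esub> \<longleftrightarrow> a \<in> irrelevant R"
    and emb_closed: "c \<in> carrier K \<Longrightarrow> emb c \<in> carrier R"
    and emb_add: "c \<in> carrier K \<Longrightarrow> c' \<in> carrier K \<Longrightarrow> emb (c \<oplus>\<^bsub>K\<^esub> c') = emb c \<oplus> emb c'"
    and emb_mult: "c \<in> carrier K \<Longrightarrow> c' \<in> carrier K \<Longrightarrow> emb (c \<otimes>\<^bsub>K\<^esub> c') = emb c \<otimes> emb c'"
    and emb_one: "emb \<one>\<^bsub>K\<^esub> = \<one>"
    and res_emb: "c \<in> carrier K \<Longrightarrow> res (emb c) = c"
    and emb_def: "c \<in> carrier K \<Longrightarrow> emb c = c \<odot> \<one>"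

text \<open>\<open>K\<close> embeds into \<open>R\<close> because
  \<open>\<one> \<noteq> \<zero>\<close> in \<open>R\<close> and nonzero scalars are invertible;
  \<open>res a\<close> is the scalar belonging to the component of \<open>a\<close> in degree
  0.\<close>

lemma (in standard_graded_algebra) graded_residue:
  "\<exists>res. graded_residue K R res (\<lambda>c. c \<odot>\<^bsub>R\<^esub> \<one>\<^bsub>R\<^esub>)"
proof -
  interpret RR: graded_cring R by (rule graded_cring)
  let ?emb = "\<lambda>c. c \<odot>\<^bsub>R\<^esub> \<one>\<^bsub>R\<^esub>"
  have one: "\<one>\<^bsub>R\<^esub> \<in> carrier R" by (rule cring.cring_simprules(6)[OF R.M_cring])
  have cl: "?emb c \<in> carrier R" if "c \<in> carrier K" for c using R.smult_closed[OF that one] .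
  have add: "?emb (c \<oplus>\<^bsub>K\<^esub> c') = ?emb c \<oplus>\<^bsub>R\<^esub> ?emb c'" if "c \<in> carrier K" "c' \<in> carrier K" for c c'
    by (rule R.smult_l_distr[OF that one])
  have mult: "?emb (c \<otimes>\<^bsub>K\<^esub> c') = ?emb c \<otimes>\<^bsub>R\<^esub> ?emb c'" if "c \<in> carrier K" "c' \<in> carrier K" for c c'
  proof -
    have "?emb c \<otimes>\<^bsub>R\<^esub> ?emb c' = c \<odot>\<^bsub>R\<^esub> (\<one>\<^bsub>R\<^esub> \<otimes>\<^bsub>R\<^esub> ?emb c')" by (rule R.smult_assoc2[OF that(1) one cl[OF that(2)]])
    also have "\<dots> = c \<odot>\<^bsub>R\<^esub> ?emb c'" using cring.cring_simprules(12)[OF R.M_cring cl[OF that(2)]] by simp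
    also have "\<dots> = ?emb (c \<otimes>\<^bsub>K\<^esub> c')" by (rule R.smult_assoc1[OF that one, symmetric])
    finally show ?thesis by simp
  qed
  have inj: "c = c'" if c: "c \<in> carrier K" "c' \<in> carrier K" "?emb c = ?emb c'" for c c'
  proof (rule ccontr)
    assume "c \<noteq> c'"
    let ?d = "c \<ominus>\<^bsub>K\<^esub> c'"
    have d: "?d \<in> carrier K" using c by simp
    have "?d \<noteq> \<zero>\<^bsub>K\<^esub>" using c \<open>c \<noteq> c'\<close> by simp
    then have u: "inv\<^bsub>K\<^esub> ?d \<in> carrier K" "inv\<^bsub>K\<^esub> ?d \<otimes>\<^bsub>K\<^esub> ?d = \<one>\<^bsub>K\<^esub>" using d K.field_Units by auto
    have "?emb ?d \<oplus>\<^bsub>R\<^esub> ?emb c' = ?emb c"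
      using add[OF d c(2)] c by (simp add: a_minus_def K.a_assoc K.l_neg)
    then have "?emb ?d \<oplus>\<^bsub>R\<^esub> ?emb c' = \<zero>\<^bsub>R\<^esub> \<oplus>\<^bsub>R\<^esub> ?emb c'" using c cl by simp
    then have "?emb ?d = \<zero>\<^bsub>R\<^esub>" using cl[OF d] cl[OF c(2)] by simp
    then have "?emb \<one>\<^bsub>K\<^esub> = \<zero>\<^bsub>R\<^esub>" using mult[OF u(1) d] u cl by simp
    then show False using R.smult_one[OF one] nontrivial by simp
  qed
  define res where "res a = (THE c. c \<in> carrier K \<and> ?emb c = component R a 0)" for a
  have res: "res a \<in> carrier K \<and> ?emb (res a) = component R a 0" if a: "a \<in> carrier R" for a
  proof -
    have "component R a 0 \<in> ?emb ` carrier K" using RR.G.component_hpart[OF a, of 0] unfolding zero_part .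
    then obtain c where c: "c \<in> carrier K" "?emb c = component R a 0" by auto
    then show ?thesis unfolding res_def by (rule_tac theI2[of _ c]) (use inj in auto)
  qed
  have res_unique: "res a = c" if "a \<in> carrier R" "c \<in> carrier K" "component R a 0 = ?emb c" for a c
    using inj[of "res a" c] res[OF that(1)] that by simp
  have "graded_residue K R res ?emb"
  proof (rule graded_residue.intro[OF RR.graded_cring_axioms K.field_axioms graded_residue_axioms.intro])
    fix a b assume ab: "a \<in> carrier R" "b \<in> carrier R"
    show "res (a \<oplus>\<^bsub>R\<^esub> b) = res a \<oplus>\<^bsub>K\<^esub> res b"
      by (rule res_unique) (use ab res[OF ab(1)] res[OF ab(2)] add in \<open>simp_all add: RR.component_0_add\<close>)
    show "res (a \<otimes>\<^bsub>R\<^esub> b) = res a \<otimes>\<^bsub>K\<^esub> res b"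
      by (rule res_unique) (use ab res[OF ab(1)] res[OF ab(2)] mult in \<open>simp_all add: RR.component_0_mult\<close>)
  next
    fix a assume a: "a \<in> carrier R"
    have z: "?emb \<zero>\<^bsub>K\<^esub> = \<zero>\<^bsub>R\<^esub>" by (rule R.smult_l_null[OF one])
    show "res a = \<zero>\<^bsub>K\<^esub> \<longleftrightarrow> a \<in> irrelevant R"
      unfolding RR.irrelevant_iff using res[OF a] a z inj[of "res a" "\<zero>\<^bsub>K\<^esub>"] by auto
  next
    fix c assume c: "c \<in> carrier K"
    have "?emb c \<in> hpart R 0" using c by (simp add: zero_part)
    then show "res (?emb c) = c"
      using RR.G.component_homogeneous[of "?emb c" 0] by (intro res_unique cl c) simp
  qed (use res cl add mult R.smult_one[OF one] in blast)+
  then show ?thesis by blast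
qed

section \<open>Coordinate spaces over the field and the uniqueness of ranks\<close>

lemma (in vectorspace) dim_func_space:
  fixes n :: nat
  shows "vectorspace.dim K (func_space {..<n}) = n" and "vectorspace.fin_dim K (func_space {..<n})"
proof -
  let ?V = "func_space {..<n}" and ?e = "basis_elt K {..<n}"
  interpret V: vectorspace K ?V by (rule func_space_is_vs)
  have e: "?e j \<in> carrier ?V" if "j < n" for j using basis_elt_carrier[of j "{..<n}"] that by simp
  let ?B = "?e ` {..<n}"
  have ev: "?e i j = (if i = j then \<one>\<^bsub>K\<^esub> else \<zero>\<^bsub>K\<^esub>)" if "j < n" for i j
    using that by (auto simp: basis_elt_def)
  have inj: "inj_on ?e {..<n}"
  proof (rule inj_onI)
    fix i j assume ij: "i \<in> {..<n}" "j \<in> {..<n}" "?e i = ?e j"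
    then have "?e i j = \<one>\<^bsub>K\<^esub>" using ev[of j j] by simp
    then show "i = j" using ev[of j i] ij by (auto split: if_splits)
  qed
  have B: "finite ?B" "?B \<subseteq> carrier ?V" "card ?B = n" using e inj by (auto simp: card_image)
  have lc: "V.lincomb a ?B = (\<Oplus>\<^bsub>?V\<^esub>j\<in>{..<n}. a (?e j) \<odot>\<^bsub>?V\<^esub> ?e j)" if "a \<in> ?B \<rightarrow> carrier K" for a
    unfolding V.lincomb_def using inj e that by (subst V.M.finsum_reindex) auto
  have ss: "submodule K (V.span ?B) ?V" by (rule V.span_is_submodule[OF B(2)])
  have gen: "V.gen_set ?B"
  proof
    show "V.span ?B \<subseteq> carrier ?V" by (rule V.span_is_subset2[OF B(2)])
    show "carrier ?V \<subseteq> V.span ?B"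
    proof
      fix f assume f: "f \<in> carrier ?V"
      have fj: "f j \<in> carrier K" if "j < n" for j using f that by (auto simp: func_space_simps)
      have eB: "?e j \<in> V.span ?B" if "j < n" for j using V.in_own_span[OF B(2)] that by auto
      have "(\<Oplus>\<^bsub>?V\<^esub>j\<in>{..<n}. f j \<odot>\<^bsub>?V\<^esub> ?e j) \<in> V.span ?B"
        by (rule submod_finsum[OF ss]) (use fj eB submodD(5)[OF ss] in auto)
      then show "f \<in> V.span ?B" using func_space_expand[OF _ f] by simp
    qed
  qed
  have li: "V.lin_indpt ?B"
  proof (rule V.finite_lin_indpt2[OF B(1,2)])
    fix a assume a: "a \<in> ?B \<rightarrow> carrier K" "V.lincomb a ?B = \<zero>\<^bsub>?V\<^esub>"
    have ac: "a (?e j) \<in> carrier K" if "j < n" for j using a(1) that by auto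
    show "\<forall>v\<in>?B. a v = \<zero>\<^bsub>K\<^esub>"
    proof
      fix v assume "v \<in> ?B"
      then obtain i where i: "i < n" "v = ?e i" by auto
      have "\<zero>\<^bsub>K\<^esub> = (\<Oplus>\<^bsub>?V\<^esub>j\<in>{..<n}. a (?e j) \<odot>\<^bsub>?V\<^esub> ?e j) i"
        using a(2) lc[OF a(1)] i by (simp add: func_space_simps(2))
      also have "\<dots> = (\<Oplus>\<^bsub>K\<^esub>j\<in>{..<n}. (a (?e j) \<odot>\<^bsub>?V\<^esub> ?e j) i)"
        by (rule finsum_func_space) (use e ac i in auto)
      also have "\<dots> = (\<Oplus>\<^bsub>K\<^esub>j\<in>{..<n}. if i = j then a (?e j) else \<zero>\<^bsub>K\<^esub>)"
        by (rule R.finsum_cong') (use ac i ev in \<open>auto simp: func_space_simps(4)\<close>)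
      also have "\<dots> = a (?e i)" using i ac by (intro R.add.finprod_singleton) auto
      finally show "a v = \<zero>\<^bsub>K\<^esub>" using i by simp
    qed
  qed
  show fd: "V.fin_dim" unfolding V.fin_dim_def using B gen by blast
  have "V.basis ?B" unfolding V.basis_def using li gen B(2) by blast
  then show "V.dim = n" using V.dim_basis[OF B(1)] B(3) by simp
qed

context graded_residue
begin

lemma res_vec_zero_iff:
  "w \<in> max_power R (func_space {..<n}) 1 \<longleftrightarrow> w \<in> carrier (func_space {..<n}) \<and> (\<forall>j<n. res (w j) = \<zero>\<^bsub>K\<^esub>)"
  for n :: nat
proof
  assume w: "w \<in> max_power R (func_space {..<n}) 1"
  interpret I: ideal "irrelevant R" R by (rule ideal_irrelevant)
  have "max_power R (func_space {..<n}) (Suc 0) \<subseteq> {w \<in> carrier (func_space {..<n}). \<forall>j<n. w j \<in> irrelevant R}"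
  proof (rule max_power_Suc_least)
    show "submodule R {w \<in> carrier (func_space {..<n}). \<forall>j<n. w j \<in> irrelevant R} (func_space {..<n})"
      by (rule submodI[OF func_space_is_module]) (auto simp: func_space_simps I.I_l_closed)
    show "r \<odot>\<^bsub>func_space {..<n}\<^esub> v \<in> {w \<in> carrier (func_space {..<n}). \<forall>j<n. w j \<in> irrelevant R}"
      if "r \<in> irrelevant R" "v \<in> max_power R (func_space {..<n}) 0" for r v
    proof -
      interpret V: module R "func_space {..<n}" by (rule func_space_is_module)
      have r: "r \<in> carrier R" by (rule I.Icarr[OF that(1)])
      have v: "v \<in> carrier (func_space {..<n})" using that(2) by simp
      have "(r \<odot>\<^bsub>func_space {..<n}\<^esub> v) j \<in> irrelevant R" if "j < n" for j
        using I.I_r_closed[OF \<open>r \<in> irrelevant R\<close>, of "v j"] v that by (auto simp: func_space_simps)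
      then show ?thesis using V.smult_closed[OF r v] by simp
    qed
  qed
  then have "w \<in> carrier (func_space {..<n})" "\<forall>j<n. w j \<in> irrelevant R" using w by auto
  then show "w \<in> carrier (func_space {..<n}) \<and> (\<forall>j<n. res (w j) = \<zero>\<^bsub>K\<^esub>)"
    using res_zero_iff I.Icarr by auto
next
  assume w: "w \<in> carrier (func_space {..<n}) \<and> (\<forall>j<n. res (w j) = \<zero>\<^bsub>K\<^esub>)"
  have wc: "w j \<in> carrier R" if "j < n" for j using w that by (auto simp: func_space_simps)
  have "w \<in> max_power R (free_gmod R n (\<lambda>_. 0)) 1"
    by (rule free_gmod_irrelevant) (use w wc res_zero_iff in \<open>auto simp: free_gmod_simps func_space_simps\<close>)
  from max_power_hom0[OF free_gmod_to_func_space this] show "w \<in> max_power R (func_space {..<n}) 1" .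
qed

definition resv :: "nat \<Rightarrow> (nat \<Rightarrow> 'a) \<Rightarrow> nat \<Rightarrow> 'k" where
  "resv n w = (\<lambda>j\<in>{..<n}. res (w j))"

definition embv :: "nat \<Rightarrow> (nat \<Rightarrow> 'k) \<Rightarrow> nat \<Rightarrow> 'a" where
  "embv n c = (\<lambda>j\<in>{..<n}. emb (c j))"

abbreviation "KV n \<equiv> ring.func_space K {..<n::nat}"
abbreviation "RV n \<equiv> func_space {..<n::nat}"

lemma resv_closed: "w \<in> carrier (RV n) \<Longrightarrow> resv n w \<in> carrier (KV n)"
  by (auto simp: resv_def func_space_simps K.func_space_simps intro!: res_closed)

lemma embv_closed: "c \<in> carrier (KV n) \<Longrightarrow> embv n c \<in> carrier (RV n)"
  by (auto simp: embv_def func_space_simps K.func_space_simps intro!: emb_closed)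

lemma RV_component: "w \<in> carrier (RV n) \<Longrightarrow> j < n \<Longrightarrow> w j \<in> carrier R"
  by (auto simp: func_space_simps)

lemma KV_component: "c \<in> carrier (KV n) \<Longrightarrow> j < n \<Longrightarrow> c j \<in> carrier K"
  by (auto simp: K.func_space_simps)

lemma resv_add:
  assumes "u \<in> carrier (RV n)" "w \<in> carrier (RV n)"
  shows "resv n (u \<oplus>\<^bsub>RV n\<^esub> w) = resv n u \<oplus>\<^bsub>KV n\<^esub> resv n w"
  unfolding resv_def func_space_simps K.func_space_simps
  by (rule restrict_ext) (simp add: res_add RV_component[OF assms(1)] RV_component[OF assms(2)])

lemma resv_smult:
  assumes "r \<in> carrier R" "w \<in> carrier (RV n)"
  shows "resv n (r \<odot>\<^bsub>RV n\<^esub> w) = res r \<odot>\<^bsub>KV n\<^esub> resv n w"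
  unfolding resv_def func_space_simps K.func_space_simps
  by (rule restrict_ext) (simp add: res_mult assms(1) RV_component[OF assms(2)])

lemma embv_add:
  assumes "c \<in> carrier (KV n)" "c' \<in> carrier (KV n)"
  shows "embv n (c \<oplus>\<^bsub>KV n\<^esub> c') = embv n c \<oplus>\<^bsub>RV n\<^esub> embv n c'"
  unfolding embv_def func_space_simps K.func_space_simps
  by (rule restrict_ext) (simp add: emb_add KV_component[OF assms(1)] KV_component[OF assms(2)])

lemma embv_smult:
  assumes "k \<in> carrier K" "c \<in> carrier (KV n)"
  shows "embv n (k \<odot>\<^bsub>KV n\<^esub> c) = emb k \<odot>\<^bsub>RV n\<^esub> embv n c"
  unfolding embv_def func_space_simps K.func_space_simps
  by (rule restrict_ext) (simp add: emb_mult assms(1) KV_component[OF assms(2)])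

lemma resv_embv: "c \<in> carrier (KV n) \<Longrightarrow> resv n (embv n c) = c"
proof
  fix j assume c: "c \<in> carrier (KV n)"
  show "resv n (embv n c) j = c j"
  proof (cases "j < n")
    case True
    then show ?thesis by (simp add: resv_def embv_def res_emb KV_component[OF c])
  next
    case False
    then show ?thesis using c by (simp add: resv_def K.func_space_simps PiE_def extensional_def)
  qed
qed

lemma resv_zero_iff:
  assumes "w \<in> carrier (RV n)" shows "resv n w = \<zero>\<^bsub>KV n\<^esub> \<longleftrightarrow> w \<in> max_power R (RV n) 1"
  unfolding res_vec_zero_iff using assms by (auto simp: resv_def K.func_space_simps(2) fun_eq_iff restrict_def)

lemma resv_eq_iff:
  assumes "u \<in> carrier (RV n)" "w \<in> carrier (RV n)"
  shows "resv n u = resv n w \<longleftrightarrow> u \<ominus>\<^bsub>RV n\<^esub> w \<in> max_power R (RV n) 1"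
proof -
  interpret V: module R "RV n" by (rule func_space_is_module)
  interpret KV: module K "KV n" by (rule K.func_space_is_module)
  have "u = (u \<ominus>\<^bsub>RV n\<^esub> w) \<oplus>\<^bsub>RV n\<^esub> w" using assms by (simp add: a_minus_def V.M.a_assoc V.M.l_neg)
  then have "resv n u = resv n (u \<ominus>\<^bsub>RV n\<^esub> w) \<oplus>\<^bsub>KV n\<^esub> resv n w"
    using resv_add[of "u \<ominus>\<^bsub>RV n\<^esub> w" n w] assms by simp
  then have "resv n u = resv n w \<longleftrightarrow> resv n (u \<ominus>\<^bsub>RV n\<^esub> w) = \<zero>\<^bsub>KV n\<^esub>"
    using resv_closed assms by simp
  then show ?thesis using resv_zero_iff[of "u \<ominus>\<^bsub>RV n\<^esub> w" n] assms by simp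
qed

lemma K_vectorspace: "vectorspace K (KV n)"
  using K.func_space_is_module K.field_axioms by (simp add: vectorspace_def)

lemma dim_KV: "vectorspace.dim K (KV n) = n" "vectorspace.fin_dim K (KV n)"
  using vectorspace.dim_func_space[OF K_vectorspace] .

text \<open>Modulo the maximal ideal \<open>\<beta>\<close> becomes a surjection of coordinate
  spaces over \<open>K\<close>, and rank-nullity compares dimensions. Vectors over \<open>K\<close>
  are lifted by constants, and \<open>resv_eq_iff\<close> shows that another lift changes nothing
  modulo the maximal ideal.\<close>

lemma rank_le:
  assumes A: "free_module R A a" and B: "free_module R B b" and \<beta>: "mod_hom R B A \<beta>"
    and onto: "\<And>v. v \<in> carrier A \<Longrightarrow> \<exists>u\<in>carrier B. \<beta> u \<ominus>\<^bsub>A\<^esub> v \<in> max_power R A 1"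
  shows "a \<le> b"
proof -
  obtain f g where f: "mod_hom R (RV a) A f" and g: "mod_hom R A (RV a) g"
      and fg: "\<forall>v\<in>carrier A. f (g v) = v" "\<forall>u\<in>carrier (RV a). g (f u) = u"
    using free_module_inverse[OF A] by (elim exE conjE)
  obtain f' g' where f': "mod_hom R (RV b) B f'" and g': "mod_hom R B (RV b) g'"
      and fg': "\<forall>v\<in>carrier B. f' (g' v) = v" "\<forall>u\<in>carrier (RV b). g' (f' u) = u"
    using free_module_inverse[OF B] by (elim exE conjE)
  let ?h = "\<lambda>w. g (\<beta> (f' w))"
  have h: "mod_hom R (RV b) (RV a) ?h" by (rule mod_hom_comp[OF mod_hom_comp[OF f' \<beta>] g])
  interpret h: mod_hom R "RV b" "RV a" ?h by (rule h)
  define S where "S c = resv a (?h (embv b c))" for c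
  interpret KB: vectorspace K "KV b" by (rule K_vectorspace)
  interpret KA: vectorspace K "KV a" by (rule K_vectorspace)
  have S: "mod_hom K (KV b) (KV a) S"
  proof (rule mod_homI[OF K.func_space_is_module K.func_space_is_module])
    fix c c' assume c: "c \<in> carrier (KV b)" "c' \<in> carrier (KV b)"
    show "S c \<in> carrier (KV a)" unfolding S_def by (intro resv_closed h.f_im embv_closed c)
    show "S (c \<oplus>\<^bsub>KV b\<^esub> c') = S c \<oplus>\<^bsub>KV a\<^esub> S c'"
      unfolding S_def embv_add[OF c] using h.f_add[OF embv_closed[OF c(1)] embv_closed[OF c(2)]]
        resv_add[OF h.f_im h.f_im, OF embv_closed[OF c(1)] embv_closed[OF c(2)]] by simp
  next
    fix k c assume k: "k \<in> carrier K" and c: "c \<in> carrier (KV b)"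
    show "S (k \<odot>\<^bsub>KV b\<^esub> c) = k \<odot>\<^bsub>KV a\<^esub> S c"
      unfolding S_def embv_smult[OF k c] using h.f_smult[OF emb_closed[OF k] embv_closed[OF c]]
        resv_smult[OF emb_closed[OF k] h.f_im[OF embv_closed[OF c]]] res_emb[OF k] by simp
  qed
  interpret S: linear_map K "KV b" "KV a" S
    using S K_vectorspace by (simp add: linear_map_def mod_hom_def)
  have "S ` carrier (KV b) = carrier (KV a)"
  proof
    show "S ` carrier (KV b) \<subseteq> carrier (KV a)" using mod_hom.f_im[OF S] by auto
    show "carrier (KV a) \<subseteq> S ` carrier (KV b)"
    proof
      fix y assume y: "y \<in> carrier (KV a)"
      have v: "f (embv a y) \<in> carrier A" by (rule mod_hom.f_im[OF f embv_closed[OF y]])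
      obtain u where u: "u \<in> carrier B" "\<beta> u \<ominus>\<^bsub>A\<^esub> f (embv a y) \<in> max_power R A 1" using onto[OF v] by blast
      let ?c = "resv b (g' u)"
      have gu: "g' u \<in> carrier (RV b)" by (rule mod_hom.f_im[OF g' u(1)])
      have c: "?c \<in> carrier (KV b)" by (rule resv_closed[OF gu])
      have "resv b (embv b ?c) = resv b (g' u)" by (rule resv_embv[OF c])
      then have "embv b ?c \<ominus>\<^bsub>RV b\<^esub> g' u \<in> max_power R (RV b) 1"
        using resv_eq_iff[OF embv_closed[OF c] gu] by simp
      from max_power_hom0[OF h this] have "?h (embv b ?c) \<ominus>\<^bsub>RV a\<^esub> ?h (g' u) \<in> max_power R (RV a) 1"
        using h.f_minus[OF embv_closed[OF c] gu] by simp
      then have "S ?c = resv a (?h (g' u))"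
        unfolding S_def using resv_eq_iff[OF h.f_im[OF embv_closed[OF c]] h.f_im[OF gu]] by simp
      also have "?h (g' u) = g (\<beta> u)" using fg'(1) u(1) by simp
      also have "resv a (g (\<beta> u)) = resv a (g (f (embv a y)))"
      proof -
        have bu: "\<beta> u \<in> carrier A" by (rule mod_hom.f_im[OF \<beta> u(1)])
        have "g (\<beta> u) \<ominus>\<^bsub>RV a\<^esub> g (f (embv a y)) \<in> max_power R (RV a) 1"
          using max_power_hom0[OF g u(2)] mod_hom.f_minus[OF g bu v] by simp
        then show ?thesis using resv_eq_iff[OF mod_hom.f_im[OF g bu] mod_hom.f_im[OF g v]] by simp
      qed
      also have "g (f (embv a y)) = embv a y" using fg(2) embv_closed[OF y] by simp
      finally have "S ?c = y" using resv_embv[OF y] by simp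
      then show "y \<in> S ` carrier (KV b)" using c by (metis imageI)
    qed
  qed
  then have "S.im = carrier (KV a)" by (simp add: S.im_def)
  then have "KA.dim + vectorspace.dim K (KB.vs S.ker) = KB.dim"
    using S.rank_nullity dim_KV(2)[of b] by simp
  then show ?thesis using dim_KV by simp
qed

text \<open>By the homotopy formula and minimality, the composite of \<open>\<alpha>\<close> and
  \<open>\<beta>\<close> is the identity modulo the maximal ideal, so \<open>\<beta>\<close> is onto
  modulo it.\<close>

lemma resolution_rank_le:
  fixes F :: "nat \<Rightarrow> ('a, 'm, 'e) module_scheme" and G :: "nat \<Rightarrow> ('a, 'm2, 'e2) module_scheme"
  assumes F: "minimal_resolution R F dF eF M nF" and G: "minimal_resolution R G dG eG M nG"
  shows "nF i \<le> nG i"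
proof -
  interpret F: minimal_resolution R F dF eF M nF by fact
  interpret G: minimal_resolution R G dG eG M nG by fact
  obtain \<alpha> \<beta> h where \<alpha>: "\<And>i. mod_hom R (F i) (G i) (\<alpha> i)" and \<beta>: "\<And>i. mod_hom R (G i) (F i) (\<beta> i)"
    and h: "\<And>i. mod_hom R (F i) (F (Suc i)) (h i)"
    and eq0: "\<And>v. v \<in> carrier (F 0) \<Longrightarrow> \<beta> 0 (\<alpha> 0 v) \<ominus>\<^bsub>F 0\<^esub> v = dF (Suc 0) (h 0 v)"
    and eq: "\<And>i v. v \<in> carrier (F (Suc i)) \<Longrightarrow> \<beta> (Suc i) (\<alpha> (Suc i) v) \<ominus>\<^bsub>F (Suc i)\<^esub> v
       = dF (Suc (Suc i)) (h (Suc i) v) \<oplus>\<^bsub>F (Suc i)\<^esub> h i (dF (Suc i) v)"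
    by (rule resolution_comparison[OF F G]) blast
  show ?thesis
  proof (rule rank_le[OF F.free G.free \<beta>])
    fix v assume v: "v \<in> carrier (F i)"
    have "\<beta> i (\<alpha> i v) \<ominus>\<^bsub>F i\<^esub> v \<in> max_power R (F i) 1"
    proof (cases i)
      case 0
      then show ?thesis using eq0[of v] v F.minimal[OF mod_hom.f_im[OF h]] by simp
    next
      case (Suc k)
      have v': "v \<in> carrier (F (Suc k))" using v Suc by simp
      show ?thesis
        unfolding Suc eq[OF v']
        by (rule max_power_add[OF F.C_module F.minimal[OF mod_hom.f_im[OF h v']] max_power_hom0[OF h F.minimal[OF v']]])
    qed
    then show "\<exists>u\<in>carrier (G i). \<beta> i u \<ominus>\<^bsub>F i\<^esub> v \<in> max_power R (F i) 1" using mod_hom.f_im[OF \<alpha> v] by blast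
  qed
qed

lemma rank_unique:
  assumes "minimal_resolution R F dF eF M nF" and "minimal_resolution R G dG eG M nG"
  shows "nF i = nG i"
  using resolution_rank_le[OF assms] resolution_rank_le[OF assms(2,1)] by (rule antisym)

end

subsection \<open>Free modules on arbitrary sets\<close>

text \<open>The sum inside \<open>tensor_map\<close>, isolated so that its linearity is proved once
  for all targets.\<close>

definition linear_extension :: "('a, 'b) ring_scheme \<Rightarrow> ('a, 'm, 'e) module_scheme \<Rightarrow> 's set \<Rightarrow>
    ('s \<Rightarrow> 'm) \<Rightarrow> ('s \<Rightarrow> 'a) \<Rightarrow> 'm" where
  "linear_extension R W S b \<phi> = (\<Oplus>\<^bsub>W\<^esub>s\<in>{s \<in> S. \<phi> s \<noteq> \<zero>\<^bsub>R\<^esub>}. \<phi> s \<odot>\<^bsub>W\<^esub> b s)"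

context irrelevant_cring
begin

lemma free_on_simps:
  "carrier (free_on R S) = {f \<in> S \<rightarrow>\<^sub>E carrier R. finite {s \<in> S. f s \<noteq> \<zero>}}"
  "\<zero>\<^bsub>free_on R S\<^esub> = (\<lambda>v\<in>S. \<zero>)"
  "f \<oplus>\<^bsub>free_on R S\<^esub> g = (\<lambda>v\<in>S. f v \<oplus> g v)"
  "c \<odot>\<^bsub>free_on R S\<^esub> f = (\<lambda>v\<in>S. c \<otimes> f v)"
  by (auto simp: free_on_def func_space_def)

lemma free_on_module: "module R (free_on R S)"
  unfolding free_on_def
proof (rule submod_module[OF submodI[OF func_space_is_module]])
  fix f g assume fg: "f \<in> {f \<in> S \<rightarrow>\<^sub>E carrier R. finite {s \<in> S. f s \<noteq> \<zero>}}" "g \<in> {f \<in> S \<rightarrow>\<^sub>E carrier R. finite {s \<in> S. f s \<noteq> \<zero>}}"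
  have "finite {s \<in> S. (f \<oplus>\<^bsub>func_space S\<^esub> g) s \<noteq> \<zero>}"
    by (rule finite_subset[of _ "{s \<in> S. f s \<noteq> \<zero>} \<union> {s \<in> S. g s \<noteq> \<zero>}"]) (use fg in \<open>auto simp: func_space_simps\<close>)
  then show "f \<oplus>\<^bsub>func_space S\<^esub> g \<in> {f \<in> S \<rightarrow>\<^sub>E carrier R. finite {s \<in> S. f s \<noteq> \<zero>}}"
    using fg by (auto simp: func_space_simps)
next
  fix r f assume rf: "r \<in> carrier R" "f \<in> {f \<in> S \<rightarrow>\<^sub>E carrier R. finite {s \<in> S. f s \<noteq> \<zero>}}"
  have "finite {s \<in> S. (r \<odot>\<^bsub>func_space S\<^esub> f) s \<noteq> \<zero>}"
    by (rule finite_subset[of _ "{s \<in> S. f s \<noteq> \<zero>}"]) (use rf in \<open>auto simp: func_space_simps\<close>)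
  then show "r \<odot>\<^bsub>func_space S\<^esub> f \<in> {f \<in> S \<rightarrow>\<^sub>E carrier R. finite {s \<in> S. f s \<noteq> \<zero>}}"
    using rf by (auto simp: func_space_simps)
qed (auto simp: func_space_simps)

lemma free_on_basis: "s \<in> S \<Longrightarrow> basis_elt R S s \<in> carrier (free_on R S)"
  by (auto simp: free_on_simps basis_elt_def intro: finite_subset[of _ "{s}"])

lemma free_on_component: "\<phi> \<in> carrier (free_on R S) \<Longrightarrow> s \<in> S \<Longrightarrow> \<phi> s \<in> carrier R"
  by (auto simp: free_on_simps)

lemma linear_extension_superset:
  assumes W: "module R W" and b: "\<And>s. s \<in> S \<Longrightarrow> b s \<in> carrier W" and \<phi>: "\<phi> \<in> carrier (free_on R S)"
    and A: "finite A" "A \<subseteq> S" "{s \<in> S. \<phi> s \<noteq> \<zero>} \<subseteq> A"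
  shows "linear_extension R W S b \<phi> = (\<Oplus>\<^bsub>W\<^esub>s\<in>A. \<phi> s \<odot>\<^bsub>W\<^esub> b s)"
proof -
  interpret W: module R W by fact
  have c: "\<phi> s \<odot>\<^bsub>W\<^esub> b s \<in> carrier W" if "s \<in> S" for s
    by (rule W.smult_closed[OF free_on_component[OF \<phi> that] b[OF that]])
  have z: "\<phi> s \<odot>\<^bsub>W\<^esub> b s = \<zero>\<^bsub>W\<^esub>" if "s \<in> A - {s \<in> S. \<phi> s \<noteq> \<zero>}" for s using that A b by auto
  show ?thesis unfolding linear_extension_def
    by (rule W.M.add.finprod_mono_neutral_cong_left) (use A c z in auto)
qed

lemma linear_extension_hom:
  assumes W: "module R W" and b: "\<And>s. s \<in> S \<Longrightarrow> b s \<in> carrier W"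
  shows "mod_hom R (free_on R S) W (linear_extension R W S b)"
proof (rule mod_homI[OF free_on_module W])
  interpret W: module R W by fact
  interpret P: module R "free_on R S" by (rule free_on_module)
  have c: "\<phi> s \<odot>\<^bsub>W\<^esub> b s \<in> carrier W" if "\<phi> \<in> carrier (free_on R S)" "s \<in> S" for \<phi> s
    by (rule W.smult_closed[OF free_on_component[OF that] b[OF that(2)]])
  have fin: "finite {s \<in> S. \<phi> s \<noteq> \<zero>}" if "\<phi> \<in> carrier (free_on R S)" for \<phi>
    using that by (simp add: free_on_simps)
  show "linear_extension R W S b \<phi> \<in> carrier W" if "\<phi> \<in> carrier (free_on R S)" for \<phi>
    unfolding linear_extension_def by (rule W.M.finsum_closed) (use c[OF that] in auto)
  fix f g assume f: "f \<in> carrier (free_on R S)" and g: "g \<in> carrier (free_on R S)"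
  let ?A = "{s \<in> S. f s \<noteq> \<zero>} \<union> {s \<in> S. g s \<noteq> \<zero>}"
  have A: "finite ?A" "?A \<subseteq> S" using fin[OF f] fin[OF g] by auto
  note lin = linear_extension_superset[where b = b, OF W _ _ A]
  have "linear_extension R W S b (f \<oplus>\<^bsub>free_on R S\<^esub> g) = (\<Oplus>\<^bsub>W\<^esub>s\<in>?A. (f \<oplus>\<^bsub>free_on R S\<^esub> g) s \<odot>\<^bsub>W\<^esub> b s)"
    by (rule lin, erule b, rule P.M.a_closed[OF f g]) (auto simp: free_on_simps(3))
  also have "\<dots> = (\<Oplus>\<^bsub>W\<^esub>s\<in>?A. f s \<odot>\<^bsub>W\<^esub> b s \<oplus>\<^bsub>W\<^esub> g s \<odot>\<^bsub>W\<^esub> b s)"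
    by (rule W.M.finsum_cong')
      (use A(2) c[OF f] c[OF g] free_on_component[OF f] free_on_component[OF g] b in \<open>auto simp: free_on_simps(3) W.smult_l_distr\<close>)
  also have "\<dots> = (\<Oplus>\<^bsub>W\<^esub>s\<in>?A. f s \<odot>\<^bsub>W\<^esub> b s) \<oplus>\<^bsub>W\<^esub> (\<Oplus>\<^bsub>W\<^esub>s\<in>?A. g s \<odot>\<^bsub>W\<^esub> b s)"
    by (rule W.M.finsum_addf) (use A(2) c[OF f] c[OF g] in auto)
  also have "(\<Oplus>\<^bsub>W\<^esub>s\<in>?A. f s \<odot>\<^bsub>W\<^esub> b s) = linear_extension R W S b f" by (rule lin[symmetric]) (use b f in auto)
  also have "(\<Oplus>\<^bsub>W\<^esub>s\<in>?A. g s \<odot>\<^bsub>W\<^esub> b s) = linear_extension R W S b g" by (rule lin[symmetric]) (use b g in auto)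
  finally show "linear_extension R W S b (f \<oplus>\<^bsub>free_on R S\<^esub> g) = linear_extension R W S b f \<oplus>\<^bsub>W\<^esub> linear_extension R W S b g" .
next
  interpret W: module R W by fact
  interpret P: module R "free_on R S" by (rule free_on_module)
  fix r f assume r: "r \<in> carrier R" and f: "f \<in> carrier (free_on R S)"
  let ?A = "{s \<in> S. f s \<noteq> \<zero>}"
  have A: "finite ?A" "?A \<subseteq> S" using f by (auto simp: free_on_simps)
  have c: "f s \<odot>\<^bsub>W\<^esub> b s \<in> carrier W" if "s \<in> S" for s
    by (rule W.smult_closed[OF free_on_component[OF f that] b[OF that]])
  have "linear_extension R W S b (r \<odot>\<^bsub>free_on R S\<^esub> f) = (\<Oplus>\<^bsub>W\<^esub>s\<in>?A. (r \<odot>\<^bsub>free_on R S\<^esub> f) s \<odot>\<^bsub>W\<^esub> b s)"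
    by (rule linear_extension_superset[OF W _ _ A], erule b, rule P.smult_closed[OF r f]) (use r in \<open>auto simp: free_on_simps(4)\<close>)
  also have "\<dots> = (\<Oplus>\<^bsub>W\<^esub>s\<in>?A. r \<odot>\<^bsub>W\<^esub> (f s \<odot>\<^bsub>W\<^esub> b s))"
    by (rule W.M.finsum_cong')
      (use c r b free_on_component[OF f] in \<open>auto simp: free_on_simps(4) W.smult_assoc1\<close>)
  also have "\<dots> = r \<odot>\<^bsub>W\<^esub> (\<Oplus>\<^bsub>W\<^esub>s\<in>?A. f s \<odot>\<^bsub>W\<^esub> b s)"
    by (rule W.finsum_smult_ldistr[symmetric]) (use A r c in auto)
  finally show "linear_extension R W S b (r \<odot>\<^bsub>free_on R S\<^esub> f) = r \<odot>\<^bsub>W\<^esub> linear_extension R W S b f"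
    by (simp add: linear_extension_def)
qed

lemma linear_extension_basis:
  assumes W: "module R W" and b: "\<And>s. s \<in> S \<Longrightarrow> b s \<in> carrier W" and s: "s \<in> S"
  shows "linear_extension R W S b (basis_elt R S s) = b s"
proof -
  interpret W: module R W by fact
  have "linear_extension R W S b (basis_elt R S s) = (\<Oplus>\<^bsub>W\<^esub>t\<in>{s}. basis_elt R S s t \<odot>\<^bsub>W\<^esub> b t)"
    by (rule linear_extension_superset[OF W b free_on_basis[OF s]]) (use s in \<open>auto simp: basis_elt_def\<close>)
  then show ?thesis using b[OF s] s by (simp add: basis_elt_def)
qed

lemma free_on_expand:
  assumes \<phi>: "\<phi> \<in> carrier (free_on R S)"
  shows "\<phi> = linear_extension R (free_on R S) S (basis_elt R S) \<phi>" (is "_ = ?\<psi>")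
proof
  have hom: "mod_hom R (free_on R S) (free_on R S) (linear_extension R (free_on R S) S (basis_elt R S))"
    by (rule linear_extension_hom[OF free_on_module free_on_basis])
  have \<psi>: "?\<psi> \<in> carrier (free_on R S)" by (rule mod_hom.f_im[OF hom \<phi>])
  interpret P: module R "free_on R S" by (rule free_on_module)
  fix t show "\<phi> t = ?\<psi> t"
  proof (cases "t \<in> S")
    case True
    let ?A = "{s \<in> S. \<phi> s \<noteq> \<zero>}"
    have A: "finite ?A" using \<phi> by (simp add: free_on_simps)
    have ev: "mod_hom R (free_on R S) (ring_mod R) (\<lambda>f. f t)"
      by (rule mod_homI[OF free_on_module ring_mod_module])
        (use True in \<open>auto simp: ring_mod_simps free_on_simps\<close>)
    have c: "\<phi> s \<in> carrier R" if "s \<in> S" for s by (rule free_on_component[OF \<phi> that])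
    have "?\<psi> t = (\<Oplus>\<^bsub>ring_mod R\<^esub>s\<in>?A. (\<phi> s \<odot>\<^bsub>free_on R S\<^esub> basis_elt R S s) t)"
      unfolding linear_extension_def
      by (rule finsum_hom[OF ev A]) (auto intro!: P.smult_closed c free_on_basis)
    also have "\<dots> = (\<Oplus>s\<in>?A. if t = s then \<phi> s else \<zero>)"
      unfolding ring_mod_finsum
      by (rule finsum_cong') (use c True in \<open>auto simp: free_on_simps(4) basis_elt_def\<close>)
    also have "\<dots> = \<phi> t"
    proof (cases "\<phi> t = \<zero>")
      case True
      have "(\<Oplus>s\<in>?A. if t = s then \<phi> s else \<zero>) = (\<Oplus>s\<in>?A. \<zero>)"
        by (rule finsum_cong') (use True in auto)
      then show ?thesis using True by simp
    next
      case False
      then show ?thesis using True A c by (intro add.finprod_singleton) auto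
    qed
    finally show ?thesis by simp
  next
    case False
    then show ?thesis using \<phi> \<psi> by (auto simp: free_on_simps PiE_def extensional_def)
  qed
qed

lemma free_on_hom:
  assumes f: "mod_hom R (free_on R S) W f" and \<phi>: "\<phi> \<in> carrier (free_on R S)"
  shows "f \<phi> = (\<Oplus>\<^bsub>W\<^esub>s\<in>{s \<in> S. \<phi> s \<noteq> \<zero>}. \<phi> s \<odot>\<^bsub>W\<^esub> f (basis_elt R S s))"
proof -
  interpret f: mod_hom R "free_on R S" W f by fact
  let ?A = "{s \<in> S. \<phi> s \<noteq> \<zero>}"
  have A: "finite ?A" using \<phi> by (simp add: free_on_simps)
  have "f \<phi> = f (\<Oplus>\<^bsub>free_on R S\<^esub>s\<in>?A. \<phi> s \<odot>\<^bsub>free_on R S\<^esub> basis_elt R S s)"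
    using free_on_expand[OF \<phi>] by (simp add: linear_extension_def)
  also have "\<dots> = (\<Oplus>\<^bsub>W\<^esub>s\<in>?A. f (\<phi> s \<odot>\<^bsub>free_on R S\<^esub> basis_elt R S s))"
    by (rule finsum_hom[OF f A]) (auto intro!: f.M.smult_closed free_on_component[OF \<phi>] free_on_basis)
  also have "\<dots> = (\<Oplus>\<^bsub>W\<^esub>s\<in>?A. \<phi> s \<odot>\<^bsub>W\<^esub> f (basis_elt R S s))"
  proof (rule f.N.M.finsum_cong'[OF refl])
    show "(\<lambda>s. \<phi> s \<odot>\<^bsub>W\<^esub> f (basis_elt R S s)) \<in> ?A \<rightarrow> carrier W"
      by (auto intro!: f.N.smult_closed free_on_component[OF \<phi>] f.f_im free_on_basis)
    fix s assume "s \<in> ?A"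
    then show "f (\<phi> s \<odot>\<^bsub>free_on R S\<^esub> basis_elt R S s) = \<phi> s \<odot>\<^bsub>W\<^esub> f (basis_elt R S s)"
      by (intro f.f_smult free_on_component[OF \<phi>] free_on_basis) auto
  qed
  finally show ?thesis .
qed

end

subsection \<open>Tensoring with the residue field\<close>

lemma (in irrelevant_cring) submod_span:
  assumes "module R M" "X \<subseteq> carrier M"
  shows "submodule R (LinearCombinations.module.span R M X) M" "X \<subseteq> LinearCombinations.module.span R M X"
proof -
  interpret M: module R M by fact
  show "submodule R (M.span X) M" by (rule M.span_is_submodule[OF assms(2)])
  show "X \<subseteq> M.span X" by (rule M.in_own_span[OF assms(2)])
qed

lemma (in irrelevant_cring) span_least:
  assumes "X \<subseteq> N" "submodule R N M"
  shows "LinearCombinations.module.span R M X \<subseteq> N"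
proof -
  interpret M: module R M by (rule submodD(1)[OF assms(2)])
  show ?thesis by (rule M.span_is_subset[OF assms])
qed

definition res_class :: "('k, 'a) gmodule \<Rightarrow> 'a \<Rightarrow> 'a set" where
  "res_class R r = irrelevant R +>\<^bsub>ring_mod R\<^esub> r"

text \<open>The bilinear map from the residue field and \<open>V\<close> to \<open>V / m V\<close>
  that underlies the tensor product; a representative is chosen, and \<open>pairing\<close> shows
  that the choice has no influence.\<close>

definition res_pairing :: "('k, 'a) gmodule \<Rightarrow> ('a, 'm, 'e) module_scheme \<Rightarrow> 'a set \<times> 'm \<Rightarrow> 'm set" where
  "res_pairing R V s = (SOME r. r \<in> carrier R \<and> fst s = res_class R r) \<odot>\<^bsub>quot_mod V (max_power R V (Suc 0))\<^esub>
     (max_power R V (Suc 0) +>\<^bsub>V\<^esub> snd s)"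

text \<open>The aim is to identify the tensor product of the residue field and \<open>V\<close> with
  \<open>V / m V\<close>: \<open>\<Psi>\<close> is induced by the pairing on the free module of
  pairs, and \<open>\<theta>\<close> sends \<open>v\<close> to the class of
  \<open>1 \<otimes> v\<close>.\<close>

locale tensor_residue = graded_cring R + V: module R V
  for R :: "('k, 'a) gmodule" (structure) and V :: "('a, 'm, 'e) module_scheme"
begin

abbreviation "k \<equiv> residue_field R"
abbreviation "S \<equiv> carrier k \<times> carrier V"
abbreviation "P \<equiv> free_on R S"
abbreviation "e \<equiv> basis_elt R S"
abbreviation "rel \<equiv> tensor_rel R k V"
abbreviation "Q \<equiv> quot_mod V (max_power R V (Suc 0))"
abbreviation "q v \<equiv> max_power R V (Suc 0) +>\<^bsub>V\<^esub> v"
abbreviation "cl \<equiv> res_class R"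
abbreviation "\<beta> \<equiv> res_pairing R V"

lemma k_simps:
  "module R k" "mod_hom R (ring_mod R) k cl" "carrier k = cl ` carrier R"
  and cl_eq_iff: "r \<in> carrier R \<Longrightarrow> r' \<in> carrier R \<Longrightarrow> cl r = cl r' \<longleftrightarrow> (\<exists>n\<in>irrelevant R. r = n \<oplus> r')"
proof -
  have s: "submodule R (irrelevant R) (ring_mod R)" using ideal_irrelevant by (simp add: submodule_ring_mod_iff)
  show "module R k" unfolding residue_field_def by (rule quot_mod_module[OF s])
  have "cl = (\<lambda>r. irrelevant R +>\<^bsub>ring_mod R\<^esub> r)" by (simp add: fun_eq_iff res_class_def)
  then show "mod_hom R (ring_mod R) k cl" unfolding residue_field_def using quot_mod_module(2)[OF s] by simp
  show "carrier k = cl ` carrier R"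
    by (simp add: residue_field_def quot_mod_simps ring_mod_simps res_class_def)
  assume "r \<in> carrier R" "r' \<in> carrier R"
  then show "cl r = cl r' \<longleftrightarrow> (\<exists>n\<in>irrelevant R. r = n \<oplus> r')"
    unfolding res_class_def using coset_eq_iff[OF s, of r r'] by (simp add: ring_mod_simps)
qed

lemma cl_closed: "r \<in> carrier R \<Longrightarrow> cl r \<in> carrier k"
  by (simp add: k_simps(3))

lemma cl_add: "r \<in> carrier R \<Longrightarrow> r' \<in> carrier R \<Longrightarrow> cl r \<oplus>\<^bsub>k\<^esub> cl r' = cl (r \<oplus> r')"
  using module_hom_add[OF mod_hom.f_hom[OF k_simps(2)], of r r'] by (simp add: ring_mod_simps)

lemma cl_smult: "r \<in> carrier R \<Longrightarrow> r' \<in> carrier R \<Longrightarrow> r \<odot>\<^bsub>k\<^esub> cl r' = cl (r \<otimes> r')"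
  using module_hom_smult[OF mod_hom.f_hom[OF k_simps(2)], of r r'] by (simp add: ring_mod_simps)

lemma q_hom: "mod_hom R V Q (\<lambda>v. q v)"
  by (rule quot_mod_module(2)[OF max_power_submod[OF V.module_axioms]])

lemma q_module: "module R Q"
  by (rule quot_mod_module(1)[OF max_power_submod[OF V.module_axioms]])

lemma q_zero_iff: "v \<in> carrier V \<Longrightarrow> q v = \<zero>\<^bsub>Q\<^esub> \<longleftrightarrow> v \<in> max_power R V (Suc 0)"
  unfolding quot_mod_simps by (rule coset_eq_self_iff[OF max_power_submod[OF V.module_axioms]])

lemma irrelevant_smult_q:
  assumes "n \<in> irrelevant R" "v \<in> carrier V"
  shows "n \<odot>\<^bsub>Q\<^esub> q v = \<zero>\<^bsub>Q\<^esub>"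
proof -
  have n: "n \<in> carrier R" by (rule irrelevant_carrier[OF assms(1)])
  have "n \<odot>\<^bsub>Q\<^esub> q v = q (n \<odot>\<^bsub>V\<^esub> v)"
    using module_hom_smult[OF mod_hom.f_hom[OF q_hom] n assms(2)] by simp
  moreover have "n \<odot>\<^bsub>V\<^esub> v \<in> max_power R V (Suc 0)"
    using max_power_smult_Suc[OF V.module_axioms assms(1), of v 0] assms(2) by simp
  ultimately show ?thesis using q_zero_iff[OF V.smult_closed[OF n assms(2)]] by simp
qed

text \<open>Two representatives differ by an element of the irrelevant ideal, which annihilates
  \<open>V / m V\<close>.\<close>

lemma pairing:
  assumes r: "r \<in> carrier R" and v: "v \<in> carrier V"
  shows "\<beta> (cl r, v) = r \<odot>\<^bsub>Q\<^esub> q v"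
proof -
  interpret Q: module R Q by (rule q_module)
  define r' where "r' = (SOME r'. r' \<in> carrier R \<and> cl r = cl r')"
  have r': "r' \<in> carrier R \<and> cl r = cl r'"
    unfolding r'_def by (rule someI[of _ r]) (use r in simp)
  then obtain n where n: "n \<in> irrelevant R" "r = n \<oplus> r'" using cl_eq_iff[OF r] by auto
  have qv: "q v \<in> carrier Q" by (rule mod_hom.f_im[OF q_hom v])
  have "r \<odot>\<^bsub>Q\<^esub> q v = n \<odot>\<^bsub>Q\<^esub> q v \<oplus>\<^bsub>Q\<^esub> r' \<odot>\<^bsub>Q\<^esub> q v"
    unfolding n(2) by (rule Q.smult_l_distr[OF irrelevant_carrier[OF n(1)] _ qv]) (use r' in simp)
  also have "\<dots> = r' \<odot>\<^bsub>Q\<^esub> q v"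
    unfolding irrelevant_smult_q[OF n(1) v] by (rule Q.M.l_zero[OF Q.smult_closed[OF _ qv]]) (use r' in simp)
  finally show ?thesis by (simp add: res_pairing_def r'_def)
qed

lemma pairing_closed: "s \<in> S \<Longrightarrow> \<beta> s \<in> carrier Q"
proof -
  interpret Q: module R Q by (rule q_module)
  assume "s \<in> S"
  then obtain r v where "s = (cl r, v)" "r \<in> carrier R" "v \<in> carrier V" by (auto simp: k_simps(3))
  then show "\<beta> s \<in> carrier Q" using mod_hom.f_im[OF q_hom] by (simp add: pairing)
qed

definition "\<Psi> = linear_extension R Q S \<beta>"

lemma Psi_hom: "mod_hom R P Q \<Psi>"
  unfolding \<Psi>_def by (rule linear_extension_hom[OF q_module pairing_closed])

lemma Psi_basis: "r \<in> carrier R \<Longrightarrow> v \<in> carrier V \<Longrightarrow> \<Psi> (e (cl r, v)) = r \<odot>\<^bsub>Q\<^esub> q v"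
  unfolding \<Psi>_def using linear_extension_basis[OF q_module pairing_closed, where s = "(cl r, v)"]
  by (simp add: cl_closed pairing)

lemma e_closed: "u \<in> carrier k \<Longrightarrow> v \<in> carrier V \<Longrightarrow> e (u, v) \<in> carrier P"
  by (rule free_on_basis) simp

text \<open>The generating set of \<open>tensor_rel\<close>, named so that a single relation can be
  applied through \<open>t_eqI\<close>.\<close>

definition relators where "relators =
  {e (u \<oplus>\<^bsub>k\<^esub> u', v) \<ominus>\<^bsub>P\<^esub> (e (u, v) \<oplus>\<^bsub>P\<^esub> e (u', v)) | u u' v.
     u \<in> carrier k \<and> u' \<in> carrier k \<and> v \<in> carrier V} \<union>
  {e (u, v \<oplus>\<^bsub>V\<^esub> v') \<ominus>\<^bsub>P\<^esub> (e (u, v) \<oplus>\<^bsub>P\<^esub> e (u, v')) | u v v'.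
     u \<in> carrier k \<and> v \<in> carrier V \<and> v' \<in> carrier V} \<union>
  {e (r \<odot>\<^bsub>k\<^esub> u, v) \<ominus>\<^bsub>P\<^esub> r \<odot>\<^bsub>P\<^esub> e (u, v) | r u v.
     r \<in> carrier R \<and> u \<in> carrier k \<and> v \<in> carrier V} \<union>
  {e (u, r \<odot>\<^bsub>V\<^esub> v) \<ominus>\<^bsub>P\<^esub> r \<odot>\<^bsub>P\<^esub> e (u, v) | r u v.
     r \<in> carrier R \<and> u \<in> carrier k \<and> v \<in> carrier V}"

lemma rel_eq: "rel = LinearCombinations.module.span R P relators"
  unfolding tensor_rel_def relators_def Let_def ..

lemma relators_Psi: "\<phi> \<in> relators \<Longrightarrow> \<phi> \<in> carrier P \<and> \<Psi> \<phi> = \<zero>\<^bsub>Q\<^esub>"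
proof -
  interpret Q: module R Q by (rule q_module)
  interpret k: module R k by (rule k_simps(1))
  interpret P: module R P by (rule free_on_module)
  have Padd: "\<Psi> (f \<oplus>\<^bsub>P\<^esub> g) = \<Psi> f \<oplus>\<^bsub>Q\<^esub> \<Psi> g" if "f \<in> carrier P" "g \<in> carrier P" for f g
    by (rule module_hom_add[OF mod_hom.f_hom[OF Psi_hom] that])
  have Psm: "\<Psi> (r \<odot>\<^bsub>P\<^esub> f) = r \<odot>\<^bsub>Q\<^esub> \<Psi> f" if "r \<in> carrier R" "f \<in> carrier P" for r f
    by (rule module_hom_smult[OF mod_hom.f_hom[OF Psi_hom] that])
  have qc: "q v \<in> carrier Q" if "v \<in> carrier V" for v by (rule mod_hom.f_im[OF q_hom that])
  have qadd: "q (v \<oplus>\<^bsub>V\<^esub> v') = q v \<oplus>\<^bsub>Q\<^esub> q v'" if "v \<in> carrier V" "v' \<in> carrier V" for v v'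
    by (rule module_hom_add[OF mod_hom.f_hom[OF q_hom] that])
  have qsm: "q (r \<odot>\<^bsub>V\<^esub> v) = r \<odot>\<^bsub>Q\<^esub> q v" if "r \<in> carrier R" "v \<in> carrier V" for r v
    by (rule module_hom_smult[OF mod_hom.f_hom[OF q_hom] that])
  have key: "f \<ominus>\<^bsub>P\<^esub> g \<in> carrier P \<and> \<Psi> (f \<ominus>\<^bsub>P\<^esub> g) = \<zero>\<^bsub>Q\<^esub>"
    if "f \<in> carrier P" "g \<in> carrier P" "\<Psi> f = \<Psi> g" for f g
    using that mod_hom.f_minus[OF Psi_hom that(1,2)] mod_hom.f_im[OF Psi_hom that(2)]
    by (simp add: a_minus_def Q.M.r_neg)
  assume "\<phi> \<in> relators"
  then consider
      (1) u u' v where "\<phi> = e (u \<oplus>\<^bsub>k\<^esub> u', v) \<ominus>\<^bsub>P\<^esub> (e (u, v) \<oplus>\<^bsub>P\<^esub> e (u', v))"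
        "u \<in> carrier k" "u' \<in> carrier k" "v \<in> carrier V"
    | (2) u v v' where "\<phi> = e (u, v \<oplus>\<^bsub>V\<^esub> v') \<ominus>\<^bsub>P\<^esub> (e (u, v) \<oplus>\<^bsub>P\<^esub> e (u, v'))"
        "u \<in> carrier k" "v \<in> carrier V" "v' \<in> carrier V"
    | (3) r u v where "\<phi> = e (r \<odot>\<^bsub>k\<^esub> u, v) \<ominus>\<^bsub>P\<^esub> r \<odot>\<^bsub>P\<^esub> e (u, v)"
        "r \<in> carrier R" "u \<in> carrier k" "v \<in> carrier V"
    | (4) r u v where "\<phi> = e (u, r \<odot>\<^bsub>V\<^esub> v) \<ominus>\<^bsub>P\<^esub> r \<odot>\<^bsub>P\<^esub> e (u, v)"
        "r \<in> carrier R" "u \<in> carrier k" "v \<in> carrier V"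
    unfolding relators_def by (elim UnE CollectE exE conjE)
  then show "\<phi> \<in> carrier P \<and> \<Psi> \<phi> = \<zero>\<^bsub>Q\<^esub>"
  proof cases
    case 1
    obtain a a' where a: "u = cl a" "a \<in> carrier R" "u' = cl a'" "a' \<in> carrier R" using 1(2,3) unfolding k_simps(3) by auto
    show ?thesis unfolding 1(1)
      by (rule key) (use 1 a in \<open>simp_all add: e_closed cl_closed cl_add Padd Psi_basis Q.smult_l_distr qc\<close>)
  next
    case 2
    obtain a where a: "u = cl a" "a \<in> carrier R" using 2(2) unfolding k_simps(3) by auto
    show ?thesis unfolding 2(1)
      by (rule key) (use 2 a in \<open>simp_all add: e_closed cl_closed Padd Psi_basis qadd Q.smult_r_distr qc\<close>)
  next
    case 3
    obtain a where a: "u = cl a" "a \<in> carrier R" using 3(3) unfolding k_simps(3) by auto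
    show ?thesis unfolding 3(1)
      by (rule key) (use 3 a in \<open>simp_all add: e_closed cl_closed cl_smult Psm Psi_basis Q.smult_assoc1 qc\<close>)
  next
    case 4
    obtain a where a: "u = cl a" "a \<in> carrier R" using 4(3) unfolding k_simps(3) by auto
    show ?thesis unfolding 4(1)
      by (rule key) (use 4 a in \<open>simp_all add: e_closed cl_closed Psm Psi_basis qsm Q.smult_assoc1[symmetric] qc m_comm\<close>)
  qed
qed

lemma rel_submod: "submodule R rel P"
  unfolding rel_eq by (rule submod_span[OF free_on_module]) (use relators_Psi in auto)

lemma relators_subset: "relators \<subseteq> rel"
  unfolding rel_eq by (rule submod_span[OF free_on_module]) (use relators_Psi in auto)

lemma rel_Psi: "\<phi> \<in> rel \<Longrightarrow> \<Psi> \<phi> = \<zero>\<^bsub>Q\<^esub>"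
proof -
  have "rel \<subseteq> {\<phi> \<in> carrier P. \<Psi> \<phi> = \<zero>\<^bsub>Q\<^esub>}"
    unfolding rel_eq by (rule span_least[OF _ submod_kernel[OF Psi_hom]]) (use relators_Psi in auto)
  then show "\<phi> \<in> rel \<Longrightarrow> \<Psi> \<phi> = \<zero>\<^bsub>Q\<^esub>" by auto
qed

abbreviation "t \<phi> \<equiv> rel +>\<^bsub>P\<^esub> \<phi>"
definition "\<theta> v = t (e (cl \<one>, v))"

lemma t_hom: "mod_hom R P (tensor R k V) (\<lambda>\<phi>. t \<phi>)"
  unfolding tensor_def by (rule quot_mod_module(2)[OF rel_submod])

lemma tensor_module: "module R (tensor R k V)"
  by (rule mod_hom_modules(2)[OF t_hom])

lemma tensor_carrier: "carrier (tensor R k V) = (\<lambda>\<phi>. t \<phi>) ` carrier P" and tensor_zero: "\<zero>\<^bsub>tensor R k V\<^esub> = rel"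
  unfolding tensor_def by (rule quot_mod_simps)+

lemma t_eqI:
  assumes "f \<ominus>\<^bsub>P\<^esub> g \<in> relators" "f \<in> carrier P" "g \<in> carrier P"
  shows "t f = t g"
proof -
  interpret P: module R P by (rule free_on_module)
  have "f = (f \<ominus>\<^bsub>P\<^esub> g) \<oplus>\<^bsub>P\<^esub> g" using assms by (simp add: a_minus_def P.M.a_assoc P.M.l_neg)
  then show ?thesis unfolding coset_eq_iff[OF rel_submod assms(2,3)] using assms(1) relators_subset by blast
qed

lemma t_add: "f \<in> carrier P \<Longrightarrow> g \<in> carrier P \<Longrightarrow> t (f \<oplus>\<^bsub>P\<^esub> g) = t f \<oplus>\<^bsub>tensor R k V\<^esub> t g"
  by (rule module_hom_add[OF mod_hom.f_hom[OF t_hom]])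

lemma t_smult: "r \<in> carrier R \<Longrightarrow> f \<in> carrier P \<Longrightarrow> t (r \<odot>\<^bsub>P\<^esub> f) = r \<odot>\<^bsub>tensor R k V\<^esub> t f"
  by (rule module_hom_smult[OF mod_hom.f_hom[OF t_hom]])

lemma theta_hom: "mod_hom R V (tensor R k V) \<theta>"
proof (rule mod_homI[OF V.module_axioms tensor_module])
  interpret P: module R P by (rule free_on_module)
  have c1: "cl \<one> \<in> carrier k" by (simp add: cl_closed)
  show "\<theta> v \<in> carrier (tensor R k V)" if "v \<in> carrier V" for v
    unfolding \<theta>_def by (rule mod_hom.f_im[OF t_hom e_closed[OF c1 that]])
  fix v assume v: "v \<in> carrier V"
  show "\<theta> (v \<oplus>\<^bsub>V\<^esub> w) = \<theta> v \<oplus>\<^bsub>tensor R k V\<^esub> \<theta> w" if w: "w \<in> carrier V" for w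
  proof -
    have "t (e (cl \<one>, v \<oplus>\<^bsub>V\<^esub> w)) = t (e (cl \<one>, v) \<oplus>\<^bsub>P\<^esub> e (cl \<one>, w))"
      by (rule t_eqI) (use v w c1 in \<open>auto simp: relators_def intro!: e_closed P.M.a_closed\<close>)
    then show ?thesis unfolding \<theta>_def using t_add[OF e_closed[OF c1 v] e_closed[OF c1 w]] by simp
  qed
  show "\<theta> (r \<odot>\<^bsub>V\<^esub> v) = r \<odot>\<^bsub>tensor R k V\<^esub> \<theta> v" if r: "r \<in> carrier R" for r
  proof -
    have "t (e (cl \<one>, r \<odot>\<^bsub>V\<^esub> v)) = t (r \<odot>\<^bsub>P\<^esub> e (cl \<one>, v))"
      by (rule t_eqI) (use r v c1 in \<open>auto simp: relators_def intro!: e_closed P.smult_closed\<close>)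
    then show ?thesis unfolding \<theta>_def using t_smult[OF r e_closed[OF c1 v]] by simp
  qed
qed

text \<open>Scalars move across the tensor sign, and the class of \<open>r\<close> is
  \<open>r\<close> times the class of \<open>1\<close>.\<close>

lemma t_basis:
  assumes r: "r \<in> carrier R" and v: "v \<in> carrier V"
  shows "t (e (cl r, v)) = \<theta> (r \<odot>\<^bsub>V\<^esub> v)"
proof -
  interpret P: module R P by (rule free_on_module)
  have c1: "cl \<one> \<in> carrier k" by (simp add: cl_closed)
  have r1: "cl r = r \<odot>\<^bsub>k\<^esub> cl \<one>" using cl_smult[OF r one_closed] r by simp
  have m: "e (r \<odot>\<^bsub>k\<^esub> cl \<one>, v) \<ominus>\<^bsub>P\<^esub> r \<odot>\<^bsub>P\<^esub> e (cl \<one>, v) \<in> relators"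
    unfolding relators_def using r v c1
    by (intro UnI1[OF UnI2] CollectI exI[of _ r] exI[of _ "cl \<one>"] exI[of _ v] conjI) simp_all
  have "t (e (cl r, v)) = t (r \<odot>\<^bsub>P\<^esub> e (cl \<one>, v))"
    by (rule t_eqI[OF m[folded r1] e_closed[OF cl_closed[OF r] v] P.smult_closed[OF r e_closed[OF c1 v]]])
  also have "\<dots> = \<theta> (r \<odot>\<^bsub>V\<^esub> v)"
    using t_smult[OF r e_closed[OF c1 v]] module_hom_smult[OF mod_hom.f_hom[OF theta_hom] r v] by (simp add: \<theta>_def)
  finally show ?thesis .
qed

lemma t_eq_theta:
  assumes \<phi>: "\<phi> \<in> carrier P" shows "\<exists>v\<in>carrier V. t \<phi> = \<theta> v"
proof -
  have im: "submodule R (\<theta> ` carrier V) (tensor R k V)"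
    by (rule submod_image[OF theta_hom submod_carrier[OF V.module_axioms]])
  have eq: "t \<phi> = (\<Oplus>\<^bsub>tensor R k V\<^esub>s\<in>{s \<in> S. \<phi> s \<noteq> \<zero>}. \<phi> s \<odot>\<^bsub>tensor R k V\<^esub> t (e s))"
    by (rule free_on_hom[OF t_hom \<phi>])
  have "t \<phi> \<in> \<theta> ` carrier V"
    unfolding eq
  proof (rule submod_finsum[OF im])
    show "finite {s \<in> S. \<phi> s \<noteq> \<zero>}" using \<phi> by (simp add: free_on_simps)
    fix s assume "s \<in> {s \<in> S. \<phi> s \<noteq> \<zero>}"
    then have s: "s \<in> S" by simp
    then obtain r v where rv: "s = (cl r, v)" "r \<in> carrier R" "v \<in> carrier V" unfolding k_simps(3) by auto
    have "t (e s) \<in> \<theta> ` carrier V" unfolding rv(1) t_basis[OF rv(2,3)] using rv by simp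
    then show "\<phi> s \<odot>\<^bsub>tensor R k V\<^esub> t (e s) \<in> \<theta> ` carrier V"
      by (rule submodD(5)[OF im free_on_component[OF \<phi> s]])
  qed
  then show ?thesis by auto
qed

text \<open>If \<open>1 \<otimes> v\<close> vanishes, \<open>\<Psi>\<close> shows that
  \<open>v\<close> is zero in \<open>V / m V\<close>. Conversely, for \<open>n\<close> in the
  irrelevant ideal \<open>1 \<otimes> n w\<close> equals \<open>n \<otimes> w\<close>, and the class
  of \<open>n\<close> in the residue field is that of \<open>0\<close>.\<close>

lemma theta_zero_iff:
  assumes v: "v \<in> carrier V" shows "\<theta> v = \<zero>\<^bsub>tensor R k V\<^esub> \<longleftrightarrow> v \<in> max_power R V (Suc 0)"
proof
  interpret P: module R P by (rule free_on_module)
  interpret Q: module R Q by (rule q_module)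
  have c1: "cl \<one> \<in> carrier k" by (simp add: cl_closed)
  assume "\<theta> v = \<zero>\<^bsub>tensor R k V\<^esub>"
  then have "e (cl \<one>, v) \<in> rel"
    using coset_eq_self_iff[OF rel_submod e_closed[OF c1 v]] by (simp add: \<theta>_def tensor_zero)
  then have "\<one> \<odot>\<^bsub>Q\<^esub> q v = \<zero>\<^bsub>Q\<^esub>" using rel_Psi Psi_basis[OF one_closed v] by simp
  then show "v \<in> max_power R V (Suc 0)" using q_zero_iff[OF v] mod_hom.f_im[OF q_hom v] by simp
next
  interpret T: module R "tensor R k V" by (rule tensor_module)
  have "max_power R V (Suc 0) \<subseteq> {v \<in> carrier V. \<theta> v = \<zero>\<^bsub>tensor R k V\<^esub>}"
  proof (rule max_power_Suc_least[OF submod_kernel[OF theta_hom]])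
    fix n w assume n: "n \<in> irrelevant R" and "w \<in> max_power R V 0"
    then have w: "w \<in> carrier V" by simp
    have nc: "n \<in> carrier R" by (rule irrelevant_carrier[OF n])
    have "cl n = cl \<zero>" unfolding cl_eq_iff[OF nc zero_closed] using n nc by (intro bexI[of _ n]) simp_all
    then have "\<theta> (n \<odot>\<^bsub>V\<^esub> w) = \<theta> (\<zero> \<odot>\<^bsub>V\<^esub> w)" using t_basis[OF nc w] t_basis[OF zero_closed w] by simp
    also have "\<dots> = \<zero>\<^bsub>tensor R k V\<^esub>" using w mod_hom.f0_is_0[OF theta_hom] by simp
    finally show "n \<odot>\<^bsub>V\<^esub> w \<in> {v \<in> carrier V. \<theta> v = \<zero>\<^bsub>tensor R k V\<^esub>}" using nc w by simp
  qed
  then show "v \<in> max_power R V (Suc 0) \<Longrightarrow> \<theta> v = \<zero>\<^bsub>tensor R k V\<^esub>" by auto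
qed

text \<open>Every class is some \<open>1 \<otimes> v\<close>, and on these \<open>\<Psi>\<close> is
  faithful by \<open>theta_zero_iff\<close>. This turns membership in the relations into a
  computation in \<open>V / m V\<close>.\<close>

lemma rel_iff:
  assumes \<phi>: "\<phi> \<in> carrier P" shows "\<phi> \<in> rel \<longleftrightarrow> \<Psi> \<phi> = \<zero>\<^bsub>Q\<^esub>"
proof
  assume z: "\<Psi> \<phi> = \<zero>\<^bsub>Q\<^esub>"
  interpret Q: module R Q by (rule q_module)
  have c1: "cl \<one> \<in> carrier k" by (simp add: cl_closed)
  obtain v where v: "v \<in> carrier V" "t \<phi> = t (e (cl \<one>, v))" using t_eq_theta[OF \<phi>] unfolding \<theta>_def by auto
  then obtain n where n: "n \<in> rel" "\<phi> = n \<oplus>\<^bsub>P\<^esub> e (cl \<one>, v)"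
    using coset_eq_iff[OF rel_submod \<phi> e_closed[OF c1 v(1)]] by auto
  have nP: "n \<in> carrier P" using n(1) submodD(2)[OF rel_submod] by auto
  have qv: "q v \<in> carrier Q" by (rule mod_hom.f_im[OF q_hom v(1)])
  have "\<Psi> \<phi> = \<Psi> n \<oplus>\<^bsub>Q\<^esub> \<Psi> (e (cl \<one>, v))"
    unfolding n(2) by (rule module_hom_add[OF mod_hom.f_hom[OF Psi_hom] nP e_closed[OF c1 v(1)]])
  then have "q v = \<zero>\<^bsub>Q\<^esub>" using z rel_Psi[OF n(1)] Psi_basis[OF one_closed v(1)] qv by simp
  then have "\<theta> v = \<zero>\<^bsub>tensor R k V\<^esub>" using q_zero_iff[OF v(1)] theta_zero_iff[OF v(1)] by simp
  then have "t \<phi> = rel" using v(2) by (simp add: \<theta>_def tensor_zero)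
  then show "\<phi> \<in> rel" using coset_eq_self_iff[OF rel_submod \<phi>] by simp
qed (rule rel_Psi)

end

context graded_cring
begin

text \<open>On a generator \<open>r \<otimes> v\<close> the image is \<open>r \<otimes> f v\<close>,
  which \<open>\<Psi>\<close> sends to \<open>r\<close> times the class of \<open>f v\<close> in
  \<open>V' / m V'\<close>, that is to 0.\<close>

lemma tensor_map_zero:
  fixes V :: "('a, 'm, 'e) module_scheme" and V' :: "('a, 'm2, 'e2) module_scheme"
  assumes f: "mod_hom R V V' f" and f_max: "\<And>v. v \<in> carrier V \<Longrightarrow> f v \<in> max_power R V' (Suc 0)"
    and U: "U \<in> carrier (tensor R (residue_field R) V)"
  shows "tensor_map R (residue_field R) V V' f U = \<zero>\<^bsub>tensor R (residue_field R) V'\<^esub>"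
proof -
  interpret A: tensor_residue R V
    by (intro tensor_residue.intro graded_cring_axioms mod_hom_modules(1)[OF f])
  interpret B: tensor_residue R V'
    by (intro tensor_residue.intro graded_cring_axioms mod_hom_modules(2)[OF f])
  let ?L = "linear_extension R B.P A.S (\<lambda>s. B.e (fst s, f (snd s)))"
  have b: "B.e (fst s, f (snd s)) \<in> carrier B.P" if "s \<in> A.S" for s
    by (rule B.e_closed) (use that mod_hom.f_im[OF f] in auto)
  have L: "mod_hom R A.P B.P ?L" by (rule linear_extension_hom[OF free_on_module b])
  have comp: "mod_hom R A.P B.Q (\<lambda>\<phi>. B.\<Psi> (?L \<phi>))" by (rule mod_hom_comp[OF L B.Psi_hom])
  interpret Q: module R B.Q by (rule B.q_module)
  have gen: "B.\<Psi> (?L (A.e s)) = \<zero>\<^bsub>B.Q\<^esub>" if s: "s \<in> A.S" for s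
  proof -
    from s obtain r v where rv: "s = (res_class R r, v)" "r \<in> carrier R" "v \<in> carrier V"
      unfolding A.k_simps(3) by auto
    have fv: "f v \<in> carrier V'" by (rule mod_hom.f_im[OF f rv(3)])
    have "?L (A.e s) = B.e (fst s, f (snd s))" by (rule linear_extension_basis[OF free_on_module b s])
    then have "B.\<Psi> (?L (A.e s)) = r \<odot>\<^bsub>B.Q\<^esub> B.q (f v)"
      using B.Psi_basis[OF rv(2) fv] rv(1) by simp
    also have "B.q (f v) = \<zero>\<^bsub>B.Q\<^esub>" using B.q_zero_iff[OF fv] f_max[OF rv(3)] by simp
    finally show ?thesis using rv(2) by simp
  qed
  have zero: "?L \<phi> \<in> B.rel" if \<phi>: "\<phi> \<in> carrier A.P" for \<phi>
  proof -
    have "B.\<Psi> (?L \<phi>) = (\<Oplus>\<^bsub>B.Q\<^esub>s\<in>{s \<in> A.S. \<phi> s \<noteq> \<zero>}. \<phi> s \<odot>\<^bsub>B.Q\<^esub> B.\<Psi> (?L (A.e s)))"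
      by (rule free_on_hom[OF comp \<phi>])
    also have "\<dots> = (\<Oplus>\<^bsub>B.Q\<^esub>s\<in>{s \<in> A.S. \<phi> s \<noteq> \<zero>}. \<zero>\<^bsub>B.Q\<^esub>)"
    proof (rule Q.M.finsum_cong'[OF refl])
      fix s assume "s \<in> {s \<in> A.S. \<phi> s \<noteq> \<zero>}"
      then have s: "s \<in> A.S" by simp
      show "\<phi> s \<odot>\<^bsub>B.Q\<^esub> B.\<Psi> (?L (A.e s)) = \<zero>\<^bsub>B.Q\<^esub>"
        unfolding gen[OF s] by (rule Q.smult_r_null[OF free_on_component[OF \<phi> s]])
    qed (rule Pi_I, rule Q.M.zero_closed)
    also have "\<dots> = \<zero>\<^bsub>B.Q\<^esub>" by (rule Q.M.finsum_zero)
    finally show ?thesis using B.rel_iff[OF mod_hom.f_im[OF L \<phi>]] by simp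
  qed
  obtain \<phi> where \<phi>: "\<phi> \<in> carrier A.P" "U = A.t \<phi>" using U unfolding A.tensor_carrier by auto
  have "tensor_map R (residue_field R) V V' f U = quot_map B.P B.rel ?L U"
    by (simp add: tensor_map_def Let_def linear_extension_def[abs_def])
  also have "\<dots> = B.t (?L \<phi>)"
    unfolding \<phi>(2)
    by (rule quot_map_coset[OF L A.rel_submod B.rel_submod _ \<phi>(1)]) (use zero submodD(2)[OF A.rel_submod] in auto)
  also have "\<dots> = B.rel"
    using coset_eq_self_iff[OF B.rel_submod mod_hom.f_im[OF L \<phi>(1)]] zero[OF \<phi>(1)] by simp
  finally show ?thesis by (simp add: B.tensor_zero)
qed

text \<open>All differentials of the resolution are minimal, so they vanish after tensoring with the
  residue field: every element is a cycle, the only boundary is 0, and the homology in degree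
  \<open>i\<close> is \<open>F_i / m F_i\<close>.\<close>

lemma Tor_residue_field:
  fixes M :: "('a, 'm) gmodule"
  assumes F: "minimal_resolution R (fmod R (min_res R M)) (diff (min_res R M)) e M n"
  shows "\<exists>\<Theta>. mod_hom R (fmod R (min_res R M) i) (Tor R (residue_field R) M i) \<Theta> \<and>
    \<Theta> ` carrier (fmod R (min_res R M) i) = carrier (Tor R (residue_field R) M i) \<and>
    (\<forall>v\<in>carrier (fmod R (min_res R M) i). \<Theta> v = \<zero>\<^bsub>Tor R (residue_field R) M i\<^esub> \<longleftrightarrow>
       v \<in> max_power R (fmod R (min_res R M) i) 1)"
proof -
  let ?F = "min_res R M" and ?k = "residue_field R"
  let ?T = "\<lambda>i. tensor R ?k (fmod R ?F i)"
  let ?d = "\<lambda>i. tensor_map R ?k (fmod R ?F i) (fmod R ?F (i - 1)) (diff ?F i)"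
  interpret F: minimal_resolution R "fmod R ?F" "diff ?F" e M n by fact
  have tr: "tensor_residue R (fmod R ?F i)" for i
    by (intro tensor_residue.intro graded_cring_axioms F.C_module)
  interpret A: tensor_residue R "fmod R ?F i" by (rule tr)
  have d: "?d (Suc i) U = \<zero>\<^bsub>?T i\<^esub>" if "U \<in> carrier (?T (Suc i))" for i U
    unfolding diff_Suc_1 by (rule tensor_map_zero[OF F.d_hom _ that]) (use F.minimal in simp)
  have Tm: "module R (?T i)" for i by (rule tensor_residue.tensor_module[OF tr])
  have cyc: "cycles ?T ?d i = carrier (?T i)"
  proof (cases i)
    case (Suc j)
    then show ?thesis unfolding cycles_def using d[of _ j] by auto
  qed (simp add: cycles_def)
  have bnd: "boundaries ?T ?d i = {\<zero>\<^bsub>?T i\<^esub>}"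
  proof
    show "boundaries ?T ?d i \<subseteq> {\<zero>\<^bsub>?T i\<^esub>}" unfolding boundaries_def using d[of _ i] by auto
    have "\<zero>\<^bsub>?T (Suc i)\<^esub> \<in> carrier (?T (Suc i))"
      using submodD(3)[OF submod_carrier[OF Tm]] .
    then have "?d (Suc i) \<zero>\<^bsub>?T (Suc i)\<^esub> \<in> boundaries ?T ?d i" unfolding boundaries_def by (rule imageI)
    then show "{\<zero>\<^bsub>?T i\<^esub>} \<subseteq> boundaries ?T ?d i"
      unfolding d[OF \<open>\<zero>\<^bsub>?T (Suc i)\<^esub> \<in> carrier (?T (Suc i))\<close>] by simp
  qed
  have upd: "(?T i)\<lparr>carrier := carrier (?T i)\<rparr> = ?T i" by simp
  have Tor: "Tor R ?k M i = quot_mod (?T i) {\<zero>\<^bsub>?T i\<^esub>}"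
    unfolding Tor_def Let_def homology_def cyc bnd upd ..
  have s: "submodule R {\<zero>\<^bsub>?T i\<^esub>} (?T i)" by (rule submod_zero[OF Tm])
  \<comment> \<open>The additional coset of the zero submodule comes from homology being defined as
    a quotient by the boundaries.\<close>
  let ?\<Theta> = "\<lambda>v. {\<zero>\<^bsub>?T i\<^esub>} +>\<^bsub>?T i\<^esub> A.\<theta> v"
  have "mod_hom R (fmod R ?F i) (Tor R ?k M i) ?\<Theta>"
    unfolding Tor by (rule mod_hom_comp[OF A.theta_hom quot_mod_module(2)[OF s]])
  moreover have "?\<Theta> ` carrier (fmod R ?F i) = carrier (Tor R ?k M i)"
  proof -
    have "A.\<theta> ` carrier (fmod R ?F i) = carrier (?T i)"
    proof
      show "A.\<theta> ` carrier (fmod R ?F i) \<subseteq> carrier (?T i)" using mod_hom.f_im[OF A.theta_hom] by auto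
      show "carrier (?T i) \<subseteq> A.\<theta> ` carrier (fmod R ?F i)"
        unfolding A.tensor_carrier using A.t_eq_theta by auto
    qed
    then show ?thesis unfolding Tor quot_mod_simps by (auto simp: image_image[symmetric])
  qed
  moreover have "?\<Theta> v = \<zero>\<^bsub>Tor R ?k M i\<^esub> \<longleftrightarrow> v \<in> max_power R (fmod R ?F i) 1"
    if v: "v \<in> carrier (fmod R ?F i)" for v
    unfolding Tor quot_mod_simps coset_eq_self_iff[OF s mod_hom.f_im[OF A.theta_hom v]]
    using A.theta_zero_iff[OF v] by simp
  ultimately show ?thesis by blast
qed

end

section \<open>Betti numbers as ranks of a minimal resolution\<close>

context graded_residue
begin

lemma restrict_scalars_simps:
  "carrier (restrict_scalars R V) = carrier V" "\<zero>\<^bsub>restrict_scalars R V\<^esub> = \<zero>\<^bsub>V\<^esub>"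
  "u \<oplus>\<^bsub>restrict_scalars R V\<^esub> v = u \<oplus>\<^bsub>V\<^esub> v"
  "c \<in> carrier K \<Longrightarrow> c \<odot>\<^bsub>restrict_scalars R V\<^esub> v = emb c \<odot>\<^bsub>V\<^esub> v"
  by (simp_all add: restrict_scalars_def emb_def)

lemma restrict_scalars_vectorspace:
  assumes "module R V" shows "vectorspace K (restrict_scalars R V)"
proof -
  interpret V: module R V by fact
  have "module K (restrict_scalars R V)"
  proof (rule module_criteria)
    show "cring K" by (rule K.is_cring)
    show "\<forall>v\<in>carrier (restrict_scalars R V). \<exists>neg_v\<in>carrier (restrict_scalars R V).
        v \<oplus>\<^bsub>restrict_scalars R V\<^esub> neg_v = \<zero>\<^bsub>restrict_scalars R V\<^esub>"
      unfolding restrict_scalars_simps using V.M.r_neg by (auto intro: bexI[of _ "\<ominus>\<^bsub>V\<^esub> _"])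
  qed (auto simp: restrict_scalars_simps emb_closed emb_add emb_mult emb_one V.M.a_ac
      V.smult_l_distr V.smult_r_distr V.smult_assoc1)
  then show ?thesis using K.field_axioms by (simp add: vectorspace_def)
qed

text \<open>Constant vectors identify \<open>F_i / m F_i\<close> with a coordinate space over
  \<open>K\<close> whose dimension is the rank of \<open>F_i\<close>; \<open>rank_unique\<close>
  then replaces the chosen resolution by \<open>G\<close>.\<close>

theorem betti_eq_rank:
  fixes M :: "('a, 'm) gmodule"
  assumes F: "\<exists>F. min_free_resolution R M F" and M: "module R M"
    and G: "minimal_resolution R G dG eG M nG"
  shows "betti K R M i = nG i"
proof -
  let ?F = "min_res R M" and ?k = "residue_field R"
  have mf: "min_free_resolution R M ?F" unfolding min_res_def by (rule someI_ex[OF F])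
  obtain e where res: "minimal_resolution R (fmod R ?F) (diff ?F) e M (rank ?F)"
    using min_free_resolution_imp[OF mf M] by (rule exE)
  let ?n = "rank ?F i" and ?V = "fmod R ?F i" and ?T = "Tor R ?k M i"
  obtain \<Theta> where \<Theta>: "mod_hom R ?V ?T \<Theta>" "\<Theta> ` carrier ?V = carrier ?T"
      "\<forall>v\<in>carrier ?V. \<Theta> v = \<zero>\<^bsub>?T\<^esub> \<longleftrightarrow> v \<in> max_power R ?V 1"
    using Tor_residue_field[OF res, of i] by (elim exE conjE)
  have VR: "mod_hom R ?V (RV ?n) (\<lambda>v. v)" "mod_hom R (RV ?n) ?V (\<lambda>v. v)"
    unfolding fmod_def by (rule free_gmod_to_func_space, rule func_space_to_free_gmod)
  have carr: "carrier ?V = carrier (RV ?n)" by (simp add: fmod_simps func_space_simps)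
  have maxeq: "max_power R ?V 1 = max_power R (RV ?n) 1"
    using max_power_hom0[OF VR(1)] max_power_hom0[OF VR(2)] by blast
  have \<Theta>': "mod_hom R (RV ?n) ?T \<Theta>" by (rule mod_hom_comp[OF VR(2) \<Theta>(1)])
  interpret \<Theta>: mod_hom R "RV ?n" ?T \<Theta> by (rule \<Theta>')
  let ?\<Lambda> = "\<lambda>c. \<Theta> (embv ?n c)" and ?W = "restrict_scalars R ?T"
  have vW: "vectorspace K ?W" by (rule restrict_scalars_vectorspace[OF mod_hom_modules(2)[OF \<Theta>']])
  have vK: "vectorspace K (KV ?n)" by (rule K_vectorspace)
  have hom: "mod_hom K (KV ?n) ?W ?\<Lambda>"
  proof (rule mod_homI)
    show "module K (KV ?n)" "module K ?W" using vW vK by (simp_all add: vectorspace_def)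
    fix c assume c: "c \<in> carrier (KV ?n)"
    show "?\<Lambda> c \<in> carrier ?W" unfolding restrict_scalars_simps by (rule \<Theta>.f_im[OF embv_closed[OF c]])
    show "?\<Lambda> (c \<oplus>\<^bsub>KV ?n\<^esub> c') = ?\<Lambda> c \<oplus>\<^bsub>?W\<^esub> ?\<Lambda> c'" if c': "c' \<in> carrier (KV ?n)" for c'
      unfolding restrict_scalars_simps embv_add[OF c c'] by (rule \<Theta>.f_add[OF embv_closed[OF c] embv_closed[OF c']])
    show "?\<Lambda> (r \<odot>\<^bsub>KV ?n\<^esub> c) = r \<odot>\<^bsub>?W\<^esub> ?\<Lambda> c" if r: "r \<in> carrier K" for r
      unfolding restrict_scalars_simps(4)[OF r] embv_smult[OF r c] by (rule \<Theta>.f_smult[OF emb_closed[OF r] embv_closed[OF c]])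
  qed
  interpret L: linear_map K "KV ?n" ?W ?\<Lambda>
    using hom vK vW by (simp add: linear_map_def mod_hom_def)
  have surj: "?\<Lambda> ` carrier (KV ?n) = carrier ?W"
  proof
    show "?\<Lambda> ` carrier (KV ?n) \<subseteq> carrier ?W" using mod_hom.f_im[OF hom] by auto
    show "carrier ?W \<subseteq> ?\<Lambda> ` carrier (KV ?n)"
    proof
      fix U assume "U \<in> carrier ?W"
      then have "U \<in> \<Theta> ` carrier (RV ?n)" using \<Theta>(2) carr by (simp add: restrict_scalars_simps)
      then obtain v where v: "v \<in> carrier (RV ?n)" "U = \<Theta> v" by (elim imageE)
      let ?c = "resv ?n v"
      have c: "?c \<in> carrier (KV ?n)" by (rule resv_closed[OF v(1)])
      have e: "embv ?n ?c \<in> carrier (RV ?n)" by (rule embv_closed[OF c])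
      have "resv ?n (embv ?n ?c) = resv ?n v" by (rule resv_embv[OF c])
      then have "embv ?n ?c \<ominus>\<^bsub>RV ?n\<^esub> v \<in> max_power R (RV ?n) 1" unfolding resv_eq_iff[OF e v(1)] .
      then have "\<Theta> (embv ?n ?c \<ominus>\<^bsub>RV ?n\<^esub> v) = \<zero>\<^bsub>?T\<^esub>"
        by (rule \<Theta>(3)[unfolded carr maxeq, rule_format, OF \<Theta>.M.M.minus_closed[OF e v(1)], THEN iffD2])
      then have "?\<Lambda> ?c = U"
        using \<Theta>.f_minus[OF e v(1)] \<Theta>.f_im[OF e] \<Theta>.f_im[OF v(1)] v(2) by simp
      then show "U \<in> ?\<Lambda> ` carrier (KV ?n)" using c by (rule image_eqI[OF sym])
    qed
  qed
  have inj: "inj_on ?\<Lambda> (carrier (KV ?n))"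
  proof (rule inj_onI)
    fix c c' assume c: "c \<in> carrier (KV ?n)" and c': "c' \<in> carrier (KV ?n)" and eq: "?\<Lambda> c = ?\<Lambda> c'"
    note e = embv_closed[OF c] and e' = embv_closed[OF c']
    have "\<Theta> (embv ?n c \<ominus>\<^bsub>RV ?n\<^esub> embv ?n c') = \<zero>\<^bsub>?T\<^esub>"
      using \<Theta>.f_minus[OF e e'] \<Theta>.f_im[OF e'] eq by simp
    then have "embv ?n c \<ominus>\<^bsub>RV ?n\<^esub> embv ?n c' \<in> max_power R (RV ?n) 1"
      by (rule \<Theta>(3)[unfolded carr maxeq, rule_format, OF \<Theta>.M.M.minus_closed[OF e e'], THEN iffD1])
    then have "resv ?n (embv ?n c) = resv ?n (embv ?n c')" unfolding resv_eq_iff[OF e e'] .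
    then show "c = c'" unfolding resv_embv[OF c] resv_embv[OF c'] .
  qed
  have "vectorspace.dim K (KV ?n) = vectorspace.dim K ?W" by (rule L.dim_eq[OF dim_KV(2) inj surj])
  then have "betti K R M i = ?n" unfolding betti_def dim_KV(1) by simp
  also have "?n = nG i" by (rule rank_unique[OF res G])
  finally show ?thesis .
qed

end

subsection \<open>Splittings of ideals\<close>

lemma enat_le_all: "(\<And>t. b \<le> enat t \<Longrightarrow> a \<le> enat t) \<Longrightarrow> a \<le> b" for a b :: enat
  by (cases b) auto

lemma regular_on_quotient:
  assumes N: "submodule R N M" and x: "x \<in> carrier R" and reg: "regular_on x (quot_mod M N)"
    and v: "v \<in> carrier M" "x \<odot>\<^bsub>M\<^esub> v \<in> N"
  shows "v \<in> N"
proof -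
  interpret M: module R M by (rule submodD(1)[OF N])
  interpret q: mod_hom R M "quot_mod M N" "\<lambda>v. N +>\<^bsub>M\<^esub> v" by (rule quot_mod_module(2)[OF N])
  have "N +>\<^bsub>M\<^esub> (x \<odot>\<^bsub>M\<^esub> v) = N +>\<^bsub>M\<^esub> (x \<odot>\<^bsub>M\<^esub> \<zero>\<^bsub>M\<^esub>)"
    using coset_eq_self_iff[OF N M.smult_closed[OF x v(1)], THEN iffD2, OF v(2)]
      coset_eq_self_iff[OF N M.M.zero_closed, THEN iffD2, OF submodD(3)[OF N]] by (simp only: M.smult_r_null[OF x])
  then have "x \<odot>\<^bsub>quot_mod M N\<^esub> (N +>\<^bsub>M\<^esub> v) = x \<odot>\<^bsub>quot_mod M N\<^esub> (N +>\<^bsub>M\<^esub> \<zero>\<^bsub>M\<^esub>)"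
    unfolding q.f_smult[OF x v(1)] q.f_smult[OF x M.M.zero_closed] .
  then have "N +>\<^bsub>M\<^esub> v = N +>\<^bsub>M\<^esub> \<zero>\<^bsub>M\<^esub>"
    by (rule inj_onD[OF reg[unfolded regular_on_def]]) (rule q.f_im, simp add: v)+
  also have "\<dots> = N" by (rule coset_eq_self_iff[OF N M.M.zero_closed, THEN iffD2, OF submodD(3)[OF N]])
  finally show ?thesis by (rule coset_eq_self_iff[OF N v(1), THEN iffD1])
qed

context irrelevant_cring
begin

text \<open>The class of \<open>w\<close> in the graded piece of degree \<open>s\<close> has the
  same image as the zero class, so injectivity makes it zero.\<close>

lemma gr_regular_onD:
  fixes M :: "('a, 'm) gmodule"
  assumes M: "module R M" and x: "x \<in> irrelevant R" and reg: "gr_regular_on R x M"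
    and w: "w \<in> max_power R M s" "x \<odot>\<^bsub>M\<^esub> w \<in> max_power R M (Suc (Suc s))"
  shows "w \<in> max_power R M (Suc s)"
proof -
  interpret M: module R M by fact
  let ?A = "max_power R M (Suc s)" and ?B = "max_power R M (Suc (Suc s))"
  let ?f = "\<lambda>v. x \<odot>\<^bsub>M\<^esub> v"
  have xR: "x \<in> carrier R" by (rule irrelevant_carrier[OF x])
  note A = max_power_submod[OF M, of "Suc s"] and B = max_power_submod[OF M, of "Suc (Suc s)"]
  have wc: "w \<in> carrier M" by (rule max_power_carrier[OF M w(1)])
  have q: "quot_map M ?B ?f (?A +>\<^bsub>M\<^esub> v) = ?B +>\<^bsub>M\<^esub> (x \<odot>\<^bsub>M\<^esub> v)" if "v \<in> carrier M" for v
    by (rule quot_map_coset[OF mod_hom_smult[OF M xR] A B _ that]) (use max_power_smult_Suc[OF M x] in auto)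
  have "quot_map M ?B ?f (?A +>\<^bsub>M\<^esub> w) = quot_map M ?B ?f (?A +>\<^bsub>M\<^esub> \<zero>\<^bsub>M\<^esub>)"
    unfolding q[OF wc] q[OF M.M.zero_closed]
    using coset_eq_self_iff[OF B M.smult_closed[OF xR wc], THEN iffD2, OF w(2)]
      coset_eq_self_iff[OF B M.M.zero_closed, THEN iffD2, OF submodD(3)[OF B]] by (simp only: M.smult_r_null[OF xR])
  moreover have "?A +>\<^bsub>M\<^esub> v \<in> carrier (gr_part R M s)" if "v \<in> max_power R M s" for v
    using that by (simp add: gr_part_def quot_mod_simps coset_restrict)
  ultimately have "?A +>\<^bsub>M\<^esub> w = ?A +>\<^bsub>M\<^esub> \<zero>\<^bsub>M\<^esub>"
    using inj_onD[OF reg[unfolded gr_regular_on_def, THEN spec, of s]] w(1) max_power_zero[OF M] by blast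
  also have "\<dots> = ?A" by (rule coset_eq_self_iff[OF A M.M.zero_closed, THEN iffD2, OF submodD(3)[OF A]])
  finally show ?thesis by (rule coset_eq_self_iff[OF A wc, THEN iffD1])
qed

lemma ideal_prod_irrelevant:
  assumes J: "ideal J R" and a: "a \<in> ideal_prod R (irrelevant R) J"
  shows "a \<in> max_power R (ideal_mod R J) 1"
  using a
proof (induction rule: ideal_prod.induct)
  case (prod r s)
  then show ?case
    using max_power_smult_Suc[OF ideal_mod_module[OF J], of r s 0] by (simp add: ideal_mod_simps)
next
  case (sum a b)
  then show ?case using max_power_add[OF ideal_mod_module[OF J], of a 1 b] by (simp add: ideal_mod_simps)
qed

lemma mult_set_submodule:
  assumes "ideal T R" "x \<in> carrier R" shows "submodule R (mult_set R x T) (ideal_mod R T)"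
  using submod_image[OF mod_hom_smult[OF ideal_mod_module[OF assms(1)] assms(2)] submod_carrier[OF ideal_mod_module[OF assms(1)]]]
  by (simp add: ideal_mod_simps mult_set_def)

text \<open>\<open>R\<close> resolves itself, concentrated in degree 0. Writing the terms as ideals,
  the unit ideal and zero ideals, gives them one type and lets \<open>R\<close> take the place of
  \<open>I'\<close>; the linearity condition then concerns zero modules.\<close>

lemma ring_resolution:
  "minimal_resolution R (\<lambda>i. ideal_mod R (if i = 0 then carrier R else {\<zero>})) (\<lambda>_ _. \<zero>) (\<lambda>v. v)
     (ideal_mod R (carrier R)) (\<lambda>i. if i = 0 then 1 else 0)"
  and ring_linear_at: "linear_at R (\<lambda>i. ideal_mod R (if i = 0 then carrier R else {\<zero>})) (\<lambda>_ _. \<zero>) i"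
proof -
  let ?C = "\<lambda>i::nat. ideal_mod R (if i = 0 then carrier R else {\<zero>})" and ?d = "\<lambda>_ _. \<zero>"
  have m: "module R (?C i)" for i by (rule ideal_mod_module) (simp add: oneideal zeroideal)
  have m1: "module R (ideal_mod R (carrier R))" using m[of 0] by simp
  have zero: "\<zero> \<in> max_power R (?C i) s" for i s using max_power_zero[OF m, of i s] by (simp add: ideal_mod_simps)
  have free0: "free_module R (ideal_mod R (carrier R)) 1"
  proof (rule free_moduleI)
    show "mod_hom R (func_space {..<1::nat}) (ideal_mod R (carrier R)) (\<lambda>f. f 0)"
      by (rule mod_homI[OF func_space_is_module m1]) (auto simp: func_space_simps ideal_mod_simps)
    show "mod_hom R (ideal_mod R (carrier R)) (func_space {..<1::nat}) (\<lambda>a. \<lambda>_\<in>{..<1}. a)"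
      by (rule mod_homI[OF m1 func_space_is_module]) (auto simp: func_space_simps ideal_mod_simps)
  qed (auto simp: func_space_simps ideal_mod_simps PiE_def extensional_def fun_eq_iff)
  show "minimal_resolution R ?C ?d (\<lambda>v. v) (ideal_mod R (carrier R)) (\<lambda>i. if i = 0 then 1 else 0)"
  proof (rule minimal_resolution.intro[OF irrelevant_cring_axioms minimal_resolution_axioms.intro])
    show "free_module R (?C i) (if i = 0 then 1 else 0)" for i
      using free0 free_module_trivial[OF m, of i] by (simp add: ideal_mod_simps)
    show "mod_hom R (?C (Suc i)) (?C i) (?d (Suc i))" for i
      using mod_hom_zero[OF m m, of "Suc i" i] by (simp add: ideal_mod_simps)
    show "mod_hom R (?C 0) (ideal_mod R (carrier R)) (\<lambda>v. v)" using mod_hom_id[OF m1] by simp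
    show "?d (Suc i) v \<in> max_power R (?C i) 1" for i v by (rule zero)
  qed (auto simp: ideal_mod_simps)
  show "linear_at R ?C ?d i"
    unfolding linear_at_def
  proof (intro allI ballI impI)
    fix s z assume "z \<in> carrier (?C (Suc i))"
    then have "z = \<zero> \<oplus>\<^bsub>?C (Suc i)\<^esub> \<zero>" by (simp add: ideal_mod_simps)
    moreover have "\<zero> \<in> carrier (?C (Suc (Suc i)))" by (simp add: ideal_mod_simps)
    ultimately show "\<exists>y\<in>max_power R (?C (Suc i)) s. \<exists>w\<in>carrier (?C (Suc (Suc i))). z = y \<oplus>\<^bsub>?C (Suc i)\<^esub> \<zero>"
      using zero[of "Suc i" s] by blast
  qed
qed

end

context graded_cring
begin

text \<open>\<open>J\<close> will be \<open>I'\<close> or \<open>R\<close>. The sum map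
  \<open>(u, v) \<mapsto> x u + v\<close> has as kernel the pairs \<open>(w, - x w)\<close> with
  \<open>w\<close> in \<open>T\<close>: if \<open>x u = - v\<close> lies in \<open>T\<close>,
  regularity of \<open>x\<close> on \<open>R / T\<close> puts \<open>u\<close> into
  \<open>T\<close>.\<close>

lemma ideal_splitting_cones:
  fixes F :: "nat \<Rightarrow> ('a, 'm, 'e) module_scheme" and G :: "nat \<Rightarrow> ('a, 'm2, 'e2) module_scheme"
  assumes F: "minimal_resolution R F dF eF (ideal_mod R J) nF" "\<And>i. linear_at R F dF i"
    and G: "minimal_resolution R G dG eG (ideal_mod R T) nG"
    and J: "ideal J R" and T: "ideal T R" and TJ: "T \<subseteq> J"
    and max: "\<And>v. v \<in> T \<Longrightarrow> v \<in> max_power R (ideal_mod R J) 1"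
    and x: "x \<in> irrelevant R"
    and reg_T: "\<And>w. w \<in> T \<Longrightarrow> x \<otimes> w = \<zero> \<Longrightarrow> w = \<zero>"
    and reg_quot: "\<And>a. a \<in> carrier R \<Longrightarrow> x \<otimes> a \<in> T \<Longrightarrow> a \<in> T"
    and gr: "gr_regular_on R x (ideal_mod R T)"
  shows "koszul_splitting_cones R F dF eF (ideal_mod R J) nF G dG eG (ideal_mod R T) nG x (\<lambda>v. v)
    (\<lambda>u. x \<otimes> fst u \<oplus> snd u) (ideal_mod R (mult_set R x J <+>\<^bsub>R\<^esub> T))
    (\<lambda>v. mult_set R x T +>\<^bsub>ideal_mod R T\<^esub> v) (quot_gmod (ideal_mod R T) (mult_set R x T))"
proof -
  interpret J: ideal J R by (rule J)
  interpret T: ideal T R by (rule T)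
  have xR: "x \<in> carrier R" by (rule irrelevant_carrier[OF x])
  have I: "ideal (mult_set R x J <+>\<^bsub>R\<^esub> T) R" by (rule add_ideals[OF mult_set_ideal[OF J xR] T])
  note mJ = ideal_mod_module[OF J] and mT = ideal_mod_module[OF T] and mI = ideal_mod_module[OF I]
  have neg: "\<ominus>\<^bsub>ideal_mod R T\<^esub> v = \<ominus> v" if "v \<in> T" for v
  proof -
    interpret MT: module R "ideal_mod R T" by (rule mT)
    show ?thesis by (rule MT.M.minus_equality) (use that T.Icarr in \<open>auto simp: ideal_mod_simps l_neg\<close>)
  qed
  have xT: "submodule R (mult_set R x T) (ideal_mod R T)"
    by (rule mult_set_submodule[OF T xR])
  have xTT: "x \<otimes> w \<in> T" if "w \<in> T" for w by (rule T.I_l_closed[OF that xR])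
  \<comment> \<open>The cone divides out the image of \<open>- x\<close>, the quotient is by
    \<open>x T\<close>; as sets they agree.\<close>
  have mult_neg: "mult_set R x T = (\<lambda>w. \<ominus> (x \<otimes> w)) ` T"
  proof
    have "x \<otimes> w \<in> (\<lambda>w. \<ominus> (x \<otimes> w)) ` T" if w: "w \<in> T" for w
      by (rule image_eqI[of _ _ "\<ominus> w"]) (use w xR T.Icarr T.a_inv_closed in \<open>auto simp: r_minus\<close>)
    then show "mult_set R x T \<subseteq> (\<lambda>w. \<ominus> (x \<otimes> w)) ` T" by (auto simp: mult_set_def)
    have "\<ominus> (x \<otimes> w) \<in> mult_set R x T" if w: "w \<in> T" for w
      unfolding mult_set_def by (rule image_eqI[of _ _ "\<ominus> w"]) (use w xR T.Icarr T.a_inv_closed in \<open>auto simp: r_minus\<close>)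
    then show "(\<lambda>w. \<ominus> (x \<otimes> w)) ` T \<subseteq> mult_set R x T" by auto
  qed
  let ?p = "\<lambda>u. x \<otimes> fst u \<oplus> snd u"
  have p: "mod_hom R (direct_sum (ideal_mod R J) (ideal_mod R T)) (ideal_mod R (mult_set R x J <+>\<^bsub>R\<^esub> T)) ?p"
  proof (rule mod_homI[OF direct_sum_is_module[OF mJ mT] mI])
    show "?p u \<in> carrier (ideal_mod R (mult_set R x J <+>\<^bsub>R\<^esub> T))"
      if "u \<in> carrier (direct_sum (ideal_mod R J) (ideal_mod R T))" for u
      using that by (auto simp: direct_sum_simps ideal_mod_simps set_add_def' mult_set_def) blast
  qed (use xR J.Icarr T.Icarr in \<open>auto simp: direct_sum_simps ideal_mod_simps r_distr a_ac m_ac\<close>)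
  show ?thesis
  proof (intro koszul_splitting_cones.intro koszul_splitting.intro[OF F(1) G]
      koszul_splitting_axioms.intro koszul_splitting_cones_axioms.intro)
    show "x \<in> irrelevant R" "linear_at R F dF i" for i by fact+
    show "mod_hom R (ideal_mod R T) (ideal_mod R J) (\<lambda>v. v)" by (rule ideal_mod_inclusion[OF T J TJ])
    show "v \<in> max_power R (ideal_mod R J) 1" if "v \<in> carrier (ideal_mod R T)" for v
      using max that by (simp add: ideal_mod_simps)
    show "?p ` carrier (direct_sum (ideal_mod R J) (ideal_mod R T)) = carrier (ideal_mod R (mult_set R x J <+>\<^bsub>R\<^esub> T))"
      by (force simp: direct_sum_simps ideal_mod_simps set_add_def' mult_set_def)
    show "{u \<in> carrier (direct_sum (ideal_mod R J) (ideal_mod R T)). ?p u = \<zero>\<^bsub>ideal_mod R (mult_set R x J <+>\<^bsub>R\<^esub> T)\<^esub>}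
        = (\<lambda>w. (w, \<ominus>\<^bsub>ideal_mod R T\<^esub> (x \<odot>\<^bsub>ideal_mod R T\<^esub> w))) ` carrier (ideal_mod R T)" (is "?L = ?R")
    proof
      show "?L \<subseteq> ?R"
      proof
        fix q assume "q \<in> ?L"
        then obtain u v where q: "q = (u, v)" "u \<in> J" "v \<in> T" "x \<otimes> u \<oplus> v = \<zero>"
          by (cases q) (auto simp: direct_sum_simps ideal_mod_simps)
        then have v: "x \<otimes> u = \<ominus> v" using xR J.Icarr T.Icarr by (metis m_closed minus_equality minus_minus)
        then have "x \<otimes> u \<in> T" using T.a_inv_closed[OF q(3)] by simp
        then have u: "u \<in> T" by (rule reg_quot[OF J.Icarr[OF q(2)]])
        have "\<ominus> (x \<otimes> u) = v" using v T.Icarr[OF q(3)] by simp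
        then show "q \<in> ?R" using u q(1) neg[OF xTT[OF u]] by (auto simp: ideal_mod_simps)
      qed
      show "?R \<subseteq> ?L"
      proof
        fix q assume "q \<in> ?R"
        then obtain w where w: "w \<in> T" "q = (w, \<ominus> (x \<otimes> w))" using neg[OF xTT] by (auto simp: ideal_mod_simps)
        then show "q \<in> ?L"
          using TJ T.a_inv_closed[OF xTT[OF w(1)]] xR T.Icarr[OF w(1)] by (auto simp: direct_sum_simps ideal_mod_simps r_neg)
      qed
    qed
    show "mod_hom R (direct_sum (ideal_mod R J) (ideal_mod R T)) (ideal_mod R (mult_set R x J <+>\<^bsub>R\<^esub> T)) ?p" by (rule p)
    show "mod_hom R (ideal_mod R T) (quot_gmod (ideal_mod R T) (mult_set R x T)) (\<lambda>v. mult_set R x T +>\<^bsub>ideal_mod R T\<^esub> v)"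
      by (rule quot_gmod_module(2)[OF xT])
    show "(\<lambda>v. mult_set R x T +>\<^bsub>ideal_mod R T\<^esub> v) ` carrier (ideal_mod R T) = carrier (quot_gmod (ideal_mod R T) (mult_set R x T))"
      by (simp add: quot_gmod_simps quot_mod_simps)
    have "(\<lambda>w. \<ominus>\<^bsub>ideal_mod R T\<^esub> (x \<odot>\<^bsub>ideal_mod R T\<^esub> w)) ` carrier (ideal_mod R T) = mult_set R x T"
      unfolding mult_neg ideal_mod_simps by (rule image_cong) (use neg[OF xTT] in auto)
    then show "{u \<in> carrier (ideal_mod R T). mult_set R x T +>\<^bsub>ideal_mod R T\<^esub> u = \<zero>\<^bsub>quot_gmod (ideal_mod R T) (mult_set R x T)\<^esub>}
        = (\<lambda>w. \<ominus>\<^bsub>ideal_mod R T\<^esub> (x \<odot>\<^bsub>ideal_mod R T\<^esub> w)) ` carrier (ideal_mod R T)"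
      using quot_gmod_kernel[OF xT] by simp
    show "w = \<zero>\<^bsub>ideal_mod R T\<^esub>" if "w \<in> carrier (ideal_mod R T)" "x \<odot>\<^bsub>ideal_mod R T\<^esub> w = \<zero>\<^bsub>ideal_mod R T\<^esub>" for w
      using reg_T that by (simp add: ideal_mod_simps)
    show "w \<in> max_power R (ideal_mod R T) (Suc s)"
      if "w \<in> max_power R (ideal_mod R T) s" "x \<odot>\<^bsub>ideal_mod R T\<^esub> w \<in> max_power R (ideal_mod R T) (Suc (Suc s))" for w s
      by (rule gr_regular_onD[OF mT x gr that])
  qed
qed

lemma mult_set_quotient_resolution_exists:
  assumes T: "homogeneous_ideal R T" and x: "x \<in> hpart R s"
  shows "\<exists>F. min_free_resolution R (quot_gmod (ideal_mod R T) (mult_set R x T)) F"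
    and "module R (quot_gmod (ideal_mod R T) (mult_set R x T))"
proof -
  interpret T: ideal T R by (rule homogeneous_idealD[OF T])
  have xR: "x \<in> carrier R" by (rule G.hpart_carrier[OF x])
  have xT: "submodule R (mult_set R x T) (ideal_mod R T)"
    by (rule mult_set_submodule[OF homogeneous_idealD[OF T] xR])
  have sub: "mult_set R x T \<subseteq> T" using T.I_l_closed xR by (auto simp: mult_set_def)
  have "graded_closed (ideal_mod R T) (mult_set R x T)"
    using homogeneous_ideal_mult_set[OF T x] sub component_ideal_mod[OF T]
    unfolding graded_closed_def homogeneous_ideal_iff by auto
  then show "\<exists>F. min_free_resolution R (quot_gmod (ideal_mod R T) (mult_set R x T)) F"
    using ideal_mod_fin_gen[OF homogeneous_idealD[OF T]]
    by (intro quot_gmod_resolution_exists[OF ideal_mod_graded[OF T] _ xT]) (simp_all add: ideal_mod_simps)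
  show "module R (quot_gmod (ideal_mod R T) (mult_set R x T))" by (rule quot_gmod_module(1)[OF xT])
qed

lemma homogeneous_ideal_resolution:
  assumes "homogeneous_ideal R J"
  shows "\<exists>F e. minimal_resolution R (fmod R F) (diff F) e (ideal_mod R J) (rank F)"
  using ideal_mod_resolution_exists[OF assms] min_free_resolution_imp[OF _ ideal_mod_module[OF homogeneous_idealD[OF assms]]]
  by blast

text \<open>Multiplication by \<open>x\<close> is an isomorphism of \<open>J\<close> onto
  \<open>x J\<close>, so \<open>x J\<close> has the ranks of \<open>J\<close>.\<close>

lemma mult_set_resolution:
  assumes C: "minimal_resolution R C d e (ideal_mod R J) n" and J: "ideal J R" and x: "x \<in> carrier R"
    and reg: "inj_on (\<lambda>a. x \<otimes> a) J"
  shows "minimal_resolution R C d (\<lambda>v. x \<otimes> e v) (ideal_mod R (mult_set R x J)) n"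
proof (rule minimal_resolution_iso[OF C])
  interpret J: ideal J R by (rule J)
  show "mod_hom R (ideal_mod R J) (ideal_mod R (mult_set R x J)) (\<lambda>a. x \<otimes> a)"
    by (rule mod_homI[OF ideal_mod_module[OF J] ideal_mod_module[OF mult_set_ideal[OF J x]]])
      (use x J.Icarr in \<open>auto simp: ideal_mod_simps mult_set_def r_distr m_ac\<close>)
  show "bij_betw (\<lambda>a. x \<otimes> a) (carrier (ideal_mod R J)) (carrier (ideal_mod R (mult_set R x J)))"
    using reg by (simp add: bij_betw_def ideal_mod_simps mult_set_def)
qed

end

theorem theorem5p1:
  fixes K :: "('k, 'c) ring_scheme" and R :: "('k, 'a) gmodule"
    and x :: 'a and I' T I :: "'a set"
  assumes "standard_graded_algebra K R"
    and "x \<in> hpart R 1" and "x \<noteq> \<zero>\<^bsub>R\<^esub>"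
    and "homogeneous_ideal R I'" and "I' \<noteq> {\<zero>\<^bsub>R\<^esub>}"
    and "homogeneous_ideal R T" and "T \<noteq> {\<zero>\<^bsub>R\<^esub>}"
    and "koszul R (ideal_mod R I')" and "regular_on x (ideal_mod R I')"
    and "T \<subseteq> ideal_prod R (irrelevant R) I'"
    and "regular_on x (quot_mod (ring_mod R) T)" and "gr_regular_on R x (ideal_mod R T)"
    and "I = mult_set R x I' <+>\<^bsub>R\<^esub> T"
  shows "betti_splitting K R I (mult_set R x I') T \<and>
    lin_defect R (ideal_mod R T) \<le> lin_defect R (ideal_mod R I) \<and>
    lin_defect R (ideal_mod R I) = lin_defect R (ideal_mod R (T <+>\<^bsub>R\<^esub> PIdl\<^bsub>R\<^esub> x)) \<and>
    lin_defect R (ideal_mod R (T <+>\<^bsub>R\<^esub> PIdl\<^bsub>R\<^esub> x)) =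
           lin_defect R (quot_gmod (ideal_mod R T) (mult_set R x T)) \<and>
    lin_defect R (quot_gmod (ideal_mod R T) (mult_set R x T)) \<le> lin_defect R (ideal_mod R T) + 1 \<and>
    (koszul R (ideal_mod R I) \<longleftrightarrow> koszul R (ideal_mod R T))"
proof -
  obtain res where gr: "graded_residue K R res (\<lambda>c. c \<odot>\<^bsub>R\<^esub> \<one>\<^bsub>R\<^esub>)" using standard_graded_algebra.graded_residue[OF assms(1)] by (rule exE)
  interpret R: graded_residue K R res "\<lambda>c. c \<odot>\<^bsub>R\<^esub> \<one>\<^bsub>R\<^esub>" by (rule gr)
  note x1 = assms(2) and hI' = assms(4) and hT = assms(6)
  note iI' = R.homogeneous_idealD[OF hI'] and iT = R.homogeneous_idealD[OF hT]
  interpret I': ideal I' R by (rule iI')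
  interpret T: ideal T R by (rule iT)
  interpret m: ideal "irrelevant R" R by (rule R.ideal_irrelevant)
  have x: "x \<in> irrelevant R" using R.hpart_subset_irrelevant[of 1] x1 by auto
  have xR: "x \<in> carrier R" by (rule R.irrelevant_carrier[OF x])
  have prod: "a \<in> I' \<and> a \<in> irrelevant R" if "a \<in> ideal_prod R (irrelevant R) I'" for a
    using that
  proof (induction rule: ideal_prod.induct)
    case (prod r s)
    then show ?case using I'.I_l_closed m.I_r_closed m.Icarr I'.Icarr by auto
  next
    case (sum a b)
    then show ?case using I'.a_closed m.a_closed by auto
  qed
  have TI': "T \<subseteq> I'" and Tm: "T \<subseteq> irrelevant R" using prod assms(10) by auto
  have inj: "inj_on (\<lambda>a. x \<otimes>\<^bsub>R\<^esub> a) I'" using assms(9) by (simp add: regular_on_def ideal_mod_simps)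
  have reg_I': "w = \<zero>\<^bsub>R\<^esub>" if "w \<in> I'" "x \<otimes>\<^bsub>R\<^esub> w = \<zero>\<^bsub>R\<^esub>" for w
    by (rule inj_onD[OF inj _ that(1) additive_subgroup.zero_closed[OF I'.additive_subgroup_axioms]])
      (use that xR in simp)
  have reg_T: "w = \<zero>\<^bsub>R\<^esub>" if "w \<in> T" "x \<otimes>\<^bsub>R\<^esub> w = \<zero>\<^bsub>R\<^esub>" for w using reg_I' that TI' by auto
  have sT: "submodule R T (ring_mod R)" using iT by (simp add: R.submodule_ring_mod_iff)
  have reg_quot: "a \<in> T" if "a \<in> carrier R" "x \<otimes>\<^bsub>R\<^esub> a \<in> T" for a
    by (rule regular_on_quotient[OF sT xR assms(11)]) (use that in \<open>simp_all add: ring_mod_simps\<close>)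

  have hxI': "homogeneous_ideal R (mult_set R x I')" by (rule R.homogeneous_ideal_mult_set[OF hI' x1])
  have hI: "homogeneous_ideal R I" unfolding assms(13) by (rule R.homogeneous_ideal_sum[OF hxI' hT])
  let ?Tx = "mult_set R x (carrier R) <+>\<^bsub>R\<^esub> T"
  have hTx: "homogeneous_ideal R ?Tx"
    by (rule R.homogeneous_ideal_sum[OF R.homogeneous_ideal_mult_set[OF R.homogeneous_ideal_carrier x1] hT])
  have Tx: "T <+>\<^bsub>R\<^esub> PIdl\<^bsub>R\<^esub> x = ?Tx"
    unfolding R.PIdl_mult_set[OF xR] using T.Icarr xR by (force simp: set_add_def' mult_set_def R.a_comm)
  let ?Q = "quot_gmod (ideal_mod R T) (mult_set R x T)"

  obtain F eF where F: "minimal_resolution R (fmod R F) (diff F) eF (ideal_mod R I') (rank F)"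
    using R.homogeneous_ideal_resolution[OF hI'] by (elim exE)
  obtain G eG where G: "minimal_resolution R (fmod R G) (diff G) eG (ideal_mod R T) (rank G)"
    using R.homogeneous_ideal_resolution[OF hT] by (elim exE)
  have "lin_defect R (ideal_mod R I') \<le> enat 0" using assms(8) by (simp add: koszul_def zero_enat_def)
  then have linF: "linear_at R (fmod R F) (diff F) i" for i
    unfolding R.lin_defect_le_iff[OF R.ideal_mod_resolution_exists[OF hI'] R.ideal_mod_module[OF iI'] F] by simp
  have max: "v \<in> max_power R (ideal_mod R I') 1" if "v \<in> T" for v
    by (rule R.ideal_prod_irrelevant[OF iI']) (use that assms(10) in auto)
  \<comment> \<open>For \<open>R\<close> in place of \<open>I'\<close> the condition reads
    \<open>T \<subseteq> m\<close>, each \<open>v\<close> being \<open>v\<close> in \<open>m\<close>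
    times \<open>1\<close>.\<close>
  have max': "v \<in> max_power R (ideal_mod R (carrier R)) 1" if "v \<in> T" for v
    using R.max_power_smult_Suc[OF R.ideal_mod_module[OF R.oneideal], of v "\<one>\<^bsub>R\<^esub>" 0] Tm T.Icarr that
    by (auto simp: ideal_mod_simps)

  \<comment> \<open>\<open>A\<close> treats \<open>I\<close> and \<open>B\<close> treats
    \<open>T + (x)\<close>. Both use the same resolution \<open>G\<close> and the same cone over
    \<open>- x\<close>, so both defects are compared with that of \<open>T / x T\<close>.\<close>
  interpret A: koszul_splitting_cones R "fmod R F" "diff F" eF "ideal_mod R I'" "rank F"
    "fmod R G" "diff G" eG "ideal_mod R T" "rank G" x "\<lambda>v. v" "\<lambda>u. x \<otimes>\<^bsub>R\<^esub> fst u \<oplus>\<^bsub>R\<^esub> snd u" "ideal_mod R I"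
    "\<lambda>v. mult_set R x T +>\<^bsub>ideal_mod R T\<^esub> v" ?Q
    unfolding assms(13)
    by (rule R.ideal_splitting_cones[OF F linF G iI' iT TI' max x reg_T reg_quot assms(12)])
  interpret B: koszul_splitting_cones R "\<lambda>i. ideal_mod R (if i = 0 then carrier R else {\<zero>\<^bsub>R\<^esub>})" "\<lambda>_ _. \<zero>\<^bsub>R\<^esub>" "\<lambda>v. v"
    "ideal_mod R (carrier R)" "\<lambda>i. if i = 0 then 1 else 0"
    "fmod R G" "diff G" eG "ideal_mod R T" "rank G" x "\<lambda>v. v" "\<lambda>u. x \<otimes>\<^bsub>R\<^esub> fst u \<oplus>\<^bsub>R\<^esub> snd u" "ideal_mod R ?Tx"
    "\<lambda>v. mult_set R x T +>\<^bsub>ideal_mod R T\<^esub> v" ?Q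
    by (rule R.ideal_splitting_cones[OF R.ring_resolution R.ring_linear_at G R.oneideal iT _ max' x reg_T reg_quot assms(12)])
      (use T.Icarr in auto)

  note exI = R.ideal_mod_resolution_exists[OF hI] and mI = R.ideal_mod_module[OF R.homogeneous_idealD[OF hI]]
  note ldI = R.lin_defect_le_iff[OF exI mI A.H.resolution]
  note ldTx = R.lin_defect_le_iff[OF R.ideal_mod_resolution_exists[OF hTx] R.ideal_mod_module[OF R.homogeneous_idealD[OF hTx]] B.H.resolution]
  note ldQ = R.lin_defect_le_iff[OF R.mult_set_quotient_resolution_exists[OF hT x1] A.C.resolution]
  note ldT = R.lin_defect_le_iff[OF R.ideal_mod_resolution_exists[OF hT] R.ideal_mod_module[OF iT] G]

  have ld1: "lin_defect R (ideal_mod R T) \<le> lin_defect R (ideal_mod R I)"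
    by (rule enat_le_all) (use A.linear_at_T in \<open>auto simp: ldI ldT\<close>)
  have ld2: "lin_defect R (ideal_mod R I) = lin_defect R ?Q"
  proof (rule antisym; rule enat_le_all)
    show "lin_defect R ?Q \<le> enat t \<Longrightarrow> lin_defect R (ideal_mod R I) \<le> enat t" for t
      unfolding ldI ldQ using A.linear_at_C_imp_H by blast
    show "lin_defect R (ideal_mod R I) \<le> enat t \<Longrightarrow> lin_defect R ?Q \<le> enat t" for t
      unfolding ldI ldQ using A.linear_at_H_imp_C by blast
  qed
  have ld3: "lin_defect R (ideal_mod R ?Tx) = lin_defect R ?Q"
  proof (rule antisym; rule enat_le_all)
    show "lin_defect R ?Q \<le> enat t \<Longrightarrow> lin_defect R (ideal_mod R ?Tx) \<le> enat t" for t
      unfolding ldTx ldQ using B.linear_at_C_imp_H by blast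
    show "lin_defect R (ideal_mod R ?Tx) \<le> enat t \<Longrightarrow> lin_defect R ?Q \<le> enat t" for t
      unfolding ldTx ldQ using B.linear_at_H_imp_C by blast
  qed
  \<comment> \<open>For \<open>k \<ge> Suc t\<close> both \<open>k\<close> and its predecessor lie
    in the tail where \<open>T\<close> is linear.\<close>
  have ld4: "lin_defect R ?Q \<le> lin_defect R (ideal_mod R T) + 1"
  proof (cases "lin_defect R (ideal_mod R T)")
    case (enat t)
    then have lin: "\<forall>k\<ge>t. linear_at R (fmod R G) (diff G) k" using ldT[of t] by simp
    have "linear_at R A.C.CC A.C.dC k" if "k \<ge> Suc t" for k
      by (rule A.linear_at_T_imp_C) (use lin that in auto)
    then have "lin_defect R ?Q \<le> enat (Suc t)" unfolding ldQ by blast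
    then show ?thesis using enat by (simp add: one_enat_def)
  qed simp
  \<comment> \<open>If the defect of \<open>T\<close> is 0, the condition holds in every degree, so
    at all predecessors as well, and degree 0 is covered by \<open>head_decomposition\<close>: no
    degree is lost. The general bound would only give 1.\<close>
  have ld5: "lin_defect R ?Q = 0" if "lin_defect R (ideal_mod R T) = 0"
  proof -
    have "lin_defect R (ideal_mod R T) \<le> enat 0" unfolding that by simp
    then have lin: "linear_at R (fmod R G) (diff G) k" for k unfolding ldT by simp
    have "lin_defect R ?Q \<le> enat 0" unfolding ldQ by (intro allI impI A.linear_at_T_imp_C lin)
    then show ?thesis unfolding enat_0 le_zero_eq .
  qed
  have kos: "koszul R (ideal_mod R I) \<longleftrightarrow> koszul R (ideal_mod R T)"
    unfolding koszul_def
  proof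
    show "lin_defect R (ideal_mod R I) = 0 \<Longrightarrow> lin_defect R (ideal_mod R T) = 0" using ld1 by simp
    show "lin_defect R (ideal_mod R T) = 0 \<Longrightarrow> lin_defect R (ideal_mod R I) = 0"
      unfolding ld2 by (rule ld5)
  qed

  \<comment> \<open>An element \<open>x a\<close> of \<open>T\<close> has \<open>a\<close> in
    \<open>T\<close> by regularity on \<open>R / T\<close>. Hence the intersection is isomorphic to
    \<open>T\<close> and has its Betti numbers.\<close>
  have inter: "mult_set R x I' \<inter> T = mult_set R x T"
  proof
    show "mult_set R x I' \<inter> T \<subseteq> mult_set R x T" unfolding mult_set_def using reg_quot I'.Icarr by blast
    show "mult_set R x T \<subseteq> mult_set R x I' \<inter> T"
      unfolding mult_set_def using TI' T.I_l_closed[OF _ xR] by blast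
  qed
  have resA: "minimal_resolution R (fmod R F) (diff F) (\<lambda>v. x \<otimes>\<^bsub>R\<^esub> eF v) (ideal_mod R (mult_set R x I')) (rank F)"
    by (rule R.mult_set_resolution[OF F iI' xR inj])
  have resAB: "minimal_resolution R (fmod R G) (diff G) (\<lambda>v. x \<otimes>\<^bsub>R\<^esub> eG v) (ideal_mod R (mult_set R x T)) (rank G)"
    by (rule R.mult_set_resolution[OF G iT xR inj_on_subset[OF inj TI']])
  have hxT: "homogeneous_ideal R (mult_set R x T)" by (rule R.homogeneous_ideal_mult_set[OF hT x1])
  note betti = R.betti_eq_rank[OF R.ideal_mod_resolution_exists R.ideal_mod_module[OF R.homogeneous_idealD]]
  \<comment> \<open>The cone has rank \<open>nF_i + nG_i + nG_(i-1)\<close> in degree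
    \<open>i\<close>; \<open>F\<close> also resolves \<open>x I'\<close>, and \<open>G\<close>
    resolves both \<open>T\<close> and \<open>x T\<close>.\<close>
  have betti_sum: "betti K R (ideal_mod R I) i = betti K R (ideal_mod R (mult_set R x I')) i + betti K R (ideal_mod R T) i +
      (if i = 0 then 0 else betti K R (ideal_mod R (mult_set R x I' \<inter> T)) (i - 1))" for i
    unfolding inter betti[OF hI hI A.H.resolution] betti[OF hxI' hxI' resA] betti[OF hT hT G] betti[OF hxT hxT resAB]
    by (cases i) simp_all

  \<comment> \<open>Properness: the unit has residue 1 and so lies outside the irrelevant ideal,
    which contains \<open>I\<close>, \<open>x I'\<close> and \<open>T\<close>.\<close>
  have "res \<one>\<^bsub>R\<^esub> \<noteq> \<zero>\<^bsub>K\<^esub>"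
    using R.res_emb[OF R.K.one_closed] R.emb_one R.K.one_not_zero by simp
  then have "\<one>\<^bsub>R\<^esub> \<notin> irrelevant R" using R.res_zero_iff[OF R.one_closed] by simp
  then have proper: "J \<noteq> carrier R" if "J \<subseteq> irrelevant R" for J using that by auto
  have xI'm: "mult_set R x I' \<subseteq> irrelevant R" using m.I_r_closed[OF x] I'.Icarr by (auto simp: mult_set_def)
  have Im: "I \<subseteq> irrelevant R"
    unfolding assms(13) using xI'm Tm m.a_closed by (auto simp: set_add_def')
  have xI'0: "mult_set R x I' \<noteq> {\<zero>\<^bsub>R\<^esub>}"
  proof
    assume eq: "mult_set R x I' = {\<zero>\<^bsub>R\<^esub>}"
    have "I' \<subseteq> {\<zero>\<^bsub>R\<^esub>}"
    proof
      fix a assume a: "a \<in> I'"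
      then have "x \<otimes>\<^bsub>R\<^esub> a = \<zero>\<^bsub>R\<^esub>" using eq by (auto simp: mult_set_def)
      then show "a \<in> {\<zero>\<^bsub>R\<^esub>}" using reg_I'[OF a] by simp
    qed
    then show False using assms(5) additive_subgroup.zero_closed[OF I'.additive_subgroup_axioms] by auto
  qed
  have "T \<subseteq> I"
  proof
    fix v assume v: "v \<in> T"
    have "x \<otimes>\<^bsub>R\<^esub> \<zero>\<^bsub>R\<^esub> \<in> mult_set R x I'"
      unfolding mult_set_def by (rule imageI[OF additive_subgroup.zero_closed[OF I'.additive_subgroup_axioms]])
    then have "x \<otimes>\<^bsub>R\<^esub> \<zero>\<^bsub>R\<^esub> \<oplus>\<^bsub>R\<^esub> v \<in> I" unfolding assms(13) set_add_def' using v by blast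
    then show "v \<in> I" using v xR T.Icarr by simp
  qed
  then have I0: "I \<noteq> {\<zero>\<^bsub>R\<^esub>}"
    using assms(7) additive_subgroup.zero_closed[OF T.additive_subgroup_axioms] by auto
  have "betti_splitting K R I (mult_set R x I') T"
    unfolding betti_splitting_def
    using hI hxI' hT I0 xI'0 assms(7) proper[OF Im] proper[OF xI'm] proper[OF Tm] assms(13) betti_sum
    by (intro conjI ballI allI) auto
  then show ?thesis unfolding Tx using ld1 ld2 ld3 ld4 kos by (intro conjI) simp_all
qed

end
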